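(* Let $P>0$ and let $f:(-1,1)\to\mathbb{R}$ be a given piecewise Lipschitz-continuous function. There exists a unique $(t,u)\in \bigcup_{p>1}L^p(-1,1)\times \bigcup_{p>1}W^{1,p}(-1,1)$ such that: \begin{itemize} \item $-\frac{1}{\pi}\,\mathrm{pv}\frac{1}{x} * t + f\,t = u'$ in $\mathscr{D}'((-1,1))$, \item $u\leq 0$, $t\leq 0$, $u\,t=0$ a.e. in $(-1,1)$, \item $\int_{-1}^{1} t(x)\,\mathrm{d}x=-P$. \end{itemize} The displacement $u$ is actually always $0$ on $(-1,1)$. In the particular case where $f$ is the piecewise constant function $$f(x)=\sum_{i=1}^n f_i\,\chi_{(x_{i-1},x_i)}(x),$$ where the $f_i$ and $-1=x_0<x_1<\cdots<x_n=1$ are given real constants and $\chi_{(a,b)}$ denotes the characteristic function of $(a,b)$, the unique solution $t$ is explicitly given by $$t(x) = -\frac{P \prod_{i=1}^{n-1}|x-x_{i}|^{\alpha_{i}-\alpha_{i+1}}}{\pi \sqrt{1+f^2(x)}\,(1+x)^{\frac{1}{2} +\alpha_{1}}(1-x)^{\frac{1}{2}-\alpha_{n}}},\qquad \text{where } \alpha_i:=\tfrac{1}{\pi}\arctan f_i.$$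
   Context: $\mathrm{pv}\frac1x$ denotes the distributional derivative of $\log|x|$ on $\mathbb{R}$ (Cauchy principal value), $*$ is convolution on $\mathbb{R}$, and the convolution $\mathrm{pv}\frac1x*t$ is understood after extending $t$ by zero to $\mathbb{R}$ (then restricting to $(-1,1)$). Piecewise Lipschitz-continuous means: there are finitely many points $-1=y_0<\dots<y_m=1$ such that $f$ is Lipschitz-continuous on each $(y_{j-1},y_j)$. *)

theory Defs
  imports "HOL-Analysis.Analysis"
begin

text \<open>
  Real test functions on an open set \<open>U\<close>: infinitely differentiable functions on the whole line
  whose (compact) support lies in \<open>U\<close>.
\<close>

definition test_functions :: "real set \<Rightarrow> (real \<Rightarrow> real) set" where
  "test_functions U =
     {\<phi>. (\<forall>k. (deriv ^^ k) \<phi> differentiable_on UNIV)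
        \<and> compact (closure {x. \<phi> x \<noteq> 0}) \<and> closure {x. \<phi> x \<noteq> 0} \<subseteq> U}"

text \<open>
  Distributions are represented by functionals on functions; only their values on test functions
  matter for \<open>distr_eq\<close>. Continuity is not part of the type, but it holds for every functional
  built below from (locally) integrable functions.
\<close>

type_synonym distr = "(real \<Rightarrow> real) \<Rightarrow> real"

definition distr_eq :: "real set \<Rightarrow> distr \<Rightarrow> distr \<Rightarrow> bool" where
  "distr_eq U S T \<longleftrightarrow> (\<forall>\<phi>\<in>test_functions U. S \<phi> = T \<phi>)"

definition regular_distr :: "real set \<Rightarrow> (real \<Rightarrow> real) \<Rightarrow> distr" where
  "regular_distr U g = (\<lambda>\<phi>. LINT x|lebesgue_on U. g x * \<phi> x)"

definition distr_deriv :: "distr \<Rightarrow> distr" where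
  "distr_deriv T = (\<lambda>\<phi>. - T (deriv \<phi>))"

text \<open>
  The convolution of \<open>T\<close> with a compactly supported \<open>S\<close>:
  \<open>\<langle>T * S, \<phi>\<rangle> = \<langle>S\<^sub>y, \<langle>T\<^sub>x, \<phi> (x + y)\<rangle>\<rangle>\<close>. The inner pairing is smooth in \<open>y\<close> but in general not
  compactly supported, which is harmless for compactly supported \<open>S\<close>.
\<close>

definition distr_conv :: "distr \<Rightarrow> distr \<Rightarrow> distr" where
  "distr_conv T S = (\<lambda>\<phi>. S (\<lambda>y. T (\<lambda>x. \<phi> (x + y))))"

definition pv_inverse :: distr where
  "pv_inverse = distr_deriv (regular_distr UNIV (\<lambda>x. ln \<bar>x\<bar>))"

definition zero_extension :: "real set \<Rightarrow> (real \<Rightarrow> real) \<Rightarrow> real \<Rightarrow> real" where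
  "zero_extension U g = (\<lambda>x. if x \<in> U then g x else 0)"

text \<open>
  Elements of \<open>L\<^sup>p(U)\<close> and \<open>W\<^sup>1\<^sup>,\<^sup>p(U)\<close> are represented by functions, two representatives being
  identified if they agree almost everywhere on \<open>U\<close>. The definitions are meant for open \<open>U\<close> and
  \<open>1 \<le> p < \<infinity>\<close>.
\<close>

definition Lp_functions :: "real \<Rightarrow> real set \<Rightarrow> (real \<Rightarrow> real) set" where
  "Lp_functions p U =
     {g. g \<in> borel_measurable (lebesgue_on U)
       \<and> integrable (lebesgue_on U) (\<lambda>x. \<bar>g x\<bar> powr p)}"

definition W1p_functions :: "real \<Rightarrow> real set \<Rightarrow> (real \<Rightarrow> real) set" where
  "W1p_functions p U =
     {g \<in> Lp_functions p U.
        \<exists>h\<in>Lp_functions p U. distr_eq U (distr_deriv (regular_distr U g)) (regular_distr U h)}"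

definition piecewise_lipschitz :: "(real \<Rightarrow> real) \<Rightarrow> bool" where
  "piecewise_lipschitz f \<longleftrightarrow>
     (\<exists>(m::nat) y. y 0 = -1 \<and> y m = 1 \<and> (\<forall>j\<in>{1..m}. y (j - 1) < y j)
        \<and> (\<forall>j\<in>{1..m}. \<exists>C. C-lipschitz_on {y (j - 1)<..<y j} f))"

text \<open>
  In the union over \<open>p > 1\<close> the value \<open>p = \<infinity>\<close> adds nothing, since the interval is bounded.
\<close>

definition contact_solution ::
  "real \<Rightarrow> (real \<Rightarrow> real) \<Rightarrow> (real \<Rightarrow> real) \<Rightarrow> (real \<Rightarrow> real) \<Rightarrow> bool" where
  "contact_solution P f t u \<longleftrightarrow>
     t \<in> (\<Union>p\<in>{1<..}. Lp_functions p {-1<..<1})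
   \<and> u \<in> (\<Union>p\<in>{1<..}. W1p_functions p {-1<..<1})
   \<and> distr_eq {-1<..<1}
       (\<lambda>\<phi>. - (1 / pi)
               * distr_conv pv_inverse (regular_distr UNIV (zero_extension {-1<..<1} t)) \<phi>
             + regular_distr {-1<..<1} (\<lambda>x. f x * t x) \<phi>)
       (distr_deriv (regular_distr {-1<..<1} u))
   \<and> (AE x in lebesgue_on {-1<..<1}. u x \<le> 0 \<and> t x \<le> 0 \<and> u x * t x = 0)
   \<and> (LINT x|lebesgue_on {-1<..<1}. t x) = - P"

end

theory Submission
  imports Defs "HOL-Complex_Analysis.Complex_Analysis" "HOL-Real_Asymp.Real_Asymp"
begin

text \<open>
  Write \<open>W\<close> for the logarithmic potential of \<open>t\<close>, divided by \<open>pi\<close>. The convolution of \<open>pv (1/x)\<close> with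
  \<open>t\<close> is \<open>pi\<close> times the derivative of \<open>W\<close>, so by the lemma of du Bois-Reymond the contact equation says
  that \<open>u\<close> is a constant plus a primitive of \<open>f t\<close> minus \<open>W\<close> (\<open>contact_equation_iff\<close>). An \<open>L\<^sup>p\<close> function
  with \<open>p > 1\<close> has uniformly bounded Riesz potentials of some small order, hence \<open>W\<close> is continuous, and so
  is \<open>u\<close> after a change on a null set.

  The displacement vanishes (\<open>displacement_eq_0\<close>): on a component of \<open>{u < 0}\<close> there is no pressure, so
  \<open>u\<close> is a constant minus the potential of a nonpositive charge lying elsewhere. That makes \<open>u\<close> concave
  on the component, where \<open>u\<close> then cannot lie below its boundary values \<open>0\<close>.

  With \<open>u = 0\<close> the equation speaks of the Cauchy transform of \<open>t\<close>, a holomorphic function on the upper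
  half plane: its boundary values \<open>X + i Y\<close> satisfy \<open>Y = - t\<close> and \<open>X = f t\<close>, that is, they are real
  multiples of \<open>i - f\<close>, whose argument is \<open>pi/2 + arctan f\<close>. A function with these arguments can be
  written down: it is the exponential of a Cauchy integral of the angle \<open>1/2 + arctan f / pi\<close>, divided
  by \<open>z - 1\<close> (\<open>solution_transform\<close>). The Lipschitz pieces of \<open>f\<close> make the exponent logarithmic near each
  point, with a coefficient that keeps the function below an integrable power of the distance. Cauchy's
  formula for the half plane (\<open>half_plane_Cauchy_formula\<close>) then shows that it is the transform of a
  charge on the interval, and this charge is the solution \<open>pressure\<close>.

  For uniqueness let \<open>t\<close> be another solution. Both transforms map the upper half plane into itself, as
  both charges are nonpositive and nonzero, so their quotient has a holomorphic square root with
  nonnegative real part. The map \<open>w \<mapsto> (w - 1) / (w + 1)\<close> turns the root into a bounded function which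
  vanishes at infinity and has real boundary values almost everywhere, because the two transforms have
  the same direction there (\<open>boundary_direction\<close>). By Cauchy's formula again it is zero
  (\<open>pressure_unique\<close>). For a step function the Cauchy integral of the angle is a sum of logarithms, and
  the modulus of the boundary values gives the product formula (\<open>pressure_step_function\<close>).
\<close>

section \<open>Charges and their potentials\<close>

lemma integral_abs_powr_singularity:
  fixes c N b :: real
  assumes "b < 1" "0 \<le> N"
  shows "integrable lborel (\<lambda>x. indicator {c-N..c+N} x * \<bar>x - c\<bar> powr - b)" (is "integrable lborel ?F")
    and "(LINT x|lborel. indicator {c-N..c+N} x * \<bar>x - c\<bar> powr - b) = 2 * N powr (1-b) / (1-b)"
proof -
  define h where "h = (\<lambda>x::real. indicator {0..N} x * x powr - b)"
  have 1: "((\<lambda>x. x powr - b) has_integral N powr (- b + 1) / (- b + 1)) {0..N}"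
    using assms by (intro has_integral_powr_from_0) auto
  have nn: "integral\<^sup>N lborel (\<lambda>x. ennreal (h x)) = ennreal (N powr (1-b) / (1-b))"
    using nn_integral_has_integral_lebesgue[OF _ 1] by (simp add: h_def)
  have hb: "has_bochner_integral lborel h (N powr (1-b) / (1-b))"
    using nn assms by (intro has_bochner_integral_nn_integral) (auto simp: h_def)
  have i1: "has_bochner_integral lborel (\<lambda>x. h (- c + 1 * x)) (N powr (1-b) / (1-b))"
    using lborel_has_bochner_integral_real_affine_iff[of 1 h "N powr (1-b) / (1-b)" "-c"] hb by simp
  have i2: "has_bochner_integral lborel (\<lambda>x. h (c + (-1) * x)) (N powr (1-b) / (1-b))"
    using lborel_has_bochner_integral_real_affine_iff[of "-1" h "N powr (1-b) / (1-b)" "c"] hb by simp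
  have eq: "h (- c + 1 * x) + h (c + (-1) * x) = ?F x" for x
    by (auto simp: h_def indicator_def abs_if)
  have "has_bochner_integral lborel ?F (N powr (1-b) / (1-b) + N powr (1-b) / (1-b))"
    using has_bochner_integral_add[OF i1 i2] unfolding eq .
  then show "integrable lborel ?F" "(LINT x|lborel. ?F x) = 2 * N powr (1-b) / (1-b)"
    by (auto simp: has_bochner_integral_iff)
qed

lemma ln_one_plus_le_powr:
  fixes v c :: real
  assumes "0 < v" "0 < c" "c \<le> 1"
  shows "ln (1 + v) \<le> v powr c / c"
proof (cases "v \<le> 1")
  case True
  have "ln (1 + v) \<le> v" using assms by (simp add: ln_add_one_self_le_self)
  also have "v \<le> v powr c" using powr_mono'[of c 1 v] assms True by simp
  also have "\<dots> \<le> v powr c / c" using assms by (simp add: field_simps mult_left_le)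
  finally show ?thesis .
next
  case False
  have "ln (1 + v) \<le> ln (2 * v)" using False by simp
  also have "\<dots> = ln 2 + ln v" using assms by (simp add: ln_mult)
  also have "ln 2 \<le> (1::real)" using ln_le_minus_one[of "2::real"] by simp
  also have "ln v \<le> (v powr c - 1) / c"
    using ln_le_minus_one[of "v powr c"] assms by (simp add: ln_powr field_simps)
  also have "1 + (v powr c - 1) / c \<le> v powr c / c" using assms by (simp add: field_simps)
  finally show ?thesis by simp
qed

lemma abs_ln_le_powr:
  fixes r s :: real
  assumes "0 < s" "0 \<le> r"
  shows "\<bar>ln r\<bar> \<le> r powr - s / s + r"
proof (cases "r = 0")
  case False
  then have r: "0 < r" using assms by simp
  show ?thesis
  proof (cases "r \<le> 1")
    case True
    have "- ln r = ln (r powr - s) / s" using assms r by (simp add: ln_powr)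
    also have "\<dots> \<le> (r powr - s - 1) / s"
      using ln_le_minus_one[of "r powr - s"] r assms by (intro divide_right_mono) auto
    also have "\<dots> \<le> r powr - s / s" using assms by (simp add: field_simps)
    finally have "- ln r \<le> r powr - s / s" .
    moreover have "\<bar>ln r\<bar> = - ln r" using True r by (simp add: abs_if)
    ultimately show ?thesis using r by linarith
  next
    case F: False
    have "ln r \<le> r" using ln_le_minus_one[of r] r by simp
    moreover have "0 \<le> ln r" using F by simp
    moreover have "0 \<le> r powr - s / s" using assms by simp
    ultimately show ?thesis by (simp add: abs_if)
  qed
qed simp

text \<open>
  With this sign the transform of a nonpositive charge maps the upper half plane into itself, and its
  imaginary part tends to \<open>- t\<close> on the real axis.
\<close>
definition cauchy_transform :: "(real \<Rightarrow> real) \<Rightarrow> complex \<Rightarrow> complex" where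
  "cauchy_transform t z = (LINT y|lborel. complex_of_real (t y) / (z - of_real y)) / of_real pi"

definition log_potential :: "(real \<Rightarrow> real) \<Rightarrow> real \<Rightarrow> real" where
  "log_potential t x = (LINT y|lborel. t y * ln \<bar>x - y\<bar>) / pi"

definition smoothed_log_potential :: "(real \<Rightarrow> real) \<Rightarrow> real \<Rightarrow> real \<Rightarrow> real" where
  "smoothed_log_potential t e x = (LINT y|lborel. t y * (ln ((x - y)\<^sup>2 + e\<^sup>2) / 2)) / pi"

locale charge =
  fixes t :: "real \<Rightarrow> real"
  assumes borel [measurable]: "t \<in> borel_measurable borel"
    and support: "x \<notin> {-1<..<1} \<Longrightarrow> t x = 0"
    and integrable: "integrable lborel t"

text \<open>
  A uniform bound on the Riesz potentials of one small order is the form in which integrability to a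
  power \<open>p > 1\<close> enters. It dominates the logarithmic kernel, uniformly in the position.
\<close>
locale mild_charge = charge +
  fixes s M :: real
  assumes s: "0 < s" "s < 1"
    and riesz_integrable: "integrable lborel (\<lambda>y. \<bar>t y\<bar> * \<bar>x - y\<bar> powr - s)"
    and riesz_le: "(LINT y|lborel. \<bar>t y\<bar> * \<bar>x - y\<bar> powr - s) \<le> M"

text \<open>
  A variant of Young's inequality: where the Riesz kernel is at most \<open>|t| powr (p - 1)\<close>, the product is at
  most \<open>|t| powr p\<close>; elsewhere \<open>|t|\<close> is below a power of the kernel, and the order \<open>s\<close> is chosen such that
  the product is below \<open>|x - y| powr (- 1/2)\<close>.
\<close>
lemma mild_charge_of_Lp:
  assumes [measurable]: "t \<in> borel_measurable borel"
    and support: "\<And>x. x \<notin> {-1<..<1} \<Longrightarrow> t x = 0"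
    and p: "1 < p" and int: "integrable lborel (\<lambda>x. \<bar>t x\<bar> powr p)"
  obtains s M where "mild_charge t s M"
proof -
  define s where "s = (p - 1) / (2 * p)"
  have s: "0 < s" "s < 1" using p by (auto simp: s_def field_simps)
  have dom: "\<bar>t y\<bar> * \<bar>x - y\<bar> powr - s \<le>
      \<bar>t y\<bar> powr p + (indicator {x-1..x+1} y * \<bar>y - x\<bar> powr - (1/2) + indicator {-1..1} y)" for x y
  proof (cases "y \<in> {-1<..<1} \<and> y \<noteq> x \<and> t y \<noteq> 0")
    case False
    then show ?thesis using support[of y] by (auto simp: indicator_def)
  next
    case True
    let ?v = "\<bar>x - y\<bar> powr - s"
    have v: "0 < ?v" using True by simp
    have "\<bar>t y\<bar> * ?v \<le> \<bar>t y\<bar> powr p + \<bar>x - y\<bar> powr - (1/2)"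
    proof (cases "?v \<le> \<bar>t y\<bar> powr (p - 1)")
      case A: True
      have "\<bar>t y\<bar> * ?v \<le> \<bar>t y\<bar> powr 1 * \<bar>t y\<bar> powr (p - 1)"
        using A by (simp add: mult_left_mono)
      also have "\<dots> = \<bar>t y\<bar> powr p" by (simp only: powr_add[symmetric]) simp
      finally show ?thesis by (rule order_trans) simp
    next
      case B: False
      have "\<bar>t y\<bar> = (\<bar>t y\<bar> powr (p-1)) powr (1/(p-1))" using p True by (simp add: powr_powr)
      also have "\<dots> \<le> ?v powr (1/(p-1))" using B p by (intro powr_mono2) auto
      finally have "\<bar>t y\<bar> * ?v \<le> ?v powr (1/(p-1)) * ?v powr 1" using v by (simp add: mult_right_mono)
      also have "\<dots> = ?v powr (1/(p-1) + 1)" by (simp only: powr_add)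
      also have "\<dots> = \<bar>x - y\<bar> powr (- s * (1/(p-1) + 1))" by (simp add: powr_powr)
      also have "- s * (1/(p-1) + 1) = - (1/2)" using p by (simp add: s_def field_simps)
      finally show ?thesis by (rule order_trans) simp
    qed
    also have "\<bar>x - y\<bar> powr - (1/2) \<le> indicator {x-1..x+1} y * \<bar>y - x\<bar> powr - (1/2) + indicator {-1..1} y"
    proof (cases "y \<in> {x-1..x+1}")
      case False
      have "\<bar>x - y\<bar> powr - (1/2) \<le> 1 powr - (1/2)" using False by (intro powr_mono2') auto
      then show ?thesis using True False by (auto simp: indicator_def)
    qed (auto simp: indicator_def abs_minus_commute)
    finally show ?thesis by simp
  qed
  note sing = integral_abs_powr_singularity[of "1/2" 1]
  have rint: "integrable lborel (\<lambda>y. \<bar>t y\<bar> powr p +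
      (indicator {x-1..x+1} y * \<bar>y - x\<bar> powr - (1/2) + indicator {-1..1} y))" for x
    using sing(1)[of x] by (intro Bochner_Integration.integrable_add int) (auto simp: integrable_real_indicator)
  have ri: "integrable lborel (\<lambda>y. \<bar>t y\<bar> * \<bar>x - y\<bar> powr - s)" for x
    by (rule Bochner_Integration.integrable_bound[OF rint[of x]]) (use dom[of _ x] in \<open>auto simp: abs_mult intro!: order_trans[OF dom]\<close>)
  have ti: "integrable lborel t"
  proof (rule Bochner_Integration.integrable_bound)
    show "integrable lborel (\<lambda>y. \<bar>t y\<bar> powr p + indicator {-1..1} y :: real)"
      by (intro Bochner_Integration.integrable_add int) (auto simp: integrable_real_indicator)
    have "\<bar>t y\<bar> \<le> \<bar>t y\<bar> powr p + indicator {-1..1} y" for y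
    proof (cases "\<bar>t y\<bar> \<le> 1")
      case True
      then show ?thesis using support[of y] by (auto simp: indicator_def intro: order_trans)
    next
      case False
      then show ?thesis using powr_mono[of 1 p "\<bar>t y\<bar>"] p by (auto simp: indicator_def)
    qed
    then show "AE y in lborel. norm (t y) \<le> norm (\<bar>t y\<bar> powr p + indicator {-1..1} y :: real)"
      by (intro AE_I2) (auto intro: order_trans)
  qed auto
  have "(LINT y|lborel. \<bar>t y\<bar> * \<bar>x - y\<bar> powr - s) \<le> (LINT y|lborel. \<bar>t y\<bar> powr p) + 6" for x
  proof -
    have "(LINT y|lborel. \<bar>t y\<bar> * \<bar>x - y\<bar> powr - s) \<le> (LINT y|lborel. \<bar>t y\<bar> powr p +
      (indicator {x-1..x+1} y * \<bar>y - x\<bar> powr - (1/2) + indicator {-1..1} y))"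
      by (intro integral_mono ri rint dom)
    also have "\<dots> = (LINT y|lborel. \<bar>t y\<bar> powr p) + 6"
      using sing[of x] int by (subst Bochner_Integration.integral_add) (auto simp: integrable_real_indicator)
    finally show ?thesis .
  qed
  then have "mild_charge t s ((LINT y|lborel. \<bar>t y\<bar> powr p) + 6)"
    by unfold_locales (use s support ti ri in auto)
  then show ?thesis by (rule that)
qed

lemma half_ln_diff_le:
  fixes r e s :: real
  assumes "r \<noteq> 0" "0 < s" "s < 1"
  shows "\<bar>ln (r\<^sup>2 + e\<^sup>2) / 2 - ln \<bar>r\<bar>\<bar> \<le> \<bar>e\<bar> powr s / s * \<bar>r\<bar> powr - s"
proof (cases "e = 0")
  case True
  have "ln (r\<^sup>2) = 2 * ln \<bar>r\<bar>" using assms by (metis ln_realpow of_nat_numeral power2_abs zero_less_abs_iff)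
  then show ?thesis using True assms by simp
next
  case False
  have r2: "ln (r\<^sup>2) = 2 * ln \<bar>r\<bar>" using assms by (metis ln_realpow of_nat_numeral power2_abs zero_less_abs_iff)
  have "r\<^sup>2 + e\<^sup>2 = r\<^sup>2 * (1 + (e/r)\<^sup>2)" using assms by (simp add: field_simps)
  then have "ln (r\<^sup>2 + e\<^sup>2) = ln (r\<^sup>2) + ln (1 + (e/r)\<^sup>2)"
    using ln_mult_pos[of "r\<^sup>2" "1 + (e/r)\<^sup>2"] assms(1) add_pos_nonneg[OF zero_less_one zero_le_power2, of "e/r"]
    by (metis zero_less_power2)
  then have eq: "ln (r\<^sup>2 + e\<^sup>2) / 2 - ln \<bar>r\<bar> = ln (1 + (e/r)\<^sup>2) / 2"
    using r2 by (simp add: add_divide_distrib)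
  have "ln (1 + (e/r)\<^sup>2) \<le> ((e/r)\<^sup>2) powr (s/2) / (s/2)"
    using False assms by (intro ln_one_plus_le_powr) auto
  also have "((e/r)\<^sup>2) powr (s/2) = (\<bar>e/r\<bar> powr 2) powr (s/2)"
    using False assms by (simp add: power_divide)
  also have "\<dots> = \<bar>e/r\<bar> powr s" by (simp only: powr_powr) simp
  also have "\<dots> = \<bar>e\<bar> powr s * \<bar>r\<bar> powr - s" using assms by (simp add: powr_divide powr_minus field_simps)
  finally have "ln (1 + (e/r)\<^sup>2) / 2 \<le> \<bar>e\<bar> powr s / s * \<bar>r\<bar> powr - s" by simp
  moreover have "0 \<le> ln (1 + (e/r)\<^sup>2)" by simp
  ultimately show ?thesis unfolding eq by simp
qed

lemma half_ln_Lipschitz: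
  fixes a b e :: real
  assumes "0 < e"
  shows "\<bar>ln (a\<^sup>2 + e\<^sup>2) / 2 - ln (b\<^sup>2 + e\<^sup>2) / 2\<bar> \<le> \<bar>a - b\<bar> / e"
proof -
  have der: "((\<lambda>x. ln (x\<^sup>2 + e\<^sup>2) / 2) has_field_derivative x / (x\<^sup>2 + e\<^sup>2)) (at x within UNIV)" for x
  proof -
    have "0 < x\<^sup>2 + e\<^sup>2" using assms by (simp add: add_nonneg_pos)
    then show ?thesis by (auto intro!: derivative_eq_intros simp: divide_simps)
  qed
  have bd: "norm (x / (x\<^sup>2 + e\<^sup>2)) \<le> 1 / e" for x
  proof -
    have "2 * \<bar>x\<bar> * e \<le> x\<^sup>2 + e\<^sup>2" using zero_le_power2[of "\<bar>x\<bar> - e"]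
      by (simp add: power2_eq_square algebra_simps)
    moreover have "0 \<le> \<bar>x\<bar> * e" using assms by simp
    ultimately have "\<bar>x\<bar> * e \<le> x\<^sup>2 + e\<^sup>2" by linarith
    moreover have "0 < x\<^sup>2 + e\<^sup>2" using assms by (simp add: add_nonneg_pos)
    ultimately show ?thesis using assms by (simp add: abs_divide divide_simps mult.commute)
  qed
  show ?thesis
    using field_differentiable_bound[of UNIV _ _ "1/e" a b, OF _ der bd] assms by (simp add: dist_real_def)
qed

context charge
begin

lemma abs_integrable: "integrable lborel (\<lambda>y. \<bar>t y\<bar>)"
  using integrable by simp

lemma integrable_mult_bounded:
  fixes g :: "real \<Rightarrow> 'b :: {second_countable_topology, banach, real_normed_field}"
  assumes [measurable]: "g \<in> borel_measurable borel" and "\<And>y. y \<in> {-1<..<1} \<Longrightarrow> norm (g y) \<le> C"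
  shows "integrable lborel (\<lambda>y. of_real (t y) * g y)"
proof (rule Bochner_Integration.integrable_bound)
  show "integrable lborel (\<lambda>y. C * \<bar>t y\<bar>)" using abs_integrable by simp
  have "norm (of_real (t y) * g y) \<le> C * \<bar>t y\<bar>" for y
    using assms(2)[of y] support[of y]
    by (cases "y \<in> {-1<..<1}") (auto simp: norm_mult mult.commute[of C] mult_left_mono)
  then show "AE y in lborel. norm (of_real (t y) * g y) \<le> norm (C * \<bar>t y\<bar>)"
    by (intro AE_I2) (simp add: order_trans[OF _ abs_ge_self])
qed simp

lemma cauchy_integrable:
  assumes "Im z \<noteq> 0"
  shows "integrable lborel (\<lambda>y. complex_of_real (t y) / (z - of_real y))"
proof -
  have "integrable lborel (\<lambda>y. complex_of_real (t y) * (1 / (z - of_real y)))"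
  proof (rule integrable_mult_bounded)
    fix y
    have "\<bar>Im z\<bar> \<le> cmod (z - of_real y)" using abs_Im_le_cmod[of "z - of_real y"] by simp
    then show "norm (1 / (z - of_real y)) \<le> 1 / \<bar>Im z\<bar>"
      using assms by (auto simp: norm_divide intro!: divide_left_mono mult_pos_pos)
  qed simp
  then show ?thesis by simp
qed

lemma Re_cauchy_transform:
  assumes "0 < e"
  shows "Re (cauchy_transform t (Complex x e)) = (LINT y|lborel. t y * ((x - y) / ((x - y)\<^sup>2 + e\<^sup>2))) / pi"
  using integral_Re[OF cauchy_integrable[of "Complex x e"]] assms
  by (simp add: cauchy_transform_def Re_divide power2_eq_square)

lemma Im_cauchy_transform:
  assumes "0 < e"
  shows "Im (cauchy_transform t (Complex x e)) = - (LINT y|lborel. t y * (e / ((x - y)\<^sup>2 + e\<^sup>2))) / pi"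
  using integral_Im[OF cauchy_integrable[of "Complex x e"]] assms
  by (simp add: cauchy_transform_def Im_divide power2_eq_square)

lemma smoothed_integrable:
  assumes "0 < e"
  shows "integrable lborel (\<lambda>y. t y * (ln ((x - y)\<^sup>2 + e\<^sup>2) / 2))"
proof -
  have "integrable lborel (\<lambda>y. of_real (t y) * (ln ((x - y)\<^sup>2 + e\<^sup>2) / 2))"
  proof (rule integrable_mult_bounded)
    fix y :: real assume y: "y \<in> {-1<..<1}"
    have "norm (ln ((x - y)\<^sup>2 + e\<^sup>2) / 2) \<le> \<bar>ln (0\<^sup>2 + e\<^sup>2) / 2\<bar> + \<bar>x - y\<bar> / e"
      using half_ln_Lipschitz[OF assms, of "x - y" 0] unfolding real_norm_def diff_zero by linarith
    also have "\<dots> \<le> \<bar>ln (0\<^sup>2 + e\<^sup>2) / 2\<bar> + (\<bar>x\<bar> + 1) / e"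
      using y assms by (intro add_left_mono divide_right_mono) auto
    finally show "norm (ln ((x - y)\<^sup>2 + e\<^sup>2) / 2) \<le> \<bar>ln (0\<^sup>2 + e\<^sup>2) / 2\<bar> + (\<bar>x\<bar> + 1) / e" .
  qed simp
  then show ?thesis by simp
qed

lemma continuous_smoothed:
  assumes "0 < e"
  shows "continuous_on A (smoothed_log_potential t e)"
proof -
  let ?C = "(LINT y|lborel. \<bar>t y\<bar>) / e / pi"
  have C0: "0 \<le> ?C" using assms by auto
  have "dist (smoothed_log_potential t e x) (smoothed_log_potential t e y) \<le> ?C * dist x y" for x y
  proof -
    have "\<bar>(LINT w|lborel. t w * (ln ((x - w)\<^sup>2 + e\<^sup>2) / 2)) - (LINT w|lborel. t w * (ln ((y - w)\<^sup>2 + e\<^sup>2) / 2))\<bar>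
       = \<bar>LINT w|lborel. t w * (ln ((x - w)\<^sup>2 + e\<^sup>2) / 2 - ln ((y - w)\<^sup>2 + e\<^sup>2) / 2)\<bar>"
      using smoothed_integrable[OF assms] by (simp add: right_diff_distrib)
    also have "\<dots> \<le> (LINT w|lborel. \<bar>t w\<bar> * (\<bar>x - y\<bar> / e))"
    proof (rule integral_abs_bound_integral)
      show "integrable lborel (\<lambda>w. t w * (ln ((x - w)\<^sup>2 + e\<^sup>2) / 2 - ln ((y - w)\<^sup>2 + e\<^sup>2) / 2))"
        using smoothed_integrable[OF assms] by (simp add: right_diff_distrib)
      show "integrable lborel (\<lambda>w. \<bar>t w\<bar> * (\<bar>x - y\<bar> / e))" using abs_integrable by simp
      show "\<bar>t w * (ln ((x - w)\<^sup>2 + e\<^sup>2) / 2 - ln ((y - w)\<^sup>2 + e\<^sup>2) / 2)\<bar> \<le> \<bar>t w\<bar> * (\<bar>x - y\<bar> / e)" for w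
        using half_ln_Lipschitz[OF assms, of "x - w" "y - w"] 
        by (simp only: abs_mult) (rule mult_left_mono, auto)
    qed
    finally show ?thesis
      by (simp add: smoothed_log_potential_def dist_real_def diff_divide_distrib[symmetric] field_simps)
  qed
  then have "?C-lipschitz_on A (smoothed_log_potential t e)" using C0 by (intro lipschitz_onI) auto
  then show ?thesis by (rule lipschitz_on_continuous_on)
qed

end

context mild_charge
begin

lemma log_dominated: "\<bar>t y * ln \<bar>x - y\<bar>\<bar> \<le> (\<bar>t y\<bar> * \<bar>x - y\<bar> powr - s) / s + (\<bar>x\<bar> + 1) * \<bar>t y\<bar>"
proof (cases "y \<in> {-1<..<1}")
  case True
  have "\<bar>ln \<bar>x - y\<bar>\<bar> \<le> \<bar>x - y\<bar> powr - s / s + (\<bar>x\<bar> + 1)"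
    using abs_ln_le_powr[OF s(1), of "\<bar>x-y\<bar>"] True by auto
  then have "\<bar>t y\<bar> * \<bar>ln \<bar>x - y\<bar>\<bar> \<le> \<bar>t y\<bar> * (\<bar>x - y\<bar> powr - s / s + (\<bar>x\<bar> + 1))" by (intro mult_left_mono) auto
  then show ?thesis by (simp add: abs_mult algebra_simps)
qed (simp add: support)

lemma log_dominated_integrable:
  "integrable lborel (\<lambda>y. (\<bar>t y\<bar> * \<bar>x - y\<bar> powr - s) / s + (\<bar>x\<bar> + 1) * \<bar>t y\<bar>)"
  using riesz_integrable[of x] abs_integrable by simp

lemma log_integrable: "integrable lborel (\<lambda>y. t y * ln \<bar>x - y\<bar>)"
  by (rule Bochner_Integration.integrable_bound[OF log_dominated_integrable[of x]])
     (auto intro!: AE_I2 order_trans[OF log_dominated])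

lemma abs_log_integral_le:
  "(LINT y|lborel. \<bar>t y * ln \<bar>x - y\<bar>\<bar>) \<le> (M / s + (LINT y|lborel. \<bar>t y\<bar>)) * (1 + \<bar>x\<bar>)"
proof -
  have "(LINT y|lborel. \<bar>t y * ln \<bar>x - y\<bar>\<bar>) \<le> (LINT y|lborel. (\<bar>t y\<bar> * \<bar>x - y\<bar> powr - s) / s + (\<bar>x\<bar> + 1) * \<bar>t y\<bar>)"
    using log_integrable by (intro integral_mono log_dominated_integrable log_dominated integrable_abs)
  also have "\<dots> = (LINT y|lborel. (\<bar>t y\<bar> * \<bar>x - y\<bar> powr - s)) / s + (\<bar>x\<bar> + 1) * (LINT y|lborel. \<bar>t y\<bar>)"
    using riesz_integrable[of x] abs_integrable by simp
  also have "\<dots> \<le> M / s + (\<bar>x\<bar> + 1) * (LINT y|lborel. \<bar>t y\<bar>)"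
    using riesz_le[of x] s by (intro add_right_mono divide_right_mono) auto
  also have "\<dots> \<le> M / s * (1 + \<bar>x\<bar>) + (\<bar>x\<bar> + 1) * (LINT y|lborel. \<bar>t y\<bar>)"
  proof -
    have "0 \<le> (LINT y|lborel. \<bar>t y\<bar> * \<bar>x - y\<bar> powr - s)" by (intro integral_nonneg_AE) auto
    then have "0 \<le> M / s" using order_trans[OF _ riesz_le[of x]] s by simp
    then have "M / s * 1 \<le> M / s * (1 + \<bar>x\<bar>)" by (intro mult_left_mono) auto
    then show ?thesis by simp
  qed
  finally show ?thesis by (simp add: algebra_simps)
qed

lemma smoothed_log_potential_close:
  assumes "0 < e"
  shows "\<bar>smoothed_log_potential t e x - log_potential t x\<bar> \<le> e powr s * (M / (s * pi))"
proof -
  have "\<bar>(LINT y|lborel. t y * (ln ((x - y)\<^sup>2 + e\<^sup>2) / 2)) - (LINT y|lborel. t y * ln \<bar>x - y\<bar>)\<bar>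
      = \<bar>LINT y|lborel. t y * (ln ((x - y)\<^sup>2 + e\<^sup>2) / 2 - ln \<bar>x - y\<bar>)\<bar>"
    using smoothed_integrable[OF assms] log_integrable by (simp add: right_diff_distrib)
  also have "\<dots> \<le> (LINT y|lborel. \<bar>t y * (ln ((x - y)\<^sup>2 + e\<^sup>2) / 2 - ln \<bar>x - y\<bar>)\<bar>)"
    by (rule integral_abs_bound)
  also have "\<dots> \<le> (LINT y|lborel. e powr s / s * (\<bar>t y\<bar> * \<bar>x - y\<bar> powr - s))"
  proof (rule integral_mono_AE)
    show "integrable lborel (\<lambda>y. \<bar>t y * (ln ((x - y)\<^sup>2 + e\<^sup>2) / 2 - ln \<bar>x - y\<bar>)\<bar>)"
      using smoothed_integrable[OF assms] log_integrable by (simp add: right_diff_distrib)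
    show "integrable lborel (\<lambda>y. e powr s / s * (\<bar>t y\<bar> * \<bar>x - y\<bar> powr - s))"
      using riesz_integrable by simp
    have "\<bar>t y * (ln ((x - y)\<^sup>2 + e\<^sup>2) / 2 - ln \<bar>x - y\<bar>)\<bar> \<le> e powr s / s * (\<bar>t y\<bar> * \<bar>x - y\<bar> powr - s)"
      if "y \<noteq> x" for y
    proof -
      have "\<bar>t y\<bar> * \<bar>ln ((x - y)\<^sup>2 + e\<^sup>2) / 2 - ln \<bar>x - y\<bar>\<bar> \<le> \<bar>t y\<bar> * (\<bar>e\<bar> powr s / s * \<bar>x - y\<bar> powr - s)"
        using that s by (intro mult_left_mono half_ln_diff_le) auto
      also have "\<dots> = e powr s / s * (\<bar>t y\<bar> * \<bar>x - y\<bar> powr - s)" using assms by simp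
      finally show ?thesis by (simp only: abs_mult)
    qed
    then show "AE y in lborel. \<bar>t y * (ln ((x - y)\<^sup>2 + e\<^sup>2) / 2 - ln \<bar>x - y\<bar>)\<bar> \<le> e powr s / s * (\<bar>t y\<bar> * \<bar>x - y\<bar> powr - s)"
      using AE_lborel_singleton[of x] by (auto elim!: eventually_mono)
  qed
  also have "\<dots> \<le> e powr s / s * M" using riesz_le[of x] s by (simp add: divide_right_mono mult_left_mono)
  finally have "\<bar>(LINT y|lborel. t y * (ln ((x - y)\<^sup>2 + e\<^sup>2) / 2)) - (LINT y|lborel. t y * ln \<bar>x - y\<bar>)\<bar> / pi
     \<le> e powr s / s * M / pi" by (intro divide_right_mono) auto
  then show ?thesis
    unfolding smoothed_log_potential_def log_potential_def diff_divide_distrib[symmetric] abs_divide by simp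
qed

text \<open>
  Regularising the kernel to the smooth \<open>ln (r^2 + e^2) / 2\<close> changes the potential by at most a multiple
  of \<open>e powr s\<close>. This gives the continuity of the potential, and a passage from half plane to axis.
\<close>
lemma uniform_limit_smoothed: "uniform_limit A (smoothed_log_potential t) (log_potential t) (at_right 0)"
proof (rule uniform_limitI)
  fix d :: real assume d: "0 < d"
  have "((\<lambda>e. e powr s * (M / (s * pi))) \<longlongrightarrow> 0 * (M / (s * pi))) (at_right 0)"
    using s by (intro tendsto_intros) real_asymp
  then have "eventually (\<lambda>e. e powr s * (M / (s * pi)) < d) (at_right 0)"
    using d by (auto dest: order_tendstoD)
  then show "\<forall>\<^sub>F e in at_right 0. \<forall>x\<in>A. dist (smoothed_log_potential t e x) (log_potential t x) < d"
    using eventually_at_right_less[of 0]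
  proof eventually_elim
    case (elim e)
    then show ?case using smoothed_log_potential_close[of e]
      by (auto simp: dist_real_def intro: order_le_less_trans)
  qed
qed

lemma continuous_log_potential: "continuous_on A (log_potential t)"
proof (rule uniform_limit_theorem[OF _ uniform_limit_smoothed])
  show "\<forall>\<^sub>F e in at_right 0. continuous_on A (smoothed_log_potential t e)"
    using eventually_at_right_less[of 0] by eventually_elim (rule continuous_smoothed)
qed simp

end

section \<open>Exchange of integrals\<close>

lemma integral_tendsto_at_right_0:
  fixes s :: "real \<Rightarrow> 'a \<Rightarrow> 'b :: {banach, second_countable_topology}"
  assumes f: "f \<in> borel_measurable L" and s: "\<And>e. s e \<in> borel_measurable L"
    and w: "integrable L w"
    and lim: "AE x in L. ((\<lambda>e. s e x) \<longlongrightarrow> f x) (at_right 0)"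
    and bound: "\<And>e. 0 < e \<Longrightarrow> e < 1 \<Longrightarrow> AE x in L. norm (s e x) \<le> w x"
  shows "((\<lambda>e. integral\<^sup>L L (s e)) \<longlongrightarrow> integral\<^sup>L L f) (at_right 0)" and "integrable L f"
proof -
  have l: "AE x in L. ((\<lambda>e. s (inverse e) x) \<longlongrightarrow> f x) at_top"
    using lim by (simp add: filterlim_at_right_to_top)
  have b: "\<forall>\<^sub>F e in at_top. AE x in L. norm (s (inverse e) x) \<le> w x"
    using eventually_gt_at_top[of 1] by eventually_elim (auto intro!: bound simp: field_simps)
  show "((\<lambda>e. integral\<^sup>L L (s e)) \<longlongrightarrow> integral\<^sup>L L f) (at_right 0)"
    unfolding filterlim_at_right_to_top
    using integral_dominated_convergence_at_top[OF f s w l b] .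
  show "integrable L f" using integrable_dominated_convergence_at_top[OF f s w l b] .
qed

lemma Fubini_dominated:
  fixes H :: "real \<Rightarrow> real \<Rightarrow> real"
  assumes [measurable]: "(\<lambda>(x, y). H x y) \<in> borel_measurable (lborel \<Otimes>\<^sub>M lborel)"
    and 1: "\<And>x. integrable lborel (H x)"
    and 2: "\<And>x. (LINT y|lborel. \<bar>H x y\<bar>) \<le> B x" and 3: "integrable lborel B"
  shows "AE y in lborel. integrable lborel (\<lambda>x. H x y)"
    and "integrable lborel (\<lambda>x. LINT y|lborel. H x y)"
    and "integrable lborel (\<lambda>y. LINT x|lborel. H x y)"
    and "(LINT y|lborel. LINT x|lborel. H x y) = (LINT x|lborel. LINT y|lborel. H x y)"
proof -
  have i: "integrable (lborel \<Otimes>\<^sub>M lborel) (\<lambda>(x, y). H x y)"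
  proof (rule lborel_pair.Fubini_integrable)
    show "integrable lborel (\<lambda>x. LINT y|lborel. norm (case (x, y) of (x, y) \<Rightarrow> H x y))"
    proof (rule Bochner_Integration.integrable_bound[OF 3])
      have "\<bar>LINT y|lborel. \<bar>H x y\<bar>\<bar> \<le> \<bar>B x\<bar>" for x
      proof -
        have "0 \<le> (LINT y|lborel. \<bar>H x y\<bar>)" by (intro integral_nonneg_AE) auto
        then show ?thesis using 2[of x] by linarith
      qed
      then show "AE x in lborel. norm (LINT y|lborel. norm (case (x, y) of (x, y) \<Rightarrow> H x y)) \<le> norm (B x)"
        by auto
    qed measurable
  qed (use 1 in auto)
  show "AE y in lborel. integrable lborel (\<lambda>x. H x y)"
    using lborel_pair.AE_integrable_snd[OF i] .
  show "integrable lborel (\<lambda>x. LINT y|lborel. H x y)"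
    using lborel_pair.integrable_fst[OF i] .
  show "integrable lborel (\<lambda>y. LINT x|lborel. H x y)"
    using lborel_pair.integrable_snd[OF i] .
  show "(LINT y|lborel. LINT x|lborel. H x y) = (LINT x|lborel. LINT y|lborel. H x y)"
    using lborel_pair.Fubini_integral[OF i] .
qed

lemma DERIV_half_ln:
  fixes c e x :: real
  assumes "0 < e"
  shows "((\<lambda>x. ln ((x - c)\<^sup>2 + e\<^sup>2) / 2) has_field_derivative (x - c) / ((x - c)\<^sup>2 + e\<^sup>2)) (at x)"
proof -
  have pos: "0 < (x - c)\<^sup>2 + e\<^sup>2" using assms by (simp add: add_nonneg_pos)
  have "((\<lambda>x. (x - c)\<^sup>2 + e\<^sup>2) has_field_derivative 2 * (x - c)) (at x)"
    by (auto intro!: derivative_eq_intros)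
  from DERIV_cdivide[OF DERIV_chain2[OF DERIV_ln_divide[OF pos] this], of 2]
  have "((\<lambda>x. ln ((x - c)\<^sup>2 + e\<^sup>2) / 2) has_field_derivative (1 / ((x - c)\<^sup>2 + e\<^sup>2)) * (2 * (x - c)) / 2) (at x)" .
  moreover have "1 / q * (2 * k) / 2 = k / q" for q k :: real by simp
  ultimately show ?thesis by (simp only:)
qed

lemma DERIV_arctan_scaled:
  fixes c e x :: real
  assumes "0 < e"
  shows "((\<lambda>x. arctan ((x - c) / e)) has_field_derivative e / ((x - c)\<^sup>2 + e\<^sup>2)) (at x)"
proof -
  have "0 < (x - c)\<^sup>2 + e\<^sup>2" using assms by (simp add: add_nonneg_pos)
  then have "1 / e / (1 + ((x - c) / e)\<^sup>2) = e / ((x - c)\<^sup>2 + e\<^sup>2)"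
    using assms by (simp add: field_simps power2_eq_square)
  then show ?thesis using assms by (auto intro!: derivative_eq_intros simp: divide_inverse mult.commute)
qed

context charge
begin

lemma swap_bounded_kernel:
  fixes K :: "real \<Rightarrow> real \<Rightarrow> real"
  assumes [measurable]: "(\<lambda>(x, y). K x y) \<in> borel_measurable (lborel \<Otimes>\<^sub>M lborel)"
    and bd: "\<And>x y. x \<in> {a..b} \<Longrightarrow> \<bar>K x y\<bar> \<le> C"
  shows "(LINT x|lborel. indicator {a..b} x * (LINT y|lborel. t y * K x y))
       = (LINT y|lborel. t y * (LINT x|lborel. indicator {a..b} x * K x y))"
    and "integrable lborel (\<lambda>x. indicator {a..b} x * (LINT y|lborel. t y * K x y))"
proof -
  define H where "H = (\<lambda>x y. indicator {a..b} x * (t y * K x y))"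
  have H[measurable]: "(\<lambda>(x, y). H x y) \<in> borel_measurable (lborel \<Otimes>\<^sub>M lborel)"
    unfolding H_def by measurable
  have Hb: "\<bar>H x y\<bar> \<le> indicator {a..b} x * \<bar>C\<bar> * \<bar>t y\<bar>" for x y
  proof (cases "x \<in> {a..b}")
    case True
    have "\<bar>t y\<bar> * \<bar>K x y\<bar> \<le> \<bar>t y\<bar> * \<bar>C\<bar>" using bd[OF True, of y] by (intro mult_left_mono) auto
    then show ?thesis using True by (simp add: H_def abs_mult mult.commute)
  qed (simp add: H_def)
  have Hi: "integrable lborel (H x)" for x
  proof (rule Bochner_Integration.integrable_bound)
    show "integrable lborel (\<lambda>y. indicator {a..b} x * \<bar>C\<bar> * \<bar>t y\<bar>)" using abs_integrable by simp
    show "AE y in lborel. norm (H x y) \<le> norm (indicator {a..b} x * \<bar>C\<bar> * \<bar>t y\<bar>)"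
      using Hb by (intro AE_I2) (simp add: order_trans[OF _ abs_ge_self])
  qed measurable
  have B: "(LINT y|lborel. \<bar>H x y\<bar>) \<le> indicator {a..b} x * (\<bar>C\<bar> * (LINT y|lborel. \<bar>t y\<bar>))" for x
  proof -
    have "(LINT y|lborel. \<bar>H x y\<bar>) \<le> (LINT y|lborel. indicator {a..b} x * \<bar>C\<bar> * \<bar>t y\<bar>)"
      using Hi abs_integrable by (intro integral_mono Hb integrable_abs) auto
    then show ?thesis by (simp add: mult.assoc)
  qed
  have Bi: "integrable lborel (\<lambda>x. indicator {a..b} x * (\<bar>C\<bar> * (LINT y|lborel. \<bar>t y\<bar>)))"
    by (intro integrable_mult_left) (auto simp: integrable_real_indicator emeasure_lborel_Icc_eq)
  note F = Fubini_dominated[OF H Hi B Bi]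
  have e1: "(LINT y|lborel. H x y) = indicator {a..b} x * (LINT y|lborel. t y * K x y)" for x
    by (simp add: H_def)
  have e2: "(LINT x|lborel. H x y) = t y * (LINT x|lborel. indicator {a..b} x * K x y)" for y
  proof -
    have "(LINT x|lborel. H x y) = (LINT x|lborel. t y * (indicator {a..b} x * K x y))"
      unfolding H_def by (intro Bochner_Integration.integral_cong) auto
    then show ?thesis by simp
  qed
  show "(LINT x|lborel. indicator {a..b} x * (LINT y|lborel. t y * K x y))
       = (LINT y|lborel. t y * (LINT x|lborel. indicator {a..b} x * K x y))"
    using F(4) unfolding e1 e2 by simp
  show "integrable lborel (\<lambda>x. indicator {a..b} x * (LINT y|lborel. t y * K x y))"
    using F(2) unfolding e1 .
qed

text \<open>The kernel of the real part is the derivative of the regularised logarithm.\<close>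
lemma integral_Re_cauchy_transform:
  assumes "0 < e" "a \<le> b"
  shows "(LINT x|lborel. indicator {a..b} x * Re (cauchy_transform t (Complex x e)))
    = smoothed_log_potential t e b - smoothed_log_potential t e a"
proof -
  have pos: "0 < r\<^sup>2 + e\<^sup>2" for r using assms by (simp add: add_nonneg_pos)
  have "\<bar>r / (r\<^sup>2 + e\<^sup>2)\<bar> \<le> 1 / e" for r
  proof -
    have "2 * \<bar>r\<bar> * e \<le> r\<^sup>2 + e\<^sup>2" using zero_le_power2[of "\<bar>r\<bar> - e"]
      by (simp add: power2_eq_square algebra_simps)
    moreover have "0 \<le> \<bar>r\<bar> * e" using assms by simp
    ultimately have "\<bar>r\<bar> * e \<le> r\<^sup>2 + e\<^sup>2" by linarith
    then show ?thesis using assms pos[of r] by (simp add: abs_divide divide_simps mult.commute)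
  qed
  note swap = swap_bounded_kernel(1)[of "\<lambda>x y. (x - y) / ((x - y)\<^sup>2 + e\<^sup>2)" a b "1/e", OF _ this]
  have inner: "(LINT x|lborel. indicator {a..b} x * ((x - y) / ((x - y)\<^sup>2 + e\<^sup>2)))
       = ln ((b - y)\<^sup>2 + e\<^sup>2) / 2 - ln ((a - y)\<^sup>2 + e\<^sup>2) / 2" for y
  proof -
    have "(LINT x|lborel. ((x - y) / ((x - y)\<^sup>2 + e\<^sup>2)) * indicator {a..b} x)
       = ln ((b - y)\<^sup>2 + e\<^sup>2) / 2 - ln ((a - y)\<^sup>2 + e\<^sup>2) / 2"
    proof (rule integral_FTC_Icc_real)
      fix x
      show "DERIV (\<lambda>x. ln ((x - y)\<^sup>2 + e\<^sup>2) / 2) x :> (x - y) / ((x - y)\<^sup>2 + e\<^sup>2)"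
        by (rule DERIV_half_ln[OF assms(1)])
      show "isCont (\<lambda>x. (x - y) / ((x - y)\<^sup>2 + e\<^sup>2)) x"
        using pos[of "x - y"] by (intro continuous_intros) auto
    qed (use assms in auto)
    then show ?thesis by (simp add: mult.commute)
  qed
  have "(LINT x|lborel. indicator {a..b} x * Re (cauchy_transform t (Complex x e)))
     = (LINT x|lborel. indicator {a..b} x * (LINT y|lborel. t y * ((x - y) / ((x - y)\<^sup>2 + e\<^sup>2)))) / pi"
    by (simp add: Re_cauchy_transform[OF assms(1)])
  also have "\<dots> = (LINT y|lborel. t y * (ln ((b - y)\<^sup>2 + e\<^sup>2) / 2 - ln ((a - y)\<^sup>2 + e\<^sup>2) / 2)) / pi"
    by (subst swap) (measurable, simp only: inner)
  also have "\<dots> = smoothed_log_potential t e b - smoothed_log_potential t e a"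
    unfolding right_diff_distrib
    by (subst Bochner_Integration.integral_diff[OF smoothed_integrable[OF assms(1)] smoothed_integrable[OF assms(1)]])
       (simp only: smoothed_log_potential_def diff_divide_distrib)
  finally show ?thesis .
qed

text \<open>
  Stieltjes inversion: the Poisson kernel integrated over the interval is a difference of two arctangents,
  which tends to \<open>pi\<close> inside and to \<open>0\<close> outside.
\<close>
lemma integral_Im_cauchy_transform_tendsto:
  assumes "a \<le> b"
  shows "((\<lambda>e. LINT x|lborel. indicator {a..b} x * Im (cauchy_transform t (Complex x e)))
    \<longlongrightarrow> - (LINT y|lborel. indicator {a..b} y * t y)) (at_right 0)"
proof -
  define A where "A = (\<lambda>e y. arctan ((b - y) / e) - arctan ((a - y) / e))"
  have eq: "(LINT x|lborel. indicator {a..b} x * Im (cauchy_transform t (Complex x e)))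
      = - (LINT y|lborel. t y * A e y) / pi" if e: "0 < e" for e
  proof -
    have pos: "0 < r\<^sup>2 + e\<^sup>2" for r using e by (simp add: add_nonneg_pos)
    have "\<bar>e / (r\<^sup>2 + e\<^sup>2)\<bar> \<le> 1 / e" for r
      using e pos[of r] by (simp add: abs_divide divide_simps power2_eq_square)
    note swap = swap_bounded_kernel(1)[of "\<lambda>x y. e / ((x - y)\<^sup>2 + e\<^sup>2)" a b "1/e", OF _ this]
    have inner: "(LINT x|lborel. indicator {a..b} x * (e / ((x - y)\<^sup>2 + e\<^sup>2))) = A e y" for y
    proof -
      have "(LINT x|lborel. (e / ((x - y)\<^sup>2 + e\<^sup>2)) * indicator {a..b} x)
         = arctan ((b - y) / e) - arctan ((a - y) / e)"
      proof (rule integral_FTC_Icc_real)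
        fix x
        show "DERIV (\<lambda>x. arctan ((x - y) / e)) x :> e / ((x - y)\<^sup>2 + e\<^sup>2)"
          by (rule DERIV_arctan_scaled[OF e])
        show "isCont (\<lambda>x. e / ((x - y)\<^sup>2 + e\<^sup>2)) x"
          using pos[of "x - y"] by (intro continuous_intros) auto
      qed (use assms in auto)
      then show ?thesis by (simp add: mult.commute A_def)
    qed
    have "(LINT x|lborel. indicator {a..b} x * Im (cauchy_transform t (Complex x e)))
       = - (LINT x|lborel. indicator {a..b} x * (LINT y|lborel. t y * (e / ((x - y)\<^sup>2 + e\<^sup>2)))) / pi"
      by (simp add: Im_cauchy_transform[OF e])
    also have "\<dots> = - (LINT y|lborel. t y * A e y) / pi"
      by (subst swap) (measurable, simp only: inner)
    finally show ?thesis .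
  qed
  have "((\<lambda>e. LINT y|lborel. t y * A e y) \<longlongrightarrow> (LINT y|lborel. pi * (indicator {a..b} y * t y))) (at_right 0)"
  proof (rule integral_tendsto_at_right_0)
    show "integrable lborel (\<lambda>y. pi * \<bar>t y\<bar>)" using abs_integrable by simp
    show "AE y in lborel. norm (t y * A e y) \<le> pi * \<bar>t y\<bar>" for e
    proof (intro AE_I2)
      fix y
      have "\<bar>A e y\<bar> \<le> pi" using arctan_bounded[of "(b-y)/e"] arctan_bounded[of "(a-y)/e"]
        unfolding A_def by linarith
      then have "\<bar>t y\<bar> * \<bar>A e y\<bar> \<le> \<bar>t y\<bar> * pi" by (intro mult_left_mono) auto
      then show "norm (t y * A e y) \<le> pi * \<bar>t y\<bar>" by (simp add: abs_mult mult.commute)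
    qed
    have lim: "((\<lambda>e. t y * A e y) \<longlongrightarrow> pi * (indicator {a..b} y * t y)) (at_right 0)" if ne: "y \<noteq> a" "y \<noteq> b" for y
    proof -
      consider "y < a" | "a < y" "y < b" | "b < y" using ne by linarith
      then have "((\<lambda>e. A e y) \<longlongrightarrow> pi * indicator {a..b} y) (at_right 0)"
      proof cases
        case 1
        then have "0 < b - y" "0 < a - y" using assms by auto
        then have "((\<lambda>e. A e y) \<longlongrightarrow> 0) (at_right 0)" unfolding A_def by real_asymp
        then show ?thesis using 1 by simp
      next
        case 2
        then have "0 < b - y" "a - y < 0" using assms by auto
        then have "((\<lambda>e. A e y) \<longlongrightarrow> pi) (at_right 0)" unfolding A_def by real_asymp
        then show ?thesis using 2 by simp
      next
        case 3
        then have "b - y < 0" "a - y < 0" using assms by auto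
        then have "((\<lambda>e. A e y) \<longlongrightarrow> 0) (at_right 0)" unfolding A_def by real_asymp
        then show ?thesis using 3 by simp
      qed
      from tendsto_mult_left[OF this, of "t y"] show ?thesis by (simp add: mult_ac)
    qed
    show "AE y in lborel. ((\<lambda>e. t y * A e y) \<longlongrightarrow> pi * (indicator {a..b} y * t y)) (at_right 0)"
      using AE_lborel_singleton[of a] AE_lborel_singleton[of b]
    proof eventually_elim
      case (elim y) then show ?case by (rule lim)
    qed
  qed (auto simp: A_def)
  then have "((\<lambda>e. - (LINT y|lborel. t y * A e y) / pi) \<longlongrightarrow> - (LINT y|lborel. pi * (indicator {a..b} y * t y)) / pi) (at_right 0)"
    by (intro tendsto_intros) auto
  then have l: "((\<lambda>e. - (LINT y|lborel. t y * A e y) / pi) \<longlongrightarrow> - (LINT y|lborel. indicator {a..b} y * t y)) (at_right 0)"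
    by simp
  show ?thesis
    by (rule Lim_transform_eventually[OF l]) (use eventually_at_right_less[of 0] in eventually_elim, simp add: eq)
qed

end

context mild_charge
begin

lemma log_potential_measurable [measurable]: "log_potential t \<in> borel_measurable borel"
  by (intro borel_measurable_continuous_onI continuous_log_potential)

lemma log_potential_pairing:
  assumes [measurable]: "k \<in> borel_measurable borel"
    and k: "integrable lborel (\<lambda>x. (1 + \<bar>x\<bar>) * \<bar>k x\<bar>)"
  shows "AE y in lborel. integrable lborel (\<lambda>x. t y * ln \<bar>x - y\<bar> * k x)"
    and "integrable lborel (\<lambda>x. log_potential t x * k x)"
    and "(LINT x|lborel. log_potential t x * k x) = (LINT y|lborel. t y * (LINT x|lborel. ln \<bar>x - y\<bar> * k x)) / pi"
proof -
  define H where "H = (\<lambda>x y. t y * ln \<bar>x - y\<bar> * k x)"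
  have H[measurable]: "(\<lambda>(x, y). H x y) \<in> borel_measurable (lborel \<Otimes>\<^sub>M lborel)"
    unfolding H_def by measurable
  have Hi: "integrable lborel (H x)" for x
    using log_integrable[of x] by (auto simp: H_def)
  let ?C = "M / s + (LINT y|lborel. \<bar>t y\<bar>)"
  have B: "(LINT y|lborel. \<bar>H x y\<bar>) \<le> ?C * ((1 + \<bar>x\<bar>) * \<bar>k x\<bar>)" for x
  proof -
    have "(LINT y|lborel. \<bar>H x y\<bar>) = (LINT y|lborel. \<bar>t y * ln \<bar>x - y\<bar>\<bar>) * \<bar>k x\<bar>"
      by (simp add: H_def abs_mult)
    also have "\<dots> \<le> (?C * (1 + \<bar>x\<bar>)) * \<bar>k x\<bar>"
      by (intro mult_right_mono abs_log_integral_le) auto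
    finally show ?thesis by (simp add: mult.assoc)
  qed
  have Bi: "integrable lborel (\<lambda>x. ?C * ((1 + \<bar>x\<bar>) * \<bar>k x\<bar>))" using k by simp
  note F = Fubini_dominated[OF H Hi B Bi]
  have e1: "(LINT y|lborel. H x y) = pi * (log_potential t x * k x)" for x
    by (simp add: H_def log_potential_def)
  have e2: "(LINT x|lborel. H x y) = t y * (LINT x|lborel. ln \<bar>x - y\<bar> * k x)" for y
    by (simp add: H_def mult.assoc)
  show "AE y in lborel. integrable lborel (\<lambda>x. t y * ln \<bar>x - y\<bar> * k x)"
    using F(1) by (simp add: H_def)
  show "integrable lborel (\<lambda>x. log_potential t x * k x)"
    using F(2) unfolding e1 by simp
  show "(LINT x|lborel. log_potential t x * k x) = (LINT y|lborel. t y * (LINT x|lborel. ln \<bar>x - y\<bar> * k x)) / pi"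
    using F(4) unfolding e1 e2 by simp
qed

end

text \<open>
  The Poisson integral of \<open>ln |x|\<close> is \<open>ln |z|\<close>; this is the horizontal derivative of that fact, with the
  derivative put on the Poisson kernel.
\<close>
lemma log_kernel_integral:
  fixes a e :: real
  assumes e: "0 < e"
    and int: "integrable lborel (\<lambda>x::real. ln \<bar>x\<bar> * (2 * e * (x - a) / ((x - a)\<^sup>2 + e\<^sup>2)\<^sup>2))"
  shows "(LINT x|lborel. ln \<bar>x\<bar> * (2 * e * (x - a) / ((x - a)\<^sup>2 + e\<^sup>2)\<^sup>2)) = pi * (a / (a\<^sup>2 + e\<^sup>2))"
proof -
  let ?f = "\<lambda>x::real. ln \<bar>x\<bar> * (2 * e * (x - a) / ((x - a)\<^sup>2 + e\<^sup>2)\<^sup>2)"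
  define D where "D = a\<^sup>2 + e\<^sup>2"
  have D: "0 < D" using e by (simp add: D_def add_nonneg_pos)
  have pos: "0 < (x - a)\<^sup>2 + e\<^sup>2" for x using e by (simp add: add_nonneg_pos)
  \<comment> \<open>A primitive, found by an integration by parts and a partial fraction decomposition. The constant \<open>e / D\<close> makes it continuous at \<open>0\<close>.\<close>
  define F where "F = (\<lambda>x. ln \<bar>x\<bar> * (e / D - e / ((x - a)\<^sup>2 + e\<^sup>2))
     - e / D * (ln ((x - a)\<^sup>2 + e\<^sup>2) / 2) + a / D * arctan ((x - a) / e))"
  have der: "(F has_vector_derivative ?f x) (at x)" if x: "x \<noteq> 0" for x
  proof -
    have dl: "((\<lambda>x. ln \<bar>x\<bar>) has_field_derivative 1 / x) (at x)"
    proof (cases "0 < x")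
      case True
      have "eventually (\<lambda>y. y \<in> {0<..}) (nhds x)" using True by (intro eventually_nhds_in_open) auto
      then have "eventually (\<lambda>y. ln \<bar>y\<bar> = ln y) (nhds x)" by eventually_elim auto
      then show ?thesis using True by (subst DERIV_cong_ev[OF refl _ refl]) (auto intro!: derivative_eq_intros)
    next
      case False
      have "eventually (\<lambda>y. y \<in> {..<0}) (nhds x)" using False x by (intro eventually_nhds_in_open) auto
      then have "eventually (\<lambda>y. ln \<bar>y\<bar> = ln (- y)) (nhds x)" by eventually_elim auto
      then show ?thesis using False x by (subst DERIV_cong_ev[OF refl _ refl]) (auto intro!: derivative_eq_intros)
    qed
    let ?q = "(x - a)\<^sup>2 + e\<^sup>2"
    have q0: "?q \<noteq> 0" using less_imp_neq[OF pos[of x]] by (rule not_sym)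
    note darc = DERIV_arctan_scaled[OF e, of a x] and dlq = DERIV_half_ln[OF e, of a x]
    have dq: "((\<lambda>x. (x - a)\<^sup>2 + e\<^sup>2) has_field_derivative 2 * (x - a)) (at x)"
      by (auto intro!: derivative_eq_intros)
    have dinv: "((\<lambda>x. e / D - e / ((x - a)\<^sup>2 + e\<^sup>2)) has_field_derivative e * (2 * (x - a)) / ?q\<^sup>2) (at x)"
      using DERIV_diff[OF DERIV_const[of "e / D"] DERIV_divide[OF DERIV_const[of e] dq q0]]
      by (simp add: power2_eq_square)
    have "(F has_field_derivative (1 / x) * (e / D - e / ?q) + (e * (2 * (x - a)) / ?q\<^sup>2) * ln \<bar>x\<bar>
        - e / D * ((x - a) / ?q) + a / D * (e / ?q)) (at x)"
      unfolding F_def by (intro DERIV_add DERIV_diff DERIV_mult DERIV_cmult dl dinv dlq darc)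
    also have "(1 / x) * (e / D - e / ?q) - e / D * ((x - a) / ?q) + a / D * (e / ?q) = 0"
    proof -
      have "e / D - e / ?q = e * (?q - D) / (D * ?q)" using D q0 by (simp add: field_simps)
      also have "?q - D = x * (x - 2 * a)" by (simp add: D_def power2_eq_square algebra_simps)
      finally have "(1 / x) * (e / D - e / ?q) = e * (x - 2 * a) / (D * ?q)" using x by simp
      then have "(1 / x) * (e / D - e / ?q) - e / D * ((x - a) / ?q) + a / D * (e / ?q)
         = (e * (x - 2 * a) - e * (x - a) + a * e) / (D * ?q)"
        by (simp only: times_divide_times_eq) (simp only: add_divide_distrib[symmetric] diff_divide_distrib[symmetric])
      also have "e * (x - 2 * a) - e * (x - a) + a * e = 0" by (simp add: algebra_simps)
      finally show ?thesis by simp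
    qed
    then have "(1 / x) * (e / D - e / ?q) + (e * (2 * (x - a)) / ?q\<^sup>2) * ln \<bar>x\<bar>
        - e / D * ((x - a) / ?q) + a / D * (e / ?q) = ?f x" by (simp add: mult_ac)
    finally show ?thesis by (simp add: has_real_derivative_iff_has_vector_derivative)
  qed
  have cont: "isCont ?f x" if "x \<noteq> 0" for x
  proof -
    have "((x - a)\<^sup>2 + e\<^sup>2)\<^sup>2 \<noteq> 0" using less_imp_neq[OF pos[of x]] by (metis power_not_zero)
    then show ?thesis using that by (intro continuous_intros) auto
  qed
  define F0 where "F0 = - e / D * (ln (a\<^sup>2 + e\<^sup>2) / 2) + a / D * arctan (- a / e)"
  have l0: "((\<lambda>x. ln \<bar>x\<bar> * (e / D - e / ((x - a)\<^sup>2 + e\<^sup>2))) \<longlongrightarrow> 0) (at 0)"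
  proof -
    have eq: "ln \<bar>x\<bar> * (e / D - e / ((x - a)\<^sup>2 + e\<^sup>2)) = (x * ln \<bar>x\<bar>) * (e * (x - 2 * a) / (D * ((x - a)\<^sup>2 + e\<^sup>2)))" for x
    proof -
      have q0: "(x - a)\<^sup>2 + e\<^sup>2 \<noteq> 0" using less_imp_neq[OF pos[of x]] by (rule not_sym)
      have "e / D - e / ((x - a)\<^sup>2 + e\<^sup>2) = e * (((x - a)\<^sup>2 + e\<^sup>2) - D) / (D * ((x - a)\<^sup>2 + e\<^sup>2))"
        using D q0 by (simp add: field_simps)
      also have "((x - a)\<^sup>2 + e\<^sup>2) - D = x * (x - 2 * a)" by (simp add: D_def power2_eq_square algebra_simps)
      finally show ?thesis by simp
    qed
    have "((\<lambda>x::real. x * ln \<bar>x\<bar>) \<longlongrightarrow> 0) (at_right 0)" "((\<lambda>x::real. x * ln \<bar>x\<bar>) \<longlongrightarrow> 0) (at_left 0)"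
      by real_asymp+
    then have "((\<lambda>x::real. x * ln \<bar>x\<bar>) \<longlongrightarrow> 0) (at 0)" by (simp add: filterlim_split_at)
    then have "((\<lambda>x. (x * ln \<bar>x\<bar>) * (e * (x - 2 * a) / (D * ((x - a)\<^sup>2 + e\<^sup>2)))) \<longlongrightarrow>
        0 * (e * (0 - 2 * a) / (D * ((0 - a)\<^sup>2 + e\<^sup>2)))) (at 0)"
      using D pos[of 0] by (intro tendsto_intros) auto
    then show ?thesis unfolding eq by simp
  qed
  have lim0: "(F \<longlongrightarrow> F0) (at 0)"
  proof -
    have "(F \<longlongrightarrow> 0 - e / D * (ln ((0 - a)\<^sup>2 + e\<^sup>2) / 2) + a / D * arctan ((0 - a) / e)) (at 0)"
      unfolding F_def using pos[of 0] e by (intro tendsto_intros l0) auto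
    then show ?thesis by (simp add: F0_def)
  qed
  have lim_top: "(F \<longlongrightarrow> a / D * (pi / 2)) at_top"
    unfolding F_def using e D by real_asymp
  have lim_bot: "(F \<longlongrightarrow> a / D * (- pi / 2)) at_bot"
    unfolding F_def using e D by real_asymp
  have si: "set_integrable lborel A ?f" if "A \<in> sets borel" for A
    unfolding set_integrable_def using integrable_mult_indicator[OF _ int, of A] that by simp
  have "(LBINT x=0..\<infinity>. ?f x) = a / D * (pi / 2) - F0"
  proof (rule interval_integral_FTC_integrable)
    fix x assume "0 < ereal x"
    then have x: "x \<noteq> 0" by auto
    show "(F has_vector_derivative ?f x) (at x)" by (rule der[OF x])
    show "isCont ?f x" by (rule cont[OF x])
  next
    show "((F \<circ> real_of_ereal) \<longlongrightarrow> F0) (at_right 0)"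
      using lim0 by (simp add: filterlim_at_split zero_ereal_def ereal_tendsto_simps)
    show "((F \<circ> real_of_ereal) \<longlongrightarrow> a / D * (pi / 2)) (at_left \<infinity>)"
      using lim_top by (simp add: ereal_tendsto_simps)
    show "set_integrable lborel (einterval 0 \<infinity>) ?f" by (rule si) simp
  qed simp
  moreover have "(LBINT x=-\<infinity>..0. ?f x) = F0 - a / D * (- pi / 2)"
  proof (rule interval_integral_FTC_integrable)
    fix x assume "ereal x < 0"
    then have x: "x \<noteq> 0" by auto
    show "(F has_vector_derivative ?f x) (at x)" by (rule der[OF x])
    show "isCont ?f x" by (rule cont[OF x])
  next
    show "((F \<circ> real_of_ereal) \<longlongrightarrow> F0) (at_left 0)"
      using lim0 by (simp add: filterlim_at_split zero_ereal_def ereal_tendsto_simps)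
    show "((F \<circ> real_of_ereal) \<longlongrightarrow> a / D * (- pi / 2)) (at_right (-\<infinity>))"
      using lim_bot by (simp add: ereal_tendsto_simps)
    show "set_integrable lborel (einterval (-\<infinity>) 0) ?f" by (rule si) simp
  qed simp
  moreover have "(LBINT x=-\<infinity>..0. ?f x) + (LBINT x=0..\<infinity>. ?f x) = (LBINT x=-\<infinity>..\<infinity>. ?f x)"
  proof (rule interval_integral_sum)
    have "set_integrable lborel (einterval (-\<infinity>) \<infinity>) ?f" by (rule si) simp
    then show "interval_lebesgue_integrable lborel (min (-\<infinity>) (min 0 \<infinity>)) (max (-\<infinity>) (max 0 \<infinity>)) ?f"
      by (simp add: interval_lebesgue_integrable_def)
  qed
  moreover have "(LBINT x=-\<infinity>..\<infinity>. ?f x) = (LINT x|lborel. ?f x)"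
    by (simp add: interval_lebesgue_integral_def einterval_def set_lebesgue_integral_def)
  ultimately have "(LINT x|lborel. ?f x) = F0 - a / D * (- pi / 2) + (a / D * (pi / 2) - F0)"
    by (simp only:)
  also have "\<dots> = pi * (a / (a\<^sup>2 + e\<^sup>2))" by (simp add: D_def[symmetric])
  finally show ?thesis .
qed

section \<open>Test functions and the lemma of du Bois-Reymond\<close>

text \<open>
  Smoothness of order \<open>k\<close> by recursion on \<open>k\<close>; the recursive form makes closure under products
  a plain induction.
\<close>
fun times_differentiable :: "nat \<Rightarrow> (real \<Rightarrow> real) \<Rightarrow> bool" where
  "times_differentiable 0 f \<longleftrightarrow> f differentiable_on UNIV"
| "times_differentiable (Suc k) f \<longleftrightarrow> f differentiable_on UNIV \<and> times_differentiable k (deriv f)"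

lemma times_differentiable_iff:
  "times_differentiable k f \<longleftrightarrow> (\<forall>j\<le>k. (deriv ^^ j) f differentiable_on UNIV)"
proof (induction k arbitrary: f)
  case (Suc k)
  have "(\<forall>j\<le>Suc k. (deriv ^^ j) f differentiable_on UNIV) \<longleftrightarrow>
      f differentiable_on UNIV \<and> (\<forall>j\<le>k. (deriv ^^ Suc j) f differentiable_on UNIV)"
    by (metis Suc_le_mono funpow_0 le0 not0_implies_Suc)
  then show ?case using Suc.IH[of "deriv f"] by (simp add: funpow_Suc_right del: funpow.simps)
qed simp

definition smooth :: "(real \<Rightarrow> real) \<Rightarrow> bool" where
  "smooth f \<longleftrightarrow> (\<forall>k. times_differentiable k f)"

lemma smooth_iff: "smooth f \<longleftrightarrow> (\<forall>k. (deriv ^^ k) f differentiable_on UNIV)"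
  unfolding smooth_def times_differentiable_iff by blast

lemma differentiable_DERIV_deriv:
  fixes f :: "real \<Rightarrow> real"
  shows "f differentiable_on UNIV \<Longrightarrow> (f has_field_derivative deriv f x) (at x)"
  by (simp add: DERIV_deriv_iff_real_differentiable differentiable_on_def)

lemma DERIV_imp_differentiable_on:
  fixes f :: "real \<Rightarrow> real"
  shows "(\<And>x. (f has_field_derivative f' x) (at x)) \<Longrightarrow> f differentiable_on UNIV"
  unfolding differentiable_on_def differentiable_def has_field_derivative_def by blast

lemma times_differentiable_SucI:
  assumes "\<And>x. (f has_field_derivative f' x) (at x)" "times_differentiable k f'"
  shows "times_differentiable (Suc k) f"
proof -
  have "deriv f = f'" using assms(1) by (intro ext DERIV_imp_deriv)
  then show ?thesis using assms DERIV_imp_differentiable_on[OF assms(1)] by simp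
qed

lemma times_differentiable_mono: "times_differentiable (Suc k) f \<Longrightarrow> times_differentiable k f"
  unfolding times_differentiable_iff by simp

lemma times_differentiable_add:
  "times_differentiable k f \<Longrightarrow> times_differentiable k g \<Longrightarrow> times_differentiable k (\<lambda>x. f x + g x)"
proof (induction k arbitrary: f g)
  case (Suc k)
  then show ?case
    by (intro times_differentiable_SucI[of _ "\<lambda>x. deriv f x + deriv g x"])
       (auto intro!: derivative_intros differentiable_DERIV_deriv)
qed (auto intro!: derivative_intros)

lemma times_differentiable_cmult:
  "times_differentiable k f \<Longrightarrow> times_differentiable k (\<lambda>x. c * f x)"
proof (induction k arbitrary: f)
  case (Suc k)
  then show ?case
    by (intro times_differentiable_SucI[of _ "\<lambda>x. c * deriv f x"])
       (auto intro!: DERIV_cmult differentiable_DERIV_deriv)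
qed (auto intro!: derivative_intros)

lemma times_differentiable_mult:
  "times_differentiable k f \<Longrightarrow> times_differentiable k g \<Longrightarrow> times_differentiable k (\<lambda>x. f x * g x)"
proof (induction k arbitrary: f g)
  case (Suc k)
  have "times_differentiable k (\<lambda>x. deriv f x * g x + deriv g x * f x)"
    using Suc.prems by (intro times_differentiable_add Suc.IH) (auto intro: times_differentiable_mono)
  then show ?case using Suc.prems
    by (intro times_differentiable_SucI[of _ "\<lambda>x. deriv f x * g x + deriv g x * f x"])
       (auto intro!: DERIV_mult differentiable_DERIV_deriv)
qed (auto intro!: derivative_intros)

lemma times_differentiable_affine:
  "times_differentiable k f \<Longrightarrow> times_differentiable k (\<lambda>x. f (c * x + d))"
proof (induction k arbitrary: f)
  case 0
  then have "((\<lambda>x. f (c * x + d)) has_field_derivative deriv f (c * x + d) * c) (at x)" for x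
    by (intro DERIV_chain2[OF differentiable_DERIV_deriv]) (auto intro!: derivative_eq_intros)
  then have "(\<lambda>x. f (c * x + d)) differentiable_on UNIV" by (rule DERIV_imp_differentiable_on)
  then show ?case by simp
next
  case (Suc k)
  have "((\<lambda>x. f (c * x + d)) has_field_derivative c * deriv f (c * x + d)) (at x)" for x
  proof -
    have "((\<lambda>x. f (c * x + d)) has_field_derivative deriv f (c * x + d) * c) (at x)"
      using Suc.prems by (intro DERIV_chain2[OF differentiable_DERIV_deriv]) (auto intro!: derivative_eq_intros)
    then show ?thesis by (simp add: mult.commute)
  qed
  moreover have "times_differentiable k (\<lambda>x. c * deriv f (c * x + d))"
    using Suc by (intro times_differentiable_cmult) auto
  ultimately show ?case by (rule times_differentiable_SucI)
qed

lemma smooth_add: "smooth f \<Longrightarrow> smooth g \<Longrightarrow> smooth (\<lambda>x. f x + g x)"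
  and smooth_mult: "smooth f \<Longrightarrow> smooth g \<Longrightarrow> smooth (\<lambda>x. f x * g x)"
  and smooth_cmult: "smooth f \<Longrightarrow> smooth (\<lambda>x. c * f x)"
  and smooth_affine: "smooth f \<Longrightarrow> smooth (\<lambda>x. f (c * x + d))"
  by (auto simp: smooth_def times_differentiable_add times_differentiable_mult
      times_differentiable_cmult times_differentiable_affine)

lemma smooth_primitive:
  assumes "\<And>x. (f has_field_derivative f' x) (at x)" "smooth f'"
  shows "smooth f"
  unfolding smooth_def
proof
  fix k show "times_differentiable k f"
    using assms(2) unfolding smooth_def
    by (blast intro: times_differentiable_mono[OF times_differentiable_SucI[OF assms(1)]])
qed

text \<open>
  The classical flat function, together with all its derivatives: these have the form
  \<open>p (1/x) * exp (-1/x)\<close> with a polynomial \<open>p\<close>.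
\<close>
definition flat :: "real poly \<Rightarrow> real \<Rightarrow> real" where
  "flat p x = (if 0 < x then poly p (1 / x) * exp (- (1 / x)) else 0)"

lemma flat_tendsto_0: "((\<lambda>h. poly p (1 / h) * exp (- (1 / h))) \<longlongrightarrow> 0) (at_right (0::real))"
proof -
  have "((\<lambda>v. poly p v * exp (- v)) \<longlongrightarrow> 0) (at_top :: real filter)"
  proof (induction p)
    case (pCons a p)
    have "((\<lambda>v. a * exp (- v) + v * (poly p v * exp (- v))) \<longlongrightarrow> 0) (at_top :: real filter)"
    proof -
      have "((\<lambda>v. poly p v / exp v) \<longlongrightarrow> 0) at_top" for p :: "real poly"
      proof -
        have "((\<lambda>v. \<Sum>i\<le>degree p. coeff p i * (v ^ i / exp v)) \<longlongrightarrow> (\<Sum>i\<le>degree p. coeff p i * 0)) at_top"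
          by (intro tendsto_intros tendsto_power_div_exp_0)
        then show ?thesis by (simp add: poly_altdef sum_divide_distrib)
      qed
      from this[of "pCons a p"] show ?thesis by (simp add: exp_minus field_simps)
    qed
    then show ?case by (simp add: algebra_simps)
  qed simp
  then show ?thesis by (simp add: filterlim_at_right_to_top field_simps)
qed

lemma flat_has_derivative:
  "(flat p has_field_derivative flat ([:0, 0, 1:] * (p - pderiv p)) x) (at x)"
proof -
  consider "x < 0" | "0 < x" | "x = 0" by linarith
  then show ?thesis
  proof cases
    case 1
    have "eventually (\<lambda>y. y \<in> {..<0}) (nhds x)" using 1 by (intro eventually_nhds_in_open) auto
    then have "eventually (\<lambda>y. flat p y = 0) (nhds x)" by eventually_elim (auto simp: flat_def)
    then show ?thesis using 1 by (subst DERIV_cong_ev[OF refl _ refl]) (auto simp: flat_def)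
  next
    case 2
    have "eventually (\<lambda>y. y \<in> {0<..}) (nhds x)" using 2 by (intro eventually_nhds_in_open) auto
    then have ev: "eventually (\<lambda>y. flat p y = poly p (1 / y) * exp (- (1 / y))) (nhds x)"
      by eventually_elim (auto simp: flat_def)
    have d: "((\<lambda>y. 1 / y) has_field_derivative - (1 / x\<^sup>2)) (at x)"
      using 2 by (auto intro!: derivative_eq_intros simp: power2_eq_square)
    have "((\<lambda>y. poly p (1 / y) * exp (- (1 / y))) has_field_derivative
       poly (pderiv p) (1 / x) * - (1 / x\<^sup>2) * exp (- (1 / x)) + exp (- (1 / x)) * - (- (1 / x\<^sup>2)) * poly p (1 / x)) (at x)"
      by (intro DERIV_mult DERIV_chain2[OF poly_DERIV d] DERIV_chain2[OF DERIV_exp] DERIV_minus d)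
    moreover have "poly (pderiv p) (1 / x) * - (1 / x\<^sup>2) * exp (- (1 / x)) + exp (- (1 / x)) * - (- (1 / x\<^sup>2)) * poly p (1 / x)
        = flat ([:0, 0, 1:] * (p - pderiv p)) x"
      using 2 by (simp add: flat_def power2_eq_square algebra_simps diff_divide_distrib)
    ultimately show ?thesis by (subst DERIV_cong_ev[OF refl ev refl]) simp
  next
    case 3
    have "((\<lambda>h. flat p h / h) \<longlongrightarrow> 0) (at_right 0)"
    proof (rule Lim_transform_eventually[OF flat_tendsto_0[of "[:0, 1:] * p"]])
      show "\<forall>\<^sub>F h in at_right 0. poly ([:0, 1:] * p) (1 / h) * exp (- (1 / h)) = flat p h / h"
        using eventually_at_right_less[of 0] by eventually_elim (simp add: flat_def)
    qed
    moreover have "((\<lambda>h. flat p h / h) \<longlongrightarrow> 0) (at_left 0)"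
    proof (rule Lim_transform_eventually[OF tendsto_const])
      have "eventually (\<lambda>h. h < 0) (at_left (0::real))" by (simp add: eventually_at_filter)
      then show "\<forall>\<^sub>F h in at_left 0. 0 = flat p h / h" by eventually_elim (simp add: flat_def)
    qed
    ultimately have "((\<lambda>h. flat p h / h) \<longlongrightarrow> 0) (at 0)" by (simp add: filterlim_split_at)
    then show ?thesis using 3 by (simp add: DERIV_def flat_def)
  qed
qed

lemma smooth_flat: "smooth (flat p)"
  unfolding smooth_def
proof
  fix k show "times_differentiable k (flat p)"
  proof (induction k arbitrary: p)
    case 0
    then show ?case using DERIV_imp_differentiable_on[OF flat_has_derivative] by simp
  next
    case (Suc k)
    then show ?case using flat_has_derivative by (intro times_differentiable_SucI)
  qed
qed

text \<open>
  The factor \<open>n\<close> sharpens the flanks without moving the support: as \<open>n\<close> grows, the values increase to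
  the indicator of \<open>{a<..<b}\<close>.
\<close>
definition cutoff :: "real \<Rightarrow> real \<Rightarrow> real \<Rightarrow> real \<Rightarrow> real" where
  "cutoff n a b x = flat 1 (n * x + (- n * a)) * flat 1 (- n * x + n * b)"

lemma smooth_cutoff: "smooth (cutoff n a b)"
  using smooth_mult[OF smooth_affine[OF smooth_flat] smooth_affine[OF smooth_flat]]
  unfolding cutoff_def by blast

lemma flat_1_bounds: "0 \<le> flat 1 x" "flat 1 x \<le> 1"
  by (auto simp: flat_def)

lemma cutoff_bounds: "0 \<le> cutoff n a b x" "cutoff n a b x \<le> 1"
  using flat_1_bounds by (auto simp: cutoff_def intro: mult_le_one)

lemma cutoff_pos_iff: "0 < n \<Longrightarrow> cutoff n a b x \<noteq> 0 \<longleftrightarrow> a < x \<and> x < b"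
  by (auto simp: cutoff_def flat_def algebra_simps)

lemma cutoff_tendsto: "(\<lambda>n. cutoff (real (Suc n)) a b x) \<longlonglongrightarrow> indicator {a<..<b} x"
proof (cases "a < x \<and> x < b")
  case True
  have *: "(\<lambda>n. flat 1 (real (Suc n) * d)) \<longlonglongrightarrow> 1" if "0 < d" for d
  proof -
    have "(\<lambda>n. exp (- (1 / (real (Suc n) * d)))) \<longlonglongrightarrow> 1" using that by real_asymp
    then show ?thesis using that by (simp add: flat_def)
  qed
  have "cutoff (real (Suc n)) a b x = flat 1 (real (Suc n) * (x - a)) * flat 1 (real (Suc n) * (b - x))" for n
    unfolding cutoff_def by (intro arg_cong2[of _ _ _ _ times] arg_cong[of _ _ "flat 1"]) (simp_all add: algebra_simps)
  then show ?thesis using tendsto_mult[OF *[of "x - a"] *[of "b - x"]] True by simp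
next
  case False
  then have "cutoff (real (Suc n)) a b x = 0" for n using cutoff_pos_iff[of "real (Suc n)" a b x] by auto
  then show ?thesis using False by simp
qed

lemma smooth_imp_DERIV: "smooth f \<Longrightarrow> (f has_field_derivative deriv f x) (at x)"
  using differentiable_DERIV_deriv[of f] by (auto simp: smooth_iff dest: spec[of _ 0])

lemma smooth_imp_continuous_on: "smooth f \<Longrightarrow> continuous_on A f"
  by (meson DERIV_isCont continuous_at_imp_continuous_on smooth_imp_DERIV)

lemma smooth_deriv: "smooth f \<Longrightarrow> smooth (deriv f)"
  unfolding smooth_iff by (metis funpow_Suc_right o_apply)

text \<open>
  The positive and the negative part of the difference are densities of the same measure, because this
  measure is determined by its values on half lines.
\<close>
lemma AE_eq_of_interval_integrals:
  fixes g h :: "real \<Rightarrow> real"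
  assumes g: "integrable lborel g" and h: "integrable lborel h"
    and eq: "\<And>x. (LINT y|lborel. indicator {x<..} y * g y) = (LINT y|lborel. indicator {x<..} y * h y)"
  shows "AE x in lborel. g x = h x"
proof -
  have [measurable]: "g \<in> borel_measurable borel" "h \<in> borel_measurable borel" using g h by auto
  define p where "p = (\<lambda>x. max 0 (g x - h x))"
  define n where "n = (\<lambda>x. max 0 (h x - g x))"
  have p: "integrable lborel p" "\<And>x. 0 \<le> p x" and n: "integrable lborel n" "\<And>x. 0 \<le> n x"
    using g h by (auto simp: p_def n_def)
  have [measurable]: "p \<in> borel_measurable borel" "n \<in> borel_measurable borel" using p n by auto
  have ind: "integrable lborel (\<lambda>y. indicator {x<..} y * q y)" if "integrable lborel q" for q :: "real \<Rightarrow> real" and x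
    using integrable_real_mult_indicator[of "{x<..}" lborel q] that by (simp add: mult.commute)
  have pi: "integrable lborel (\<lambda>y. indicator {x<..} y * p y)" and ni: "integrable lborel (\<lambda>y. indicator {x<..} y * n y)"
    and gi: "integrable lborel (\<lambda>y. indicator {x<..} y * g y)" and hi: "integrable lborel (\<lambda>y. indicator {x<..} y * h y)" for x
    by (auto intro!: ind p n g h)
  have em: "emeasure (density lborel (\<lambda>x. ennreal (q x))) {x<..} = ennreal (LINT y|lborel. indicator {x<..} y * q y)"
    if [measurable]: "q \<in> borel_measurable borel" and "\<And>x. 0 \<le> q x" "integrable lborel (\<lambda>y. indicator {x<..} y * q y)" for q :: "real \<Rightarrow> real" and x
  proof -
    have "emeasure (density lborel (\<lambda>x. ennreal (q x))) {x<..} = (\<integral>\<^sup>+y. ennreal (q y) * indicator {x<..} y \<partial>lborel)"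
      by (subst emeasure_density) auto
    also have "\<dots> = (\<integral>\<^sup>+y. ennreal (indicator {x<..} y * q y) \<partial>lborel)"
      by (intro nn_integral_cong) (auto simp: indicator_def)
    also have "\<dots> = ennreal (LINT y|lborel. indicator {x<..} y * q y)"
      using that by (intro nn_integral_eq_integral) auto
    finally show ?thesis .
  qed
  have pn: "(LINT y|lborel. indicator {x<..} y * p y) = (LINT y|lborel. indicator {x<..} y * n y)" for x
  proof -
    have "(LINT y|lborel. indicator {x<..} y * p y) - (LINT y|lborel. indicator {x<..} y * n y)
        = (LINT y|lborel. indicator {x<..} y * p y - indicator {x<..} y * n y)"
      using pi ni by simp
    also have "\<dots> = (LINT y|lborel. indicator {x<..} y * g y - indicator {x<..} y * h y)"
      by (intro Bochner_Integration.integral_cong) (auto simp: p_def n_def indicator_def)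
    also have "\<dots> = 0" using gi hi eq by simp
    finally show ?thesis by simp
  qed
  have "density lborel (\<lambda>x. ennreal (p x)) = density lborel (\<lambda>x. ennreal (n x))"
  proof (rule measure_eqI_lessThan)
    fix x
    show "emeasure (density lborel (\<lambda>x. ennreal (p x))) {x<..} < \<infinity>"
      using em[of p x] p pi by simp
    show "emeasure (density lborel (\<lambda>x. ennreal (p x))) {x<..} = emeasure (density lborel (\<lambda>x. ennreal (n x))) {x<..}"
      using em[of p x] em[of n x] p n pi ni pn by simp
  qed auto
  then have "AE x in lborel. ennreal (p x) = ennreal (n x)"
    by (subst (asm) sigma_finite_measure.density_unique_iff[OF sigma_finite_lborel]) auto
  then show ?thesis
    by eventually_elim (use p n in \<open>auto simp: p_def n_def max_def split: if_splits\<close>)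
qed

lemma smooth_in_test_functions:
  assumes "smooth \<phi>" "-1 < a" "b < 1" "\<And>x. x \<notin> {a..b} \<Longrightarrow> \<phi> x = 0"
  shows "\<phi> \<in> test_functions {-1<..<1}"
proof -
  have "closure {x. \<phi> x \<noteq> 0} \<subseteq> {a..b}"
  proof (rule closure_minimal)
    show "{x. \<phi> x \<noteq> 0} \<subseteq> {a..b}" using assms(4) by blast
  qed simp
  moreover from this have "compact (closure {x. \<phi> x \<noteq> 0})"
    using bounded_subset[OF bounded_closed_interval[of a b]] by (auto simp: compact_eq_bounded_closed)
  ultimately show ?thesis using assms by (auto simp: test_functions_def smooth_iff)
qed

text \<open>
  The lemma of du Bois-Reymond: a function whose distributional derivative on the interval vanishes
  is constant. A test function of the form \<open>\<psi> - (\<integral>\<psi>) \<rho>\<close> with a fixed \<open>\<rho>\<close> of mean one is the derivative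
  of another one, and \<open>\<psi>\<close> can approximate the indicator of an interval.
\<close>
lemma du_Bois_Reymond:
  fixes h :: "real \<Rightarrow> real"
  assumes h: "integrable lborel h" and out: "\<And>x. x \<notin> {-1<..<1} \<Longrightarrow> h x = 0"
    and test: "\<And>\<phi>. \<phi> \<in> test_functions {-1<..<1} \<Longrightarrow> (LINT x|lborel. h x * deriv \<phi> x) = 0"
  obtains c where "AE x in lborel. x \<in> {-1<..<1} \<longrightarrow> h x = c"
proof -
  have [measurable]: "h \<in> borel_measurable borel" using h by auto
  have ci: "integrable lborel (cutoff n a b)" if "0 < n" for n a b
  proof -
    have [measurable]: "cutoff n a b \<in> borel_measurable borel"
      by (intro borel_measurable_continuous_onI smooth_imp_continuous_on smooth_cutoff)
    have "integrable lborel (\<lambda>x. indicator {a..b} x :: real)"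
      by (auto simp: integrable_real_indicator emeasure_lborel_Icc_eq)
    then show ?thesis
    proof (rule Bochner_Integration.integrable_bound)
      have "\<bar>cutoff n a b x\<bar> \<le> indicator {a..b} x" for x
        using cutoff_bounds[of n a b x] cutoff_pos_iff[OF that, of a b x]
        by (cases "cutoff n a b x = 0") (auto simp: indicator_def)
      then show "AE x in lborel. norm (cutoff n a b x) \<le> norm (indicator {a..b} x :: real)" by auto
    qed measurable
  qed
  define \<rho> where "\<rho> = cutoff 1 (-1/2) (1/2)"
  define m where "m = (LINT x|lborel. \<rho> x)"
  have m: "0 < m"
  proof -
    have "m \<noteq> 0"
    proof
      assume "m = 0"
      then have "AE x in lborel. \<rho> x = 0"
        using ci[of 1 "-1/2" "1/2"] cutoff_bounds by (subst (asm) m_def, subst (asm) integral_nonneg_eq_0_iff_AE) (auto simp: \<rho>_def)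
      then have "AE x in lborel. x \<notin> {-1/2<..<1/2::real}"
        by eventually_elim (use cutoff_pos_iff[of 1 "-1/2" "1/2"] in \<open>auto simp: \<rho>_def\<close>)
      then have z: "emeasure lborel {-1/2<..<1/2::real} = 0"
        by (rule AE_iff_measurable[THEN iffD1, rotated 2]) auto
      have o: "emeasure lborel {-1/2<..<1/2::real} = ennreal (1/2 - (-1/2))"
        by (rule emeasure_lborel_Ioo) simp
      show False using z unfolding o by (simp add: ennreal_eq_0_iff)
    qed
    moreover have "0 \<le> m" unfolding m_def \<rho>_def
      by (intro integral_nonneg_AE AE_I2 cutoff_bounds(1))
    ultimately show ?thesis by linarith
  qed
  define c where "c = (LINT x|lborel. h x * \<rho> x) / m"
  have hc: "integrable lborel (\<lambda>x. h x * cutoff n a b x)" for n a b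
  proof (rule Bochner_Integration.integrable_bound[OF h])
    have [measurable]: "cutoff n a b \<in> borel_measurable borel"
      by (intro borel_measurable_continuous_onI smooth_imp_continuous_on smooth_cutoff)
    show "(\<lambda>x. h x * cutoff n a b x) \<in> borel_measurable lborel" by measurable
    show "AE x in lborel. norm (h x * cutoff n a b x) \<le> norm (h x)"
      using cutoff_bounds[of n a b] by (auto simp: abs_mult intro!: mult_left_le)
  qed
  have weak: "(LINT x|lborel. h x * cutoff n a b x) = c * (LINT x|lborel. cutoff n a b x)"
    if ab: "-1 < a" "a < b" "b < 1" and n: "0 < n" for a b n
  proof -
    define q where "q = (LINT x|lborel. cutoff n a b x) / m"
    define g where "g = (\<lambda>x. cutoff n a b x + (- q) * \<rho> x)"
    define l where "l = min a (-1/2)"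
    define r where "r = max b (1/2)"
    have lr: "-1 < l" "l < r" "r < 1" "l \<le> a" "b \<le> r" "l \<le> -1/2" "1/2 \<le> r" using ab by (auto simp: l_def r_def)
    have sg: "smooth g" unfolding g_def \<rho>_def by (intro smooth_add smooth_cmult smooth_cutoff)
    have g0: "g x = 0" if "x \<notin> {l..r}" for x
      using that lr cutoff_pos_iff[OF n, of a b x] cutoff_pos_iff[of 1 "-1/2" "1/2" x]
      by (auto simp: g_def \<rho>_def)
    have gi: "integrable lborel g" "(LINT x|lborel. g x) = 0"
    proof -
      have \<rho>i: "integrable lborel \<rho>" unfolding \<rho>_def by (rule ci) simp
      show "integrable lborel g" unfolding g_def
        by (intro Bochner_Integration.integrable_add ci n integrable_mult_right \<rho>i)
      have "(LINT x|lborel. g x) = (LINT x|lborel. cutoff n a b x) + (- q) * m"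
        unfolding g_def m_def using ci[OF n, of a b] \<rho>i by (subst Bochner_Integration.integral_add) auto
      then show "(LINT x|lborel. g x) = 0" using m by (simp add: q_def)
    qed
    define \<phi> where "\<phi> = (\<lambda>x. integral {-1..x} g)"
    have contg: "continuous_on A g" for A by (rule smooth_imp_continuous_on[OF sg])
    have ints: "g integrable_on {x..y}" for x y by (rule integrable_continuous_real[OF contg])
    define \<Phi> where "\<Phi> = (\<lambda>x. if x \<le> -1 then 0 else \<phi> x)"
    have zero_left: "\<phi> x = 0" if "x \<le> l" for x
    proof -
      have "integral {-1..x} g = integral {-1..x} (\<lambda>_. 0)"
        by (rule integral_spike[of "{l}"]) (use that g0 in force)+
      then show ?thesis by (simp add: \<phi>_def)
    qed
    have tot: "integral UNIV g = 0"
      using integral_lborel[OF gi(1)] gi(2) by simp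
    have "integral {l..r} g = integral UNIV (\<lambda>x. if x \<in> {l..r} then g x else 0)"
      by (rule integral_restrict_UNIV[symmetric])
    also have "(\<lambda>x. if x \<in> {l..r} then g x else 0) = g" using g0 by auto
    finally have lr0: "integral {l..r} g = 0" using tot by simp
    have zero_right: "\<phi> x = 0" if "r \<le> x" for x
    proof -
      have a: "integral {-1..l} g + integral {l..r} g = integral {-1..r} g"
        using lr by (intro Henstock_Kurzweil_Integration.integral_combine ints) auto
      have b: "integral {-1..r} g + integral {r..x} g = integral {-1..x} g"
        using lr that by (intro Henstock_Kurzweil_Integration.integral_combine ints) auto
      have "integral {r..x} g = integral {r..x} (\<lambda>_. 0)"
        by (rule integral_spike[of "{r}"]) (use that g0 in force)+
      then show ?thesis using a b lr0 zero_left[of l] by (simp add: \<phi>_def)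
    qed
    have d\<phi>: "(\<phi> has_field_derivative g x) (at x)" for x
    proof (cases "x < l")
      case True
      have "eventually (\<lambda>y. y \<in> {..<l}) (nhds x)" using True by (intro eventually_nhds_in_open) auto
      then have ev: "eventually (\<lambda>y. \<phi> y = 0) (nhds x)" by eventually_elim (auto simp: zero_left)
      have "g x = 0" using True by (intro g0) auto
      then show ?thesis by (subst DERIV_cong_ev[OF refl ev refl]) simp
    next
      case False
      have "((\<lambda>u. integral {-1..u} g) has_vector_derivative g x) (at x within {-1..x+1})"
        by (rule integral_has_vector_derivative[OF contg]) (use False lr in simp)
      then have "(\<phi> has_field_derivative g x) (at x within {-1..x+1})"
        unfolding \<phi>_def has_real_derivative_iff_has_vector_derivative .
      moreover have "at x within {-1..x+1} = at x"
        by (rule at_within_Icc_at) (use False lr in linarith)+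
      ultimately show ?thesis by (simp only:)
    qed
    have "\<phi> \<in> test_functions {-1<..<1}"
    proof (rule smooth_in_test_functions[OF smooth_primitive[OF d\<phi> sg] lr(1,3)])
      fix x assume "x \<notin> {l..r}"
      then show "\<phi> x = 0" using zero_left[of x] zero_right[of x] by auto
    qed
    from test[OF this] have "0 = (LINT x|lborel. h x * deriv \<phi> x)" by (rule sym)
    also have "deriv \<phi> = g" using d\<phi> by (intro ext DERIV_imp_deriv)
    also have "(LINT x|lborel. h x * g x) = (LINT x|lborel. h x * cutoff n a b x) - q * (LINT x|lborel. h x * \<rho> x)"
    proof -
      have "(LINT x|lborel. h x * g x) = (LINT x|lborel. h x * cutoff n a b x - q * (h x * \<rho> x))"
        by (intro Bochner_Integration.integral_cong) (auto simp: g_def algebra_simps)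
      moreover have "integrable lborel (\<lambda>x. h x * \<rho> x)" unfolding \<rho>_def by (rule hc)
      ultimately show ?thesis using hc[of n a b] by simp
    qed
    finally have "(LINT x|lborel. h x * cutoff n a b x) = q * (LINT x|lborel. h x * \<rho> x)" by linarith
    also have "\<dots> = c * (LINT x|lborel. cutoff n a b x)" unfolding q_def c_def by simp
    finally show ?thesis .
  qed
  have intervals: "(LINT x|lborel. indicator {a<..<b} x * h x) = c * (b - a)"
    if ab: "-1 < a" "a < b" "b < 1" for a b
  proof -
    have [measurable]: "cutoff n a b \<in> borel_measurable borel" for n
      by (intro borel_measurable_continuous_onI smooth_imp_continuous_on smooth_cutoff)
    have l1: "(\<lambda>n. LINT x|lborel. h x * cutoff (real (Suc n)) a b x) \<longlonglongrightarrow> (LINT x|lborel. h x * indicator {a<..<b} x)"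
    proof (rule integral_dominated_convergence[where w = "\<lambda>x. \<bar>h x\<bar>"])
      show "AE x in lborel. (\<lambda>n. h x * cutoff (real (Suc n)) a b x) \<longlonglongrightarrow> h x * indicator {a<..<b} x"
        by (intro AE_I2 tendsto_intros cutoff_tendsto)
      show "AE x in lborel. norm (h x * cutoff (real (Suc n)) a b x) \<le> \<bar>h x\<bar>" for n
        using cutoff_bounds[of "real (Suc n)" a b] by (auto simp: abs_mult intro!: mult_left_le)
    qed (use h in auto)
    have l2: "(\<lambda>n. LINT x|lborel. cutoff (real (Suc n)) a b x) \<longlonglongrightarrow> (LINT x|lborel. indicator {a<..<b} x)"
    proof (rule integral_dominated_convergence[where w = "indicator {a..b}"])
      show "AE x in lborel. (\<lambda>n. cutoff (real (Suc n)) a b x) \<longlonglongrightarrow> indicator {a<..<b} x"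
        by (intro AE_I2 cutoff_tendsto)
      show "integrable lborel (indicator {a..b} :: real \<Rightarrow> real)"
        by (auto simp: integrable_real_indicator emeasure_lborel_Icc_eq)
      show "AE x in lborel. norm (cutoff (real (Suc n)) a b x) \<le> indicator {a..b} x" for n
      proof (intro AE_I2)
        fix x
        show "norm (cutoff (real (Suc n)) a b x) \<le> indicator {a..b} x"
          using cutoff_bounds[of "real (Suc n)" a b x] cutoff_pos_iff[of "real (Suc n)" a b x]
          by (cases "cutoff (real (Suc n)) a b x = 0") (auto simp: indicator_def)
      qed
    qed auto
    have "(LINT x|lborel. indicator {a<..<b} x) = b - a" using ab by simp
    then have "(\<lambda>n. LINT x|lborel. h x * cutoff (real (Suc n)) a b x) \<longlonglongrightarrow> c * (b - a)"
      using tendsto_mult_left[OF l2, of c] weak[OF ab] by simp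
    from LIMSEQ_unique[OF l1 this] show ?thesis by (simp add: mult.commute)
  qed
  define k where "k = (\<lambda>x::real. indicator {-1<..<1} x * c)"
  have k: "integrable lborel k" unfolding k_def by (intro integrable_mult_left) (auto simp: integrable_real_indicator)
  have "AE x in lborel. h x = k x"
  proof (rule AE_eq_of_interval_integrals[OF h k])
    fix x :: real
    have lim: "(\<lambda>n. LINT y|lborel. indicator {max x (-1) + 1 / real (Suc n)<..<1 - 1 / real (Suc n)} y * q y) \<longlonglongrightarrow>
        (LINT y|lborel. indicator {x<..} y * q y)"
      if q: "integrable lborel q" and q0: "\<And>y. y \<notin> {-1<..<1} \<Longrightarrow> q y = 0" for q :: "real \<Rightarrow> real"
    proof (rule integral_dominated_convergence[where w = "\<lambda>x. \<bar>q x\<bar>"])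
      have [measurable]: "q \<in> borel_measurable borel" using q by auto
      show "AE y in lborel. (\<lambda>n. indicator {max x (-1) + 1 / real (Suc n)<..<1 - 1 / real (Suc n)} y * q y)
           \<longlonglongrightarrow> indicator {x<..} y * q y"
      proof (intro AE_I2)
        fix y
        show "(\<lambda>n. indicator {max x (-1) + 1 / real (Suc n)<..<1 - 1 / real (Suc n)} y * q y)
           \<longlonglongrightarrow> indicator {x<..} y * q y"
        proof (cases "y \<in> {-1<..<1} \<and> x < y")
          case True
          have "(\<lambda>n. max x (-1) + 1 / real (Suc n)) \<longlonglongrightarrow> max x (-1)" "(\<lambda>n. 1 - 1 / real (Suc n)) \<longlonglongrightarrow> 1"
            by real_asymp+
          then have "eventually (\<lambda>n. max x (-1) + 1 / real (Suc n) < y) sequentially"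
            "eventually (\<lambda>n. y < 1 - 1 / real (Suc n)) sequentially"
            using True by (auto intro: order_tendstoD)
          then have "eventually (\<lambda>n. indicator {max x (-1) + 1 / real (Suc n)<..<1 - 1 / real (Suc n)} y * q y = indicator {x<..} y * q y) sequentially"
            by eventually_elim (use True in auto)
          then show ?thesis by (rule tendsto_eventually)
        next
          case False
          have "y \<notin> {max x (-1) + 1 / real (Suc n)<..<1 - 1 / real (Suc n)} \<or> q y = 0" for n
          proof (cases "y \<in> {-1<..<1}")
            case True
            then have "y \<le> x" using False by auto
            moreover have "0 < 1 / real (Suc n)" by simp
            ultimately have "y \<le> max x (-1) + 1 / real (Suc n)" by linarith
            then show ?thesis by auto
          qed (simp add: q0)
          then have "indicator {max x (-1) + 1 / real (Suc n)<..<1 - 1 / real (Suc n)} y * q y = 0" for n by fastforce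
          moreover have "indicator {x<..} y * q y = 0" using False q0[of y] by (auto simp: indicator_def)
          ultimately show ?thesis by (simp only: tendsto_const)
        qed
      qed
      show "AE y in lborel. norm (indicator {max x (-1) + 1 / real (Suc n)<..<1 - 1 / real (Suc n)} y * q y) \<le> \<bar>q y\<bar>" for n
        by (intro AE_I2) (auto simp: indicator_def)
    qed (use q in auto)
    have "(LINT y|lborel. indicator {max x (-1) + 1 / real (Suc n)<..<1 - 1 / real (Suc n)} y * h y)
        = (LINT y|lborel. indicator {max x (-1) + 1 / real (Suc n)<..<1 - 1 / real (Suc n)} y * k y)" for n
    proof (cases "max x (-1) + 1 / real (Suc n) < 1 - 1 / real (Suc n)")
      case True
      let ?a = "max x (-1) + 1 / real (Suc n)" and ?b = "1 - 1 / real (Suc n)"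
      have "0 < 1 / real (Suc n)" "-1 \<le> max x (-1)" by auto
      then have 1: "-1 < ?a" "?b < 1" by linarith+
      have "(LINT y|lborel. indicator {?a<..<?b} y * k y) = (LINT y|lborel. c * indicator {?a<..<?b} y)"
      proof (intro Bochner_Integration.integral_cong refl)
        fix y
        have "y \<in> {-1<..<1}" if "y \<in> {?a<..<?b}"
          using that 1 unfolding greaterThanLessThan_iff by linarith
        then show "indicator {?a<..<?b} y * k y = c * indicator {?a<..<?b} y"
          by (cases "y \<in> {?a<..<?b}") (auto simp: k_def)
      qed
      also have "\<dots> = c * (?b - ?a)" using True by simp
      finally show ?thesis using intervals[OF 1(1) True 1(2)] by simp
    next
      case False
      then have "{max x (-1) + 1 / real (Suc n)<..<1 - 1 / real (Suc n)} = {}" by auto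
      then show ?thesis by simp
    qed
    with lim[OF h out] lim[OF k] show "(LINT y|lborel. indicator {x<..} y * h y) = (LINT y|lborel. indicator {x<..} y * k y)"
      by (auto simp: k_def intro: LIMSEQ_unique)
  qed
  then have "AE x in lborel. x \<in> {-1<..<1} \<longrightarrow> h x = c" by eventually_elim (auto simp: k_def)
  then show ?thesis by (rule that)
qed

section \<open>The contact equation in terms of potentials\<close>

lemma borel_representative:
  fixes g :: "real \<Rightarrow> real"
  assumes g: "g \<in> borel_measurable (lebesgue_on {-1<..<1})"
  obtains h where "h \<in> borel_measurable borel" "\<And>x. x \<notin> {-1<..<1} \<Longrightarrow> h x = 0"
    "AE x in lborel. x \<in> {-1<..<1} \<longrightarrow> g x = h x"
proof -
  have "(\<lambda>x. indicator {-1<..<1} x *\<^sub>R g x) \<in> borel_measurable lebesgue"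
    using g by (subst (asm) borel_measurable_restrict_space_iff) auto
  then obtain h where h: "h \<in> borel_measurable lborel" "AE x in lborel. indicator {-1<..<1} x *\<^sub>R g x = h x"
    using completion_ex_borel_measurable_real by blast
  show ?thesis
  proof
    show "(\<lambda>x. indicator {-1<..<1} x * h x) \<in> borel_measurable borel" using h(1) by simp
    show "AE x in lborel. x \<in> {-1<..<1} \<longrightarrow> g x = indicator {-1<..<1} x * h x"
      using h(2) by eventually_elim auto
  qed auto
qed

lemma AE_lebesgue_on_interval:
  "(AE x in lebesgue_on {-1<..<1::real}. Q x) \<longleftrightarrow> (AE x in lborel. x \<in> {-1<..<1} \<longrightarrow> Q x)"
  by (subst AE_restrict_space_iff) (auto simp: AE_completion_iff)

lemma AE_cong_measurable_lebesgue_on: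
  fixes g h :: "real \<Rightarrow> real"
  assumes ae: "AE x in lborel. x \<in> {-1<..<1} \<longrightarrow> g x = h x"
    and h[measurable]: "h \<in> borel_measurable borel" and out: "\<And>x. x \<notin> {-1<..<1} \<Longrightarrow> h x = 0"
    and g: "g \<in> borel_measurable (lebesgue_on {-1<..<1})"
  shows "(LINT x|lebesgue_on {-1<..<1}. g x) = (LINT x|lborel. h x)"
    and "integrable (lebesgue_on {-1<..<1}) g \<longleftrightarrow> integrable lborel h"
proof -
  have gm: "(\<lambda>x. indicator {-1<..<1} x *\<^sub>R g x) \<in> borel_measurable lebesgue"
    using g by (subst (asm) borel_measurable_restrict_space_iff) auto
  have hm: "h \<in> borel_measurable lebesgue" using h by (intro measurable_completion) simp
  have ae': "AE x in lebesgue. indicator {-1<..<1} x *\<^sub>R g x = h x"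
    using ae unfolding AE_completion_iff by eventually_elim (auto simp: indicator_def out)
  have "(LINT x|lebesgue_on {-1<..<1}. g x) = (LINT x|lebesgue. indicator {-1<..<1} x *\<^sub>R g x)"
    by (rule integral_restrict_space) auto
  also have "\<dots> = (LINT x|lebesgue. h x)" by (rule integral_cong_AE[OF gm hm ae'])
  also have "\<dots> = (LINT x|lborel. h x)" by (rule integral_completion) simp
  finally show "(LINT x|lebesgue_on {-1<..<1}. g x) = (LINT x|lborel. h x)" .
  have "integrable (lebesgue_on {-1<..<1}) g \<longleftrightarrow> integrable lebesgue (\<lambda>x. indicator {-1<..<1} x *\<^sub>R g x)"
    by (rule integrable_restrict_space) auto
  also have "\<dots> \<longleftrightarrow> integrable lebesgue h" by (rule integrable_cong_AE[OF gm hm ae'])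
  also have "\<dots> \<longleftrightarrow> integrable lborel h" by (rule integrable_completion) simp
  finally show "integrable (lebesgue_on {-1<..<1}) g \<longleftrightarrow> integrable lborel h" .
qed

lemma borel_measurable_lebesgue_on:
  "h \<in> borel_measurable borel \<Longrightarrow> (h :: real \<Rightarrow> real) \<in> borel_measurable (lebesgue_on S)"
  by (intro measurable_restrict_space1 measurable_completion) simp

lemma continuous_on_bounded_Icc:
  fixes g :: "real \<Rightarrow> real"
  assumes "continuous_on A g" "{a..b} \<subseteq> A"
  obtains C where "\<And>x. x \<in> {a..b} \<Longrightarrow> \<bar>g x\<bar> \<le> C"
proof -
  have "bounded (g ` {a..b})"
    by (intro compact_imp_bounded compact_continuous_image continuous_on_subset[OF assms]) simp
  then show ?thesis using that unfolding bounded_iff by fastforce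
qed

lemma integrable_indicator_Icc: "integrable lborel (indicator {a..b} :: real \<Rightarrow> real)"
  by (auto intro!: integrable_real_indicator simp: emeasure_lborel_Icc_eq)

definition primitive :: "(real \<Rightarrow> real) \<Rightarrow> real \<Rightarrow> real" where
  "primitive g x = (LINT y|lborel. g y * indicator {..x} y)"

context charge
begin

lemma indicator_integrable: "A \<in> sets borel \<Longrightarrow> integrable lborel (\<lambda>y. t y * indicator A y)"
  using integrable_real_mult_indicator[OF _ integrable, of A] by simp

lemma continuous_primitive: "continuous_on A (primitive t)"
proof (intro continuous_at_imp_continuous_on ballI)
  fix x
  show "isCont (primitive t) x"
    unfolding continuous_at_sequentially
  proof (intro allI impI)
    fix X :: "nat \<Rightarrow> real" assume X: "X \<longlonglongrightarrow> x"
    have "(\<lambda>n. LINT y|lborel. t y * indicator {..X n} y) \<longlonglongrightarrow> (LINT y|lborel. t y * indicator {..x} y)"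
    proof (rule integral_dominated_convergence[where w = "\<lambda>y. \<bar>t y\<bar>"])
      have "(\<lambda>n. t y * indicator {..X n} y) \<longlonglongrightarrow> t y * indicator {..x} y" if "y \<noteq> x" for y
      proof (cases "y < x")
        case True
        have "eventually (\<lambda>n. t y * indicator {..X n} y = t y * indicator {..x} y) sequentially"
          using order_tendstoD(1)[OF X True] by eventually_elim (use True in auto)
        then show ?thesis by (rule tendsto_eventually)
      next
        case False
        then have "x < y" using that by simp
        have "eventually (\<lambda>n. t y * indicator {..X n} y = t y * indicator {..x} y) sequentially"
          using order_tendstoD(2)[OF X \<open>x < y\<close>] by eventually_elim (use \<open>x < y\<close> in auto)
        then show ?thesis by (rule tendsto_eventually)
      qed
      then show "AE y in lborel. (\<lambda>n. t y * indicator {..X n} y) \<longlonglongrightarrow> t y * indicator {..x} y"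
        using AE_lborel_singleton[of x] by (auto elim!: eventually_mono)
      show "AE y in lborel. norm (t y * indicator {..X n} y) \<le> \<bar>t y\<bar>" for n
        by (intro AE_I2) (auto simp: indicator_def)
    qed (use abs_integrable in auto)
    then show "(primitive t \<circ> X) \<longlonglongrightarrow> primitive t x" by (simp add: o_def primitive_def)
  qed
qed

lemma primitive_diff:
  assumes "a \<le> b"
  shows "primitive t b - primitive t a = (LINT y|lborel. t y * indicator {a<..b} y)"
proof -
  have "primitive t b - primitive t a = (LINT y|lborel. t y * indicator {..b} y - t y * indicator {..a} y)"
    unfolding primitive_def using indicator_integrable by simp
  also have "\<dots> = (LINT y|lborel. t y * indicator {a<..b} y)"
    using assms by (intro Bochner_Integration.integral_cong) (auto simp: indicator_def)
  finally show ?thesis .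
qed

text \<open>Fubini's theorem for the kernel that is \<open>\<phi>' x\<close> for \<open>y \<le> x\<close> and zero otherwise.\<close>
lemma integration_by_parts:
  assumes d: "\<And>x. (\<phi> has_field_derivative \<phi>' x) (at x)" and c: "continuous_on UNIV \<phi>'"
  shows "(LINT x|lborel. indicator {-1..1} x * (primitive t x * \<phi>' x)) = \<phi> 1 * (LINT y|lborel. t y) - (LINT y|lborel. t y * \<phi> y)"
    and "integrable lborel (\<lambda>x. indicator {-1..1} x * (primitive t x * \<phi>' x))"
proof -
  have [measurable]: "\<phi>' \<in> borel_measurable borel" by (rule borel_measurable_continuous_onI[OF c])
  have c\<phi>: "continuous_on A \<phi>" for A using d by (meson DERIV_isCont continuous_at_imp_continuous_on)
  have [measurable]: "\<phi> \<in> borel_measurable borel" by (rule borel_measurable_continuous_onI[OF c\<phi>])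
  define K where "K = (\<lambda>x y. if y \<le> x then \<phi>' x else 0)"
  obtain C where C: "\<And>x. x \<in> {-1..1} \<Longrightarrow> \<bar>\<phi>' x\<bar> \<le> C"
    using continuous_on_bounded_Icc[OF c, of "-1" 1] by auto
  have K: "(\<lambda>(x, y). K x y) \<in> borel_measurable (lborel \<Otimes>\<^sub>M lborel)" unfolding K_def by measurable
  have Kb: "\<bar>K x y\<bar> \<le> C" if "x \<in> {-1..1}" for x y
    using C[OF that] by (auto simp: K_def)
  have e1: "(LINT y|lborel. t y * K x y) = primitive t x * \<phi>' x" for x
  proof -
    have "(LINT y|lborel. t y * K x y) = (LINT y|lborel. (t y * indicator {..x} y) * \<phi>' x)"
      by (intro Bochner_Integration.integral_cong) (auto simp: K_def)
    then show ?thesis by (simp add: primitive_def)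
  qed
  have e2: "t y * (LINT x|lborel. indicator {-1..1} x * K x y) = t y * (\<phi> 1 - \<phi> y)" for y
  proof (cases "y \<in> {-1<..<1}")
    case True
    have "(LINT x|lborel. indicator {-1..1} x * K x y) = (LINT x|lborel. \<phi>' x * indicator {y..1} x)"
      using True by (intro Bochner_Integration.integral_cong) (auto simp: K_def indicator_def)
    also have "\<dots> = \<phi> 1 - \<phi> y"
    proof (rule integral_FTC_Icc_real)
      show "isCont \<phi>' x" for x using c by (simp add: continuous_on_eq_continuous_at)
    qed (use True d in auto)
    finally show ?thesis by simp
  qed (simp add: support)
  note sw = swap_bounded_kernel[OF K, of "-1" 1 C, OF Kb]
  have "integrable lborel (\<lambda>y. of_real (t y) * \<phi> y)"
  proof -
    obtain D where "\<And>x. x \<in> {-1..1} \<Longrightarrow> \<bar>\<phi> x\<bar> \<le> D"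
      using continuous_on_bounded_Icc[OF c\<phi>[of UNIV], of "-1" 1] by auto
    then show ?thesis by (intro integrable_mult_bounded[of _ D]) auto
  qed
  then have "(LINT y|lborel. t y * (\<phi> 1 - \<phi> y)) = \<phi> 1 * (LINT y|lborel. t y) - (LINT y|lborel. t y * \<phi> y)"
    using integrable by (simp add: right_diff_distrib mult.commute)
  then show "(LINT x|lborel. indicator {-1..1} x * (primitive t x * \<phi>' x)) = \<phi> 1 * (LINT y|lborel. t y) - (LINT y|lborel. t y * \<phi> y)"
    using sw(1) unfolding e1 e2 by simp
  show "integrable lborel (\<lambda>x. indicator {-1..1} x * (primitive t x * \<phi>' x))"
    using sw(2) unfolding e1 .
qed

end

lemma test_function_facts:
  assumes "\<phi> \<in> test_functions {-1<..<1}"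
  shows "smooth \<phi>" "\<And>x. x \<notin> {-1<..<1} \<Longrightarrow> \<phi> x = 0" "\<And>x. x \<notin> {-1<..<1} \<Longrightarrow> deriv \<phi> x = 0"
proof -
  show sm: "smooth \<phi>" using assms by (simp add: test_functions_def smooth_iff)
  have sub: "closure {x. \<phi> x \<noteq> 0} \<subseteq> {-1<..<1}" using assms by (simp add: test_functions_def)
  show "\<phi> x = 0" if "x \<notin> {-1<..<1}" for x
    using sub that closure_subset[of "{x. \<phi> x \<noteq> 0}"] by blast
  show "deriv \<phi> x = 0" if "x \<notin> {-1<..<1}" for x
  proof -
    have "open (- closure {x. \<phi> x \<noteq> 0})" "x \<in> - closure {x. \<phi> x \<noteq> 0}" using sub that by auto
    from eventually_nhds_in_open[OF this] have ev: "eventually (\<lambda>y. \<phi> y = 0) (nhds x)"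
      using closure_subset[of "{x. \<phi> x \<noteq> 0}"] by (auto elim!: eventually_mono)
    have "(\<phi> has_field_derivative 0) (at x)" by (subst DERIV_cong_ev[OF refl ev refl]) simp
    then show ?thesis by (rule DERIV_imp_deriv)
  qed
qed

context mild_charge
begin

text \<open>
  The derivative defining \<open>pv_inverse\<close> falls on the test function, and the order of the two integrations
  against \<open>ln |x - y|\<close> may be exchanged.
\<close>
lemma distr_conv_pv_inverse:
  assumes \<phi>: "\<phi> \<in> test_functions {-1<..<1}"
    and t': "t' \<in> borel_measurable (lebesgue_on {-1<..<1})" "AE x in lborel. x \<in> {-1<..<1} \<longrightarrow> t' x = t x"
  shows "distr_conv pv_inverse (regular_distr UNIV (zero_extension {-1<..<1} t')) \<phi>
      = - pi * (LINT x|lborel. log_potential t x * deriv \<phi> x)"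
    and "integrable lborel (\<lambda>x. log_potential t x * deriv \<phi> x)"
proof -
  note F = test_function_facts[OF \<phi>]
  let ?d = "deriv \<phi>"
  have cd: "continuous_on UNIV ?d" by (rule smooth_imp_continuous_on[OF smooth_deriv[OF F(1)]])
  have [measurable]: "?d \<in> borel_measurable borel" by (rule borel_measurable_continuous_onI[OF cd])
  obtain C where C: "\<And>x. x \<in> {-1..1} \<Longrightarrow> \<bar>?d x\<bar> \<le> C"
    using continuous_on_bounded_Icc[OF cd, of "-1" 1] by auto
  have "integrable lborel (\<lambda>x. (1 + \<bar>x\<bar>) * \<bar>?d x\<bar>)"
  proof (rule Bochner_Integration.integrable_bound)
    show "integrable lborel (\<lambda>x::real. (2 * C) * indicator {-1..1} x)"
      by (intro integrable_mult_right integrable_indicator_Icc)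
    have "\<bar>(1 + \<bar>x\<bar>) * \<bar>?d x\<bar>\<bar> \<le> (2 * C) * indicator {-1..1} x" for x
    proof (cases "x \<in> {-1<..<1}")
      case True
      then have "(1 + \<bar>x\<bar>) * \<bar>?d x\<bar> \<le> 2 * C" using C[of x] by (intro mult_mono) auto
      then show ?thesis using True by simp
    qed (use F(3) C[of 0] in \<open>auto simp: indicator_def\<close>)
    then show "AE x in lborel. norm ((1 + \<bar>x\<bar>) * \<bar>?d x\<bar>) \<le> norm ((2 * C) * indicator {-1..1} x)"
      by (intro AE_I2) (simp only: real_norm_def order_trans[OF _ abs_ge_self])
  qed measurable
  note pair = log_potential_pairing[OF _ this]
  show "integrable lborel (\<lambda>x. log_potential t x * ?d x)" by (rule pair(2)) simp
  have pv: "pv_inverse (\<lambda>x. \<phi> (x + y)) = - (LINT x|lborel. ln \<bar>x - y\<bar> * ?d x)" for y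
  proof -
    have dd: "deriv (\<lambda>x. \<phi> (x + y)) = (\<lambda>x. ?d (x + y))"
    proof
      fix x
      have "((\<lambda>x. \<phi> (x + y)) has_field_derivative ?d (x + y)) (at x)"
        using smooth_imp_DERIV[OF F(1), of "x + y"] by (simp only: DERIV_shift)
      then show "deriv (\<lambda>x. \<phi> (x + y)) x = ?d (x + y)" by (rule DERIV_imp_deriv)
    qed
    have "pv_inverse (\<lambda>x. \<phi> (x + y)) = - (LINT x|lebesgue_on UNIV. ln \<bar>x\<bar> * ?d (x + y))"
      by (simp add: pv_inverse_def distr_deriv_def regular_distr_def dd)
    also have "(LINT x|lebesgue_on UNIV. ln \<bar>x\<bar> * ?d (x + y)) = (LINT x|lebesgue. ln \<bar>x\<bar> * ?d (x + y))"
      by (subst integral_restrict_space) auto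
    also have "\<dots> = (LINT x|lborel. ln \<bar>x\<bar> * ?d (x + y))" by (rule integral_completion) simp
    also have "\<dots> = (LINT x|lborel. ln \<bar>x - y\<bar> * ?d x)"
      by (subst lborel_integral_real_affine[of 1 _ "-y"]) auto
    finally show ?thesis .
  qed
  have [measurable]: "(\<lambda>y. LINT x|lborel. ln \<bar>x - y\<bar> * ?d x) \<in> borel_measurable borel" by measurable
  have tz: "zero_extension {-1<..<1} t' \<in> borel_measurable lebesgue"
  proof -
    have "(\<lambda>x. indicator {-1<..<1} x *\<^sub>R t' x) \<in> borel_measurable lebesgue"
      using t'(1) by (subst (asm) borel_measurable_restrict_space_iff) auto
    also have "(\<lambda>x. indicator {-1<..<1} x *\<^sub>R t' x) = zero_extension {-1<..<1} t'"
      by (auto simp: zero_extension_def)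
    finally show ?thesis .
  qed
  have "distr_conv pv_inverse (regular_distr UNIV (zero_extension {-1<..<1} t')) \<phi>
     = (LINT y|lebesgue_on UNIV. zero_extension {-1<..<1} t' y * - (LINT x|lborel. ln \<bar>x - y\<bar> * ?d x))"
    by (simp add: distr_conv_def regular_distr_def pv)
  also have "\<dots> = (LINT y|lebesgue. zero_extension {-1<..<1} t' y * - (LINT x|lborel. ln \<bar>x - y\<bar> * ?d x))"
    by (subst integral_restrict_space) auto
  also have "\<dots> = (LINT y|lebesgue. t y * - (LINT x|lborel. ln \<bar>x - y\<bar> * ?d x))"
  proof (rule integral_cong_AE)
    have m: "(\<lambda>y. - (LINT x|lborel. ln \<bar>x - y\<bar> * ?d x)) \<in> borel_measurable lebesgue"
      by (rule measurable_completion) simp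
    show "(\<lambda>y. zero_extension {-1<..<1} t' y * - (LINT x|lborel. ln \<bar>x - y\<bar> * ?d x)) \<in> borel_measurable lebesgue"
      by (rule borel_measurable_times[OF tz m])
    show "(\<lambda>y. t y * - (LINT x|lborel. ln \<bar>x - y\<bar> * ?d x)) \<in> borel_measurable lebesgue"
      by (rule measurable_completion) simp
    show "AE y in lebesgue. zero_extension {-1<..<1} t' y * - (LINT x|lborel. ln \<bar>x - y\<bar> * ?d x)
        = t y * - (LINT x|lborel. ln \<bar>x - y\<bar> * ?d x)"
      unfolding AE_completion_iff using t'(2) by eventually_elim (auto simp: zero_extension_def support)
  qed
  also have "\<dots> = (LINT y|lborel. t y * - (LINT x|lborel. ln \<bar>x - y\<bar> * ?d x))"
    by (rule integral_completion) simp
  also have "\<dots> = - pi * (LINT x|lborel. log_potential t x * ?d x)"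
    by (subst pair(3)) auto
  finally show "distr_conv pv_inverse (regular_distr UNIV (zero_extension {-1<..<1} t')) \<phi>
      = - pi * (LINT x|lborel. log_potential t x * deriv \<phi> x)" .
qed

text \<open>
  Every term of the equation is a derivative: the convolution that of a potential, and \<open>f t\<close> that of its
  primitive. The lemma of du Bois-Reymond removes the derivative at the price of a constant.
\<close>
lemma contact_equation_iff:
  assumes t': "t' \<in> borel_measurable (lebesgue_on {-1<..<1})" "AE x in lborel. x \<in> {-1<..<1} \<longrightarrow> t' x = t x"
    and u': "u' \<in> borel_measurable (lebesgue_on {-1<..<1})" "AE x in lborel. x \<in> {-1<..<1} \<longrightarrow> u' x = u x"
    and u: "charge u"
    and ft: "charge (\<lambda>x. f x * t x)"
    and f[measurable]: "f \<in> borel_measurable borel"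
    and f': "\<And>x. x \<in> {-1<..<1} \<Longrightarrow> f' x = f x"
  shows "distr_eq {-1<..<1}
       (\<lambda>\<phi>. - (1 / pi)
               * distr_conv pv_inverse (regular_distr UNIV (zero_extension {-1<..<1} t')) \<phi>
             + regular_distr {-1<..<1} (\<lambda>x. f' x * t' x) \<phi>)
       (distr_deriv (regular_distr {-1<..<1} u'))
    \<longleftrightarrow> (\<exists>c. AE x in lborel. x \<in> {-1<..<1} \<longrightarrow> u x = c + primitive (\<lambda>x. f x * t x) x - log_potential t x)"
proof -
  interpret u: charge u by (rule u)
  interpret ft: charge "\<lambda>x. f x * t x" by (rule ft)
  let ?G = "primitive (\<lambda>x. f x * t x)" and ?W = "log_potential t"
  have [measurable]: "?G \<in> borel_measurable borel"
    by (rule borel_measurable_continuous_onI[OF ft.continuous_primitive])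
  define h where "h = (\<lambda>x. indicator {-1<..<1} x * (?W x + u x - ?G x))"
  have [measurable]: "h \<in> borel_measurable borel" unfolding h_def by measurable
  have hi: "integrable lborel h"
  proof -
    obtain C where C: "\<And>x. x \<in> {-1..1} \<Longrightarrow> \<bar>?W x - ?G x\<bar> \<le> C"
      using continuous_on_bounded_Icc[OF continuous_on_diff[OF continuous_log_potential ft.continuous_primitive, of UNIV], of "-1" 1] by auto
    have "integrable lborel (\<lambda>x. C * indicator {-1..1} x + \<bar>u x\<bar>)"
      by (intro Bochner_Integration.integrable_add integrable_mult_right u.abs_integrable integrable_indicator_Icc)
    then show ?thesis
    proof (rule Bochner_Integration.integrable_bound)
      have "\<bar>h x\<bar> \<le> C * indicator {-1..1} x + \<bar>u x\<bar>" for x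
      proof (cases "x \<in> {-1<..<1}")
        case True
        then show ?thesis using C[of x] by (simp add: h_def) 
      qed (use C[of 0] in \<open>auto simp: h_def indicator_def\<close>)
      then show "AE x in lborel. norm (h x) \<le> norm (C * indicator {-1..1} x + \<bar>u x\<bar>)"
        by (intro AE_I2) (simp only: real_norm_def order_trans[OF _ abs_ge_self])
    qed measurable
  qed
  have key: "- (1 / pi) * distr_conv pv_inverse (regular_distr UNIV (zero_extension {-1<..<1} t')) \<phi>
             + regular_distr {-1<..<1} (\<lambda>x. f' x * t' x) \<phi> - distr_deriv (regular_distr {-1<..<1} u') \<phi>
           = (LINT x|lborel. h x * deriv \<phi> x)"
    if \<phi>: "\<phi> \<in> test_functions {-1<..<1}" for \<phi>
  proof -
    note F = test_function_facts[OF \<phi>]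
    let ?d = "deriv \<phi>"
    have cd: "continuous_on UNIV ?d" by (rule smooth_imp_continuous_on[OF smooth_deriv[OF F(1)]])
    have [measurable]: "?d \<in> borel_measurable borel" by (rule borel_measurable_continuous_onI[OF cd])
    have [measurable]: "\<phi> \<in> borel_measurable borel"
      by (rule borel_measurable_continuous_onI[OF smooth_imp_continuous_on[OF F(1)]])
    have ml: "\<psi> \<in> borel_measurable (lebesgue_on {-1<..<1})" if "\<psi> \<in> borel_measurable borel" for \<psi> :: "real \<Rightarrow> real"
      using that by (rule borel_measurable_lebesgue_on)
    have f'm: "f' \<in> borel_measurable (lebesgue_on {-1<..<1})"
      using ml[OF f] f' by (subst measurable_cong[of _ _ f]) auto
    have r1: "regular_distr {-1<..<1} (\<lambda>x. f' x * t' x) \<phi> = (LINT x|lborel. (f x * t x) * \<phi> x)"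
      unfolding regular_distr_def
    proof (rule AE_cong_measurable_lebesgue_on(1))
      show "AE x in lborel. x \<in> {-1<..<1} \<longrightarrow> f' x * t' x * \<phi> x = f x * t x * \<phi> x"
        using t'(2) by eventually_elim (auto simp: f')
      show "(\<lambda>x. f' x * t' x * \<phi> x) \<in> borel_measurable (lebesgue_on {-1<..<1})"
        by (intro borel_measurable_times f'm t'(1) ml) simp
    qed (auto simp: support)
    have r2: "distr_deriv (regular_distr {-1<..<1} u') \<phi> = - (LINT x|lborel. u x * ?d x)"
      unfolding regular_distr_def distr_deriv_def
    proof (rule arg_cong[of _ _ uminus], rule AE_cong_measurable_lebesgue_on(1))
      show "AE x in lborel. x \<in> {-1<..<1} \<longrightarrow> u' x * ?d x = u x * ?d x"
        using u'(2) by eventually_elim auto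
      show "(\<lambda>x. u' x * ?d x) \<in> borel_measurable (lebesgue_on {-1<..<1})"
        by (intro borel_measurable_times u'(1) ml) simp
    qed (auto simp: u.support)
    note parts = ft.integration_by_parts[OF smooth_imp_DERIV[OF F(1)] cd]
    have ui: "integrable lborel (\<lambda>x. u x * ?d x)"
    proof -
      obtain C where "\<And>x. x \<in> {-1..1} \<Longrightarrow> \<bar>?d x\<bar> \<le> C"
        using continuous_on_bounded_Icc[OF cd, of "-1" 1] by auto
      then have "integrable lborel (\<lambda>x. of_real (u x) * ?d x)"
        by (intro u.integrable_mult_bounded[of _ C]) auto
      then show ?thesis by simp
    qed
    have "(LINT x|lborel. h x * ?d x) = (LINT x|lborel. ?W x * ?d x + u x * ?d x - indicator {-1..1} x * (?G x * ?d x))"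
      by (intro Bochner_Integration.integral_cong) (auto simp: h_def indicator_def F(3) algebra_simps)
    also have "\<dots> = (LINT x|lborel. ?W x * ?d x) + (LINT x|lborel. u x * ?d x) - (LINT x|lborel. indicator {-1..1} x * (?G x * ?d x))"
      using distr_conv_pv_inverse(2)[OF \<phi> t'] ui parts(2) by simp
    also have "\<dots> = (LINT x|lborel. ?W x * ?d x) + (LINT x|lborel. u x * ?d x) + (LINT x|lborel. (f x * t x) * \<phi> x)"
      using F(2)[of 1] by (subst parts(1)) simp
    finally show ?thesis
      unfolding distr_conv_pv_inverse(1)[OF \<phi> t'] r1 r2 by simp
  qed
  show ?thesis (is "?L \<longleftrightarrow> ?R")
  proof
    assume ?L
    then have "(LINT x|lborel. h x * deriv \<phi> x) = 0" if "\<phi> \<in> test_functions {-1<..<1}" for \<phi>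
      using key[OF that] that by (simp add: distr_eq_def)
    moreover have "h x = 0" if "x \<notin> {-1<..<1}" for x using that by (simp add: h_def)
    ultimately obtain c where "AE x in lborel. x \<in> {-1<..<1} \<longrightarrow> h x = c"
      using du_Bois_Reymond[OF hi] by blast
    then have "AE x in lborel. x \<in> {-1<..<1} \<longrightarrow> u x = c + ?G x - ?W x"
      by eventually_elim (auto simp: h_def)
    then show ?R by blast
  next
    assume ?R
    then obtain c where c: "AE x in lborel. x \<in> {-1<..<1} \<longrightarrow> u x = c + ?G x - ?W x" by blast
    have "(LINT x|lborel. h x * deriv \<phi> x) = 0" if \<phi>: "\<phi> \<in> test_functions {-1<..<1}" for \<phi>
    proof -
      note F = test_function_facts[OF \<phi>]
      have cd: "continuous_on UNIV (deriv \<phi>)" by (rule smooth_imp_continuous_on[OF smooth_deriv[OF F(1)]])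
      have [measurable]: "deriv \<phi> \<in> borel_measurable borel" by (rule borel_measurable_continuous_onI[OF cd])
      have "(LINT x|lborel. h x * deriv \<phi> x) = (LINT x|lborel. c * (deriv \<phi> x * indicator {-1..1} x))"
        using c by (intro integral_cong_AE) (auto elim!: eventually_mono simp: h_def indicator_def F(3))
      also have "\<dots> = c * (\<phi> 1 - \<phi> (-1))"
      proof -
        have "(LINT x|lborel. deriv \<phi> x * indicator {-1..1} x) = \<phi> 1 - \<phi> (-1)"
          by (rule integral_FTC_Icc_real) (use smooth_imp_DERIV[OF F(1)] cd in \<open>auto simp: continuous_on_eq_continuous_at\<close>)
        then show ?thesis by simp
      qed
      finally show ?thesis using F(2)[of 1] F(2)[of "-1"] by simp
    qed
    then show ?L using key by (simp add: distr_eq_def)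
  qed
qed

end

section \<open>Vanishing of the displacement\<close>

lemma last_zero_before:
  fixes v :: "real \<Rightarrow> real"
  assumes c: "continuous_on UNIV v" and z: "z < x" "v z = 0" and vx: "v x < 0"
    and le: "\<And>y. z \<le> y \<Longrightarrow> y \<le> x \<Longrightarrow> v y \<le> 0"
  obtains a where "z \<le> a" "a < x" "v a = 0" "\<And>y. a < y \<Longrightarrow> y \<le> x \<Longrightarrow> v y < 0"
proof -
  define S where "S = {y \<in> {z..x}. v y = 0}"
  have "closed {y. v y = 0}"
    by (intro closed_Collect_eq c continuous_on_const)
  moreover have "S = {z..x} \<inter> {y. v y = 0}" by (auto simp: S_def)
  ultimately have "compact S" by (metis closed_Int_compact compact_Icc Int_commute)
  moreover have "z \<in> S" using z by (auto simp: S_def)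
  then have "S \<noteq> {}" by blast
  ultimately obtain a where a: "a \<in> S" "\<And>y. y \<in> S \<Longrightarrow> y \<le> a"
    using compact_attains_sup by metis
  show ?thesis
  proof
    show "z \<le> a" "v a = 0" using a(1) by (auto simp: S_def)
    have "a \<noteq> x" using a(1) vx by (auto simp: S_def)
    then show "a < x" using a(1) by (auto simp: S_def)
    show "v y < 0" if "a < y" "y \<le> x" for y
    proof -
      have "z \<le> y" using a(1) that by (auto simp: S_def)
      then have "v y \<le> 0" using le that by simp
      moreover have "v y \<noteq> 0" using a(2)[of y] that \<open>z \<le> y\<close> by (auto simp: S_def)
      ultimately show ?thesis by simp
    qed
  qed
qed

lemma first_zero_after:
  fixes v :: "real \<Rightarrow> real"
  assumes c: "continuous_on UNIV v" and z: "x < z" "v z = 0" and vx: "v x < 0"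
    and le: "\<And>y. x \<le> y \<Longrightarrow> y \<le> z \<Longrightarrow> v y \<le> 0"
  obtains b where "b \<le> z" "x < b" "v b = 0" "\<And>y. x \<le> y \<Longrightarrow> y < b \<Longrightarrow> v y < 0"
proof -
  have c': "continuous_on UNIV (\<lambda>y. v (- y))"
    by (intro continuous_on_compose2[OF c] continuous_intros) auto
  obtain a where a: "- z \<le> a" "a < - x" "v (- a) = 0" "\<And>y. a < y \<Longrightarrow> y \<le> - x \<Longrightarrow> v (- y) < 0"
    by (rule last_zero_before[OF c', of "- z" "- x"]) (use assms in auto)
  show ?thesis
  proof
    show "v y < 0" if "x \<le> y" "y < - a" for y using a(4)[of "- y"] that by simp
  qed (use a in auto)
qed

lemma AE_nonpos_imp_nonpos:
  fixes v :: "real \<Rightarrow> real"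
  assumes c: "continuous_on UNIV v" and S: "open S"
    and ae: "AE x in lborel. x \<in> S \<longrightarrow> v x \<le> 0" and x: "x \<in> S"
  shows "v x \<le> 0"
proof (rule ccontr)
  assume "\<not> v x \<le> 0"
  define T where "T = S \<inter> {x. 0 < v x}"
  have T: "open T" "x \<in> T"
    using S x \<open>\<not> v x \<le> 0\<close> open_Collect_less[OF continuous_on_const c, of 0] by (auto simp: T_def)
  have "AE x in lebesgue. x \<notin> T"
    unfolding AE_completion_iff using ae by eventually_elim (auto simp: T_def)
  then have "T \<in> null_sets lebesgue"
    using T by (subst AE_iff_null_sets) auto
  then have "negligible T" by (simp add: negligible_iff_null_sets)
  then show False using open_not_negligible[of T] T by auto
qed

lemma ln_concave_combination:
  fixes p q l :: real
  assumes "0 < p" "0 < q" "0 \<le> l" "l \<le> 1"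
  shows "(1 - l) * ln p + l * ln q \<le> ln ((1 - l) * p + l * q)"
proof -
  define m where "m = (1 - l) * p + l * q"
  have "0 < m"
  proof (cases "l = 0")
    case False
    then have "0 < l * q" "0 \<le> (1 - l) * p" using assms by auto
    then show ?thesis by (simp add: m_def)
  qed (use assms in \<open>simp add: m_def\<close>)
  have "(1 - l) * ln (p / m) + l * ln (q / m) \<le> (1 - l) * (p / m - 1) + l * (q / m - 1)"
    using assms \<open>0 < m\<close> by (intro add_mono mult_left_mono ln_le_minus_one) auto
  also have "\<dots> = ((1 - l) * p + l * q) / m - 1"
    using \<open>0 < m\<close> by (simp add: divide_simps) (simp add: algebra_simps)
  also have "\<dots> = 0" using \<open>0 < m\<close> by (simp add: m_def)
  finally have "(1 - l) * (ln p - ln m) + l * (ln q - ln m) \<le> 0"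
    using assms \<open>0 < m\<close> by (simp add: ln_div)
  then show ?thesis by (simp add: m_def algebra_simps)
qed

context mild_charge
begin

lemma log_potential_mono:
  assumes neg: "AE y in lborel. t y \<le> 0"
    and k: "AE y in lborel. t y \<noteq> 0 \<longrightarrow> (1 - l) * ln \<bar>a - y\<bar> + l * ln \<bar>b - y\<bar> \<le> ln \<bar>x - y\<bar>"
  shows "log_potential t x \<le> (1 - l) * log_potential t a + l * log_potential t b"
proof -
  have "(LINT y|lborel. t y * ln \<bar>x - y\<bar>) \<le> (LINT y|lborel. (1 - l) * (t y * ln \<bar>a - y\<bar>) + l * (t y * ln \<bar>b - y\<bar>))"
  proof (rule integral_mono_AE)
    show "AE y in lborel. t y * ln \<bar>x - y\<bar> \<le> (1 - l) * (t y * ln \<bar>a - y\<bar>) + l * (t y * ln \<bar>b - y\<bar>)"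
      using neg k
    proof eventually_elim
      case (elim y)
      show ?case
      proof (cases "t y = 0")
        case False
        then have "t y * ln \<bar>x - y\<bar> \<le> t y * ((1 - l) * ln \<bar>a - y\<bar> + l * ln \<bar>b - y\<bar>)"
          using elim by (intro mult_left_mono_neg) auto
        then show ?thesis by (simp add: algebra_simps)
      qed simp
    qed
  qed (auto intro!: log_integrable)
  also have "\<dots> = (1 - l) * (LINT y|lborel. t y * ln \<bar>a - y\<bar>) + l * (LINT y|lborel. t y * ln \<bar>b - y\<bar>)"
    using log_integrable by (subst Bochner_Integration.integral_add) auto
  finally have "(LINT y|lborel. t y * ln \<bar>x - y\<bar>) / pi \<le>
     ((1 - l) * (LINT y|lborel. t y * ln \<bar>a - y\<bar>) + l * (LINT y|lborel. t y * ln \<bar>b - y\<bar>)) / pi"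
    by (intro divide_right_mono) auto
  then show ?thesis by (simp add: log_potential_def add_divide_distrib)
qed

text \<open>
  The displacement vanishes. On a component of \<open>{v < 0}\<close> there is no pressure, so \<open>v\<close> is a constant
  minus the potential of a nonpositive charge lying outside the component. Such a potential is
  convex, and monotone if the charge lies on one side only; so \<open>v\<close> cannot lie below its boundary
  values. A component without boundary values in the open interval is the whole interval, and then
  there is no charge at all.
\<close>
theorem displacement_eq_0:
  assumes g: "charge g" and gt: "\<And>x. t x = 0 \<Longrightarrow> g x = 0"
    and neg: "AE y in lborel. t y \<le> 0" and mass: "(LINT y|lborel. t y) \<noteq> 0"
    and v: "\<And>x. v x = c + primitive g x - log_potential t x"
    and v_le: "AE x in lborel. x \<in> {-1<..<1} \<longrightarrow> v x \<le> 0"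
    and compl: "AE x in lborel. x \<in> {-1<..<1} \<longrightarrow> v x * t x = 0"
    and x1: "x1 \<in> {-1<..<1}"
  shows "v x1 = 0"
proof (rule ccontr)
  interpret g: charge g by (rule g)
  have cv: "continuous_on UNIV v"
    unfolding v by (intro continuous_intros g.continuous_primitive continuous_log_potential)
  have le: "v x \<le> 0" if "x \<in> {-1<..<1}" for x
    using AE_nonpos_imp_nonpos[OF cv _ v_le that] by simp
  assume "v x1 \<noteq> 0"
  with le[OF x1] have vx1: "v x1 < 0" by simp
  have no_charge: "AE y in lborel. y \<in> A \<longrightarrow> t y = 0"
    if "\<And>y. y \<in> A \<Longrightarrow> y \<in> {-1<..<1} \<and> v y < 0" for A
    using compl by eventually_elim (use that in force)
  have prim: "primitive g b = primitive g a" if "a \<le> b" "AE y in lborel. y \<in> {a<..<b} \<longrightarrow> t y = 0" for a b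
  proof -
    have "(LINT y|lborel. g y * indicator {a<..b} y) = 0"
    proof (rule integral_eq_zero_AE)
      show "AE y in lborel. g y * indicator {a<..b} y = 0"
        using that(2) AE_lborel_singleton[of b] by eventually_elim (auto simp: indicator_def gt)
    qed
    then show ?thesis using g.primitive_diff[OF that(1)] by simp
  qed
  have left: "(\<exists>a. -1 < a \<and> a < x1 \<and> v a = 0 \<and> (\<forall>y. a < y \<and> y \<le> x1 \<longrightarrow> v y < 0)) \<or> (\<forall>y. -1 < y \<and> y \<le> x1 \<longrightarrow> v y < 0)"
  proof (cases "\<forall>y. -1 < y \<and> y \<le> x1 \<longrightarrow> v y < 0")
    case False
    then obtain z where z: "-1 < z" "z \<le> x1" "\<not> v z < 0" by blast
    then have "v z = 0" using le[of z] x1 by auto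
    moreover have "z < x1" using z vx1 by (cases "z = x1") auto
    moreover have "v y \<le> 0" if "z \<le> y" "y \<le> x1" for y using that z x1 by (intro le) auto
    ultimately obtain a where "z \<le> a" "a < x1" "v a = 0" "\<And>y. a < y \<Longrightarrow> y \<le> x1 \<Longrightarrow> v y < 0"
      using last_zero_before[OF cv _ _ vx1, of z] by blast
    then show ?thesis using z by (intro disjI1 exI[of _ a]) auto
  qed blast
  have right: "(\<exists>b. b < 1 \<and> x1 < b \<and> v b = 0 \<and> (\<forall>y. x1 \<le> y \<and> y < b \<longrightarrow> v y < 0)) \<or> (\<forall>y. x1 \<le> y \<and> y < 1 \<longrightarrow> v y < 0)"
  proof (cases "\<forall>y. x1 \<le> y \<and> y < 1 \<longrightarrow> v y < 0")
    case False
    then obtain z where z: "x1 \<le> z" "z < 1" "\<not> v z < 0" by blast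
    then have "v z = 0" using le[of z] x1 by auto
    moreover have "x1 < z" using z vx1 by (cases "z = x1") auto
    moreover have "v y \<le> 0" if "x1 \<le> y" "y \<le> z" for y using that z x1 by (intro le) auto
    ultimately obtain b where "b \<le> z" "x1 < b" "v b = 0" "\<And>y. x1 \<le> y \<Longrightarrow> y < b \<Longrightarrow> v y < 0"
      using first_zero_after[OF cv _ _ vx1, of z] by blast
    then show ?thesis using z by (intro disjI1 exI[of _ b]) auto
  qed blast
  \<comment> \<open>The value at \<open>x1\<close> against a weighted mean of the values at \<open>a\<close> and \<open>b\<close>. The weights \<open>0\<close> and \<open>1\<close>
    serve components that reach an end of the interval, where only one boundary value is zero.\<close>
  have contra: False
    if ab: "a < x1" "x1 < b" and zero: "AE y in lborel. y \<in> {a<..<b} \<longrightarrow> t y = 0"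
      and l: "0 \<le> l" "l \<le> 1" "l = 1 \<or> v a = 0" "l = 0 \<or> v b = 0"
      and ln: "\<And>y. y \<in> {-1<..<1} \<Longrightarrow> y < a \<or> b < y \<Longrightarrow> (1 - l) * ln \<bar>a - y\<bar> + l * ln \<bar>b - y\<bar> \<le> ln \<bar>x1 - y\<bar>" for a b l
  proof -
    have "AE y in lborel. t y \<noteq> 0 \<longrightarrow> (1 - l) * ln \<bar>a - y\<bar> + l * ln \<bar>b - y\<bar> \<le> ln \<bar>x1 - y\<bar>"
      using zero AE_lborel_singleton[of a] AE_lborel_singleton[of b]
    proof eventually_elim
      case (elim y)
      show ?case
      proof
        assume "t y \<noteq> 0"
        then have "y \<in> {-1<..<1}" using support by blast
        then show "(1 - l) * ln \<bar>a - y\<bar> + l * ln \<bar>b - y\<bar> \<le> ln \<bar>x1 - y\<bar>"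
          using elim \<open>t y \<noteq> 0\<close> by (intro ln) auto
      qed
    qed
    from log_potential_mono[OF neg this]
    have W: "log_potential t x1 \<le> (1 - l) * log_potential t a + l * log_potential t b" .
    have G: "primitive g x1 = primitive g a" "primitive g b = primitive g x1"
      using ab zero by (auto intro!: prim elim!: eventually_mono)
    have "(1 - l) * v a + l * v b \<le> v x1"
      using W G unfolding v by (simp add: algebra_simps)
    moreover have "(1 - l) * v a + l * v b = 0" using l(3,4) by auto
    ultimately show False using vx1 by simp
  qed
  have x1': "-1 < x1" "x1 < 1" using x1 by auto
  from left right show False
  proof (elim disjE exE conjE)
    fix a b
    assume a: "-1 < a" "a < x1" "v a = 0" "\<forall>y. a < y \<and> y \<le> x1 \<longrightarrow> v y < 0"
      and b: "b < 1" "x1 < b" "v b = 0" "\<forall>y. x1 \<le> y \<and> y < b \<longrightarrow> v y < 0"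
    have "AE y in lborel. y \<in> {a<..<b} \<longrightarrow> t y = 0"
    proof (rule no_charge)
      fix y :: real assume "y \<in> {a<..<b}"
      then show "y \<in> {-1<..<1} \<and> v y < 0" using a b x1 by (cases "y \<le> x1") auto
    qed
    then show False
    proof (rule contra[OF a(2) b(2)])
      let ?l = "(x1 - a) / (b - a)"
      show l: "0 \<le> ?l" "?l \<le> 1" using a b by (auto simp: field_simps)
      fix y assume "y < a \<or> b < y"
      have comb: "(1 - ?l) * (a - y) + ?l * (b - y) = x1 - y"
      proof -
        have "(1 - L) * (a - y) + L * (b - y) = (a - y) + L * (b - a)" for L by (simp add: algebra_simps)
        from this[of ?l] show ?thesis using a b by simp
      qed
      from \<open>y < a \<or> b < y\<close> show "(1 - ?l) * ln \<bar>a - y\<bar> + ?l * ln \<bar>b - y\<bar> \<le> ln \<bar>x1 - y\<bar>"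
      proof
        assume "y < a"
        then have "0 < a - y" "0 < b - y" "0 < x1 - y" using a b by auto
        then show ?thesis using ln_concave_combination[of "a - y" "b - y" ?l] l comb by simp
      next
        assume "b < y"
        then have p: "0 < y - a" "0 < y - b" "0 < y - x1" using a b by auto
        have "(1 - ?l) * (y - a) + ?l * (y - b) = - ((1 - ?l) * (a - y) + ?l * (b - y))"
          by (simp only: mult_minus_right[symmetric] minus_diff_eq minus_add_distrib)
        also have "\<dots> = y - x1" unfolding comb by simp
        finally have "(1 - ?l) * ln (y - a) + ?l * ln (y - b) \<le> ln (y - x1)"
          using ln_concave_combination[of "y - a" "y - b" ?l] l p by simp
        then show ?thesis using p by (simp add: abs_minus_commute)
      qed
    qed (use a b in auto)
  next
    fix a
    assume a: "-1 < a" "a < x1" "v a = 0" "\<forall>y. a < y \<and> y \<le> x1 \<longrightarrow> v y < 0"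
      and b: "\<forall>y. x1 \<le> y \<and> y < 1 \<longrightarrow> v y < 0"
    have "AE y in lborel. y \<in> {a<..<1} \<longrightarrow> t y = 0"
    proof (rule no_charge)
      fix y :: real assume "y \<in> {a<..<1}"
      then show "y \<in> {-1<..<1} \<and> v y < 0" using a b x1 by (cases "y \<le> x1") auto
    qed
    then show False
      by (rule contra[of a 1 0, OF a(2) x1'(2)]) (use a x1 in \<open>auto simp: ln_le_cancel_iff\<close>)
  next
    fix b
    assume b: "b < 1" "x1 < b" "v b = 0" "\<forall>y. x1 \<le> y \<and> y < b \<longrightarrow> v y < 0"
      and a: "\<forall>y. -1 < y \<and> y \<le> x1 \<longrightarrow> v y < 0"
    have "AE y in lborel. y \<in> {-1<..<b} \<longrightarrow> t y = 0"
    proof (rule no_charge)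
      fix y :: real assume "y \<in> {-1<..<b}"
      then show "y \<in> {-1<..<1} \<and> v y < 0" using a b x1 by (cases "y \<le> x1") auto
    qed
    then show False
      by (rule contra[of "-1" b 1, OF x1'(1) b(2)]) (use b x1 in \<open>auto simp: ln_le_cancel_iff\<close>)
  next
    assume a: "\<forall>y. -1 < y \<and> y \<le> x1 \<longrightarrow> v y < 0" and b: "\<forall>y. x1 \<le> y \<and> y < 1 \<longrightarrow> v y < 0"
    have z: "AE y in lborel. y \<in> {-1<..<1} \<longrightarrow> t y = 0"
    proof (rule no_charge)
      fix y :: real assume "y \<in> {-1<..<1}"
      then show "y \<in> {-1<..<1} \<and> v y < 0" using a b x1 by (cases "y \<le> x1") auto
    qed
    have "AE y in lborel. t y = 0" using z by eventually_elim (use support in blast)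
    then have "(LINT y|lborel. t y) = 0" by (rule integral_eq_zero_AE)
    then show False using mass by simp
  qed
qed

end

section \<open>Boundary direction of the Cauchy transform\<close>

lemma integrable_inverse_1_plus_square: "integrable lborel (\<lambda>x::real. 1 / (1 + x\<^sup>2))"
proof -
  have "set_integrable lborel (einterval (-\<infinity>) \<infinity>) (\<lambda>x::real. 1 / (1 + x\<^sup>2))"
  proof (rule interval_integral_FTC_nonneg(1)[where F = arctan and A = "- (pi/2)" and B = "pi/2"])
    show "DERIV arctan x :> 1 / (1 + x\<^sup>2)" for x
      using DERIV_arctan[of x] by (simp add: inverse_eq_divide)
    show "isCont (\<lambda>x::real. 1 / (1 + x\<^sup>2)) x" for x
      by (intro continuous_intros) (metis add_pos_nonneg less_numeral_extra(3) zero_le_power2 zero_less_one)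
    show "((arctan \<circ> real_of_ereal) \<longlongrightarrow> - (pi/2)) (at_right (-\<infinity>))"
      using tendsto_arctan_at_bot by (simp add: ereal_tendsto_simps)
    show "((arctan \<circ> real_of_ereal) \<longlongrightarrow> pi/2) (at_left \<infinity>)"
      using tendsto_arctan_at_top by (simp add: ereal_tendsto_simps)
  qed (auto intro!: divide_nonneg_nonneg)
  then show ?thesis by (simp add: set_integrable_def einterval_def)
qed

context mild_charge
begin

lemma abs_log_potential_le: "\<bar>log_potential t x\<bar> \<le> (M / s + (LINT y|lborel. \<bar>t y\<bar>)) / pi * (1 + \<bar>x\<bar>)"
proof -
  have "\<bar>LINT y|lborel. t y * ln \<bar>x - y\<bar>\<bar> \<le> (M / s + (LINT y|lborel. \<bar>t y\<bar>)) * (1 + \<bar>x\<bar>)"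
    by (rule order_trans[OF integral_abs_bound abs_log_integral_le])
  then have "\<bar>LINT y|lborel. t y * ln \<bar>x - y\<bar>\<bar> / pi \<le> (M / s + (LINT y|lborel. \<bar>t y\<bar>)) * (1 + \<bar>x\<bar>) / pi"
    by (intro divide_right_mono) auto
  then show ?thesis by (simp add: log_potential_def abs_divide)
qed

text \<open>
  Poisson's formula for the real part of the Cauchy transform, integrated by parts so that it
  involves the potential instead of its (merely distributional) derivative.
\<close>
lemma Re_cauchy_transform_log_potential:
  fixes e x0 :: real
  assumes e: "0 < e"
  defines "k \<equiv> \<lambda>x. 2 * e * (x - x0) / ((x - x0)\<^sup>2 + e\<^sup>2)\<^sup>2"
  shows "Re (cauchy_transform t (Complex x0 e)) = (LINT x|lborel. log_potential t x * k x) / pi"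
    and "integrable lborel (\<lambda>x. log_potential t x * k x)"
proof -
  have [measurable]: "k \<in> borel_measurable borel" unfolding k_def by measurable
  have ki: "integrable lborel (\<lambda>x. (1 + \<bar>x\<bar>) * \<bar>k x\<bar>)"
  proof (rule Bochner_Integration.integrable_bound)
    define D where "D = min 1 (e\<^sup>2)"
    have D: "0 < D" "D \<le> 1" "D \<le> e\<^sup>2" using e by (auto simp: D_def)
    let ?C = "4 * e * (2 + \<bar>x0\<bar>) / D\<^sup>2"
    show "integrable lborel (\<lambda>x. ?C * (1 / (1 + (x - x0)\<^sup>2)))"
      using lborel_integrable_real_affine[OF integrable_inverse_1_plus_square, of 1 "- x0"]
      by (intro integrable_mult_right) simp
    have "(1 + \<bar>x\<bar>) * \<bar>k x\<bar> \<le> ?C * (1 / (1 + (x - x0)\<^sup>2))" for x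
    proof -
      define r where "r = x - x0"
      have q: "0 < 1 + r\<^sup>2" by (simp add: add_pos_nonneg)
      have "D * (1 + r\<^sup>2) \<le> r\<^sup>2 + e\<^sup>2"
        using mult_right_mono[OF D(2), of "r\<^sup>2"] D(3) by (simp add: algebra_simps)
      then have den: "(D * (1 + r\<^sup>2))\<^sup>2 \<le> (r\<^sup>2 + e\<^sup>2)\<^sup>2" using D q by (intro power_mono) auto
      have r2: "2 * \<bar>r\<bar> \<le> 1 + r\<^sup>2" using zero_le_power2[of "\<bar>r\<bar> - 1"] by (simp add: power2_eq_square algebra_simps)
      have num: "(1 + \<bar>x\<bar>) * (2 * e * \<bar>r\<bar>) \<le> 4 * e * (2 + \<bar>x0\<bar>) * (1 + r\<^sup>2)"
      proof -
        have "1 + \<bar>x\<bar> \<le> (1 + \<bar>x0\<bar>) + \<bar>r\<bar>" unfolding r_def by linarith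
        then have "(1 + \<bar>x\<bar>) * (2 * e * \<bar>r\<bar>) \<le> ((1 + \<bar>x0\<bar>) + \<bar>r\<bar>) * (2 * e * \<bar>r\<bar>)"
          using e by (intro mult_right_mono) auto
        also have "\<dots> = e * ((1 + \<bar>x0\<bar>) * (2 * \<bar>r\<bar>) + 2 * r\<^sup>2)"
          by (simp add: power2_eq_square algebra_simps abs_mult_self_eq)
        also have "\<dots> \<le> e * ((1 + \<bar>x0\<bar>) * (1 + r\<^sup>2) + 2 * (1 + r\<^sup>2))"
          using e r2 by (intro mult_left_mono add_mono) auto
        also have "\<dots> \<le> 4 * e * (2 + \<bar>x0\<bar>) * (1 + r\<^sup>2)"
        proof -
          have "e * ((1 + \<bar>x0\<bar>) * (1 + r\<^sup>2) + 2 * (1 + r\<^sup>2)) = (e * (1 + r\<^sup>2)) * (3 + \<bar>x0\<bar>)" by (simp add: algebra_simps)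
          also have "\<dots> \<le> (e * (1 + r\<^sup>2)) * (4 * (2 + \<bar>x0\<bar>))" using e q by (intro mult_left_mono) auto
          finally show ?thesis by (simp add: mult_ac)
        qed
        finally show ?thesis .
      qed
      have "\<bar>k x\<bar> = 2 * e * \<bar>r\<bar> / (r\<^sup>2 + e\<^sup>2)\<^sup>2" using e by (simp add: k_def r_def abs_mult)
      then have "(1 + \<bar>x\<bar>) * \<bar>k x\<bar> = (1 + \<bar>x\<bar>) * (2 * e * \<bar>r\<bar>) / (r\<^sup>2 + e\<^sup>2)\<^sup>2" by simp
      also have "\<dots> \<le> 4 * e * (2 + \<bar>x0\<bar>) * (1 + r\<^sup>2) / (D * (1 + r\<^sup>2))\<^sup>2"
        using num den D q e by (intro frac_le) auto
      also have "\<dots> = ?C * (1 / (1 + r\<^sup>2))" using q D by (simp add: power2_eq_square)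
      finally show ?thesis by (simp add: r_def)
    qed
    moreover have "norm ((1 + \<bar>x\<bar>) * \<bar>k x\<bar>) = (1 + \<bar>x\<bar>) * \<bar>k x\<bar>" for x by (simp add: abs_mult)
    ultimately show "AE x in lborel. norm ((1 + \<bar>x\<bar>) * \<bar>k x\<bar>) \<le> norm (?C * (1 / (1 + (x - x0)\<^sup>2)))"
      by (intro AE_I2) (metis abs_ge_self order_trans real_norm_def)
  qed measurable
  note pair = log_potential_pairing[OF _ ki]
  show "integrable lborel (\<lambda>x. log_potential t x * k x)" by (rule pair(2)) simp
  have inner: "AE y in lborel. t y * (LINT x|lborel. ln \<bar>x - y\<bar> * k x) = t y * (pi * ((x0 - y) / ((x0 - y)\<^sup>2 + e\<^sup>2)))"
    using pair(1)[OF \<open>k \<in> borel_measurable borel\<close>]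
  proof eventually_elim
    case (elim y)
    show ?case
    proof (cases "t y = 0")
      case False
      let ?h = "\<lambda>x. ln \<bar>x\<bar> * (2 * e * (x - (x0 - y)) / ((x - (x0 - y))\<^sup>2 + e\<^sup>2)\<^sup>2)"
      have eq: "ln \<bar>x - y\<bar> * k x = ?h (- y + 1 * x)" for x by (simp add: k_def algebra_simps)
      have "integrable lborel (\<lambda>x. ln \<bar>x - y\<bar> * k x)" using elim False by (simp add: mult.assoc)
      then have "integrable lborel ?h" unfolding eq by (subst (asm) lborel_integrable_real_affine_iff) auto
      note log_kernel_integral[OF e this]
      moreover have "(LINT x|lborel. ln \<bar>x - y\<bar> * k x) = (LINT x|lborel. ?h x)"
        unfolding eq by (subst lborel_integral_real_affine[of 1 ?h "- y"]) auto
      ultimately show ?thesis by simp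
    qed simp
  qed
  have "(LINT x|lborel. log_potential t x * k x) = (LINT y|lborel. t y * (LINT x|lborel. ln \<bar>x - y\<bar> * k x)) / pi"
    by (rule pair(3)) simp
  also have "(LINT y|lborel. t y * (LINT x|lborel. ln \<bar>x - y\<bar> * k x)) = (LINT y|lborel. t y * (pi * ((x0 - y) / ((x0 - y)\<^sup>2 + e\<^sup>2))))"
    using inner by (intro integral_cong_AE) auto
  also have "\<dots> = (LINT y|lborel. pi * (t y * ((x0 - y) / ((x0 - y)\<^sup>2 + e\<^sup>2))))"
    by (intro Bochner_Integration.integral_cong) auto
  also have "\<dots> = pi * (LINT y|lborel. t y * ((x0 - y) / ((x0 - y)\<^sup>2 + e\<^sup>2)))"
    by (rule integral_mult_right_zero)
  finally have "(LINT x|lborel. log_potential t x * k x) = (LINT y|lborel. t y * ((x0 - y) / ((x0 - y)\<^sup>2 + e\<^sup>2)))"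
    by simp
  then show "Re (cauchy_transform t (Complex x0 e)) = (LINT x|lborel. log_potential t x * k x) / pi"
    unfolding Re_cauchy_transform[OF e] by simp
qed

end

context mild_charge
begin

text \<open>
  If the potential is a primitive of \<open>f t\<close> on the interval, then at every point where \<open>f\<close> satisfies a
  Lipschitz condition the boundary values \<open>X + i Y\<close> of the Cauchy transform are asymptotically on
  the line \<open>X + f Y = 0\<close>. This holds at each such point, no matter whether \<open>X\<close> and \<open>Y\<close> converge:
  after an integration by parts \<open>X\<close> is the Poisson integral of \<open>f t\<close> up to vanishing terms, \<open>Y\<close> is minus
  that of \<open>t\<close>, and the factor \<open>f y - f x0\<close> cancels the singularity of the Poisson kernel.
\<close>
theorem boundary_direction:
  assumes g: "charge g" and gt: "\<And>x. x \<in> {-1<..<1} \<Longrightarrow> g x = f x * t x"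
    and eq: "\<And>x. x \<in> {-1..1} \<Longrightarrow> log_potential t x = c + primitive g x"
    and x0: "x0 \<in> {-1<..<1}"
    and [measurable]: "f \<in> borel_measurable borel"
    and lip: "\<And>y. y \<in> {-1<..<1} \<Longrightarrow> \<bar>f y - f x0\<bar> \<le> K * \<bar>y - x0\<bar>"
  shows "((\<lambda>e. Re (cauchy_transform t (Complex x0 e)) + f x0 * Im (cauchy_transform t (Complex x0 e))) \<longlongrightarrow> 0) (at_right 0)"
proof -
  interpret g: charge g by (rule g)
  let ?W = "log_potential t" and ?G = "primitive g"
  define m where "m = (LINT y|lborel. g y)"
  define \<kappa> where "\<kappa> = (\<lambda>e x. e / ((x - x0)\<^sup>2 + e\<^sup>2))"
  define k where "k = (\<lambda>e x. 2 * e * (x - x0) / ((x - x0)\<^sup>2 + e\<^sup>2)\<^sup>2)"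
  have [measurable]: "\<kappa> e \<in> borel_measurable borel" "k e \<in> borel_measurable borel" for e
    unfolding \<kappa>_def k_def by measurable
  have lip': "\<bar>f y - f x0\<bar> \<le> \<bar>K\<bar> * \<bar>y - x0\<bar>" if "y \<in> {-1<..<1}" for y
    using order_trans[OF lip[OF that] mult_right_mono[OF abs_ge_self[of K] abs_ge_zero]] .
  have pos: "0 < (x - x0)\<^sup>2 + e\<^sup>2" if "0 < e" for x e :: real using that by (simp add: add_nonneg_pos)
  have rep: "Re (cauchy_transform t (Complex x0 e)) + f x0 * Im (cauchy_transform t (Complex x0 e))
     = ((LINT y|lborel. (f y - f x0) * t y * \<kappa> e y) - \<kappa> e 1 * m + c * (\<kappa> e (-1) - \<kappa> e 1)
        + (LINT x|lborel. (1 - indicator {-1..1} x) * (?W x * k e x))) / pi" if e: "0 < e" for e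
  proof -
    have d: "((\<lambda>x. - \<kappa> e x) has_field_derivative k e x) (at x)" for x
    proof -
      have q: "(x - x0)\<^sup>2 + e\<^sup>2 \<noteq> 0" using less_imp_neq[OF pos[OF e, of x]] by (rule not_sym)
      have dq: "((\<lambda>x. (x - x0)\<^sup>2 + e\<^sup>2) has_field_derivative 2 * (x - x0)) (at x)"
        by (auto intro!: derivative_eq_intros)
      have "- ((0 * Q - e * (2 * r)) / (Q * Q)) = 2 * e * r / Q\<^sup>2" for Q r :: real
        by (simp add: power2_eq_square)
      with DERIV_minus[OF DERIV_divide[OF DERIV_const[of e] dq q]] show ?thesis
        unfolding \<kappa>_def k_def by (simp only:)
    qed
    have ck: "continuous_on UNIV (k e)"
    proof -
      have "((x - x0)\<^sup>2 + e\<^sup>2)\<^sup>2 \<noteq> 0" for x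
        using zero_less_power[OF pos[OF e, of x], of 2] by (rule less_imp_neq[THEN not_sym])
      then show ?thesis unfolding k_def by (intro continuous_intros ballI)
    qed
    have kint: "integrable lborel (\<lambda>x. ?W x * k e x)"
      using Re_cauchy_transform_log_potential(2)[OF e, of x0] by (simp add: k_def)
    have in_int: "integrable lborel (\<lambda>x. indicator {-1..1} x * (?W x * k e x))"
      using integrable_real_mult_indicator[OF _ kint, of "{-1..1}"] by (simp add: mult.commute)
    have out_int: "integrable lborel (\<lambda>x. (1 - indicator {-1..1} x) * (?W x * k e x))"
      using Bochner_Integration.integrable_diff[OF kint in_int] by (simp add: left_diff_distrib)
    have "(LINT x|lborel. ?W x * k e x) = (LINT x|lborel. indicator {-1..1} x * (?W x * k e x) + (1 - indicator {-1..1} x) * (?W x * k e x))"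
      by (intro Bochner_Integration.integral_cong) (auto simp: algebra_simps)
    also have "\<dots> = (LINT x|lborel. indicator {-1..1} x * (?W x * k e x)) + (LINT x|lborel. (1 - indicator {-1..1} x) * (?W x * k e x))"
      by (rule Bochner_Integration.integral_add[OF in_int out_int])
    also have "(LINT x|lborel. indicator {-1..1} x * (?W x * k e x))
        = (LINT x|lborel. c * (k e x * indicator {-1..1} x) + indicator {-1..1} x * (?G x * k e x))"
      by (intro Bochner_Integration.integral_cong) (auto simp: eq indicator_def algebra_simps)
    also have "\<dots> = c * (LINT x|lborel. k e x * indicator {-1..1} x) + (LINT x|lborel. indicator {-1..1} x * (?G x * k e x))"
    proof -
      have "has_bochner_integral lborel (\<lambda>x. k e x * indicator {-1..1} x) (- \<kappa> e 1 - (- \<kappa> e (-1)))"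
        using d ck by (intro has_bochner_integral_FTC_Icc_real) (auto simp: continuous_on_eq_continuous_at)
      then show ?thesis using g.integration_by_parts(2)[OF d ck]
        by (subst Bochner_Integration.integral_add) (auto simp: has_bochner_integral_iff)
    qed
    also have "(LINT x|lborel. k e x * indicator {-1..1} x) = - \<kappa> e 1 - (- \<kappa> e (-1))"
      using d ck by (intro integral_FTC_Icc_real) (auto simp: continuous_on_eq_continuous_at)
    also have "(LINT x|lborel. indicator {-1..1} x * (?G x * k e x)) = - \<kappa> e 1 * m - (LINT y|lborel. g y * - \<kappa> e y)"
      unfolding m_def by (rule g.integration_by_parts(1)[OF d ck])
    also have "(LINT y|lborel. g y * - \<kappa> e y) = - (LINT y|lborel. g y * \<kappa> e y)" by simp
    finally have Re: "Re (cauchy_transform t (Complex x0 e)) = (c * (- \<kappa> e 1 - (- \<kappa> e (-1))) + (- \<kappa> e 1 * m - - (LINT y|lborel. g y * \<kappa> e y))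
       + (LINT x|lborel. (1 - indicator {-1..1} x) * (?W x * k e x))) / pi"
      unfolding Re_cauchy_transform_log_potential(1)[OF e] k_def by simp
    have \<kappa>b: "\<bar>\<kappa> e y\<bar> \<le> 1 / e" for y
    proof -
      have "e / ((y - x0)\<^sup>2 + e\<^sup>2) \<le> e / e\<^sup>2" using e by (intro divide_left_mono) (auto simp: add_nonneg_pos)
      then show ?thesis using e by (simp add: \<kappa>_def power2_eq_square)
    qed
    have i: "integrable lborel (\<lambda>y. g y * \<kappa> e y)" "integrable lborel (\<lambda>y. t y * \<kappa> e y)"
      using g.integrable_mult_bounded[of "\<kappa> e" "1/e"] integrable_mult_bounded[of "\<kappa> e" "1/e"] \<kappa>b by simp_all
    have Im: "f x0 * Im (cauchy_transform t (Complex x0 e)) = - (LINT y|lborel. f x0 * (t y * \<kappa> e y)) / pi"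
      unfolding Im_cauchy_transform[OF e] integral_mult_right_zero \<kappa>_def by (simp add: power2_commute)
    have "(LINT y|lborel. (f y - f x0) * t y * \<kappa> e y) = (LINT y|lborel. g y * \<kappa> e y - f x0 * (t y * \<kappa> e y))"
    proof (intro Bochner_Integration.integral_cong refl)
      fix y
      show "(f y - f x0) * t y * \<kappa> e y = g y * \<kappa> e y - f x0 * (t y * \<kappa> e y)"
        by (cases "y \<in> {-1<..<1}") (auto simp: gt support g.support algebra_simps)
    qed
    also have "\<dots> = (LINT y|lborel. g y * \<kappa> e y) - (LINT y|lborel. f x0 * (t y * \<kappa> e y))"
      using i by (intro Bochner_Integration.integral_diff) auto
    finally have fin: "(LINT y|lborel. (f y - f x0) * t y * \<kappa> e y) = (LINT y|lborel. g y * \<kappa> e y) - (LINT y|lborel. f x0 * (t y * \<kappa> e y))" .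
    show ?thesis unfolding Re Im fin by (simp add: add_divide_distrib diff_divide_distrib algebra_simps)
  qed
  have l1: "((\<lambda>e. LINT y|lborel. (f y - f x0) * t y * \<kappa> e y) \<longlongrightarrow> (LINT y::real|lborel. 0)) (at_right 0)"
  proof (rule integral_tendsto_at_right_0(1))
    show "integrable lborel (\<lambda>y. \<bar>K\<bar> * \<bar>t y\<bar>)" using abs_integrable by simp
    show "AE y in lborel. norm ((f y - f x0) * t y * \<kappa> e y) \<le> \<bar>K\<bar> * \<bar>t y\<bar>" if e: "0 < e" for e
    proof (intro AE_I2)
      fix y
      show "norm ((f y - f x0) * t y * \<kappa> e y) \<le> \<bar>K\<bar> * \<bar>t y\<bar>"
      proof (cases "y \<in> {-1<..<1}")
        case True
        have "\<bar>y - x0\<bar> * \<kappa> e y \<le> 1"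
        proof -
          have "2 * \<bar>y - x0\<bar> * e \<le> (y - x0)\<^sup>2 + e\<^sup>2"
            using zero_le_power2[of "\<bar>y - x0\<bar> - e"] by (simp add: power2_eq_square algebra_simps abs_mult_self_eq)
          moreover have "0 \<le> \<bar>y - x0\<bar> * e" using e by simp
          ultimately show ?thesis using pos[OF e, of y] by (simp add: \<kappa>_def divide_simps)
        qed
        then have "\<bar>K\<bar> * (\<bar>y - x0\<bar> * \<kappa> e y) \<le> \<bar>K\<bar> * 1" by (intro mult_left_mono) auto
        moreover have "\<bar>f y - f x0\<bar> * \<kappa> e y \<le> (\<bar>K\<bar> * \<bar>y - x0\<bar>) * \<kappa> e y"
          using e pos[OF e, of y] by (intro mult_right_mono lip'[OF True]) (auto simp: \<kappa>_def)
        ultimately have "\<bar>f y - f x0\<bar> * \<kappa> e y \<le> \<bar>K\<bar>" by (simp add: mult.assoc)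
        then have "\<bar>t y\<bar> * (\<bar>f y - f x0\<bar> * \<kappa> e y) \<le> \<bar>t y\<bar> * \<bar>K\<bar>" by (intro mult_left_mono) auto
        moreover have "norm ((f y - f x0) * t y * \<kappa> e y) = \<bar>t y\<bar> * (\<bar>f y - f x0\<bar> * \<kappa> e y)"
        proof -
          have k: "\<bar>\<kappa> e y\<bar> = \<kappa> e y" using e pos[OF e, of y] by (simp add: \<kappa>_def)
          show ?thesis unfolding real_norm_def abs_mult k by (simp only: mult.assoc mult.left_commute)
        qed
        ultimately show ?thesis by (simp only: mult.commute[of "\<bar>K\<bar>"])
      qed (simp add: support)
    qed
    show "AE y in lborel. ((\<lambda>e. (f y - f x0) * t y * \<kappa> e y) \<longlongrightarrow> 0) (at_right 0)"
    proof (intro AE_I2)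
      fix y
      show "((\<lambda>e. (f y - f x0) * t y * \<kappa> e y) \<longlongrightarrow> 0) (at_right 0)"
      proof (cases "y = x0")
        case False
        then have "((\<lambda>e. \<kappa> e y) \<longlongrightarrow> 0 / ((y - x0)\<^sup>2 + 0\<^sup>2)) (at_right 0)"
          unfolding \<kappa>_def by (intro tendsto_intros) auto
        then have "((\<lambda>e. (f y - f x0) * t y * \<kappa> e y) \<longlongrightarrow> (f y - f x0) * t y * 0) (at_right 0)"
          by (intro tendsto_mult_left) simp
        then show ?thesis by simp
      qed simp
    qed
  qed auto
  have l2: "((\<lambda>e. \<kappa> e x) \<longlongrightarrow> 0) (at_right 0)" if "x \<noteq> x0" for x
  proof -
    have "((\<lambda>e. \<kappa> e x) \<longlongrightarrow> 0 / ((x - x0)\<^sup>2 + 0\<^sup>2)) (at_right 0)"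
      unfolding \<kappa>_def using that by (intro tendsto_intros) auto
    then show ?thesis by simp
  qed
  define d where "d = 1 - \<bar>x0\<bar>"
  have d: "0 < d" using x0 by (auto simp: d_def)
  define Cw where "Cw = \<bar>(M / s + (LINT y|lborel. \<bar>t y\<bar>)) / pi\<bar>"
  have Wb: "\<bar>?W x\<bar> \<le> Cw * (1 + \<bar>x\<bar>)" for x
    unfolding Cw_def by (rule order_trans[OF abs_log_potential_le mult_right_mono[OF abs_ge_self]]) simp
  define C3 where "C3 = (LINT x|lborel. (8 * Cw / d ^ 3) * (1 / (1 + x\<^sup>2)))"
  have l3: "((\<lambda>e. LINT x|lborel. (1 - indicator {-1..1} x) * (?W x * k e x)) \<longlongrightarrow> 0) (at_right 0)"
  proof (rule Lim_null_comparison)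
    show "((\<lambda>e. e * C3) \<longlongrightarrow> 0) (at_right 0)"
      by (rule tendsto_eq_intros refl | simp)+
    have "norm (LINT x|lborel. (1 - indicator {-1..1} x) * (?W x * k e x)) \<le> e * C3" if e: "0 < e" for e
    proof -
      have bd: "\<bar>(1 - indicator {-1..1} x) * (?W x * k e x)\<bar> \<le> e * ((8 * Cw / d ^ 3) * (1 / (1 + x\<^sup>2)))" for x
      proof (cases "x \<in> {-1..1}")
        case True
        have "0 \<le> e * ((8 * Cw / d ^ 3) * (1 / (1 + x\<^sup>2)))" using e d by (simp add: Cw_def)
        then show ?thesis using True by simp
      next
        case False
        then have x1: "1 \<le> \<bar>x\<bar>" by auto
        have "\<bar>x0\<bar> * 1 \<le> \<bar>x0\<bar> * \<bar>x\<bar>" using x1 by (intro mult_left_mono) auto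
        then have "d * \<bar>x\<bar> \<le> \<bar>x\<bar> - \<bar>x0\<bar>" by (simp add: d_def algebra_simps)
        then have r: "d * \<bar>x\<bar> \<le> \<bar>x - x0\<bar>" by linarith
        have dx: "0 < d * \<bar>x\<bar>" using d x1 by simp
        have r0: "0 < \<bar>x - x0\<bar>" using r dx by linarith
        have "\<bar>k e x\<bar> = 2 * e * \<bar>x - x0\<bar> / ((x - x0)\<^sup>2 + e\<^sup>2)\<^sup>2" using e by (simp add: k_def abs_mult)
        also have "\<dots> \<le> 2 * e * \<bar>x - x0\<bar> / ((x - x0)\<^sup>2)\<^sup>2"
        proof -
          have "((x - x0)\<^sup>2)\<^sup>2 \<le> ((x - x0)\<^sup>2 + e\<^sup>2)\<^sup>2" by (rule power_mono) auto
          moreover have "0 < ((x - x0)\<^sup>2)\<^sup>2" using r0 by simp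
          ultimately show ?thesis using e r0 by (intro divide_left_mono) (auto intro!: mult_pos_pos)
        qed
        also have "\<dots> = 2 * e / \<bar>x - x0\<bar> ^ 3"
        proof -
          have "(r\<^sup>2)\<^sup>2 = r * r ^ 3" for r :: real by (simp add: power2_eq_square power3_eq_cube)
          from this[of "\<bar>x - x0\<bar>"] have "((x - x0)\<^sup>2)\<^sup>2 = \<bar>x - x0\<bar> * \<bar>x - x0\<bar> ^ 3"
            by (simp only: power2_abs)
          then show ?thesis using r0 by simp
        qed
        also have "\<dots> \<le> 2 * e / (d * \<bar>x\<bar>) ^ 3"
        proof -
          have "(d * \<bar>x\<bar>) ^ 3 \<le> \<bar>x - x0\<bar> ^ 3" using r dx by (intro power_mono) auto
          moreover have "0 < (d * \<bar>x\<bar>) ^ 3" "0 < \<bar>x - x0\<bar> ^ 3" using dx r0 by (auto simp only: zero_less_power)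
          ultimately show ?thesis using e by (intro divide_left_mono mult_pos_pos) auto
        qed
        finally have kb: "\<bar>k e x\<bar> \<le> 2 * e / (d * \<bar>x\<bar>) ^ 3" .
        have "\<bar>(1 - indicator {-1..1} x) * (?W x * k e x)\<bar> = \<bar>?W x\<bar> * \<bar>k e x\<bar>" using False by (simp add: abs_mult)
        also have "\<dots> \<le> (Cw * (2 * \<bar>x\<bar>)) * (2 * e / (d * \<bar>x\<bar>) ^ 3)"
        proof (rule mult_mono[OF _ kb])
          have "Cw * (1 + \<bar>x\<bar>) \<le> Cw * (2 * \<bar>x\<bar>)" using x1 by (intro mult_left_mono) (auto simp: Cw_def)
          then show "\<bar>?W x\<bar> \<le> Cw * (2 * \<bar>x\<bar>)" using Wb[of x] by linarith
        qed (auto simp: Cw_def)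
        also have "\<dots> = e * ((4 * Cw / d ^ 3) * (1 / x\<^sup>2))"
        proof -
          have "(Cw * (2 * X)) * (2 * e / (d * X) ^ 3) = e * ((4 * Cw / d ^ 3) * (1 / X\<^sup>2))" if "0 < X" for X
            using that d by (simp add: power3_eq_cube power2_eq_square divide_simps)
          from this[of "\<bar>x\<bar>"] show ?thesis using x1 by (simp only: power2_abs)
        qed
        also have "\<dots> \<le> e * ((4 * Cw / d ^ 3) * (2 / (1 + x\<^sup>2)))"
        proof -
          have "1 \<le> x\<^sup>2" using x1 by (metis abs_1 abs_le_square_iff one_power2)
          then have "1 / x\<^sup>2 \<le> 2 / (1 + x\<^sup>2)" by (simp add: divide_simps)
          then show ?thesis using e d by (intro mult_left_mono) (auto simp: Cw_def)
        qed
        finally show ?thesis by simp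
      qed
      have i1: "integrable lborel (\<lambda>x. e * ((8 * Cw / d ^ 3) * (1 / (1 + x\<^sup>2))))"
        by (intro integrable_mult_right integrable_inverse_1_plus_square)
      have i2: "integrable lborel (\<lambda>x. (1 - indicator {-1..1} x) * (?W x * k e x))"
        by (rule Bochner_Integration.integrable_bound[OF i1])
           (use bd order_trans[OF bd abs_ge_self] in \<open>auto simp del: abs_mult\<close>)
      have "norm (LINT x|lborel. (1 - indicator {-1..1} x) * (?W x * k e x))
          \<le> (LINT x|lborel. e * ((8 * Cw / d ^ 3) * (1 / (1 + x\<^sup>2))))"
        using integral_abs_bound_integral[OF i2 i1 bd] by simp
      also have "\<dots> = e * C3" unfolding C3_def by (rule integral_mult_right_zero)
      finally show ?thesis .
    qed
    then show "\<forall>\<^sub>F e in at_right 0. norm (LINT x|lborel. (1 - indicator {-1..1} x) * (?W x * k e x)) \<le> e * C3"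
      using eventually_at_right_less[of 0] by (auto elim!: eventually_mono)
  qed
  have "((\<lambda>e. ((LINT y|lborel. (f y - f x0) * t y * \<kappa> e y) - \<kappa> e 1 * m + c * (\<kappa> e (-1) - \<kappa> e 1)
        + (LINT x|lborel. (1 - indicator {-1..1} x) * (?W x * k e x))) / pi) \<longlongrightarrow>
      ((LINT y::real|lborel. 0) - 0 * m + c * (0 - 0) + 0) / pi) (at_right 0)"
    using x0 by (intro tendsto_intros l1 l2 l3) auto
  then have l: "((\<lambda>e. ((LINT y|lborel. (f y - f x0) * t y * \<kappa> e y) - \<kappa> e 1 * m + c * (\<kappa> e (-1) - \<kappa> e 1)
        + (LINT x|lborel. (1 - indicator {-1..1} x) * (?W x * k e x))) / pi) \<longlongrightarrow> 0) (at_right 0)" by simp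
  show ?thesis
    by (rule Lim_transform_eventually[OF l]) (use eventually_at_right_less[of 0] in \<open>eventually_elim, simp only: rep\<close>)
qed

end

section \<open>Cauchy's formula for the upper half plane\<close>

lemma cauchy_kernel_bound:
  assumes "0 < Im z"
  shows "norm (1 / (complex_of_real x - z)) \<le> ((1 + norm z) / Im z + 1) / (1 + \<bar>x\<bar>)"
proof -
  let ?d = "norm (complex_of_real x - z)"
  have d: "Im z \<le> ?d" using abs_Im_le_cmod[of "complex_of_real x - z"] assms by simp
  then have d0: "0 < ?d" using assms by linarith
  have "\<bar>x\<bar> \<le> ?d + norm z"
    using norm_triangle_ineq[of "complex_of_real x - z" z] by simp
  then have "1 + \<bar>x\<bar> \<le> (1 + norm z) * 1 + ?d" by simp
  also have "\<dots> \<le> (1 + norm z) * (?d / Im z) + ?d"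
    using d assms by (intro add_right_mono mult_left_mono) auto
  also have "\<dots> = ((1 + norm z) / Im z + 1) * ?d" by (simp add: algebra_simps)
  finally have "(1 + \<bar>x\<bar>) / ?d \<le> (1 + norm z) / Im z + 1" by (simp only: pos_divide_le_eq[OF d0])
  moreover have "0 < 1 + \<bar>x\<bar>" by (rule add_pos_nonneg) auto
  ultimately have "1 / ?d \<le> ((1 + norm z) / Im z + 1) / (1 + \<bar>x\<bar>)" by (simp only: pos_le_divide_eq) simp
  then show ?thesis by (simp add: norm_divide)
qed

text \<open>
  The other three sides have length of order \<open>N\<close>, and the integrand is of order \<open>1 / N^2\<close> on them. The pole
  \<open>\<zeta> + i e\<close> is raised together with the bottom side, so that the kernel on that side does not depend on \<open>e\<close>.
\<close>
lemma rectangle_bottom_estimate: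
  assumes hol: "F holomorphic_on {z. 0 < Im z}"
    and decay: "\<And>z. 0 < Im z \<Longrightarrow> R \<le> norm z \<Longrightarrow> norm (F z) \<le> C / norm z"
    and e: "0 < e" "e < 1" and N: "R \<le> N" "norm \<zeta> + 1 < N" "0 < N" and C: "0 \<le> C"
    and \<zeta>: "Im \<zeta> \<noteq> 0"
    and V: "((\<lambda>w. F w / (w - (\<zeta> + \<i> * e))) has_contour_integral V) (rectpath (Complex (-N) e) (Complex N (N + e)))"
  shows "norm (integral {-N..N} (\<lambda>x. F (Complex x e) / (of_real x - \<zeta>)) - V) \<le> 6 * C / (N - norm \<zeta> - 1)"
proof -
  define f where "f = (\<lambda>w. F w / (w - (\<zeta> + \<i> * e)))"
  define a1 a2 a3 a4 where "a1 = Complex (-N) e" and "a2 = Complex N e" and "a3 = Complex N (N + e)" and "a4 = Complex (-N) (N + e)"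
  have ne: "norm (\<zeta> + \<i> * e) \<le> norm \<zeta> + 1"
    using norm_triangle_ineq[of \<zeta> "\<i> * e"] e by (simp add: norm_mult)
  have contF: "continuous_on {z. 0 < Im z} F" by (rule holomorphic_on_imp_continuous_on[OF hol])
  have seg2: "w \<in> closed_segment a2 a3 \<Longrightarrow> Re w = N \<and> e \<le> Im w"
    and seg3: "w \<in> closed_segment a3 a4 \<Longrightarrow> Im w = N + e"
    and seg4: "w \<in> closed_segment a4 a1 \<Longrightarrow> Re w = -N \<and> e \<le> Im w"
    and seg1: "w \<in> closed_segment a1 a2 \<Longrightarrow> Im w = e" for w
    using N by (auto simp: a1_def a2_def a3_def a4_def closed_segment_same_Re closed_segment_same_Im closed_segment_eq_real_ivl)
  have big: "N \<le> norm w \<and> 0 < Im w" if "w \<in> closed_segment a2 a3 \<union> closed_segment a3 a4 \<union> closed_segment a4 a1" for w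
    using seg2[of w] seg3[of w] seg4[of w] that e N abs_Re_le_cmod[of w] abs_Im_le_cmod[of w] by auto
  have fb: "norm (f w) \<le> (C / N) / (N - norm \<zeta> - 1)" if "N \<le> norm w \<and> 0 < Im w" for w
  proof -
    have "norm (F w) \<le> C / norm w" using that N by (intro decay) auto
    also have "\<dots> \<le> C / N" using that N C by (intro divide_left_mono mult_pos_pos) auto
    finally have "norm (F w) \<le> C / N" .
    moreover have "N - norm \<zeta> - 1 \<le> norm (w - (\<zeta> + \<i> * e))"
      using norm_triangle_ineq2[of w "\<zeta> + \<i> * e"] that ne by linarith
    ultimately show ?thesis unfolding f_def norm_divide using N C by (intro frac_le) auto
  qed
  have cont: "continuous_on (closed_segment a b) f"
    if "\<And>w. w \<in> closed_segment a b \<Longrightarrow> 0 < Im w \<and> w \<noteq> \<zeta> + \<i> * e" for a b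
    unfolding f_def using that
    by (intro continuous_intros continuous_on_subset[OF contF]) auto
  have far: "w \<noteq> \<zeta> + \<i> * e" if "N \<le> norm w" for w using that ne N by auto
  have ci: "f contour_integrable_on linepath a1 a2" "f contour_integrable_on linepath a2 a3"
     "f contour_integrable_on linepath a3 a4" "f contour_integrable_on linepath a4 a1"
  proof -
    have "\<zeta> + \<i> * e \<notin> closed_segment a1 a2" using seg1[of "\<zeta> + \<i> * e"] \<zeta> by auto
    then show "f contour_integrable_on linepath a1 a2"
      using seg1 e by (intro contour_integrable_continuous_linepath cont) auto
  qed (use big far in \<open>auto intro!: contour_integrable_continuous_linepath cont\<close>)
  have "contour_integral (rectpath a1 a3) f = contour_integral (linepath a1 a2) f + (contour_integral (linepath a2 a3) f
      + (contour_integral (linepath a3 a4) f + contour_integral (linepath a4 a1) f))"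
    unfolding rectpath_def Let_def using ci
    by (simp add: a1_def a2_def a3_def a4_def contour_integrable_joinI)
  moreover have "contour_integral (rectpath a1 a3) f = V"
    using V unfolding f_def a1_def a3_def by (rule contour_integral_unique)
  moreover have "contour_integral (linepath a1 a2) f = integral {-N..N} (\<lambda>x. F (Complex x e) / (of_real x - \<zeta>))"
  proof -
    have "Complex x e - (\<zeta> + \<i> * e) = of_real x - \<zeta>" for x by (simp add: complex_eq_iff)
    then have fe: "f (Complex x e) = F (Complex x e) / (of_real x - \<zeta>)" for x by (simp add: f_def)
    have lp: "linepath a1 a2 x = linepath (of_real (-N)) (of_real N) x + \<i> * e" for x
      by (simp add: linepath_def a1_def a2_def complex_eq_iff algebra_simps)
    have d: "a2 - a1 = of_real N - of_real (-N)" by (simp add: a1_def a2_def complex_eq_iff)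
    have "(f has_contour_integral contour_integral (linepath a1 a2) f) (linepath a1 a2)"
      by (rule has_contour_integral_integral[OF ci(1)])
    then have "((\<lambda>w. f (w + \<i> * e)) has_contour_integral contour_integral (linepath a1 a2) f) (linepath (of_real (-N)) (of_real N))"
      unfolding has_contour_integral_linepath lp d .
    then have "((\<lambda>x. f (of_real x + \<i> * e)) has_integral contour_integral (linepath a1 a2) f) {-N..N}"
      using N by (subst (asm) has_contour_integral_linepath_Reals_iff) auto
    moreover have "of_real x + \<i> * e = Complex x e" for x by (simp add: complex_eq_iff)
    ultimately show ?thesis using fe by (simp add: integral_unique)
  qed
  ultimately have split: "integral {-N..N} (\<lambda>x. F (Complex x e) / (of_real x - \<zeta>)) - V
     = - (contour_integral (linepath a2 a3) f + (contour_integral (linepath a3 a4) f + contour_integral (linepath a4 a1) f))"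
    by (simp add: algebra_simps)
  define E where "E = (C / N) / (N - norm \<zeta> - 1)"
  have E: "0 \<le> E" using N C by (simp add: E_def)
  have "norm (contour_integral (linepath a2 a3) f) \<le> E * norm (a3 - a2)"
    using big fb unfolding E_def[symmetric] by (intro contour_integral_bound_linepath[OF ci(2) E]) blast
  also have "norm (a3 - a2) = N" using N by (simp add: a2_def a3_def cmod_def)
  finally have E2: "norm (contour_integral (linepath a2 a3) f) \<le> E * N" .
  have "norm (contour_integral (linepath a3 a4) f) \<le> E * norm (a4 - a3)"
    using big fb unfolding E_def[symmetric] by (intro contour_integral_bound_linepath[OF ci(3) E]) blast
  also have "norm (a4 - a3) = 2 * N"
  proof -
    have "a4 - a3 = of_real (- (2 * N))" by (simp add: a3_def a4_def complex_eq_iff)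
    then show ?thesis using N by (simp only: norm_of_real)
  qed
  finally have E3: "norm (contour_integral (linepath a3 a4) f) \<le> E * (2 * N)" .
  have "norm (contour_integral (linepath a4 a1) f) \<le> E * norm (a1 - a4)"
    using big fb unfolding E_def[symmetric] by (intro contour_integral_bound_linepath[OF ci(4) E]) blast
  also have "norm (a1 - a4) = N" using N by (simp add: a4_def a1_def cmod_def)
  finally have E4: "norm (contour_integral (linepath a4 a1) f) \<le> E * N" .
  have "norm (integral {-N..N} (\<lambda>x. F (Complex x e) / (of_real x - \<zeta>)) - V) \<le> E * N + (E * (2 * N) + E * N)"
    unfolding split norm_minus_cancel
    by (intro order_trans[OF norm_triangle_ineq] add_mono E2 E3 E4)
  also have "\<dots> = 4 * (E * N)" by simp
  also have "E * N = C / (N - norm \<zeta> - 1)" using N by (simp add: E_def)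
  also have "4 * (C / (N - norm \<zeta> - 1)) \<le> 6 * C / (N - norm \<zeta> - 1)"
    using N C by (simp add: divide_right_mono)
  finally show ?thesis .
qed

text \<open>
  A holomorphic function on the upper half plane that decays at infinity is the Cauchy transform of
  the boundary values of its imaginary part alone: Cauchy's formula at \<open>z\<close> and Cauchy's theorem for the
  reflected point \<open>cnj z\<close> are combined by a complex conjugation.
\<close>
theorem half_plane_Cauchy_formula:
  fixes F :: "complex \<Rightarrow> complex" and g v :: "real \<Rightarrow> real"
  assumes hol: "F holomorphic_on {z. 0 < Im z}"
    and decay: "\<And>z. 0 < Im z \<Longrightarrow> R \<le> norm z \<Longrightarrow> norm (F z) \<le> C / norm z" and C: "0 \<le> C"
    and dom: "\<And>e. 0 < e \<Longrightarrow> e < 1 \<Longrightarrow> AE x in lborel. norm (F (Complex x e)) \<le> g x"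
    and g: "integrable lborel (\<lambda>x. g x / (1 + \<bar>x\<bar>))"
    and lim: "AE x in lborel. ((\<lambda>e. Im (F (Complex x e))) \<longlongrightarrow> v x) (at_right 0)"
    and v [measurable]: "v \<in> borel_measurable borel"
    and z: "0 < Im z"
  shows "F z = (LINT x|lborel. of_real (v x) / (of_real x - z)) / of_real pi"
proof -
  define B where "B = (1 + norm z) / Im z + 1"
  have B: "0 \<le> B" using z by (simp add: B_def)
  have contF: "continuous_on {z. 0 < Im z} F" by (rule holomorphic_on_imp_continuous_on[OF hol])
  have cF: "continuous_on UNIV (\<lambda>x. F (Complex x e))" if "0 < e" for e
  proof -
    have "continuous_on UNIV (\<lambda>x. Complex x e)" unfolding Complex_eq by (intro continuous_intros)
    then show ?thesis using that by (intro continuous_on_compose2[OF contF]) auto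
  qed
  have mF: "(\<lambda>x. Im (F (Complex x e))) \<in> borel_measurable borel" if "0 < e" for e
    by (intro borel_measurable_continuous_onI continuous_intros cF that)
  define h where "h = (\<lambda>e x. if 0 < e then of_real (Im (F (Complex x e))) / (of_real x - z) else 0)"
  have hm[measurable]: "h e \<in> borel_measurable borel" for e
  proof (cases "0 < e")
    case True
    note [measurable] = mF[OF True]
    show ?thesis unfolding h_def using True by simp
  qed (simp add: h_def)
  define w where "w = (\<lambda>x. B * (g x / (1 + \<bar>x\<bar>)))"
  have w: "integrable lborel w" unfolding w_def by (rule integrable_mult_right[OF g])
  have hb: "AE x in lborel. norm (h e x) \<le> w x" if e: "0 < e" "e < 1" for e
    using dom[OF e]
  proof eventually_elim
    case (elim x)
    have "norm (h e x) = \<bar>Im (F (Complex x e))\<bar> * norm (1 / (of_real x - z))"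
      using e by (simp add: h_def norm_divide)
    also have "\<dots> \<le> norm (F (Complex x e)) * (B / (1 + \<bar>x\<bar>))"
      unfolding B_def by (intro mult_mono abs_Im_le_cmod cauchy_kernel_bound z) auto
    also have "\<dots> \<le> g x * (B / (1 + \<bar>x\<bar>))" using elim B by (intro mult_right_mono) auto
    finally show ?case by (simp add: w_def mult_ac)
  qed
  have main: "(LINT x|lborel. h e x) = of_real pi * F (z + \<i> * e)" if e: "0 < e" "e < 1" for e
  proof -
    have hi: "integrable lborel (h e)"
      by (rule Bochner_Integration.integrable_bound[OF w]) (use hb[OF e] in \<open>auto elim!: eventually_mono\<close>)
    define J where "J = (\<lambda>\<zeta> n. integral {-real n..real n} (\<lambda>x. F (Complex x e) / (of_real x - \<zeta>)))"
    have zc: "Im z \<noteq> 0" "Im (cnj z) \<noteq> 0" using z by auto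
    have small: "(\<lambda>n. 6 * C / (real n - norm z - 1)) \<longlonglongrightarrow> 0" by real_asymp
    have ev: "eventually (\<lambda>n. R \<le> real n \<and> norm z + 1 < real n \<and> 0 < real n) sequentially"
    proof -
      have "eventually (\<lambda>n. max R (norm z + 1) < real n) sequentially"
        by (rule filterlim_at_top_dense[THEN iffD1, OF filterlim_real_sequentially, rule_format])
      then show ?thesis
      proof eventually_elim
        case (elim n)
        then show ?case using norm_ge_zero[of z] by (intro conjI) linarith+
      qed
    qed
    \<comment> \<open>Cauchy's formula: the pole lies inside the rectangle.\<close>
    have J1: "(\<lambda>n. J z n - 2 * of_real pi * \<i> * F (z + \<i> * e)) \<longlonglongrightarrow> 0"
    proof (rule Lim_null_comparison[OF _ small])
      show "eventually (\<lambda>n. norm (J z n - 2 * of_real pi * \<i> * F (z + \<i> * e)) \<le> 6 * C / (real n - norm z - 1)) sequentially"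
        using ev
      proof eventually_elim
        case (elim n)
        let ?r = "rectpath (Complex (-real n) e) (Complex (real n) (real n + e))"
        have inb: "z + \<i> * e \<in> box (Complex (-real n) e) (Complex (real n) (real n + e))"
          using elim z abs_Re_le_cmod[of z] abs_Im_le_cmod[of z] by (auto simp: in_box_complex_iff)
        have "path_image ?r \<subseteq> cbox (Complex (-real n) e) (Complex (real n) (real n + e))"
          using elim by (intro path_image_rectpath_subset_cbox) auto
        then have sub: "path_image ?r \<subseteq> {w. 0 < Im w}" using e by (auto simp: in_cbox_complex_iff)
        have "path_image ?r \<inter> box (Complex (-real n) e) (Complex (real n) (real n + e)) = {}"
          using elim by (intro path_image_rectpath_inter_box) auto
        then have sub2: "path_image ?r \<subseteq> {w. 0 < Im w} - {z + \<i> * e}" using sub inb by blast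
        have "((\<lambda>w. F w / (w - (z + \<i> * e))) has_contour_integral (2 * pi * \<i> * winding_number ?r (z + \<i> * e) * F (z + \<i> * e))) ?r"
          using hol sub2 z e
          by (intro Cauchy_integral_formula_convex_simple[of "{w. 0 < Im w}"])
             (auto simp: convex_halfspace_Im_gt open_halfspace_Im_gt interior_open)
        then have "((\<lambda>w. F w / (w - (z + \<i> * e))) has_contour_integral (2 * of_real pi * \<i> * F (z + \<i> * e))) ?r"
          using winding_number_rectpath[OF inb] by simp
        from rectangle_bottom_estimate[OF hol decay e _ _ _ C zc(1) this] show ?case
          using elim by (simp add: J_def)
      qed
    qed
    \<comment> \<open>Cauchy's theorem: the reflected pole lies below the rectangle.\<close>
    have J2: "(\<lambda>n. J (cnj z) n) \<longlonglongrightarrow> 0"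
    proof (rule Lim_null_comparison[OF _ small])
      show "eventually (\<lambda>n. norm (J (cnj z) n) \<le> 6 * C / (real n - norm z - 1)) sequentially"
        using ev
      proof eventually_elim
        case (elim n)
        let ?r = "rectpath (Complex (-real n) e) (Complex (real n) (real n + e))"
        let ?S = "{w. max 0 (e - Im z) < Im w}"
        have "path_image ?r \<subseteq> cbox (Complex (-real n) e) (Complex (real n) (real n + e))"
          using elim by (intro path_image_rectpath_subset_cbox) auto
        then have sub: "path_image ?r \<subseteq> ?S" using e z by (auto simp: in_cbox_complex_iff)
        have "((\<lambda>w. F w / (w - (cnj z + \<i> * e))) has_contour_integral 0) ?r"
        proof (rule Cauchy_theorem_convex_simple[OF _ _ _ sub])
          show "(\<lambda>w. F w / (w - (cnj z + \<i> * e))) holomorphic_on ?S"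
            using z by (intro holomorphic_intros holomorphic_on_subset[OF hol]) auto
          show "convex ?S" by (rule convex_halfspace_Im_gt)
        qed auto
        from rectangle_bottom_estimate[OF hol decay e _ _ _ C zc(2) this] show ?case
          using elim by (simp add: J_def)
      qed
    qed
    have diff: "J z n - cnj (J (cnj z) n) = 2 * \<i> * (LINT x|lborel. indicator {-real n..real n} x *\<^sub>R h e x)" for n
    proof -
      have nz: "of_real x - z \<noteq> 0" "of_real x - cnj z \<noteq> 0" for x using z by (auto simp: complex_eq_iff)
      have i: "(\<lambda>x. F (Complex x e) / (of_real x - z)) integrable_on {-real n..real n}"
        "(\<lambda>x. F (Complex x e) / (of_real x - cnj z)) integrable_on {-real n..real n}"
        using nz by (auto intro!: integrable_continuous_real continuous_intros continuous_on_subset[OF cF[OF e(1)]])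
      have "cnj (J (cnj z) n) = integral {-real n..real n} (\<lambda>x. cnj (F (Complex x e)) / (of_real x - z))"
        using integral_linear[OF i(2) bounded_linear_cnj] by (simp add: J_def o_def)
      moreover have "(\<lambda>x. cnj (F (Complex x e)) / (of_real x - z)) integrable_on {-real n..real n}"
        using integrable_linear[OF i(2) bounded_linear_cnj] by (simp add: o_def)
      ultimately have "J z n - cnj (J (cnj z) n) = integral {-real n..real n} (\<lambda>x. F (Complex x e) / (of_real x - z) - cnj (F (Complex x e)) / (of_real x - z))"
        using i(1) by (simp add: J_def Henstock_Kurzweil_Integration.integral_diff)
      also have "\<dots> = integral {-real n..real n} (\<lambda>x. 2 * \<i> * h e x)"
      proof (rule integral_cong)
        fix x
        have "F (Complex x e) - cnj (F (Complex x e)) = 2 * \<i> * of_real (Im (F (Complex x e)))"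
          by (simp add: complex_eq_iff)
        then show "F (Complex x e) / (of_real x - z) - cnj (F (Complex x e)) / (of_real x - z) = 2 * \<i> * h e x"
          using e by (simp add: h_def diff_divide_distrib[symmetric])
      qed
      also have "\<dots> = 2 * \<i> * integral {-real n..real n} (h e)" by simp
      also have "integral {-real n..real n} (h e) = (LINT x|lborel. indicator {-real n..real n} x *\<^sub>R h e x)"
      proof -
        have "set_integrable lborel {-real n..real n} (h e)"
          unfolding set_integrable_def by (rule integrable_mult_indicator[OF _ hi]) simp
        from set_borel_integral_eq_integral(2)[OF this] show ?thesis
          by (simp add: set_lebesgue_integral_def)
      qed
      finally show ?thesis .
    qed
    have "(\<lambda>n. LINT x|lborel. indicator {-real n..real n} x *\<^sub>R h e x) \<longlonglongrightarrow> (LINT x|lborel. h e x)"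
    proof (rule integral_dominated_convergence[where w = "\<lambda>x. norm (h e x)"])
      show "AE x in lborel. (\<lambda>n. indicator {-real n..real n} x *\<^sub>R h e x) \<longlonglongrightarrow> h e x"
      proof (intro AE_I2)
        fix x
        have "eventually (\<lambda>n. \<bar>x\<bar> < real n) sequentially"
          by (rule filterlim_at_top_dense[THEN iffD1, OF filterlim_real_sequentially, rule_format])
        then have "eventually (\<lambda>n. indicator {-real n..real n} x *\<^sub>R h e x = h e x) sequentially"
          by eventually_elim (simp add: indicator_def abs_less_iff)
        then show "(\<lambda>n. indicator {-real n..real n} x *\<^sub>R h e x) \<longlonglongrightarrow> h e x" by (rule tendsto_eventually)
      qed
    qed (use hi in \<open>auto simp: indicator_def\<close>)
    then have l1: "(\<lambda>n. J z n - cnj (J (cnj z) n)) \<longlonglongrightarrow> 2 * \<i> * (LINT x|lborel. h e x)"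
      unfolding diff by (intro tendsto_intros)
    have "(\<lambda>n. (J z n - 2 * of_real pi * \<i> * F (z + \<i> * e)) + 2 * of_real pi * \<i> * F (z + \<i> * e) - cnj (J (cnj z) n))
       \<longlonglongrightarrow> 0 + 2 * of_real pi * \<i> * F (z + \<i> * e) - cnj 0"
      by (intro tendsto_intros J1 J2)
    then have "(\<lambda>n. J z n - cnj (J (cnj z) n)) \<longlonglongrightarrow> 2 * of_real pi * \<i> * F (z + \<i> * e)" by simp
    from LIMSEQ_unique[OF l1 this] have "2 * \<i> * (LINT x|lborel. h e x) = 2 * \<i> * (of_real pi * F (z + \<i> * e))"
      by (simp add: mult_ac)
    then show ?thesis by simp
  qed
  have "((\<lambda>e. LINT x|lborel. h e x) \<longlongrightarrow> (LINT x|lborel. of_real (v x) / (of_real x - z))) (at_right 0)"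
  proof (rule integral_tendsto_at_right_0(1)[OF _ _ w _ hb])
    show "AE x in lborel. ((\<lambda>e. h e x) \<longlongrightarrow> of_real (v x) / (of_real x - z)) (at_right 0)"
      using lim
    proof eventually_elim
      case (elim x)
      have nz: "of_real x - z \<noteq> 0" using z by (auto simp: complex_eq_iff)
      have "((\<lambda>e. of_real (Im (F (Complex x e))) / (of_real x - z)) \<longlongrightarrow> of_real (v x) / (of_real x - z)) (at_right 0)"
        by (intro tendsto_intros elim nz)
      then show ?case
        by (rule Lim_transform_eventually) (use eventually_at_right_less[of 0] in \<open>eventually_elim, simp add: h_def\<close>)
    qed
  qed auto
  then have l: "((\<lambda>e. of_real pi * F (z + \<i> * of_real e)) \<longlongrightarrow> (LINT x|lborel. of_real (v x) / (of_real x - z))) (at_right 0)"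
  proof (rule Lim_transform_eventually)
    have "eventually (\<lambda>e::real. e < 1) (at_right 0)" by (rule eventually_at_right_field[THEN iffD2]) (auto intro: exI[of _ 1])
    then show "\<forall>\<^sub>F e in at_right 0. (LINT x|lborel. h e x) = of_real pi * F (z + \<i> * of_real e)"
      using eventually_at_right_less[of 0] by eventually_elim (rule main)
  qed
  have "isCont F z" using contF z open_halfspace_Im_gt[of 0] by (simp add: continuous_on_eq_continuous_at)
  then have "((\<lambda>e. F (z + \<i> * of_real e)) \<longlongrightarrow> F z) (at_right 0)"
  proof (rule isCont_tendsto_compose)
    have "((\<lambda>e. z + \<i> * of_real e) \<longlongrightarrow> z + \<i> * of_real 0) (at_right 0)" by (intro tendsto_intros)
    then show "((\<lambda>e. z + \<i> * of_real e) \<longlongrightarrow> z) (at_right 0)" by simp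
  qed
  then have "((\<lambda>e. of_real pi * F (z + \<i> * of_real e)) \<longlongrightarrow> of_real pi * F z) (at_right 0)"
    by (intro tendsto_intros)
  from tendsto_unique[OF _ l this] show ?thesis by simp
qed

section \<open>Integrals of Cauchy type\<close>

lemma cauchy_type_integral_has_derivative:
  fixes h :: "real \<Rightarrow> real"
  assumes h: "integrable lborel h" and z: "0 < Im z"
  shows "((\<lambda>z. LINT y|lborel. of_real (h y) / (z - of_real y)) has_field_derivative
     - (LINT y|lborel. of_real (h y) / (z - of_real y)\<^sup>2)) (at z)"
proof -
  have [measurable]: "h \<in> borel_measurable borel" using h by auto
  define d where "d = Im z / 2"
  have d: "0 < d" using z by (simp add: d_def)
  have lower: "Im w \<le> norm (w - of_real y)" for w y using abs_Im_le_cmod[of "w - of_real y"] by simp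
  have int: "integrable lborel (\<lambda>y. of_real (h y) * k y)"
    if [measurable]: "k \<in> borel_measurable borel" and "\<And>y. norm (k y) \<le> B" for k :: "real \<Rightarrow> complex" and B
  proof (rule Bochner_Integration.integrable_bound)
    show "integrable lborel (\<lambda>y. B * \<bar>h y\<bar>)" using h by simp
    have "norm (of_real (h y) * k y) \<le> B * \<bar>h y\<bar>" for y
      using that(2)[of y] by (simp add: norm_mult mult.commute[of B] mult_left_mono)
    then show "AE y in lborel. norm (of_real (h y) * k y) \<le> norm (B * \<bar>h y\<bar>)"
      by (intro AE_I2) (simp add: order_trans[OF _ abs_ge_self])
  qed measurable
  have i1: "integrable lborel (\<lambda>y. of_real (h y) / (w - of_real y))" if w: "0 < Im w" for w
  proof -
    have "norm (1 / (w - of_real y)) \<le> 1 / Im w" for y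
      using lower[of w y] w by (simp add: norm_divide frac_le)
    from int[OF _ this] show ?thesis by simp
  qed
  have i2: "integrable lborel (\<lambda>y. of_real (h y) / (z - of_real y)\<^sup>2)"
  proof -
    have "norm (1 / (z - of_real y)\<^sup>2) \<le> 1 / (Im z)\<^sup>2" for y
      using lower[of z y] z by (simp add: norm_divide norm_power frac_le power_mono)
    from int[OF _ this] show ?thesis by simp
  qed
  define I where "I = (LINT y|lborel. \<bar>h y\<bar>)"
  show ?thesis
    unfolding has_field_derivative_iff
  proof (rule LIM_zero_cancel, rule Lim_null_comparison)
    show "((\<lambda>w. norm (w - z) * (I / d ^ 3)) \<longlongrightarrow> 0) (at z)"
      by (rule tendsto_eq_intros refl | simp)+
    have "eventually (\<lambda>w. w \<in> ball z d - {z}) (at z)"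
      using d by (intro eventually_at_in_open) auto
    then show "eventually (\<lambda>w. norm (((LINT y|lborel. of_real (h y) / (w - of_real y)) - (LINT y|lborel. of_real (h y) / (z - of_real y))) / (w - z)
       - - (LINT y|lborel. of_real (h y) / (z - of_real y)\<^sup>2)) \<le> norm (w - z) * (I / d ^ 3)) (at z)"
    proof eventually_elim
      case (elim w)
      then have wz: "w \<noteq> z" and "dist z w < d" by auto
      then have "\<bar>Im z - Im w\<bar> < d" using abs_Im_le_cmod[of "z - w"] by (simp add: dist_norm)
      then have w: "d < Im w" unfolding d_def by linarith
      have nz: "w - of_real y \<noteq> 0" "z - of_real y \<noteq> 0" for y using w d z by (auto simp: complex_eq_iff)
      let ?q = "\<lambda>y. of_real (h y) * ((w - z) / ((w - of_real y) * (z - of_real y)\<^sup>2))"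
      have eq: "(of_real (h y) / (w - of_real y) - of_real (h y) / (z - of_real y)) / (w - z) + of_real (h y) / (z - of_real y)\<^sup>2 = ?q y" for y
      proof -
        have alg: "(H / a - H / b) / (a - b) + H / b\<^sup>2 = H * ((a - b) / (a * b\<^sup>2))"
          if "a \<noteq> 0" "b \<noteq> 0" "a - b \<noteq> 0" for H a b :: complex
        proof -
          have "H / a - H / b = - (H * (a - b)) / (a * b)" using that by (simp add: field_simps)
          then have "(H / a - H / b) / (a - b) = - H / (a * b)" using that by simp
          then show ?thesis using that by (simp add: power2_eq_square field_simps)
        qed
        have "(w - of_real y) - (z - of_real y) = w - z" by simp
        with alg[OF nz, of y y] wz show ?thesis by simp
      qed
      have "((LINT y|lborel. of_real (h y) / (w - of_real y)) - (LINT y|lborel. of_real (h y) / (z - of_real y))) / (w - z)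
         + (LINT y|lborel. of_real (h y) / (z - of_real y)\<^sup>2)
         = (LINT y|lborel. (of_real (h y) / (w - of_real y) - of_real (h y) / (z - of_real y)) / (w - z) + of_real (h y) / (z - of_real y)\<^sup>2)"
        using i1[of w] i1[of z] i2 w d z by simp
      also have "\<dots> = (LINT y|lborel. ?q y)" by (simp only: eq)
      also have "norm \<dots> \<le> (LINT y|lborel. \<bar>h y\<bar> * (norm (w - z) / d ^ 3))"
      proof (rule Bochner_Integration.integral_norm_bound_integral)
        have b: "norm ((w - z) / ((w - of_real y) * (z - of_real y)\<^sup>2)) \<le> norm (w - z) / d ^ 3" for y
        proof -
          have "d \<le> norm (w - of_real y)" using lower[of w y] w by linarith
          moreover have "d \<le> norm (z - of_real y)" using lower[of z y] z unfolding d_def by linarith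
          ultimately have "d * d\<^sup>2 \<le> norm (w - of_real y) * (norm (z - of_real y))\<^sup>2"
            using d by (intro mult_mono power_mono) auto
          then show ?thesis using d
            by (simp add: norm_divide norm_mult norm_power power3_eq_cube power2_eq_square mult.assoc frac_le)
        qed
        show "integrable lborel ?q" by (rule int[OF _ b]) simp
        show "integrable lborel (\<lambda>y. \<bar>h y\<bar> * (norm (w - z) / d ^ 3))" using h by simp
        show "norm (?q y) \<le> \<bar>h y\<bar> * (norm (w - z) / d ^ 3)" for y
          unfolding norm_mult[of "of_real (h y)"] norm_of_real by (intro mult_left_mono b) auto
      qed
      also have "\<dots> = norm (w - z) * (I / d ^ 3)" by (simp add: I_def)
      finally show ?case by simp
    qed
  qed
qed

lemma holomorphic_cauchy_type_integral:
  fixes h :: "real \<Rightarrow> real"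
  assumes h: "integrable lborel h"
  shows "(\<lambda>z. LINT y|lborel. of_real (h y) / (z - of_real y)) holomorphic_on {z. 0 < Im z}"
  using cauchy_type_integral_has_derivative[OF h]
  by (auto simp: holomorphic_on_def field_differentiable_def intro: has_field_derivative_at_within)

lemma conjugate_kernel_bound:
  fixes r e :: real
  assumes "0 < e"
  shows "\<bar>r / (r\<^sup>2 + e\<^sup>2)\<bar> * \<bar>r\<bar> \<le> 1" and "\<bar>r / (r\<^sup>2 + e\<^sup>2)\<bar> \<le> 1 / e"
    and "r \<noteq> 0 \<Longrightarrow> \<bar>r / (r\<^sup>2 + e\<^sup>2)\<bar> \<le> 1 / \<bar>r\<bar>"
proof -
  have pos: "0 < r\<^sup>2 + e\<^sup>2" using assms by (simp add: add_nonneg_pos)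
  have a: "\<bar>r / (r\<^sup>2 + e\<^sup>2)\<bar> = \<bar>r\<bar> / (r\<^sup>2 + e\<^sup>2)" using pos by (simp add: abs_divide)
  have "\<bar>r\<bar> * \<bar>r\<bar> \<le> r\<^sup>2 + e\<^sup>2" by (simp add: power2_eq_square abs_mult_self_eq)
  then show 1: "\<bar>r / (r\<^sup>2 + e\<^sup>2)\<bar> * \<bar>r\<bar> \<le> 1" unfolding a using pos by (simp add: divide_simps)
  have "2 * \<bar>r\<bar> * e \<le> r\<^sup>2 + e\<^sup>2" using zero_le_power2[of "\<bar>r\<bar> - e"]
    by (simp add: power2_eq_square algebra_simps abs_mult_self_eq)
  moreover have "0 \<le> \<bar>r\<bar> * e" using assms by simp
  ultimately have "\<bar>r\<bar> * e \<le> r\<^sup>2 + e\<^sup>2" by linarith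
  then show "\<bar>r / (r\<^sup>2 + e\<^sup>2)\<bar> \<le> 1 / e" unfolding a using pos assms by (simp add: divide_simps mult.commute)
  show "\<bar>r / (r\<^sup>2 + e\<^sup>2)\<bar> \<le> 1 / \<bar>r\<bar>" if "r \<noteq> 0"
    using 1 that by (subst pos_le_divide_eq) auto
qed

text \<open>
  A constant density gives an exact difference of logarithms; the deviation from the constant cancels the
  singularity of the kernel.
\<close>
lemma conjugate_integral_piece:
  fixes \<theta> :: "real \<Rightarrow> real"
  assumes [measurable]: "\<theta> \<in> borel_measurable borel" and e: "0 < e" and ab: "a \<le> b"
    and bd: "\<And>y. \<bar>\<theta> y\<bar> \<le> B"
    and A: "\<And>y. y \<in> {a<..<b} \<Longrightarrow> \<bar>\<theta> y - A\<bar> \<le> K * \<bar>x - y\<bar>" and K: "0 \<le> K"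
  shows "\<bar>(LINT y|lborel. indicator {a<..<b} y * (\<theta> y * ((x - y) / ((x - y)\<^sup>2 + e\<^sup>2))))
     - A * (ln ((x - a)\<^sup>2 + e\<^sup>2) / 2 - ln ((x - b)\<^sup>2 + e\<^sup>2) / 2)\<bar> \<le> K * (b - a)"
proof -
  define \<kappa> where "\<kappa> = (\<lambda>y. (x - y) / ((x - y)\<^sup>2 + e\<^sup>2))"
  have \<kappa>b: "\<bar>\<kappa> y\<bar> \<le> 1 / e" and \<kappa>1: "\<bar>\<kappa> y\<bar> * \<bar>x - y\<bar> \<le> 1" for y
    using conjugate_kernel_bound[OF e, of "x - y"] by (auto simp: \<kappa>_def)
  have [measurable]: "\<kappa> \<in> borel_measurable borel" unfolding \<kappa>_def by measurable
  have int: "integrable lborel (\<lambda>y. indicator {a<..<b} y * q y)"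
    if [measurable]: "q \<in> borel_measurable borel" and "\<And>y. \<bar>q y\<bar> \<le> D" for q :: "real \<Rightarrow> real" and D
  proof (rule Bochner_Integration.integrable_bound)
    show "integrable lborel (\<lambda>y::real. D * indicator {a..b} y)"
      by (intro integrable_mult_right integrable_indicator_Icc)
    have "0 \<le> D" using that(2)[of 0] by simp
    then show "AE y in lborel. norm (indicator {a<..<b} y * q y) \<le> norm (D * indicator {a..b} y)"
      using that(2) by (intro AE_I2) (auto simp: indicator_def)
  qed measurable
  have "B * (1 / e) \<ge> 0" using bd[of 0] e by simp
  have i1: "integrable lborel (\<lambda>y. indicator {a<..<b} y * (\<theta> y * \<kappa> y))"
  proof (rule int[of _ "B * (1 / e)"])
    show "\<bar>\<theta> y * \<kappa> y\<bar> \<le> B * (1 / e)" for y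
      unfolding abs_mult using order_trans[OF abs_ge_zero bd] by (intro mult_mono[OF bd \<kappa>b]) auto
  qed simp
  have i2: "integrable lborel (\<lambda>y. indicator {a<..<b} y * \<kappa> y)"
    by (rule int[OF _ \<kappa>b]) simp
  have main: "(LINT y|lborel. indicator {a<..<b} y * \<kappa> y) = ln ((x - a)\<^sup>2 + e\<^sup>2) / 2 - ln ((x - b)\<^sup>2 + e\<^sup>2) / 2"
  proof -
    have "(LINT y|lborel. indicator {a<..<b} y * \<kappa> y) = (LINT y|lborel. \<kappa> y * indicator {a..b} y)"
      using AE_lborel_singleton[of a] AE_lborel_singleton[of b]
      by (intro integral_cong_AE) (auto elim!: eventually_elim2 simp: indicator_def)
    also have "\<dots> = - (ln ((b - x)\<^sup>2 + e\<^sup>2) / 2) - - (ln ((a - x)\<^sup>2 + e\<^sup>2) / 2)"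
    proof (rule integral_FTC_Icc_real[OF ab])
      fix y
      have "- ((y - x) / ((y - x)\<^sup>2 + e\<^sup>2)) = \<kappa> y"
        by (simp add: \<kappa>_def power2_commute[of x] minus_divide_left del: minus_divide_left[symmetric])
      then show "((\<lambda>y. - (ln ((y - x)\<^sup>2 + e\<^sup>2) / 2)) has_field_derivative \<kappa> y) (at y)"
        using DERIV_minus[OF DERIV_half_ln[OF e, of x y]] by simp
      have "(x - y)\<^sup>2 + e\<^sup>2 \<noteq> 0" using e by (metis add_nonneg_pos less_irrefl zero_le_power2 zero_less_power)
      then show "isCont \<kappa> y" unfolding \<kappa>_def by (intro continuous_intros)
    qed
    finally show ?thesis by (simp add: power2_commute)
  qed
  have "(LINT y|lborel. indicator {a<..<b} y * (\<theta> y * \<kappa> y)) - A * (LINT y|lborel. indicator {a<..<b} y * \<kappa> y)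
      = (LINT y|lborel. indicator {a<..<b} y * (\<theta> y * \<kappa> y) - A * (indicator {a<..<b} y * \<kappa> y))"
    using i1 i2 by simp
  also have "\<bar>\<dots>\<bar> \<le> (LINT y|lborel. K * indicator {a..b} y)"
  proof (rule integral_abs_bound_integral)
    show "integrable lborel (\<lambda>y. indicator {a<..<b} y * (\<theta> y * \<kappa> y) - A * (indicator {a<..<b} y * \<kappa> y))"
      using i1 i2 by simp
    show "integrable lborel (\<lambda>y::real. K * indicator {a..b} y)"
      by (intro integrable_mult_right integrable_indicator_Icc)
    fix y
    show "\<bar>indicator {a<..<b} y * (\<theta> y * \<kappa> y) - A * (indicator {a<..<b} y * \<kappa> y)\<bar> \<le> K * indicator {a..b} y"
    proof (cases "y \<in> {a<..<b}")
      case True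
      have "\<bar>\<theta> y - A\<bar> * \<bar>\<kappa> y\<bar> \<le> (K * \<bar>x - y\<bar>) * \<bar>\<kappa> y\<bar>" by (intro mult_right_mono A True) auto
      also have "\<dots> = K * (\<bar>\<kappa> y\<bar> * \<bar>x - y\<bar>)" by simp
      also have "\<dots> \<le> K * 1" by (intro mult_left_mono \<kappa>1 K)
      finally have "\<bar>(\<theta> y - A) * \<kappa> y\<bar> \<le> K" by (simp add: abs_mult)
      then show ?thesis using True by (simp add: left_diff_distrib)
    qed (use K in \<open>auto simp: indicator_def\<close>)
  qed
  also have "\<dots> = K * (b - a)" using ab by simp
  finally show ?thesis unfolding main by (simp add: \<kappa>_def)
qed

section \<open>The explicit transform and its local growth\<close>

text \<open>
  The two consequences of piecewise Lipschitz continuity, for \<open>f\<close> extended by zero: at almost every point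
  of the interval a Lipschitz estimate against all other points, which yields pointwise boundary values,
  and at every point, jumps included, Lipschitz estimates on either side, which yield growth bounds.
\<close>
locale slope =
  fixes f :: "real \<Rightarrow> real" and Mf P :: real
  assumes f_borel [measurable]: "f \<in> borel_measurable borel"
    and f_bound: "\<bar>f x\<bar> \<le> Mf"
    and P: "0 < P"
    and one_sided: "\<exists>r>0. \<exists>K\<ge>0. (\<forall>x\<in>{c-r<..<c}. \<forall>y\<in>{c-r<..<c}. \<bar>f x - f y\<bar> \<le> K * \<bar>x - y\<bar>)
        \<and> (\<forall>x\<in>{c<..<c+r}. \<forall>y\<in>{c<..<c+r}. \<bar>f x - f y\<bar> \<le> K * \<bar>x - y\<bar>)"
    and regular: "AE x in lborel. x \<in> {-1<..<1} \<longrightarrow> (\<exists>K\<ge>0. \<forall>y\<in>{-1<..<1}. \<bar>f y - f x\<bar> \<le> K * \<bar>x - y\<bar>)"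
begin

text \<open>The argument of \<open>i - f\<close>, in units of \<open>pi\<close>.\<close>
definition angle :: "real \<Rightarrow> real" where
  "angle y = indicator {-1<..<1} y * (1 / 2 + arctan (f y) / pi)"

text \<open>If the angle is \<open>\<theta>\<close> on an interval \<open>(a, b)\<close> and zero elsewhere, this is \<open>\<theta>\<close> times a logarithm of \<open>(z - a) / (z - b)\<close>.\<close>
definition log_ratio :: "complex \<Rightarrow> complex" where
  "log_ratio z = (LINT y|lborel. of_real (angle y) / (z - of_real y))"

text \<open>
  On the interval the boundary values of this function from above have argument \<open>pi/2 + arctan f\<close>:
  the exponential contributes \<open>pi\<close> times the angle, and the factor \<open>- 1 / (z - 1)\<close> is positive. Hence
  they are positive multiples of \<open>i - f\<close>. The simple pole at \<open>1\<close> gives the decay of order \<open>1 / z\<close>.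
\<close>
definition solution_transform :: "complex \<Rightarrow> complex" where
  "solution_transform z = - of_real (P / pi) * exp (- log_ratio z) / (z - 1)"

text \<open>
  The distance that the angle keeps from \<open>0\<close> and \<open>1\<close> on the interval. All singularities of the solution
  are thereby of an order at most \<open>1 - margin < 1\<close>.
\<close>
definition margin :: real where
  "margin = 1 / 2 - arctan Mf / pi"

lemma margin: "0 < margin" "margin \<le> 1 / 2"
proof -
  have "0 \<le> Mf" using f_bound[of 0] by simp
  moreover have "arctan Mf < pi / 2" using arctan_bounded[of Mf] by simp
  ultimately show "0 < margin" "margin \<le> 1 / 2"
    using pi_gt_zero by (auto simp: margin_def field_simps)
qed

lemma angle_measurable [measurable]: "angle \<in> borel_measurable borel"
  unfolding angle_def by measurable

lemma angle_outside: "x \<notin> {-1<..<1} \<Longrightarrow> angle x = 0"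
  by (simp add: angle_def)

lemma angle_inside: "x \<in> {-1<..<1} \<Longrightarrow> angle x = 1 / 2 + arctan (f x) / pi"
  by (simp add: angle_def)

lemma angle_inside_bounds:
  assumes "x \<in> {-1<..<1}"
  shows "margin \<le> angle x" "angle x \<le> 1 - margin"
proof -
  have "f x \<le> Mf" "- Mf \<le> f x" using f_bound[of x] by auto
  then have "arctan (f x) \<le> arctan Mf" "arctan (- Mf) \<le> arctan (f x)"
    by (simp_all only: arctan_le_iff)
  then have "arctan (f x) / pi \<le> arctan Mf / pi" "- (arctan Mf / pi) \<le> arctan (f x) / pi"
    by (simp_all add: arctan_minus divide_right_mono minus_divide_left del: minus_divide_left[symmetric])
  then show "margin \<le> angle x" "angle x \<le> 1 - margin"
    unfolding angle_inside[OF assms] margin_def by linarith+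
qed

lemma angle_bounds: "0 \<le> angle x" "angle x \<le> 1 - margin" "\<bar>angle x\<bar> \<le> 1"
proof -
  show 1: "0 \<le> angle x" "angle x \<le> 1 - margin"
    using angle_inside_bounds[of x] angle_outside[of x] margin by (cases "x \<in> {-1<..<1}"; force)+
  then show "\<bar>angle x\<bar> \<le> 1" using margin by simp
qed

lemma angle_le_indicator: "\<bar>angle y\<bar> \<le> indicator {-1..1} y"
  using angle_bounds(3)[of y] angle_outside[of y] by (cases "y \<in> {-1<..<1}") (auto simp: indicator_def)

lemma angle_integrable: "integrable lborel angle"
  by (rule Bochner_Integration.integrable_bound[OF integrable_indicator_Icc[of "-1" 1]])
     (use angle_le_indicator in auto)

lemma integral_angle_le: "(LINT y|lborel. \<bar>angle y\<bar>) \<le> 2"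
proof -
  have "(LINT y|lborel. \<bar>angle y\<bar>) \<le> (LINT y|lborel. indicator {-1..1::real} y)"
    by (rule integral_mono[OF integrable_abs[OF angle_integrable] integrable_indicator_Icc angle_le_indicator])
  then show ?thesis by simp
qed

lemma angle_Lipschitz:
  assumes "\<bar>f y - f x\<bar> \<le> K * \<bar>x - y\<bar>" "x \<in> {-1<..<1}" "y \<in> {-1<..<1}" "0 \<le> K"
  shows "\<bar>angle y - angle x\<bar> \<le> K * \<bar>x - y\<bar>"
proof -
  have "((\<lambda>x. arctan x) has_field_derivative 1 / (1 + x\<^sup>2)) (at x within UNIV)" for x
    using DERIV_arctan[of x] by (simp add: inverse_eq_divide)
  moreover have "norm (1 / (1 + x\<^sup>2)) \<le> 1" for x :: real
  proof -
    have "0 < 1 + x\<^sup>2" by (simp add: add_pos_nonneg)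
    then show ?thesis by (simp add: pos_divide_le_eq)
  qed
  ultimately have "norm (arctan (f y) - arctan (f x)) \<le> 1 * norm (f y - f x)"
    by (intro field_differentiable_bound[of UNIV arctan]) auto
  then have a: "\<bar>arctan (f y) - arctan (f x)\<bar> \<le> K * \<bar>x - y\<bar>" using assms(1) by simp
  have "angle y - angle x = (arctan (f y) - arctan (f x)) / pi"
    using assms by (simp add: angle_inside diff_divide_distrib)
  then have "\<bar>angle y - angle x\<bar> = \<bar>arctan (f y) - arctan (f x)\<bar> / pi" by (simp add: abs_divide)
  also have "\<dots> \<le> \<bar>arctan (f y) - arctan (f x)\<bar> / 1" using pi_gt3 by (intro divide_left_mono) auto
  finally show ?thesis using a by simp
qed

lemma angle_one_sided:
  obtains r K where "0 < r" "r \<le> 1" "0 \<le> K" "c \<noteq> 1 \<Longrightarrow> r \<le> \<bar>c - 1\<bar>"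
    "\<And>x y. x \<in> {c-r<..<c} \<Longrightarrow> y \<in> {c-r<..<c} \<Longrightarrow> \<bar>angle x - angle y\<bar> \<le> K * \<bar>x - y\<bar>"
    "\<And>x y. x \<in> {c<..<c+r} \<Longrightarrow> y \<in> {c<..<c+r} \<Longrightarrow> \<bar>angle x - angle y\<bar> \<le> K * \<bar>x - y\<bar>"
proof -
  obtain r0 K where r0: "0 < r0" "0 \<le> K"
    and l: "\<And>x y. x \<in> {c-r0<..<c} \<Longrightarrow> y \<in> {c-r0<..<c} \<Longrightarrow> \<bar>f x - f y\<bar> \<le> K * \<bar>x - y\<bar>"
    and r: "\<And>x y. x \<in> {c<..<c+r0} \<Longrightarrow> y \<in> {c<..<c+r0} \<Longrightarrow> \<bar>f x - f y\<bar> \<le> K * \<bar>x - y\<bar>"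
    using one_sided[of c] by blast
  define r where "r = min (min r0 1) (min (if c = 1 then 1 else \<bar>c - 1\<bar>) (if c = -1 then 1 else \<bar>c + 1\<bar>))"
  have rr: "0 < r" "r \<le> r0" "r \<le> 1" "c \<noteq> 1 \<Longrightarrow> r \<le> \<bar>c - 1\<bar>" "c \<noteq> -1 \<Longrightarrow> r \<le> \<bar>c + 1\<bar>"
    using r0 by (auto simp: r_def)
  have sideL: "(\<forall>x\<in>{c-r<..<c}. x \<in> {-1<..<1}) \<or> (\<forall>x\<in>{c-r<..<c}. x \<notin> {-1<..<1})"
    and sideR: "(\<forall>x\<in>{c<..<c+r}. x \<in> {-1<..<1}) \<or> (\<forall>x\<in>{c<..<c+r}. x \<notin> {-1<..<1})"
    using rr by (cases "c = 1"; cases "c = -1"; cases "c < -1"; cases "c < 1"; force)+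
  show ?thesis
  proof (rule that[OF rr(1,3) r0(2) rr(4)])
    fix x y assume xy: "x \<in> {c-r<..<c}" "y \<in> {c-r<..<c}"
    then have "\<bar>f x - f y\<bar> \<le> K * \<bar>y - x\<bar>" using l[of x y] rr(2) by (auto simp: abs_minus_commute)
    then have "\<bar>angle x - angle y\<bar> \<le> K * \<bar>y - x\<bar>"
      using sideL xy r0(2) angle_Lipschitz[of x y K] angle_outside[of x] angle_outside[of y] by auto
    then show "\<bar>angle x - angle y\<bar> \<le> K * \<bar>x - y\<bar>" by (simp add: abs_minus_commute)
  next
    fix x y assume xy: "x \<in> {c<..<c+r}" "y \<in> {c<..<c+r}"
    then have "\<bar>f x - f y\<bar> \<le> K * \<bar>y - x\<bar>" using r[of x y] rr(2) by (auto simp: abs_minus_commute)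
    then have "\<bar>angle x - angle y\<bar> \<le> K * \<bar>y - x\<bar>"
      using sideR xy r0(2) angle_Lipschitz[of x y K] angle_outside[of x] angle_outside[of y] by auto
    then show "\<bar>angle x - angle y\<bar> \<le> K * \<bar>x - y\<bar>" by (simp add: abs_minus_commute)
  qed
qed

lemma log_ratio_integrable:
  assumes "Im z \<noteq> 0"
  shows "integrable lborel (\<lambda>y. of_real (angle y) / (z - of_real y))"
proof (rule Bochner_Integration.integrable_bound)
  show "integrable lborel (\<lambda>y. (1 / \<bar>Im z\<bar>) * \<bar>angle y\<bar>)" using angle_integrable by simp
  have "norm (of_real (angle y) / (z - of_real y)) \<le> (1 / \<bar>Im z\<bar>) * \<bar>angle y\<bar>" for y
  proof -
    have "\<bar>Im z\<bar> \<le> cmod (z - of_real y)" using abs_Im_le_cmod[of "z - of_real y"] by simp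
    then show ?thesis using assms by (simp add: norm_divide frac_le)
  qed
  then show "AE y in lborel. norm (of_real (angle y) / (z - of_real y)) \<le> norm ((1 / \<bar>Im z\<bar>) * \<bar>angle y\<bar>)"
    by (intro AE_I2) (simp add: order_trans[OF _ abs_ge_self])
qed measurable

lemma Re_log_ratio:
  assumes "0 < e"
  shows "Re (log_ratio (Complex x e)) = (LINT y|lborel. angle y * ((x - y) / ((x - y)\<^sup>2 + e\<^sup>2)))"
  using integral_Re[OF log_ratio_integrable[of "Complex x e"]] assms
  by (simp add: log_ratio_def Re_divide power2_eq_square)

lemma Re_log_ratio_integrable:
  assumes "0 < e"
  shows "integrable lborel (\<lambda>y. angle y * ((x - y) / ((x - y)\<^sup>2 + e\<^sup>2)))"
  using integrable_Re[OF log_ratio_integrable[of "Complex x e"]] assms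
  by (simp add: Re_divide power2_eq_square)

lemma norm_solution_transform:
  "norm (solution_transform z) = P / pi * exp (- Re (log_ratio z)) / norm (z - 1)"
  using P by (simp add: solution_transform_def norm_mult norm_divide norm_exp_eq_Re)

lemma holomorphic_solution_transform: "solution_transform holomorphic_on {z. 0 < Im z}"
proof -
  have "log_ratio holomorphic_on {z. 0 < Im z}"
    using holomorphic_cauchy_type_integral[OF angle_integrable] unfolding log_ratio_def[abs_def] .
  then show ?thesis
    unfolding solution_transform_def[abs_def] by (intro holomorphic_intros) auto
qed

text \<open>
  Near \<open>c\<close> the real part of the exponent is, up to a bounded error, at most a multiple of \<open>ln |z - c|\<close> whose
  factor is the jump of the angle across \<open>c\<close>. The left and right values of the angle at \<open>c\<close> are
  replaced by the values at the points at distance \<open>|x - c|\<close>, which avoids one-sided limits.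
\<close>
lemma Re_log_ratio_local:
  obtains r C where "0 < r" "2 * r \<le> 1" "c \<noteq> 1 \<Longrightarrow> 2 * r \<le> \<bar>c - 1\<bar>"
    "\<And>x e. x \<noteq> c \<Longrightarrow> \<bar>x - c\<bar> < r \<Longrightarrow> 0 < e \<Longrightarrow> e < 1 \<Longrightarrow>
      - Re (log_ratio (Complex x e)) \<le>
      (angle (c - \<bar>x - c\<bar>) - angle (c + \<bar>x - c\<bar>)) * (ln ((x - c)\<^sup>2 + e\<^sup>2) / 2) + C"
proof -
  obtain \<rho> K where \<rho>: "0 < \<rho>" "\<rho> \<le> 1" "0 \<le> K" "c \<noteq> 1 \<Longrightarrow> \<rho> \<le> \<bar>c - 1\<bar>"
    and L: "\<And>x y. x \<in> {c-\<rho><..<c} \<Longrightarrow> y \<in> {c-\<rho><..<c} \<Longrightarrow> \<bar>angle x - angle y\<bar> \<le> K * \<bar>x - y\<bar>"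
    and R: "\<And>x y. x \<in> {c<..<c+\<rho>} \<Longrightarrow> y \<in> {c<..<c+\<rho>} \<Longrightarrow> \<bar>angle x - angle y\<bar> \<le> K * \<bar>x - y\<bar>"
    by (rule angle_one_sided) blast
  define r where "r = \<rho> / 2"
  define B where "B = \<bar>ln r\<bar> + ln 5"
  have r: "0 < r" using \<rho> by (simp add: r_def)
  show ?thesis
  proof (rule that[of r "2 * K * \<rho> + 2 * B + 2 / r"])
    show "0 < r" "2 * r \<le> 1" "c \<noteq> 1 \<Longrightarrow> 2 * r \<le> \<bar>c - 1\<bar>" using \<rho> by (auto simp: r_def)
    fix x e assume x: "x \<noteq> c" "\<bar>x - c\<bar> < r" and e: "0 < e" "e < (1::real)"
    define \<kappa> where "\<kappa> = (\<lambda>y. (x - y) / ((x - y)\<^sup>2 + e\<^sup>2))"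
    define ll where "ll = (\<lambda>q. ln ((x - q)\<^sup>2 + e\<^sup>2) / 2)"
    define xl where "xl = c - \<bar>x - c\<bar>"
    define xr where "xr = c + \<bar>x - c\<bar>"
    have xl: "xl \<in> {c-\<rho><..<c}" and xr: "xr \<in> {c<..<c+\<rho>}" using x r by (auto simp: xl_def xr_def r_def)
    have [measurable]: "\<kappa> \<in> borel_measurable borel" unfolding \<kappa>_def by measurable
    \<comment> \<open>For \<open>y < c\<close> the point \<open>xl\<close> is at least as close to \<open>y\<close> as \<open>x\<close> is, and similarly on the right.\<close>
    have closeL: "\<bar>angle y - angle xl\<bar> \<le> K * \<bar>x - y\<bar>" if y: "y \<in> {c-\<rho><..<c}" for y
    proof -
      have "\<bar>y - xl\<bar> \<le> \<bar>x - y\<bar>" using y unfolding xl_def by (simp add: abs_if split: if_splits)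
      then have "K * \<bar>y - xl\<bar> \<le> K * \<bar>x - y\<bar>" using \<rho>(3) by (intro mult_left_mono)
      then show ?thesis using L[OF y xl] by linarith
    qed
    have closeR: "\<bar>angle y - angle xr\<bar> \<le> K * \<bar>x - y\<bar>" if y: "y \<in> {c<..<c+\<rho>}" for y
    proof -
      have "\<bar>y - xr\<bar> \<le> \<bar>x - y\<bar>" using y unfolding xr_def by (simp add: abs_if split: if_splits)
      then have "K * \<bar>y - xr\<bar> \<le> K * \<bar>x - y\<bar>" using \<rho>(3) by (intro mult_left_mono)
      then show ?thesis using R[OF y xr] by linarith
    qed
    have pL: "\<bar>(LINT y|lborel. indicator {c-\<rho><..<c} y * (angle y * \<kappa> y)) - angle xl * (ll (c - \<rho>) - ll c)\<bar> \<le> K * \<rho>"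
      using conjugate_integral_piece[where a = "c - \<rho>" and b = c, OF angle_measurable e(1) _ angle_bounds(3) closeL \<rho>(3)] \<rho>(1)
      by (simp add: \<kappa>_def ll_def)
    have pR: "\<bar>(LINT y|lborel. indicator {c<..<c+\<rho>} y * (angle y * \<kappa> y)) - angle xr * (ll c - ll (c + \<rho>))\<bar> \<le> K * \<rho>"
      using conjugate_integral_piece[where a = c and b = "c + \<rho>", OF angle_measurable e(1) _ angle_bounds(3) closeR \<rho>(3)] \<rho>(1)
      by (simp add: \<kappa>_def ll_def)
    let ?i = "\<lambda>y. angle y * \<kappa> y"
    have int: "integrable lborel ?i" using Re_log_ratio_integrable[OF e(1), of x] by (simp add: \<kappa>_def)
    have iL: "integrable lborel (\<lambda>y. indicator {c-\<rho><..<c} y * ?i y)"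
      using integrable_real_mult_indicator[OF _ int, of "{c-\<rho><..<c}"] by (simp add: mult.commute)
    have iR: "integrable lborel (\<lambda>y. indicator {c<..<c+\<rho>} y * ?i y)"
      using integrable_real_mult_indicator[OF _ int, of "{c<..<c+\<rho>}"] by (simp add: mult.commute)
    define far where "far = - {c-\<rho><..<c+\<rho>}"
    have iO: "integrable lborel (\<lambda>y. indicator far y * ?i y)"
      using integrable_real_mult_indicator[OF _ int, of far] by (simp add: mult.commute far_def)
    have "(LINT y|lborel. ?i y) = (LINT y|lborel. indicator {c-\<rho><..<c} y * ?i y + (indicator {c<..<c+\<rho>} y * ?i y + indicator far y * ?i y))"
    proof (rule integral_cong_AE)
      show "AE y in lborel. ?i y = indicator {c-\<rho><..<c} y * ?i y + (indicator {c<..<c+\<rho>} y * ?i y + indicator far y * ?i y)"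
        using AE_lborel_singleton[of c] by eventually_elim (auto simp: indicator_def far_def)
    qed (auto simp: far_def)
    also have "\<dots> = (LINT y|lborel. indicator {c-\<rho><..<c} y * ?i y) + ((LINT y|lborel. indicator {c<..<c+\<rho>} y * ?i y) + (LINT y|lborel. indicator far y * ?i y))"
      using iL iR iO by simp
    finally have split: "Re (log_ratio (Complex x e)) = (LINT y|lborel. indicator {c-\<rho><..<c} y * ?i y)
       + ((LINT y|lborel. indicator {c<..<c+\<rho>} y * ?i y) + (LINT y|lborel. indicator far y * ?i y))"
      unfolding Re_log_ratio[OF e(1)] by (simp add: \<kappa>_def)
    have pO: "\<bar>LINT y|lborel. indicator far y * ?i y\<bar> \<le> 2 / r"
    proof -
      have "\<bar>LINT y|lborel. indicator far y * ?i y\<bar> \<le> (LINT y|lborel. (1 / r) * \<bar>angle y\<bar>)"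
      proof (rule integral_abs_bound_integral[OF iO])
        show "integrable lborel (\<lambda>y. (1 / r) * \<bar>angle y\<bar>)" using angle_integrable by simp
        show "\<bar>indicator far y * ?i y\<bar> \<le> (1 / r) * \<bar>angle y\<bar>" for y
        proof (cases "y \<in> far")
          case True
          then have ry: "r \<le> \<bar>x - y\<bar>" using x unfolding far_def r_def by (auto simp: abs_if not_less split: if_splits)
          have "\<bar>\<kappa> y\<bar> \<le> 1 / \<bar>x - y\<bar>" unfolding \<kappa>_def using conjugate_kernel_bound(3)[OF e(1), of "x - y"] ry r by auto
          also have "\<dots> \<le> 1 / r" using ry r by (intro divide_left_mono mult_pos_pos) auto
          finally have "\<bar>angle y\<bar> * \<bar>\<kappa> y\<bar> \<le> \<bar>angle y\<bar> * (1 / r)" by (intro mult_left_mono) auto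
          then show ?thesis using True by (simp add: abs_mult)
        qed (use r in auto)
      qed
      also have "\<dots> = (1 / r) * (LINT y|lborel. \<bar>angle y\<bar>)" by simp
      also have "\<dots> \<le> (1 / r) * 2" using r integral_angle_le by (intro mult_left_mono) auto
      finally show ?thesis by simp
    qed
    have endpoint: "\<bar>ll q\<bar> \<le> B" if q: "r \<le> \<bar>x - q\<bar>" "\<bar>x - q\<bar> \<le> 2" for q
    proof -
      have "r\<^sup>2 \<le> (x - q)\<^sup>2" using q r by (metis abs_le_square_iff abs_of_pos)
      moreover have "0 < r\<^sup>2" using r by simp
      moreover have "(x - q)\<^sup>2 \<le> 4" using q abs_le_square_iff[of "x - q" 2] by simp
      moreover have "0 \<le> e\<^sup>2" by simp
      moreover have "e\<^sup>2 < 1" using e by (simp add: power_less_one_iff)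
      ultimately have b: "r\<^sup>2 \<le> (x - q)\<^sup>2 + e\<^sup>2" "(x - q)\<^sup>2 + e\<^sup>2 \<le> 5" "0 < (x - q)\<^sup>2 + e\<^sup>2" "0 < r\<^sup>2" by linarith+
      have "2 * ln r \<le> ln ((x - q)\<^sup>2 + e\<^sup>2)"
        using b r by (metis ln_le_cancel_iff ln_realpow of_nat_numeral)
      moreover have "ln ((x - q)\<^sup>2 + e\<^sup>2) \<le> ln 5"
        by (rule ln_le_cancel_iff[OF b(3), THEN iffD2]) (simp, rule b(2))
      moreover have "0 \<le> ln (5::real)" by simp
      ultimately show ?thesis unfolding ll_def B_def by linarith
    qed
    have xr2: "\<bar>x - c\<bar> < \<rho> / 2" using x by (simp add: r_def)
    have bl: "\<bar>ll (c - \<rho>)\<bar> \<le> B"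
      by (rule endpoint) (use xr2 \<rho>(1,2) in \<open>unfold r_def, linarith+\<close>)
    have br: "\<bar>ll (c + \<rho>)\<bar> \<le> B"
      by (rule endpoint) (use xr2 \<rho>(1,2) in \<open>unfold r_def, linarith+\<close>)
    have B0: "0 \<le> B" using bl by linarith
    have "\<bar>angle xl * ll (c - \<rho>)\<bar> \<le> 1 * B" unfolding abs_mult by (intro mult_mono angle_bounds bl) auto
    moreover have "\<bar>angle xr * ll (c + \<rho>)\<bar> \<le> 1 * B" unfolding abs_mult by (intro mult_mono angle_bounds br) auto
    ultimately have "- Re (log_ratio (Complex x e)) \<le> (angle xl - angle xr) * ll c + (2 * K * \<rho> + 2 * B + 2 / r)"
      using pL pR pO unfolding split by (simp add: algebra_simps abs_le_iff)
    then show "- Re (log_ratio (Complex x e)) \<le>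
      (angle (c - \<bar>x - c\<bar>) - angle (c + \<bar>x - c\<bar>)) * (ln ((x - c)\<^sup>2 + e\<^sup>2) / 2) + (2 * K * \<rho> + 2 * B + 2 / r)"
      by (simp add: xl_def xr_def ll_def)
  qed
qed

text \<open>
  The modulus is a power of \<open>|z - c|\<close> whose exponent is the jump of the angle across \<open>c\<close>, from right to left.
  Away from \<open>1\<close> the exponent is at least \<open>- (1 - margin)\<close> because the angle lies between \<open>0\<close> and \<open>1 - margin\<close>. At
  \<open>c = 1\<close> the pole contributes \<open>- 1\<close>, and the angle on the left, at least \<open>margin\<close>, makes up for it.
\<close>
lemma solution_transform_local_bound:
  obtains r C where "0 < r" "2 * r \<le> 1" "0 \<le> C"
    "\<And>x e. x \<noteq> c \<Longrightarrow> \<bar>x - c\<bar> < r \<Longrightarrow> 0 < e \<Longrightarrow> e < 1 \<Longrightarrow>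
      norm (solution_transform (Complex x e)) \<le> C * \<bar>x - c\<bar> powr - (1 - margin)"
proof -
  obtain r C0 where r: "0 < r" "2 * r \<le> 1" "c \<noteq> 1 \<Longrightarrow> 2 * r \<le> \<bar>c - 1\<bar>"
    and b: "\<And>x e. x \<noteq> c \<Longrightarrow> \<bar>x - c\<bar> < r \<Longrightarrow> 0 < e \<Longrightarrow> e < 1 \<Longrightarrow>
      - Re (log_ratio (Complex x e)) \<le>
      (angle (c - \<bar>x - c\<bar>) - angle (c + \<bar>x - c\<bar>)) * (ln ((x - c)\<^sup>2 + e\<^sup>2) / 2) + C0"
    by (rule Re_log_ratio_local) blast
  define \<beta> where "\<beta> = 1 - margin"
  have \<beta>: "0 < \<beta>" "\<beta> < 1" using margin by (auto simp: \<beta>_def)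
  define D where "D = (if c = 1 then 1 else 1 / r)"
  have D: "0 < D" using r by (simp add: D_def)
  show ?thesis
  proof (rule that[of r "P / pi * D * exp (C0 + 1)"])
    show "0 < r" "2 * r \<le> 1" "0 \<le> P / pi * D * exp (C0 + 1)" using r P D by auto
    fix x e assume x: "x \<noteq> c" "\<bar>x - c\<bar> < r" and e: "0 < e" "e < (1::real)"
    define l where "l = ln ((x - c)\<^sup>2 + e\<^sup>2) / 2"
    define E where "E = angle (c - \<bar>x - c\<bar>) - angle (c + \<bar>x - c\<bar>) - (if c = 1 then 1 else 0)"
    have pos: "0 < (x - c)\<^sup>2 + e\<^sup>2" using e by (simp add: add_nonneg_pos)
    have E: "- \<beta> \<le> E" "E \<le> 1"
    proof -
      note A = angle_bounds(1,2)[of "c - \<bar>x - c\<bar>"] angle_bounds(1,2)[of "c + \<bar>x - c\<bar>"]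
      show "E \<le> 1" using A margin unfolding E_def by (auto split: if_splits)
      show "- \<beta> \<le> E"
      proof (cases "c = 1")
        case True
        have "c - \<bar>x - c\<bar> \<in> {-1<..<1}" "c + \<bar>x - c\<bar> \<notin> {-1<..<1}" using True x r by auto
        then show ?thesis using angle_inside_bounds(1)[of "c - \<bar>x - c\<bar>"] angle_outside[of "c + \<bar>x - c\<bar>"] True
          by (simp add: E_def \<beta>_def)
      next
        case False
        then show ?thesis using A margin unfolding E_def \<beta>_def by auto
      qed
    qed
    have lx: "ln \<bar>x - c\<bar> \<le> l"
    proof -
      have "ln ((x - c)\<^sup>2) = 2 * ln \<bar>x - c\<bar>" using x by (metis ln_realpow of_nat_numeral power2_abs zero_less_abs_iff right_minus_eq)
      moreover have "ln ((x - c)\<^sup>2) \<le> ln ((x - c)\<^sup>2 + e\<^sup>2)" using x pos by (subst ln_le_cancel_iff) auto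
      ultimately show ?thesis by (simp add: l_def)
    qed
    have lx0: "ln \<bar>x - c\<bar> \<le> 0" using x r by simp
    have l1: "l \<le> 1"
    proof -
      have "(x - c)\<^sup>2 \<le> 1" using x r by (simp add: abs_square_le_1)
      moreover have "e\<^sup>2 \<le> 1" using e by (simp add: power_le_one)
      ultimately have "ln ((x - c)\<^sup>2 + e\<^sup>2) \<le> ln 2" using pos by (subst ln_le_cancel_iff) auto
      also have "\<dots> \<le> 1" using ln_le_minus_one[of "2::real"] by simp
      finally show ?thesis by (simp add: l_def)
    qed
    have El: "E * l \<le> - \<beta> * ln \<bar>x - c\<bar> + 1"
    proof (cases "l \<le> 0")
      case True
      have "E * l \<le> - \<beta> * l" using E True by (intro mult_right_mono_neg) auto
      also have "\<dots> \<le> - \<beta> * ln \<bar>x - c\<bar>" using lx \<beta> by (intro mult_left_mono_neg) auto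
      finally show ?thesis by simp
    next
      case False
      have "E * l \<le> 1 * 1" using E l1 False by (intro mult_mono) auto
      moreover have "0 \<le> - \<beta> * ln \<bar>x - c\<bar>" using lx0 \<beta> by (simp add: mult_nonneg_nonpos)
      ultimately show ?thesis by simp
    qed
    have den: "1 / norm (Complex x e - 1) \<le> D * exp (- (if c = 1 then 1 else 0) * l)"
    proof (cases "c = 1")
      case True
      have "norm (Complex x e - 1) = sqrt ((x - c)\<^sup>2 + e\<^sup>2)" using True by (simp add: cmod_def)
      also have "\<dots> = exp l" unfolding l_def
      proof -
        have "exp (ln ((x - c)\<^sup>2 + e\<^sup>2) / 2) ^ 2 = exp (ln ((x - c)\<^sup>2 + e\<^sup>2))"
          by (simp only: exp_of_nat_mult[symmetric]) simp
        also have "\<dots> = (x - c)\<^sup>2 + e\<^sup>2" using pos by (rule exp_ln)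
        finally show "sqrt ((x - c)\<^sup>2 + e\<^sup>2) = exp (ln ((x - c)\<^sup>2 + e\<^sup>2) / 2)"
          by (intro real_sqrt_unique) auto
      qed
      finally show ?thesis using True by (simp add: D_def exp_minus inverse_eq_divide)
    next
      case False
      have "r \<le> \<bar>x - 1\<bar>" using r(3)[OF False] x(2) by linarith
      also have "\<dots> \<le> norm (Complex x e - 1)" using abs_Re_le_cmod[of "Complex x e - 1"] by simp
      finally show ?thesis using False r by (simp add: D_def frac_le)
    qed
    have "norm (solution_transform (Complex x e)) = P / pi * (exp (- Re (log_ratio (Complex x e))) * (1 / norm (Complex x e - 1)))"
      by (simp add: norm_solution_transform)
    also have "\<dots> \<le> P / pi * (exp ((angle (c - \<bar>x - c\<bar>) - angle (c + \<bar>x - c\<bar>)) * l + C0) * (D * exp (- (if c = 1 then 1 else 0) * l)))"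
      using b[OF x e] P den by (intro mult_left_mono mult_mono) (auto simp: l_def)
    also have "\<dots> = P / pi * D * exp (E * l + C0)"
    proof -
      have "exp (a * l + C0) * (D * exp (- d * l)) = D * exp ((a - d) * l + C0)" for a d
        by (simp add: mult_exp_exp algebra_simps)
      then show ?thesis by (simp only: E_def mult.assoc)
    qed
    also have "\<dots> \<le> P / pi * D * exp ((- \<beta> * ln \<bar>x - c\<bar> + 1) + C0)"
      using P D El by (intro mult_left_mono) auto
    also have "\<dots> = P / pi * D * exp (C0 + 1) * \<bar>x - c\<bar> powr - \<beta>"
    proof -
      have "exp ((- \<beta> * q + 1) + C0) = exp (C0 + 1) * exp (- \<beta> * q)" for q
        by (simp add: mult_exp_exp algebra_simps)
      then show ?thesis using x by (simp add: powr_def)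
    qed
    finally show "norm (solution_transform (Complex x e)) \<le> P / pi * D * exp (C0 + 1) * \<bar>x - c\<bar> powr - (1 - margin)"
      by (simp add: \<beta>_def)
  qed
qed

end

section \<open>The Cauchy transform away from the support\<close>

lemma Complex_tendsto_at_right_0: "((\<lambda>e. Complex x e) \<longlongrightarrow> of_real x) (at_right 0)"
proof -
  have "((\<lambda>e. of_real x + \<i> * of_real e) \<longlongrightarrow> of_real x + \<i> * of_real 0) (at_right 0)"
    by (intro tendsto_intros)
  then show ?thesis by (simp add: Complex_eq)
qed

context charge
begin

lemma cauchy_transform_outside_tendsto:
  assumes x: "1 < \<bar>x\<bar>"
  shows "((\<lambda>e. cauchy_transform t (Complex x e)) \<longlongrightarrow> of_real ((LINT y|lborel. t y / (x - y)) / pi)) (at_right 0)"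
proof -
  have d: "\<bar>x\<bar> - 1 \<le> \<bar>x - y\<bar>" if "y \<in> {-1<..<1}" for y using that by (auto simp: abs_if split: if_splits)
  have "((\<lambda>e. LINT y|lborel. of_real (t y) / (Complex x e - of_real y)) \<longlongrightarrow> (LINT y|lborel. complex_of_real (t y / (x - y)))) (at_right 0)"
  proof (rule integral_tendsto_at_right_0(1))
    show "integrable lborel (\<lambda>y. (1 / (\<bar>x\<bar> - 1)) * \<bar>t y\<bar>)" using abs_integrable by simp
    show "AE y in lborel. norm (of_real (t y) / (Complex x e - of_real y)) \<le> (1 / (\<bar>x\<bar> - 1)) * \<bar>t y\<bar>" for e
    proof (intro AE_I2)
      fix y
      show "norm (of_real (t y) / (Complex x e - of_real y)) \<le> (1 / (\<bar>x\<bar> - 1)) * \<bar>t y\<bar>"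
      proof (cases "y \<in> {-1<..<1}")
        case True
        have "\<bar>x\<bar> - 1 \<le> norm (Complex x e - of_real y)"
          using d[OF True] abs_Re_le_cmod[of "Complex x e - of_real y"] by simp
        then show ?thesis using x by (simp add: norm_divide frac_le)
      qed (simp add: support)
    qed
    show "AE y in lborel. ((\<lambda>e. of_real (t y) / (Complex x e - of_real y)) \<longlongrightarrow> complex_of_real (t y / (x - y))) (at_right 0)"
    proof (intro AE_I2)
      fix y
      show "((\<lambda>e. of_real (t y) / (Complex x e - of_real y)) \<longlongrightarrow> complex_of_real (t y / (x - y))) (at_right 0)"
      proof (cases "y \<in> {-1<..<1}")
        case True
        then have "x \<noteq> y" using x by auto
        then have "((\<lambda>e. of_real (t y) / (Complex x e - of_real y)) \<longlongrightarrow> of_real (t y) / (of_real x - of_real y)) (at_right 0)"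
          by (intro tendsto_intros Complex_tendsto_at_right_0) auto
        then show ?thesis by simp
      qed (simp add: support)
    qed
  qed auto
  then have "((\<lambda>e. (LINT y|lborel. of_real (t y) / (Complex x e - of_real y)) / of_real pi) \<longlongrightarrow> (LINT y|lborel. complex_of_real (t y / (x - y))) / of_real pi) (at_right 0)"
    by (intro tendsto_intros) auto
  moreover have "(LINT y|lborel. complex_of_real (t y / (x - y))) / of_real pi = of_real ((LINT y|lborel. t y / (x - y)) / pi)"
    unfolding integral_complex_of_real by (rule of_real_divide[symmetric])
  ultimately show ?thesis by (simp only: cauchy_transform_def)
qed

lemma norm_cauchy_transform_le:
  assumes "1 < norm z"
  shows "norm (cauchy_transform t z) \<le> (LINT y|lborel. \<bar>t y\<bar>) / (pi * (norm z - 1))"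
proof -
  have b: "norm (of_real (t y) / (z - of_real y)) \<le> (1 / (norm z - 1)) * \<bar>t y\<bar>" for y
  proof (cases "y \<in> {-1<..<1}")
    case True
    then have "norm z - 1 \<le> norm (z - of_real y)"
      using norm_triangle_ineq2[of z "of_real y"] by (auto simp: abs_if split: if_splits)
    then show ?thesis using assms by (simp add: norm_divide frac_le)
  qed (simp add: support)
  have i: "integrable lborel (\<lambda>y. (1 / (norm z - 1)) * \<bar>t y\<bar>)" using abs_integrable by simp
  have "integrable lborel (\<lambda>y. of_real (t y) / (z - of_real y))"
    by (rule Bochner_Integration.integrable_bound[OF i])
       (use order_trans[OF b abs_ge_self] in \<open>auto simp del: norm_divide\<close>)
  then have "norm (LINT y|lborel. of_real (t y) / (z - of_real y)) \<le> (LINT y|lborel. (1 / (norm z - 1)) * \<bar>t y\<bar>)"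
    by (rule Bochner_Integration.integral_norm_bound_integral[OF _ i b])
  then have "norm (LINT y|lborel. of_real (t y) / (z - of_real y)) / pi \<le> (LINT y|lborel. \<bar>t y\<bar>) / (norm z - 1) / pi"
    by (intro divide_right_mono) auto
  then show ?thesis by (simp add: cauchy_transform_def norm_divide mult.commute)
qed

end

section \<open>Global bounds and boundary values of the explicit transform\<close>

lemma integrable_inverse_square_1_plus_abs: "integrable lborel (\<lambda>x::real. 1 / (1 + \<bar>x\<bar>) / (1 + \<bar>x\<bar>))"
proof (rule Bochner_Integration.integrable_bound[OF integrable_inverse_1_plus_square])
  have le: "1 / (1 + \<bar>x\<bar>) / (1 + \<bar>x\<bar>) \<le> 1 / (1 + x\<^sup>2)" for x :: real
  proof -
    have "1 + x\<^sup>2 \<le> (1 + \<bar>x\<bar>) * (1 + \<bar>x\<bar>)" by (simp add: algebra_simps power2_eq_square abs_mult_self_eq)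
    moreover have "0 < 1 + x\<^sup>2" by (simp add: add_pos_nonneg)
    ultimately have "1 / ((1 + \<bar>x\<bar>) * (1 + \<bar>x\<bar>)) \<le> 1 / (1 + x\<^sup>2)" by (intro frac_le) auto
    then show ?thesis by simp
  qed
  have nn: "0 \<le> 1 / (1 + \<bar>x\<bar>) / (1 + \<bar>x\<bar>)" for x :: real by (intro divide_nonneg_nonneg) auto
  show "AE x in lborel. norm (1 / (1 + \<bar>x::real\<bar>) / (1 + \<bar>x\<bar>)) \<le> norm (1 / (1 + x\<^sup>2))"
  proof (intro AE_I2)
    fix x :: real
    show "norm (1 / (1 + \<bar>x\<bar>) / (1 + \<bar>x\<bar>)) \<le> norm (1 / (1 + x\<^sup>2))"
      unfolding real_norm_def abs_of_nonneg[OF nn[of x]] by (rule order_trans[OF le abs_ge_self])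
  qed
qed measurable

context slope
begin

lemma angle_charge: "charge angle"
  by unfold_locales (simp_all add: angle_outside angle_integrable)

lemma log_ratio_cauchy_transform: "log_ratio z = of_real pi * cauchy_transform angle z"
  by (simp add: log_ratio_def cauchy_transform_def)

lemma solution_transform_decay:
  assumes "2 \<le> norm z"
  shows "norm (solution_transform z) \<le> (2 * P / pi * exp 2) / norm z"
proof -
  have "norm (log_ratio z) \<le> (LINT y|lborel. \<bar>angle y\<bar>) / (norm z - 1)"
    using charge.norm_cauchy_transform_le[OF angle_charge, of z] assms
    by (simp add: log_ratio_cauchy_transform norm_mult field_simps)
  also have "\<dots> \<le> 2 / 1" using integral_angle_le assms by (intro frac_le) auto
  finally have "- Re (log_ratio z) \<le> 2" using abs_Re_le_cmod[of "log_ratio z"] by linarith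
  moreover have "norm z / 2 \<le> norm (z - 1)" using norm_triangle_ineq2[of z 1] assms by simp
  ultimately have "P / pi * exp (- Re (log_ratio z)) / norm (z - 1) \<le> P / pi * exp 2 / (norm z / 2)"
    using P assms by (intro frac_le mult_left_mono mult_nonneg_nonneg) auto
  then show ?thesis unfolding norm_solution_transform by (simp add: mult_ac)
qed

text \<open>Finitely many of the local bounds cover the interval by compactness.\<close>
lemma solution_transform_global_bound:
  obtains T C where "finite T" "0 \<le> C"
    "\<And>x e. x \<in> {-2..2} \<Longrightarrow> x \<notin> T \<Longrightarrow> 0 < e \<Longrightarrow> e < 1 \<Longrightarrow>
       \<exists>c\<in>T. norm (solution_transform (Complex x e)) \<le> C * (indicator {c-1..c+1} x * \<bar>x - c\<bar> powr - (1 - margin))"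
proof -
  have "\<exists>r C. 0 < r \<and> 2 * r \<le> 1 \<and> 0 \<le> C \<and> (\<forall>x e. x \<noteq> c \<longrightarrow> \<bar>x - c\<bar> < r \<longrightarrow> 0 < e \<longrightarrow> e < 1 \<longrightarrow>
      norm (solution_transform (Complex x e)) \<le> C * \<bar>x - c\<bar> powr - (1 - margin))" for c
    by (rule solution_transform_local_bound[of c]) blast
  then obtain r C where rC: "\<And>c. 0 < r c" "\<And>c. 2 * r c \<le> 1" "\<And>c. 0 \<le> C c"
    and b: "\<And>c x e. x \<noteq> c \<Longrightarrow> \<bar>x - c\<bar> < r c \<Longrightarrow> 0 < e \<Longrightarrow> e < 1 \<Longrightarrow>
      norm (solution_transform (Complex x e)) \<le> C c * \<bar>x - c\<bar> powr - (1 - margin)"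
    by metis
  obtain T where T: "T \<subseteq> {-2..2}" "finite T" "{-2..2} \<subseteq> (\<Union>c\<in>T. ball c (r c))"
    by (rule compactE_image[of "{-2..2::real}" "{-2..2}" "\<lambda>c. ball c (r c)"]) (use rC in auto)
  show ?thesis
  proof (rule that[of T "\<Sum>c\<in>T. C c"])
    show "finite T" "0 \<le> (\<Sum>c\<in>T. C c)" using T rC by (auto intro: sum_nonneg)
    fix x e assume x: "x \<in> {-2..2}" "x \<notin> T" and e: "0 < e" "e < (1::real)"
    then obtain c where c: "c \<in> T" "x \<in> ball c (r c)" using T by blast
    then have xc: "\<bar>x - c\<bar> < r c" "x \<noteq> c" using x by (auto simp: dist_real_def)
    have "norm (solution_transform (Complex x e)) \<le> C c * \<bar>x - c\<bar> powr - (1 - margin)"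
      using b[OF xc(2,1) e] .
    also have "\<dots> \<le> (\<Sum>c\<in>T. C c) * \<bar>x - c\<bar> powr - (1 - margin)"
      using c T rC by (intro mult_right_mono member_le_sum) auto
    also have "\<bar>x - c\<bar> powr - (1 - margin) = indicator {c-1..c+1} x * \<bar>x - c\<bar> powr - (1 - margin)"
      using xc rC(2)[of c] by (auto simp: indicator_def abs_if split: if_splits)
    finally show "\<exists>c\<in>T. norm (solution_transform (Complex x e)) \<le> (\<Sum>c\<in>T. C c) * (indicator {c-1..c+1} x * \<bar>x - c\<bar> powr - (1 - margin))"
      using c by blast
  qed
qed

text \<open>A majorant for all heights at once: powers near the interval, and the decay \<open>1 / |z|\<close> away from it.\<close>
lemma solution_transform_dominated:
  obtains g where "integrable lborel (\<lambda>x. g x / (1 + \<bar>x\<bar>))"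
    "\<And>e. 0 < e \<Longrightarrow> e < 1 \<Longrightarrow> AE x in lborel. norm (solution_transform (Complex x e)) \<le> g x"
    "integrable lborel (\<lambda>x. indicator {-1..1} x * g x)" "\<And>x. 0 \<le> g x"
proof -
  obtain T C where T: "finite T" "0 \<le> C"
    and b: "\<And>x e. x \<in> {-2..2} \<Longrightarrow> x \<notin> T \<Longrightarrow> 0 < e \<Longrightarrow> e < 1 \<Longrightarrow>
       \<exists>c\<in>T. norm (solution_transform (Complex x e)) \<le> C * (indicator {c-1..c+1} x * \<bar>x - c\<bar> powr - (1 - margin))"
    by (rule solution_transform_global_bound) blast
  define D where "D = (\<lambda>x. \<Sum>c\<in>T. C * (indicator {c-1..c+1} x * \<bar>x - c\<bar> powr - (1 - margin)))"
  define B where "B = 2 * P / pi * exp 2"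
  have B: "0 \<le> B" using P by (simp add: B_def)
  define g where "g = (\<lambda>x. D x + 2 * B * (1 / (1 + \<bar>x\<bar>)))"
  have Di: "integrable lborel D"
    unfolding D_def using margin
    by (intro Bochner_Integration.integrable_sum integrable_mult_right integral_abs_powr_singularity) auto
  have D0: "0 \<le> D x" for x unfolding D_def using T by (intro sum_nonneg) auto
  have [measurable]: "D \<in> borel_measurable borel" using Di by auto
  have pos: "0 < 1 + \<bar>x\<bar>" for x :: real by (rule add_pos_nonneg) auto
  have i1: "integrable lborel (\<lambda>x. D x / (1 + \<bar>x\<bar>))"
  proof (rule Bochner_Integration.integrable_bound[OF Di])
    have "D x / (1 + \<bar>x\<bar>) \<le> D x / 1" for x using D0[of x] by (intro divide_left_mono) auto
    then show "AE x in lborel. norm (D x / (1 + \<bar>x\<bar>)) \<le> norm (D x)"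
      using D0 by (intro AE_I2) (simp add: abs_divide)
  qed measurable
  show ?thesis
  proof (rule that[of g])
    have "g x / (1 + \<bar>x\<bar>) = D x / (1 + \<bar>x\<bar>) + 2 * B * (1 / (1 + \<bar>x\<bar>) / (1 + \<bar>x\<bar>))" for x
      by (simp add: g_def add_divide_distrib)
    then show "integrable lborel (\<lambda>x. g x / (1 + \<bar>x\<bar>))"
      using Bochner_Integration.integrable_add[OF i1 integrable_mult_right[OF integrable_inverse_square_1_plus_abs, of "2 * B"]] by (simp only:)
    show g0: "0 \<le> g x" for x unfolding g_def using D0[of x] B pos[of x] by (intro add_nonneg_nonneg) auto
    show "integrable lborel (\<lambda>x. indicator {-1..1} x * g x)"
    proof (rule Bochner_Integration.integrable_bound)
      show "integrable lborel (\<lambda>x. D x + 2 * B * indicator {-1..1} x)"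
        by (intro Bochner_Integration.integrable_add Di integrable_mult_right integrable_indicator_Icc)
      have "indicator {-1..1} x * g x \<le> D x + 2 * B * indicator {-1..1} x" for x
      proof -
        have "1 / (1 + \<bar>x\<bar>) \<le> 1" using pos[of x] by simp
        then have "2 * B * (1 / (1 + \<bar>x\<bar>)) \<le> 2 * B * 1" using B by (intro mult_left_mono) auto
        then show ?thesis using D0[of x] by (auto simp: g_def indicator_def)
      qed
      then show "AE x in lborel. norm (indicator {-1..1} x * g x) \<le> norm (D x + 2 * B * indicator {-1..1} x)"
        using g0 by (intro AE_I2) (simp add: abs_mult order_trans[OF _ abs_ge_self])
      show "(\<lambda>x. indicator {-1..1} x * g x) \<in> borel_measurable lborel" unfolding g_def by measurable
    qed
    fix e :: real assume e: "0 < e" "e < 1"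
    have "AE x in lborel. x \<notin> T" using T(1) by (intro AE_not_in) (simp add: finite_imp_null_set_lborel)
    then show "AE x in lborel. norm (solution_transform (Complex x e)) \<le> g x"
    proof eventually_elim
      case (elim x)
      show ?case
      proof (cases "x \<in> {-2..2}")
        case True
        obtain c where c: "c \<in> T" "norm (solution_transform (Complex x e)) \<le> C * (indicator {c-1..c+1} x * \<bar>x - c\<bar> powr - (1 - margin))"
          using b[OF True elim e] by blast
        have "C * (indicator {c-1..c+1} x * \<bar>x - c\<bar> powr - (1 - margin)) \<le> D x"
          unfolding D_def using T c(1) by (intro member_le_sum[of c T]) auto
        moreover have "0 \<le> 2 * B * (1 / (1 + \<bar>x\<bar>))" using B pos[of x] by simp
        ultimately show ?thesis using c(2) unfolding g_def by linarith
      next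
        case False
        then have x2: "2 \<le> \<bar>x\<bar>" by auto
        have xz: "\<bar>x\<bar> \<le> norm (Complex x e)" using abs_Re_le_cmod[of "Complex x e"] by simp
        have "norm (solution_transform (Complex x e)) \<le> B / norm (Complex x e)"
          unfolding B_def using x2 xz by (intro solution_transform_decay) linarith
        also have "\<dots> \<le> B / ((1 + \<bar>x\<bar>) / 2)" using x2 xz B pos[of x] by (intro divide_left_mono mult_pos_pos) auto
        also have "\<dots> = 2 * B * (1 / (1 + \<bar>x\<bar>))" by simp
        finally show ?thesis using D0[of x] unfolding g_def by linarith
      qed
    qed
  qed
qed

text \<open>
  Boundary values at a point where \<open>f\<close> satisfies a Lipschitz condition: the angle differs from
  its value at the point by a function that cancels the singularity of the kernels, so dominated
  convergence applies to the difference; for the constant part the integrals are explicit.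
\<close>
lemma solution_transform_boundary:
  assumes x: "x \<in> {-1<..<1}" and lip: "0 \<le> K" "\<And>y. y \<in> {-1<..<1} \<Longrightarrow> \<bar>f y - f x\<bar> \<le> K * \<bar>x - y\<bar>"
  obtains \<rho> where "0 < \<rho>" "((\<lambda>e. solution_transform (Complex x e)) \<longlongrightarrow> of_real \<rho> * (\<i> - of_real (f x))) (at_right 0)"
proof -
  let ?A = "angle x"
  have lipA: "\<bar>angle y - ?A\<bar> \<le> K * \<bar>x - y\<bar>" if "y \<in> {-1<..<1}" for y
    using angle_Lipschitz[OF lip(2)[OF that] x that lip(1)] .
  define I where "I = (\<lambda>y. indicator {-1<..<1} y * (angle y - ?A))"
  have [measurable]: "I \<in> borel_measurable borel" unfolding I_def by measurable
  have I_le: "\<bar>I y\<bar> \<le> indicator {-1..1} y * (K * \<bar>x - y\<bar>)" for y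
    using lipA[of y] lip(1) by (auto simp: I_def indicator_def)
  have ind: "integrable lborel (\<lambda>y::real. K * indicator {-1..1} y)"
    by (intro integrable_mult_right integrable_indicator_Icc)
  have kern: "\<bar>I y * q\<bar> \<le> K * indicator {-1..1} y" if "\<bar>q\<bar> * \<bar>x - y\<bar> \<le> 1" for y q
  proof -
    have "\<bar>I y * q\<bar> \<le> (indicator {-1..1} y * (K * \<bar>x - y\<bar>)) * \<bar>q\<bar>"
      unfolding abs_mult by (intro mult_right_mono I_le) auto
    also have "\<dots> = (indicator {-1..1} y * K) * (\<bar>q\<bar> * \<bar>x - y\<bar>)" by simp
    also have "\<dots> \<le> (indicator {-1..1} y * K) * 1" using that lip(1) by (intro mult_left_mono) auto
    finally show ?thesis by (simp add: mult.commute)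
  qed
  have k1: "\<bar>(x - y) / ((x - y)\<^sup>2 + e\<^sup>2)\<bar> * \<bar>x - y\<bar> \<le> 1" if "0 < e" for e y
    by (rule conjugate_kernel_bound(1)[OF that])
  have k2: "\<bar>e / ((x - y)\<^sup>2 + e\<^sup>2)\<bar> * \<bar>x - y\<bar> \<le> 1" if e: "0 < e" for e y
  proof -
    have "0 < (x - y)\<^sup>2 + e\<^sup>2" using e by (simp add: add_nonneg_pos)
    moreover have "2 * \<bar>x - y\<bar> * e \<le> (x - y)\<^sup>2 + e\<^sup>2" using zero_le_power2[of "\<bar>x - y\<bar> - e"]
      by (simp add: power2_eq_square algebra_simps abs_mult_self_eq)
    moreover have "0 \<le> \<bar>x - y\<bar> * e" using e by simp
    ultimately have "\<bar>x - y\<bar> * e \<le> (x - y)\<^sup>2 + e\<^sup>2" "0 < (x - y)\<^sup>2 + e\<^sup>2" by linarith+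
    then show ?thesis using e by (simp add: divide_simps mult.commute)
  qed
  have int: "integrable lborel (\<lambda>y. I y * q y)" if [measurable]: "q \<in> borel_measurable borel"
    and "\<And>y. \<bar>q y\<bar> * \<bar>x - y\<bar> \<le> 1" for q
    by (rule Bochner_Integration.integrable_bound[OF ind])
       (use order_trans[OF kern[OF that(2)] abs_ge_self] in \<open>auto simp del: abs_mult\<close>)
  have indq: "integrable lborel (\<lambda>y. indicator {-1<..<1} y * q y)" if [measurable]: "q \<in> borel_measurable borel"
    and "\<And>y. \<bar>q y\<bar> \<le> D" for q :: "real \<Rightarrow> real" and D
  proof (rule Bochner_Integration.integrable_bound)
    show "integrable lborel (\<lambda>y::real. D * indicator {-1..1} y)" by (intro integrable_mult_right integrable_indicator_Icc)
    have "0 \<le> D" using that(2)[of 0] by simp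
    then show "AE y in lborel. norm (indicator {-1<..<1} y * q y) \<le> norm (D * indicator {-1..1} y)"
      using that(2) by (intro AE_I2) (auto simp: indicator_def)
  qed measurable
  have split: "(LINT y|lborel. angle y * q y) = (LINT y|lborel. I y * q y) + ?A * (LINT y|lborel. indicator {-1<..<1} y * q y)"
    if [measurable]: "q \<in> borel_measurable borel" and "\<And>y. \<bar>q y\<bar> * \<bar>x - y\<bar> \<le> 1" and "\<And>y. \<bar>q y\<bar> \<le> D" for q D
  proof -
    have "(LINT y|lborel. angle y * q y) = (LINT y|lborel. I y * q y + ?A * (indicator {-1<..<1} y * q y))"
    proof (intro Bochner_Integration.integral_cong refl)
      fix y
      show "angle y * q y = I y * q y + ?A * (indicator {-1<..<1} y * q y)"
        using angle_outside[of y] by (cases "y \<in> {-1<..<1}") (auto simp: I_def algebra_simps)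
    qed
    then show ?thesis using int[of q] indq[of q D] that by simp
  qed
  define J where "J = (LINT y|lborel. I y * (1 / (x - y)))"
  have l1: "((\<lambda>e. LINT y|lborel. I y * ((x - y) / ((x - y)\<^sup>2 + e\<^sup>2))) \<longlongrightarrow> J) (at_right 0)"
    unfolding J_def
  proof (rule integral_tendsto_at_right_0(1)[OF _ _ ind])
    show "AE y in lborel. norm (I y * ((x - y) / ((x - y)\<^sup>2 + e\<^sup>2))) \<le> K * indicator {-1..1} y" if "0 < e" for e
      using kern[OF k1[OF that]] by (intro AE_I2) (simp only: real_norm_def)
    have "((\<lambda>e. I y * ((x - y) / ((x - y)\<^sup>2 + e\<^sup>2))) \<longlongrightarrow> I y * (1 / (x - y))) (at_right 0)" if "y \<noteq> x" for y
    proof -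
      have "((\<lambda>e. I y * ((x - y) / ((x - y)\<^sup>2 + e\<^sup>2))) \<longlongrightarrow> I y * ((x - y) / ((x - y)\<^sup>2 + 0\<^sup>2))) (at_right 0)"
        using that by (intro tendsto_intros) auto
      then show ?thesis using that by (simp add: power2_eq_square)
    qed
    then show "AE y in lborel. ((\<lambda>e. I y * ((x - y) / ((x - y)\<^sup>2 + e\<^sup>2))) \<longlongrightarrow> I y * (1 / (x - y))) (at_right 0)"
      using AE_lborel_singleton[of x] by (auto elim!: eventually_mono)
  qed auto
  have l2: "((\<lambda>e. LINT y|lborel. I y * (e / ((x - y)\<^sup>2 + e\<^sup>2))) \<longlongrightarrow> (LINT y::real|lborel. 0)) (at_right 0)"
  proof (rule integral_tendsto_at_right_0(1)[OF _ _ ind])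
    show "AE y in lborel. norm (I y * (e / ((x - y)\<^sup>2 + e\<^sup>2))) \<le> K * indicator {-1..1} y" if "0 < e" for e
      using kern[OF k2[OF that]] by (intro AE_I2) (simp only: real_norm_def)
    have "((\<lambda>e. I y * (e / ((x - y)\<^sup>2 + e\<^sup>2))) \<longlongrightarrow> 0) (at_right 0)" if "y \<noteq> x" for y
    proof -
      have "((\<lambda>e. I y * (e / ((x - y)\<^sup>2 + e\<^sup>2))) \<longlongrightarrow> I y * (0 / ((x - y)\<^sup>2 + 0\<^sup>2))) (at_right 0)"
        using that by (intro tendsto_intros) auto
      then show ?thesis by simp
    qed
    then show "AE y in lborel. ((\<lambda>e. I y * (e / ((x - y)\<^sup>2 + e\<^sup>2))) \<longlongrightarrow> 0) (at_right 0)"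
      using AE_lborel_singleton[of x] by (auto elim!: eventually_mono)
  qed auto
  have Re_eq: "Re (log_ratio (Complex x e)) = (LINT y|lborel. I y * ((x - y) / ((x - y)\<^sup>2 + e\<^sup>2)))
     + ?A * (ln ((x + 1)\<^sup>2 + e\<^sup>2) / 2 - ln ((x - 1)\<^sup>2 + e\<^sup>2) / 2)" if e: "0 < e" for e
  proof -
    have "\<bar>(LINT y|lborel. indicator {-1<..<1} y * (1 * ((x - y) / ((x - y)\<^sup>2 + e\<^sup>2))))
      - 1 * (ln ((x - (-1))\<^sup>2 + e\<^sup>2) / 2 - ln ((x - 1)\<^sup>2 + e\<^sup>2) / 2)\<bar> \<le> 0 * (1 - (-1))"
      by (rule conjugate_integral_piece[where B = 1]) (use e in auto)
    then show ?thesis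
      unfolding Re_log_ratio[OF e]
      using split[of "\<lambda>y. (x - y) / ((x - y)\<^sup>2 + e\<^sup>2)" "1 / e"] k1[OF e] conjugate_kernel_bound(2)[OF e] by simp
  qed
  have Im_eq: "Im (log_ratio (Complex x e)) = - ((LINT y|lborel. I y * (e / ((x - y)\<^sup>2 + e\<^sup>2)))
     + ?A * (arctan ((1 - x) / e) - arctan ((-1 - x) / e)))" if e: "0 < e" for e
  proof -
    have b: "\<bar>e / ((x - y)\<^sup>2 + e\<^sup>2)\<bar> \<le> 1 / e" for y
    proof -
      have "e / ((x - y)\<^sup>2 + e\<^sup>2) \<le> e / e\<^sup>2" using e by (intro divide_left_mono) (auto simp: add_nonneg_pos)
      then show ?thesis using e by (simp add: power2_eq_square)
    qed
    have "(LINT y|lborel. indicator {-1<..<1} y * (e / ((x - y)\<^sup>2 + e\<^sup>2))) = (LINT y|lborel. e / ((y - x)\<^sup>2 + e\<^sup>2) * indicator {-1..1} y)"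
      using AE_lborel_singleton[of "-1"] AE_lborel_singleton[of 1]
      by (intro integral_cong_AE) (auto elim!: eventually_elim2 simp: indicator_def power2_commute)
    also have "\<dots> = arctan ((1 - x) / e) - arctan ((-1 - x) / e)"
    proof (rule integral_FTC_Icc_real)
      fix y
      show "((\<lambda>y. arctan ((y - x) / e)) has_field_derivative e / ((y - x)\<^sup>2 + e\<^sup>2)) (at y)"
        by (rule DERIV_arctan_scaled[OF e])
      have "0 < (y - x)\<^sup>2 + e\<^sup>2" using e by (simp add: add_nonneg_pos)
      then show "isCont (\<lambda>y. e / ((y - x)\<^sup>2 + e\<^sup>2)) y" by (intro continuous_intros less_imp_neq[THEN not_sym])
    qed simp
    finally have m: "(LINT y|lborel. indicator {-1<..<1} y * (e / ((x - y)\<^sup>2 + e\<^sup>2))) = arctan ((1 - x) / e) - arctan ((-1 - x) / e)" .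
    have "Im (log_ratio (Complex x e)) = - (LINT y|lborel. angle y * (e / ((x - y)\<^sup>2 + e\<^sup>2)))"
      using charge.Im_cauchy_transform[OF angle_charge e, of x] by (simp add: log_ratio_cauchy_transform)
    then show ?thesis using split[of "\<lambda>y. e / ((x - y)\<^sup>2 + e\<^sup>2)" "1 / e"] k2[OF e] b m by simp
  qed
  define \<Lambda> where "\<Lambda> = J + ?A * (ln ((x + 1)\<^sup>2 + 0\<^sup>2) / 2 - ln ((x - 1)\<^sup>2 + 0\<^sup>2) / 2)"
  have "((\<lambda>e. (LINT y|lborel. I y * ((x - y) / ((x - y)\<^sup>2 + e\<^sup>2))) + ?A * (ln ((x + 1)\<^sup>2 + e\<^sup>2) / 2 - ln ((x - 1)\<^sup>2 + e\<^sup>2) / 2)) \<longlongrightarrow> \<Lambda>) (at_right 0)"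
    unfolding \<Lambda>_def using x by (intro tendsto_intros l1) auto
  then have lRe: "((\<lambda>e. Re (log_ratio (Complex x e))) \<longlongrightarrow> \<Lambda>) (at_right 0)"
    by (rule Lim_transform_eventually) (use eventually_at_right_less[of 0] in \<open>eventually_elim, simp only: Re_eq\<close>)
  have larc: "((\<lambda>e. arctan ((1 - x) / e) - arctan ((-1 - x) / e)) \<longlongrightarrow> pi) (at_right 0)"
  proof -
    have "0 < 1 - x" "-1 - x < 0" using x by auto
    then show ?thesis by real_asymp
  qed
  have "((\<lambda>e. - ((LINT y|lborel. I y * (e / ((x - y)\<^sup>2 + e\<^sup>2))) + ?A * (arctan ((1 - x) / e) - arctan ((-1 - x) / e))))
      \<longlongrightarrow> - ((LINT y::real|lborel. 0) + ?A * pi)) (at_right 0)"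
    by (intro tendsto_intros l2 larc)
  then have "((\<lambda>e. Im (log_ratio (Complex x e))) \<longlongrightarrow> - ((LINT y::real|lborel. 0) + ?A * pi)) (at_right 0)"
    by (rule Lim_transform_eventually) (use eventually_at_right_less[of 0] in \<open>eventually_elim, simp only: Im_eq\<close>)
  then have lIm: "((\<lambda>e. Im (log_ratio (Complex x e))) \<longlongrightarrow> - (?A * pi)) (at_right 0)" by simp
  have llog: "((\<lambda>e. log_ratio (Complex x e)) \<longlongrightarrow> Complex \<Lambda> (- (?A * pi))) (at_right 0)"
    using tendsto_Complex[OF lRe lIm] by simp
  define S where "S = sqrt (1 + (f x)\<^sup>2)"
  have S: "0 < S" by (simp add: S_def add_pos_nonneg)
  define \<rho> where "\<rho> = P / pi * exp (- \<Lambda>) / (1 - x) / S"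
  have "((\<lambda>e. solution_transform (Complex x e)) \<longlongrightarrow> - of_real (P / pi) * exp (- Complex \<Lambda> (- (?A * pi))) / (of_real x - 1)) (at_right 0)"
    unfolding solution_transform_def using x
    by (intro tendsto_intros llog Complex_tendsto_at_right_0) (auto simp: complex_eq_iff)
  moreover have "- of_real (P / pi) * exp (- Complex \<Lambda> (- (?A * pi))) / (of_real x - 1) = of_real \<rho> * (\<i> - of_real (f x))"
  proof -
    have "?A * pi = pi / 2 + arctan (f x)" using angle_inside[OF x] by (simp add: field_simps)
    then have "cis (?A * pi) = (\<i> - of_real (f x)) / of_real S"
      by (simp add: complex_eq_iff cos_add sin_add cos_arctan sin_arctan S_def)
    moreover have "exp (- Complex \<Lambda> (- (?A * pi))) = of_real (exp (- \<Lambda>)) * cis (?A * pi)"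
      by (simp add: exp_eq_polar)
    moreover have "complex_of_real x - 1 = - of_real (1 - x)" by simp
    ultimately show ?thesis by (simp add: \<rho>_def mult_ac del: of_real_diff)
  qed
  moreover have "0 < \<rho>" using P S x by (simp add: \<rho>_def)
  ultimately show ?thesis using that by simp
qed

end

section \<open>The pressure\<close>

context charge
begin

text \<open>The first step of the expansion at infinity, from \<open>z / (z - y) = 1 + y / (z - y)\<close>.\<close>
lemma cauchy_transform_moment:
  assumes z: "Im z \<noteq> 0"
  shows "z * cauchy_transform t z = of_real ((LINT y|lborel. t y) / pi) + cauchy_transform (\<lambda>y. y * t y) z"
    and "charge (\<lambda>y. y * t y)"
proof -
  show c: "charge (\<lambda>y. y * t y)"
  proof
    show "integrable lborel (\<lambda>y. y * t y)"
    proof -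
      have "integrable lborel (\<lambda>y. of_real (t y) * y)" by (rule integrable_mult_bounded[of _ 1]) auto
      then show ?thesis by (simp add: mult.commute)
    qed
  qed (auto simp: support)
  have nz: "z - of_real y \<noteq> 0" for y using z by (auto simp: complex_eq_iff)
  have "z * (LINT y|lborel. of_real (t y) / (z - of_real y)) = (LINT y|lborel. z * (of_real (t y) / (z - of_real y)))"
    by (rule integral_mult_right_zero[symmetric])
  also have "\<dots> = (LINT y|lborel. complex_of_real (t y) + of_real (y * t y) / (z - of_real y))"
    using nz by (intro Bochner_Integration.integral_cong) (auto simp: field_simps)
  also have "\<dots> = (LINT y|lborel. complex_of_real (t y)) + (LINT y|lborel. of_real (y * t y) / (z - of_real y))"
    using integrable charge.cauchy_integrable[OF c z] by (intro Bochner_Integration.integral_add) auto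
  also have "(LINT y|lborel. complex_of_real (t y)) = of_real (LINT y|lborel. t y)"
    by (rule integral_complex_of_real)
  finally show "z * cauchy_transform t z = of_real ((LINT y|lborel. t y) / pi) + cauchy_transform (\<lambda>y. y * t y) z"
    by (simp add: cauchy_transform_def add_divide_distrib)
qed

lemma cauchy_transform_mass:
  "(\<lambda>n. (\<i> * of_nat (Suc n)) * cauchy_transform t (\<i> * of_nat (Suc n))) \<longlonglongrightarrow> of_real ((LINT y|lborel. t y) / pi)"
proof -
  let ?c = "(LINT y|lborel. \<bar>y * t y\<bar>)"
  have "(\<lambda>n. cauchy_transform (\<lambda>y. y * t y) (\<i> * of_nat (Suc n))) \<longlonglongrightarrow> 0"
  proof (rule Lim_null_comparison)
    have "(\<lambda>n. 1 / (pi * (real (Suc n) - 1))) \<longlonglongrightarrow> 0" by real_asymp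
    from tendsto_mult_right_zero[OF this, of ?c] show "(\<lambda>n. ?c / (pi * (real (Suc n) - 1))) \<longlonglongrightarrow> 0" by simp
    show "\<forall>\<^sub>F n in sequentially. norm (cauchy_transform (\<lambda>y. y * t y) (\<i> * of_nat (Suc n))) \<le> ?c / (pi * (real (Suc n) - 1))"
      using eventually_gt_at_top[of 0]
    proof eventually_elim
      case (elim n)
      have n: "norm (\<i> * of_nat (Suc n)) = real (Suc n)" by (simp add: norm_mult del: of_nat_Suc)
      show ?case
        using charge.norm_cauchy_transform_le[OF cauchy_transform_moment(2)[of \<i>], of "\<i> * of_nat (Suc n)"] elim
        unfolding n by simp
    qed
  qed
  then have "(\<lambda>n. of_real ((LINT y|lborel. t y) / pi) + cauchy_transform (\<lambda>y. y * t y) (\<i> * of_nat (Suc n)))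
     \<longlonglongrightarrow> of_real ((LINT y|lborel. t y) / pi) + 0" by (intro tendsto_intros)
  moreover have "(\<i> * of_nat (Suc n)) * cauchy_transform t (\<i> * of_nat (Suc n))
      = of_real ((LINT y|lborel. t y) / pi) + cauchy_transform (\<lambda>y. y * t y) (\<i> * of_nat (Suc n))" for n
    by (rule cauchy_transform_moment(1)) simp
  ultimately show ?thesis by (simp only: add_0_right)
qed

end

context slope
begin

text \<open>
  A limit along a sequence of heights is measurable by construction; the shift by two keeps the heights
  below one, the range of the growth bounds.
\<close>
definition pressure :: "real \<Rightarrow> real" where
  "pressure x = indicator {-1<..<1} x * lim (\<lambda>n. - Im (solution_transform (Complex x (1 / real (n + 2)))))"

lemma pressure_outside: "x \<notin> {-1<..<1} \<Longrightarrow> pressure x = 0"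
  by (simp add: pressure_def)

lemma continuous_solution_transform_line: "0 < e \<Longrightarrow> continuous_on UNIV (\<lambda>x. solution_transform (Complex x e))"
proof -
  assume e: "0 < e"
  have "continuous_on UNIV (\<lambda>x. Complex x e)" unfolding Complex_eq by (intro continuous_intros)
  then show ?thesis
    using e by (intro continuous_on_compose2[OF holomorphic_on_imp_continuous_on[OF holomorphic_solution_transform]]) auto
qed

lemma pressure_measurable [measurable]: "pressure \<in> borel_measurable borel"
proof -
  have [measurable]: "(\<lambda>x. Im (solution_transform (Complex x (1 / real (n + 2))))) \<in> borel_measurable borel" for n
    by (intro borel_measurable_continuous_onI continuous_intros continuous_solution_transform_line) auto
  show ?thesis unfolding pressure_def by measurable
qed

lemma pressure_boundary:
  assumes x: "x \<in> {-1<..<1}" and lip: "0 \<le> K" "\<And>y. y \<in> {-1<..<1} \<Longrightarrow> \<bar>f y - f x\<bar> \<le> K * \<bar>x - y\<bar>"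
  shows "pressure x < 0"
    and "((\<lambda>e. solution_transform (Complex x e)) \<longlongrightarrow> of_real (pressure x) * (of_real (f x) - \<i>)) (at_right 0)"
proof -
  obtain \<rho> where \<rho>: "0 < \<rho>" and l: "((\<lambda>e. solution_transform (Complex x e)) \<longlongrightarrow> of_real \<rho> * (\<i> - of_real (f x))) (at_right 0)"
    using solution_transform_boundary[OF x lip] by blast
  have "((\<lambda>e. - Im (solution_transform (Complex x e))) \<longlongrightarrow> - Im (of_real \<rho> * (\<i> - of_real (f x)))) (at_right 0)"
    by (intro tendsto_intros l)
  moreover have "filterlim (\<lambda>n. 1 / real (n + 2)) (at_right 0) sequentially" by real_asymp
  ultimately have "(\<lambda>n. - Im (solution_transform (Complex x (1 / real (n + 2))))) \<longlonglongrightarrow> - Im (of_real \<rho> * (\<i> - of_real (f x)))"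
    by (rule filterlim_compose)
  then have p: "pressure x = - \<rho>" using x by (simp add: pressure_def limI)
  show "pressure x < 0" using p \<rho> by simp
  have "of_real (pressure x) * (of_real (f x) - \<i>) = of_real \<rho> * (\<i> - of_real (f x))"
    using p by (simp add: algebra_simps)
  with l show "((\<lambda>e. solution_transform (Complex x e)) \<longlongrightarrow> of_real (pressure x) * (of_real (f x) - \<i>)) (at_right 0)"
    by simp
qed

lemma AE_pressure_boundary:
  "AE x in lborel. x \<in> {-1<..<1} \<longrightarrow> pressure x < 0 \<and>
     ((\<lambda>e. solution_transform (Complex x e)) \<longlongrightarrow> of_real (pressure x) * (of_real (f x) - \<i>)) (at_right 0)"
  using regular by eventually_elim (use pressure_boundary in blast)

lemma pressure_nonpos: "AE x in lborel. pressure x \<le> 0"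
  using AE_pressure_boundary
proof eventually_elim
  case (elim x)
  then show ?case using pressure_outside[of x] by (cases "x \<in> {-1<..<1}") auto
qed

lemma norm_pressure_le: "\<bar>p\<bar> \<le> norm (of_real p * (of_real a - \<i>))" for p a :: real
proof -
  have "1 \<le> norm (of_real a - \<i>)" using abs_Im_le_cmod[of "of_real a - \<i>"] by simp
  then have "\<bar>p\<bar> * 1 \<le> \<bar>p\<bar> * norm (of_real a - \<i>)" by (intro mult_left_mono) auto
  then show ?thesis by (simp add: norm_mult)
qed

text \<open>
  The bounds by powers of order \<open>1 - margin\<close> pass to the limit, and such a power remains integrable after
  raising it to a power slightly above one.
\<close>
lemma pressure_Lp:
  obtains p where "1 < p" "integrable lborel (\<lambda>x. \<bar>pressure x\<bar> powr p)"
proof -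
  define \<beta> where "\<beta> = 1 - margin"
  have \<beta>: "0 < \<beta>" "\<beta> < 1" using margin by (auto simp: \<beta>_def)
  define p where "p = (1 + 1 / \<beta>) / 2"
  have p: "1 < p" "\<beta> * p < 1" using \<beta> by (auto simp: p_def field_simps)
  obtain T C where T: "finite T" "0 \<le> C"
    and b: "\<And>x e. x \<in> {-2..2} \<Longrightarrow> x \<notin> T \<Longrightarrow> 0 < e \<Longrightarrow> e < 1 \<Longrightarrow>
       \<exists>c\<in>T. norm (solution_transform (Complex x e)) \<le> C * (indicator {c-1..c+1} x * \<bar>x - c\<bar> powr - (1 - margin))"
    by (rule solution_transform_global_bound) blast
  define w where "w = (\<lambda>c x. C * (indicator {c-1..c+1} x * \<bar>x - c\<bar> powr - \<beta>))"
  have w0: "0 \<le> w c x" for c x using T by (simp add: w_def)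
  have wp: "w c x powr p = C powr p * (indicator {c-1..c+1} x * \<bar>x - c\<bar> powr - (\<beta> * p))" for c x
    using T p by (auto simp: w_def powr_mult powr_powr indicator_def)
  have wi: "integrable lborel (\<lambda>x. w c x powr p)" for c
    unfolding wp using p by (intro integrable_mult_right integral_abs_powr_singularity) auto
  have "AE x in lborel. x \<notin> T" using T(1) by (intro AE_not_in) (simp add: finite_imp_null_set_lborel)
  then have bound: "AE x in lborel. \<bar>pressure x\<bar> powr p \<le> (\<Sum>c\<in>T. w c x powr p)"
    using AE_pressure_boundary
  proof eventually_elim
    case (elim x)
    show ?case
    proof (cases "x \<in> {-1<..<1}")
      case False
      then show ?thesis by (simp add: pressure_outside sum_nonneg)
    next
      case True
      have "\<exists>c\<in>T. \<bar>pressure x\<bar> \<le> w c x"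
      proof (rule ccontr)
        assume "\<not> ?thesis"
        then have less: "\<forall>c\<in>T. w c x < norm (of_real (pressure x) * (of_real (f x) - \<i>))"
          using norm_pressure_le[of "pressure x" "f x"] by (auto intro: less_le_trans simp: not_le)
        have "((\<lambda>e. norm (solution_transform (Complex x e))) \<longlongrightarrow> norm (of_real (pressure x) * (of_real (f x) - \<i>))) (at_right 0)"
          using elim True by (intro tendsto_norm) auto
        then have "\<forall>c\<in>T. \<forall>\<^sub>F e in at_right 0. w c x < norm (solution_transform (Complex x e))"
          using less by (auto dest: order_tendstoD)
        then have "\<forall>\<^sub>F e in at_right 0. \<forall>c\<in>T. w c x < norm (solution_transform (Complex x e))"
          using T(1) by (simp add: eventually_ball_finite)
        moreover have "eventually (\<lambda>e::real. e < 1) (at_right 0)"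
          by (rule eventually_at_right_field[THEN iffD2]) (auto intro: exI[of _ 1])
        moreover note eventually_at_right_less[of "0::real"]
        ultimately have "\<forall>\<^sub>F e in at_right (0::real). False"
        proof eventually_elim
          case (elim e)
          then show ?case using b[of x e] True \<open>x \<notin> T\<close> by (force simp: w_def \<beta>_def)
        qed
        then show False by (simp add: trivial_limit_at_right_real)
      qed
      then obtain c where c: "c \<in> T" "\<bar>pressure x\<bar> \<le> w c x" by blast
      then have "\<bar>pressure x\<bar> powr p \<le> w c x powr p" using p by (intro powr_mono2) auto
      also have "\<dots> \<le> (\<Sum>c\<in>T. w c x powr p)" using T c by (intro member_le_sum[of c T]) auto
      finally show ?thesis .
    qed
  qed
  have "integrable lborel (\<lambda>x. \<bar>pressure x\<bar> powr p)"
  proof (rule Bochner_Integration.integrable_bound)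
    show "integrable lborel (\<lambda>x. \<Sum>c\<in>T. w c x powr p)" using wi by (intro Bochner_Integration.integrable_sum)
    show "AE x in lborel. norm (\<bar>pressure x\<bar> powr p) \<le> norm (\<Sum>c\<in>T. w c x powr p)"
      using bound by eventually_elim (simp add: order_trans[OF _ abs_ge_self])
  qed measurable
  with p(1) show ?thesis by (rule that)
qed

lemma pressure_mild_charge: obtains s M where "mild_charge pressure s M"
proof -
  obtain p where p: "1 < p" "integrable lborel (\<lambda>x. \<bar>pressure x\<bar> powr p)" by (rule pressure_Lp)
  from mild_charge_of_Lp[OF pressure_measurable pressure_outside p] that show ?thesis by blast
qed

lemma pressure_charge: "charge pressure"
  using pressure_mild_charge mild_charge.axioms(1) by metis

lemma solution_transform_outside_tendsto:
  assumes "1 < \<bar>x\<bar>"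
  shows "((\<lambda>e. Im (solution_transform (Complex x e))) \<longlongrightarrow> 0) (at_right 0)"
proof -
  define r where "r = (LINT y|lborel. angle y / (x - y))"
  have "((\<lambda>e. log_ratio (Complex x e)) \<longlongrightarrow> of_real pi * of_real (r / pi)) (at_right 0)"
    unfolding log_ratio_cauchy_transform r_def
    by (intro tendsto_intros charge.cauchy_transform_outside_tendsto[OF angle_charge assms])
  then have "((\<lambda>e. Im (solution_transform (Complex x e))) \<longlongrightarrow>
      Im (- of_real (P / pi) * exp (- (of_real pi * of_real (r / pi))) / (of_real x - 1))) (at_right 0)"
    unfolding solution_transform_def using assms
    by (intro tendsto_intros Complex_tendsto_at_right_0) (auto simp: complex_eq_iff)
  moreover have "- of_real (P / pi) * exp (- (of_real pi * of_real (r / pi))) / (of_real x - 1)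
       = complex_of_real (- (P / pi) * exp (- (pi * (r / pi))) / (x - 1))"
    by (simp add: exp_of_real[symmetric] del: exp_of_real)
  ultimately have "((\<lambda>e. Im (solution_transform (Complex x e))) \<longlongrightarrow>
      Im (complex_of_real (- (P / pi) * exp (- (pi * (r / pi))) / (x - 1)))) (at_right 0)" by (simp only:)
  then show ?thesis by (simp only: Im_complex_of_real)
qed

text \<open>
  Outside the interval the explicit function has real boundary values, so Cauchy's formula for the half
  plane only sees the interval.
\<close>
theorem solution_transform_eq_cauchy_transform:
  assumes z: "0 < Im z"
  shows "solution_transform z = cauchy_transform pressure z"
proof -
  obtain g where g: "integrable lborel (\<lambda>x. g x / (1 + \<bar>x\<bar>))"
    and dom: "\<And>e. 0 < e \<Longrightarrow> e < 1 \<Longrightarrow> AE x in lborel. norm (solution_transform (Complex x e)) \<le> g x"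
    by (rule solution_transform_dominated) blast
  have lim: "AE x in lborel. ((\<lambda>e. Im (solution_transform (Complex x e))) \<longlongrightarrow> - pressure x) (at_right 0)"
    using AE_pressure_boundary AE_lborel_singleton[of 1] AE_lborel_singleton[of "-1"]
  proof eventually_elim
    case (elim x)
    show ?case
    proof (cases "x \<in> {-1<..<1}")
      case True
      then have "((\<lambda>e. Im (solution_transform (Complex x e))) \<longlongrightarrow> Im (of_real (pressure x) * (of_real (f x) - \<i>))) (at_right 0)"
        using elim by (intro tendsto_intros) auto
      then show ?thesis by simp
    next
      case False
      then have "1 < \<bar>x\<bar>" using elim by auto
      then show ?thesis using solution_transform_outside_tendsto False by (simp add: pressure_outside)
    qed
  qed
  have "solution_transform z = (LINT x|lborel. of_real (- pressure x) / (of_real x - z)) / of_real pi"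
    by (rule half_plane_Cauchy_formula[OF holomorphic_solution_transform solution_transform_decay _ dom g lim _ z])
       (use P in auto)
  also have "(\<lambda>x. of_real (- pressure x) / (of_real x - z)) = (\<lambda>x. of_real (pressure x) / (z - of_real x))"
    by (rule ext) (metis minus_diff_eq minus_divide_divide of_real_minus)
  finally show ?thesis by (simp add: cauchy_transform_def)
qed

text \<open>Both sides of \<open>solution_transform_eq_cauchy_transform\<close> are compared at infinity.\<close>
lemma pressure_mass: "(LINT x|lborel. pressure x) = - P"
proof -
  let ?z = "\<lambda>n. \<i> * complex_of_real (real (Suc n))"
  have zI: "0 < Im (?z n)" for n by simp
  have nz: "norm (?z n) = real (Suc n)" for n by (simp add: norm_mult del: of_nat_Suc)
  have l1: "(\<lambda>n. ?z n * cauchy_transform pressure (?z n)) \<longlonglongrightarrow> of_real ((LINT y|lborel. pressure y) / pi)"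
    using charge.cauchy_transform_mass[OF pressure_charge] by (simp del: of_nat_Suc)
  have lr: "(\<lambda>n. log_ratio (?z n)) \<longlonglongrightarrow> 0"
  proof (rule Lim_null_comparison)
    show "(\<lambda>n. 2 / (real (Suc n) - 1)) \<longlonglongrightarrow> 0" by real_asymp
    show "\<forall>\<^sub>F n in sequentially. norm (log_ratio (?z n)) \<le> 2 / (real (Suc n) - 1)"
      using eventually_gt_at_top[of 0]
    proof eventually_elim
      case (elim n)
      have "norm (log_ratio (?z n)) \<le> (LINT y|lborel. \<bar>angle y\<bar>) / (norm (?z n) - 1)"
        using charge.norm_cauchy_transform_le[OF angle_charge, of "?z n"] elim unfolding nz
        by (simp add: log_ratio_cauchy_transform norm_mult field_simps)
      also have "\<dots> \<le> 2 / (norm (?z n) - 1)"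
        using integral_angle_le elim unfolding nz by (intro divide_right_mono) auto
      finally show ?case unfolding nz .
    qed
  qed
  have l3: "(\<lambda>n. ?z n / (?z n - 1)) \<longlonglongrightarrow> 1"
  proof -
    have "(\<lambda>n. 1 / (?z n - 1)) \<longlonglongrightarrow> 0"
    proof (rule Lim_null_comparison)
      show "(\<lambda>n. 1 / real (Suc n)) \<longlonglongrightarrow> 0" by real_asymp
      have "norm (1 / (?z n - 1)) \<le> 1 / real (Suc n)" for n
        using abs_Im_le_cmod[of "?z n - 1"] by (simp add: norm_divide frac_le)
      then show "\<forall>\<^sub>F n in sequentially. norm (1 / (?z n - 1)) \<le> 1 / real (Suc n)" by simp
    qed
    then have "(\<lambda>n. 1 + 1 / (?z n - 1)) \<longlonglongrightarrow> 1 + 0" by (intro tendsto_intros)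
    moreover have "1 + 1 / (?z n - 1) = ?z n / (?z n - 1)" for n
    proof -
      have "?z n - 1 \<noteq> 0" by (simp add: complex_eq_iff)
      then show ?thesis by (simp add: divide_simps)
    qed
    ultimately show ?thesis by simp
  qed
  have "(\<lambda>n. - of_real (P / pi) * exp (- log_ratio (?z n)) * (?z n / (?z n - 1))) \<longlonglongrightarrow> - of_real (P / pi) * exp (- 0) * 1"
    by (intro tendsto_intros lr l3)
  moreover have "- of_real (P / pi) * exp (- log_ratio (?z n)) * (?z n / (?z n - 1)) = ?z n * cauchy_transform pressure (?z n)" for n
    unfolding solution_transform_eq_cauchy_transform[OF zI, symmetric] solution_transform_def by simp
  ultimately have "(\<lambda>n. ?z n * cauchy_transform pressure (?z n)) \<longlonglongrightarrow> - of_real (P / pi)" by simp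
  from LIMSEQ_unique[OF l1 this] have "complex_of_real ((LINT y|lborel. pressure y) / pi) = of_real (- (P / pi))" by simp
  then have "(LINT y|lborel. pressure y) / pi = - (P / pi)" by (simp only: of_real_eq_iff)
  then have "(LINT y|lborel. pressure y) / pi * pi = - (P / pi) * pi" by (rule arg_cong)
  then show ?thesis by simp
qed

text \<open>
  The real part of the transform is the derivative of the regularised potential, and it converges, with a
  majorant, to \<open>f\<close> times the pressure.
\<close>
lemma pressure_equation:
  assumes "charge (\<lambda>x. f x * pressure x)" and x: "x \<in> {-1..1}"
  shows "log_potential pressure x = log_potential pressure (-1) + primitive (\<lambda>x. f x * pressure x) x"
proof -
  obtain s M where "mild_charge pressure s M" by (rule pressure_mild_charge)
  then interpret p: mild_charge pressure s M .
  obtain g where g: "integrable lborel (\<lambda>x. indicator {-1..1} x * g x)" "\<And>x. 0 \<le> g x"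
    and dom: "\<And>e. 0 < e \<Longrightarrow> e < 1 \<Longrightarrow> AE x in lborel. norm (solution_transform (Complex x e)) \<le> g x"
    by (rule solution_transform_dominated) blast
  let ?s = "\<lambda>e y. if 0 < e then indicator {-1..x} y * Re (solution_transform (Complex y e)) else 0"
  have "((\<lambda>e. LINT y|lborel. ?s e y) \<longlongrightarrow> (LINT y|lborel. (f y * pressure y) * indicator {..x} y)) (at_right 0)"
  proof (rule integral_tendsto_at_right_0(1)[OF _ _ g(1)])
    show "?s e \<in> borel_measurable lborel" for e
    proof (cases "0 < e")
      case True
      have [measurable]: "(\<lambda>y. Re (solution_transform (Complex y e))) \<in> borel_measurable borel"
        by (intro borel_measurable_continuous_onI continuous_intros continuous_solution_transform_line True)
      show ?thesis using True by simp
    qed simp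
    show "AE y in lborel. norm (?s e y) \<le> indicator {-1..1} y * g y" if "0 < e" "e < 1" for e
      using dom[OF that]
    proof eventually_elim
      case (elim y)
      then have "\<bar>Re (solution_transform (Complex y e))\<bar> \<le> g y"
        using abs_Re_le_cmod[of "solution_transform (Complex y e)"] by linarith
      then show ?case using that x g(2)[of y] by (auto simp: indicator_def)
    qed
    show "AE y in lborel. ((\<lambda>e. ?s e y) \<longlongrightarrow> (f y * pressure y) * indicator {..x} y) (at_right 0)"
      using AE_pressure_boundary AE_lborel_singleton[of 1] AE_lborel_singleton[of "-1"]
    proof eventually_elim
      case (elim y)
      show ?case
      proof (cases "y \<in> {-1<..<1}")
        case True
        then have "((\<lambda>e. indicator {-1..x} y * Re (solution_transform (Complex y e))) \<longlongrightarrow>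
            indicator {-1..x} y * Re (of_real (pressure y) * (of_real (f y) - \<i>))) (at_right 0)"
          using elim by (intro tendsto_intros) auto
        moreover have "indicator {-1..x} y * Re (of_real (pressure y) * (of_real (f y) - \<i>)) = (f y * pressure y) * indicator {..x} y"
          using True by (auto simp: indicator_def)
        ultimately have "((\<lambda>e. indicator {-1..x} y * Re (solution_transform (Complex y e))) \<longlongrightarrow> (f y * pressure y) * indicator {..x} y) (at_right 0)"
          by (simp only:)
        then show ?thesis
          by (rule Lim_transform_eventually) (use eventually_at_right_less[of 0] in \<open>eventually_elim, simp\<close>)
      next
        case False
        then have "y \<notin> {-1..x}" using elim x by auto
        then have "(\<lambda>e. ?s e y) = (\<lambda>_. 0)" by (auto simp: indicator_def)
        then show ?thesis using False by (simp add: pressure_outside)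
      qed
    qed
  qed measurable
  moreover have "((\<lambda>e. LINT y|lborel. ?s e y) \<longlongrightarrow> log_potential pressure x - log_potential pressure (-1)) (at_right 0)"
  proof -
    have l: "((\<lambda>e. smoothed_log_potential pressure e x - smoothed_log_potential pressure e (-1)) \<longlongrightarrow> log_potential pressure x - log_potential pressure (-1)) (at_right 0)"
      by (intro tendsto_intros tendsto_uniform_limitI[OF p.uniform_limit_smoothed[of UNIV]]) auto
    have eq: "(LINT y|lborel. ?s e y) = smoothed_log_potential pressure e x - smoothed_log_potential pressure e (-1)" if e: "0 < e" for e
      using p.integral_Re_cauchy_transform[OF e, of "-1" x] x e
      by (simp add: solution_transform_eq_cauchy_transform)
    show ?thesis
    proof (rule Lim_transform_eventually[OF l])
      show "\<forall>\<^sub>F e in at_right 0. smoothed_log_potential pressure e x - smoothed_log_potential pressure e (-1) = (LINT y|lborel. ?s e y)"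
        using eventually_at_right_less[of 0] by eventually_elim (rule eq[symmetric])
    qed
  qed
  ultimately have "(LINT y|lborel. (f y * pressure y) * indicator {..x} y) = log_potential pressure x - log_potential pressure (-1)"
    by (rule tendsto_unique[OF trivial_limit_at_right_real])
  then show ?thesis by (simp add: primitive_def)
qed

end

section \<open>Uniqueness of the pressure\<close>

text \<open>
  The map \<open>w \<mapsto> (w - 1) / (w + 1)\<close> is bounded on the right half plane and real on the positive half
  line including its endpoints, so the square root of a quotient \<open>p / q\<close> is sent to almost real
  values as soon as \<open>p\<close> is almost nonnegative, even if \<open>p\<close> tends to zero or is unbounded.
\<close>
lemma Im_cayley_csqrt_tendsto:
  fixes p q :: "real \<Rightarrow> complex"
  assumes p: "((\<lambda>e. norm (p e) - Re (p e)) \<longlongrightarrow> 0) F"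
    and q: "(q \<longlongrightarrow> of_real q0) F" and q0: "0 < q0"
  shows "((\<lambda>e. Im ((csqrt (p e / q e) - 1) / (csqrt (p e / q e) + 1))) \<longlongrightarrow> 0) F"
proof -
  have bound: "(Im ((csqrt (P / Q) - 1) / (csqrt (P / Q) + 1)))\<^sup>2 \<le> 2 * q0 * (norm P - Re P) / (norm Q)\<^sup>2 + 4 * norm (Q - of_real q0) / norm Q"
    if Q: "Q \<noteq> 0" for P Q :: complex
  proof -
    define w where "w = csqrt (P / Q)"
    have w2: "w\<^sup>2 = P / Q" by (simp add: w_def)
    have Rew: "0 \<le> Re w" using csqrt_principal[of "P / Q"] by (auto simp: w_def)
    have n2: "(norm w)\<^sup>2 = norm P / norm Q" by (simp only: norm_power[symmetric] w2 norm_divide)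
    have nw1: "1 + (norm w)\<^sup>2 \<le> (norm (w + 1))\<^sup>2"
      using Rew by (simp only: cmod_power2) (simp add: power2_eq_square algebra_simps)
    have w1: "w + 1 \<noteq> 0" using Rew by (auto simp: complex_eq_iff)
    have Im: "Im ((w - 1) / (w + 1)) = 2 * Im w / (norm (w + 1))\<^sup>2"
    proof -
      have "(w - 1) / (w + 1) = (w - 1) * cnj (w + 1) / of_real ((norm (w + 1))\<^sup>2)"
        using complex_div_cnj[of "w - 1" "w + 1"] by (simp only: of_real_power)
      then have "Im ((w - 1) / (w + 1)) = Im ((w - 1) * cnj (w + 1)) / (norm (w + 1))\<^sup>2"
        by (simp only: Im_divide_of_real)
      moreover have "Im ((w - 1) * cnj (w + 1)) = (Re w - 1) * (- Im w) + Im w * (Re w + 1)"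
        by (simp only: times_complex.sel cnj.sel minus_complex.sel plus_complex.sel one_complex.sel diff_0_right add_0_right)
      moreover have "(Re w - 1) * (- Im w) + Im w * (Re w + 1) = 2 * Im w" by algebra
      ultimately show ?thesis by (simp only:)
    qed
    have Imw: "2 * (Im w)\<^sup>2 = norm P / norm Q - Re (P / Q)"
    proof -
      have "Re (w\<^sup>2) = (Re w)\<^sup>2 - (Im w)\<^sup>2" by (simp add: power2_eq_square)
      moreover have "(norm w)\<^sup>2 = (Re w)\<^sup>2 + (Im w)\<^sup>2" by (rule cmod_power2)
      ultimately show ?thesis using n2 w2 by simp
    qed
    let ?d = "norm P + norm Q"
    have nQ: "0 < norm Q" using Q by simp
    have d: "0 < ?d" using nQ by (simp add: add_nonneg_pos)
    have ReQ: "Re (P / Q) = Re (P * cnj Q) / (norm Q)\<^sup>2"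
      by (simp add: complex_div_cnj[of P Q])
    have num: "norm P * norm Q - Re (P * cnj Q) \<le> 2 * norm P * norm (Q - of_real q0) + q0 * (norm P - Re P)"
    proof -
      have "P * cnj Q = P * cnj (Q - of_real q0) + of_real q0 * P" by (simp add: algebra_simps)
      then have "Re (P * cnj Q) = Re (P * cnj (Q - of_real q0)) + q0 * Re P" by simp
      moreover have "- (norm P * norm (Q - of_real q0)) \<le> Re (P * cnj (Q - of_real q0))"
        using abs_Re_le_cmod[of "P * cnj (Q - of_real q0)"] by (simp only: norm_mult complex_mod_cnj)
      moreover have "norm P * norm Q \<le> norm P * (norm (Q - of_real q0) + q0)"
        using norm_triangle_ineq[of "Q - of_real q0" "of_real q0"] q0 by (intro mult_left_mono) auto
      ultimately show ?thesis by (simp add: algebra_simps)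
    qed
    have "(Im ((w - 1) / (w + 1)))\<^sup>2 = 4 * (Im w)\<^sup>2 / ((norm (w + 1))\<^sup>2)\<^sup>2"
      unfolding Im by (simp add: power_divide power_mult_distrib)
    also have "\<dots> \<le> 4 * (Im w)\<^sup>2 / (1 + (norm w)\<^sup>2)\<^sup>2"
    proof -
      have "(1 + (norm w)\<^sup>2)\<^sup>2 \<le> ((norm (w + 1))\<^sup>2)\<^sup>2" using nw1 by (intro power_mono) auto
      moreover have "0 < 1 + (norm w)\<^sup>2" by (simp add: add_pos_nonneg)
      ultimately show ?thesis by (intro divide_left_mono mult_pos_pos) (auto intro: less_le_trans zero_less_power)
    qed
    also have "\<dots> = 2 * (norm P / norm Q - Re (P / Q)) / (1 + norm P / norm Q)\<^sup>2"
      unfolding Imw[symmetric] n2 by simp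
    also have "\<dots> = 2 * (norm P * norm Q - Re (P * cnj Q)) / ?d\<^sup>2"
    proof -
      have "1 + norm P / norm Q = ?d / norm Q" using nQ by (simp add: field_simps)
      moreover have "norm P / norm Q - Re (P / Q) = (norm P * norm Q - Re (P * cnj Q)) / (norm Q)\<^sup>2"
        unfolding ReQ using nQ by (simp add: field_simps power2_eq_square)
      ultimately show ?thesis using nQ by (simp add: power_divide)
    qed
    also have "\<dots> \<le> 2 * (2 * norm P * norm (Q - of_real q0) + q0 * (norm P - Re P)) / ?d\<^sup>2"
      using num by (intro divide_right_mono mult_left_mono) auto
    also have "\<dots> = 4 * norm (Q - of_real q0) * (norm P / ?d) * (1 / ?d) + 2 * q0 * (norm P - Re P) * (1 / ?d\<^sup>2)"
    proof -
      have "2 * (2 * a * b + c * r) / d\<^sup>2 = 4 * b * (a / d) * (1 / d) + 2 * c * r * (1 / d\<^sup>2)"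
        for a b c d r :: real
        by (simp add: power2_eq_square add_divide_distrib mult_ac)
      then show ?thesis .
    qed
    also have "\<dots> \<le> 4 * norm (Q - of_real q0) * 1 * (1 / norm Q) + 2 * q0 * (norm P - Re P) * (1 / (norm Q)\<^sup>2)"
    proof (intro add_mono mult_mono mult_left_mono)
      show "norm P / ?d \<le> 1" using d by simp
      show "1 / ?d \<le> 1 / norm Q" using nQ by (intro divide_left_mono) (auto intro!: mult_pos_pos add_nonneg_pos)
      have "(norm Q)\<^sup>2 \<le> ?d\<^sup>2" by (intro power_mono) auto
      then show "1 / ?d\<^sup>2 \<le> 1 / (norm Q)\<^sup>2" using nQ d by (intro divide_left_mono mult_pos_pos) auto
      show "0 \<le> 2 * q0 * (norm P - Re P)" using q0 complex_Re_le_cmod[of P] by simp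
    qed (use d q0 complex_Re_le_cmod[of P] in auto)
    finally show ?thesis by (simp add: w_def)
  qed
  let ?B = "\<lambda>e. Im ((csqrt (p e / q e) - 1) / (csqrt (p e / q e) + 1))"
  have "((\<lambda>e. 2 * q0 * (norm (p e) - Re (p e)) / (norm (q e))\<^sup>2 + 4 * norm (q e - of_real q0) / norm (q e)) \<longlongrightarrow>
      2 * q0 * 0 / (norm (complex_of_real q0))\<^sup>2 + 4 * norm (complex_of_real q0 - of_real q0) / norm (complex_of_real q0)) F"
    using q0 by (intro tendsto_intros p q) auto
  then have l: "((\<lambda>e. 2 * q0 * (norm (p e) - Re (p e)) / (norm (q e))\<^sup>2 + 4 * norm (q e - of_real q0) / norm (q e)) \<longlongrightarrow> 0) F"
    by simp
  have "eventually (\<lambda>e. q e \<noteq> 0) F" using tendsto_imp_eventually_ne[OF q] q0 by simp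
  then have "eventually (\<lambda>e. norm ((?B e)\<^sup>2) \<le> 2 * q0 * (norm (p e) - Re (p e)) / (norm (q e))\<^sup>2 + 4 * norm (q e - of_real q0) / norm (q e)) F"
    by eventually_elim (use bound in simp)
  from Lim_null_comparison[OF this l] have "((\<lambda>e. (?B e)\<^sup>2) \<longlongrightarrow> 0) F" .
  then have "((\<lambda>e. sqrt ((?B e)\<^sup>2)) \<longlongrightarrow> sqrt 0) F" by (rule tendsto_real_sqrt)
  then show ?thesis by (simp add: tendsto_rabs_zero_iff)
qed

context charge
begin

lemma Im_cauchy_transform_pos:
  assumes neg: "AE y in lborel. t y \<le> 0" and mass: "(LINT y|lborel. t y) \<noteq> 0" and z: "0 < Im z"
  shows "0 < Im (cauchy_transform t z)"
proof -
  obtain x e where ze: "z = Complex x e" "0 < e" using z by (metis complex.exhaust_sel)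
  let ?k = "\<lambda>y. e / ((x - y)\<^sup>2 + e\<^sup>2)"
  have k: "0 < ?k y" for y using ze by (simp add: add_nonneg_pos)
  have "\<bar>?k y\<bar> \<le> 1 / e" for y
  proof -
    have "e / ((x - y)\<^sup>2 + e\<^sup>2) \<le> e / e\<^sup>2" using ze by (intro divide_left_mono) (auto simp: add_nonneg_pos)
    then show ?thesis using ze k[of y] by (simp add: power2_eq_square)
  qed
  then have i: "integrable lborel (\<lambda>y. t y * ?k y)" using integrable_mult_bounded[of ?k "1 / e"] by simp
  have nn: "AE y in lborel. 0 \<le> - (t y * ?k y)"
    using neg
  proof eventually_elim
    case (elim y)
    show ?case using mult_nonpos_nonneg[OF elim less_imp_le[OF k[of y]]] by (simp only: neg_0_le_iff_le)
  qed
  have "(LINT y|lborel. - (t y * ?k y)) \<noteq> 0"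
  proof
    assume "(LINT y|lborel. - (t y * ?k y)) = 0"
    then have "AE y in lborel. - (t y * ?k y) = 0"
      using integral_nonneg_eq_0_iff_AE[of lborel "\<lambda>y. - (t y * ?k y)"] i nn by simp
    then have "AE y in lborel. t y = 0" by eventually_elim (use k less_imp_neq in force)
    then have "(LINT y|lborel. t y) = 0" by (rule integral_eq_zero_AE)
    then show False using mass by simp
  qed
  moreover have "0 \<le> (LINT y|lborel. - (t y * ?k y))" using nn by (rule integral_nonneg_AE)
  ultimately have "0 < - (LINT y|lborel. t y * ?k y)" by simp
  then have "0 < - (LINT y|lborel. t y * ?k y) / pi" by (rule divide_pos_pos) simp
  then show ?thesis unfolding ze(1) Im_cauchy_transform[OF ze(2)] .
qed

lemma holomorphic_cauchy_transform: "cauchy_transform t holomorphic_on {z. 0 < Im z}"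
  unfolding cauchy_transform_def[abs_def]
  by (intro holomorphic_intros holomorphic_cauchy_type_integral integrable) auto

lemma sign_outside:
  assumes neg: "AE y in lborel. t y \<le> 0" and mass: "(LINT y|lborel. t y) \<noteq> 0" and x: "1 < \<bar>x\<bar>"
  shows "0 < - sgn x * ((LINT y|lborel. t y / (x - y)) / pi)"
proof -
  let ?k = "\<lambda>y. if y \<in> {-1<..<1} then sgn x / (x - y) else 1"
  have k: "0 < ?k y" for y using x by (auto simp: sgn_if divide_simps split: if_splits)
  have kb: "norm (?k y) \<le> 1 / (\<bar>x\<bar> - 1)" if "y \<in> {-1<..<1}" for y
  proof -
    have "\<bar>x\<bar> - 1 \<le> \<bar>x - y\<bar>" using that by (auto simp: abs_if split: if_splits)
    moreover have "x \<noteq> 0" using x by auto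
    then have "norm (?k y) = 1 / \<bar>x - y\<bar>" using that by (simp add: abs_divide abs_sgn_eq)
    ultimately show ?thesis using x by (simp add: frac_le)
  qed
  have i: "integrable lborel (\<lambda>y. t y * ?k y)" using integrable_mult_bounded[of ?k, OF _ kb] by simp
  have nn: "AE y in lborel. 0 \<le> - (t y * ?k y)"
    using neg by eventually_elim (use k in \<open>simp only: neg_0_le_iff_le mult_nonpos_nonneg less_imp_le\<close>)
  have "(LINT y|lborel. - (t y * ?k y)) \<noteq> 0"
  proof
    assume "(LINT y|lborel. - (t y * ?k y)) = 0"
    then have "AE y in lborel. - (t y * ?k y) = 0"
      using integral_nonneg_eq_0_iff_AE[of lborel "\<lambda>y. - (t y * ?k y)"] i nn by simp
    then have "AE y in lborel. t y = 0"
    proof eventually_elim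
      case (elim y)
      then have "t y = 0 \<or> ?k y = 0" by (simp only: neg_equal_0_iff_equal mult_eq_0_iff)
      then show ?case using k[of y] by linarith
    qed
    then have "(LINT y|lborel. t y) = 0" by (rule integral_eq_zero_AE)
    then show False using mass by simp
  qed
  moreover have "0 \<le> (LINT y|lborel. - (t y * ?k y))" using nn by (rule integral_nonneg_AE)
  ultimately have "0 < (LINT y|lborel. - (t y * ?k y))" by simp
  also have "(LINT y|lborel. - (t y * ?k y)) = (LINT y|lborel. - sgn x * (t y / (x - y)))"
    by (intro Bochner_Integration.integral_cong) (auto simp: support)
  also have "\<dots> = - sgn x * (LINT y|lborel. t y / (x - y))" by (rule integral_mult_right_zero)
  finally have "0 < - sgn x * (LINT y|lborel. t y / (x - y)) / pi" by (rule divide_pos_pos) simp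
  then show ?thesis by (simp only: times_divide_eq_right)
qed

end

text \<open>Both transforms are \<open>m / (pi z) + O(1 / z^2)\<close> with the common mass \<open>m\<close>.\<close>
lemma cauchy_transform_ratio_at_infinity:
  assumes t1: "charge t1" and t2: "charge t2"
    and eq: "(LINT y|lborel. t1 y) = (LINT y|lborel. t2 y)" and mass: "(LINT y|lborel. t2 y) \<noteq> 0"
  obtains R C where "0 \<le> C" "\<And>z. 0 < Im z \<Longrightarrow> R \<le> norm z \<Longrightarrow>
     norm (cauchy_transform t1 z / cauchy_transform t2 z - 1) \<le> C / norm z"
proof -
  define m where "m = \<bar>LINT y|lborel. t2 y\<bar> / pi"
  define c where "c = (\<lambda>t. (LINT y|lborel. \<bar>y * t y\<bar>) / pi)"
  have m: "0 < m" using mass by (simp add: m_def)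
  have c0: "0 \<le> c t" for t by (simp add: c_def)
  have exp: "z * cauchy_transform t z = of_real ((LINT y|lborel. t y) / pi) + cauchy_transform (\<lambda>y. y * t y) z"
    "norm (cauchy_transform (\<lambda>y. y * t y) z) \<le> 2 * c t / norm z"
    if t: "charge t" and z: "0 < Im z" "2 \<le> norm z" for t z
  proof -
    show "z * cauchy_transform t z = of_real ((LINT y|lborel. t y) / pi) + cauchy_transform (\<lambda>y. y * t y) z"
      by (rule charge.cauchy_transform_moment(1)[OF t]) (use z in auto)
    have "norm (cauchy_transform (\<lambda>y. y * t y) z) \<le> (LINT y|lborel. \<bar>y * t y\<bar>) / (pi * (norm z - 1))"
      by (rule charge.norm_cauchy_transform_le[OF charge.cauchy_transform_moment(2)[OF t, of z]]) (use z in auto)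
    also have "\<dots> = c t / (norm z - 1)" by (simp add: c_def)
    also have "\<dots> \<le> c t / (norm z / 2)" using z c0[of t] by (intro divide_left_mono mult_pos_pos) auto
    finally show "norm (cauchy_transform (\<lambda>y. y * t y) z) \<le> 2 * c t / norm z" by (simp add: mult.commute)
  qed
  define R where "R = max 2 (4 * c t2 / m)"
  show ?thesis
  proof (rule that[of "4 * (c t1 + c t2) / m" R])
    show "0 \<le> 4 * (c t1 + c t2) / m" using c0 m by simp
    fix z assume z: "0 < Im z" "R \<le> norm z"
    then have z2: "2 \<le> norm z" "4 * c t2 / m \<le> norm z" by (auto simp: R_def)
    have z0: "0 < norm z" using z2 by linarith
    let ?a = "z * cauchy_transform t1 z" and ?b = "z * cauchy_transform t2 z"
    have "2 * c t2 / norm z \<le> m / 2"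
      using z2 z0 m by (simp add: field_simps)
    moreover have "norm (complex_of_real ((LINT y|lborel. t2 y) / pi)) = m"
      by (simp only: norm_of_real m_def abs_divide) simp
    moreover have "norm a \<le> norm (a + q) + norm q" for a q :: complex
      using norm_triangle_ineq4[of "a + q" q] by simp
    note this[of "complex_of_real ((LINT y|lborel. t2 y) / pi)" "cauchy_transform (\<lambda>y. y * t2 y) z"]
    ultimately have b: "m / 2 \<le> norm ?b"
      using exp(2)[OF t2 z(1) z2(1)] unfolding exp(1)[OF t2 z(1) z2(1)] by linarith
    have "?a - ?b = cauchy_transform (\<lambda>y. y * t1 y) z - cauchy_transform (\<lambda>y. y * t2 y) z"
      using exp(1)[OF t1 z(1) z2(1)] exp(1)[OF t2 z(1) z2(1)] eq by simp
    then have "norm (?a - ?b) \<le> 2 * c t1 / norm z + 2 * c t2 / norm z"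
      using exp(2)[OF t1 z(1) z2(1)] exp(2)[OF t2 z(1) z2(1)]
      by (simp only:) (rule order_trans[OF norm_triangle_ineq4 add_mono])
    then have ab: "norm (?a - ?b) \<le> 2 * (c t1 + c t2) / norm z" by (simp add: add_divide_distrib)
    have bnz: "?b \<noteq> 0" using b m by auto
    have "cauchy_transform t1 z / cauchy_transform t2 z - 1 = (?a - ?b) / ?b"
      using bnz by (simp add: field_simps)
    then have "norm (cauchy_transform t1 z / cauchy_transform t2 z - 1) = norm (?a - ?b) / norm ?b"
      by (simp only: norm_divide)
    also have "\<dots> \<le> (2 * (c t1 + c t2) / norm z) / (m / 2)"
      using ab b m c0 z0 by (intro frac_le) auto
    also have "\<dots> = 4 * (c t1 + c t2) / m / norm z" by simp
    finally show "norm (cauchy_transform t1 z / cauchy_transform t2 z - 1) \<le> 4 * (c t1 + c t2) / m / norm z" .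
  qed
qed

text \<open>By Stieltjes inversion the transform determines the integrals over intervals.\<close>
lemma charge_eq_of_cauchy_transform_eq:
  assumes t1: "charge t1" and t2: "charge t2"
    and eq: "\<And>z. 0 < Im z \<Longrightarrow> cauchy_transform t1 z = cauchy_transform t2 z"
  shows "AE x in lborel. t1 x = t2 x"
proof (rule AE_eq_of_interval_integrals)
  show "integrable lborel t1" "integrable lborel t2" using t1 t2 by (auto simp: charge_def)
  fix x :: real
  have ind: "indicator {x<..} y * t y = indicator {x<..1} y * t y" if "charge t" for t y
    using charge.support[OF that, of y] by (auto simp: indicator_def)
  have ae: "(LINT y|lborel. indicator {x<..1} y * t y) = (LINT y|lborel. indicator {x..1} y * t y)" if "charge t" for t
  proof (rule integral_cong_AE)
    show "AE y in lborel. indicator {x<..1} y * t y = indicator {x..1} y * t y"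
      using AE_lborel_singleton[of x] by eventually_elim (auto simp: indicator_def)
  qed (use charge.borel[OF that] in auto)
  have "(LINT y|lborel. indicator {x..1} y * t1 y) = (LINT y|lborel. indicator {x..1} y * t2 y)"
  proof (cases "x \<le> 1")
    case True
    have "((\<lambda>e. LINT y|lborel. indicator {x..1} y * Im (cauchy_transform t1 (Complex y e))) \<longlongrightarrow> - (LINT y|lborel. indicator {x..1} y * t2 y)) (at_right 0)"
    proof (rule Lim_transform_eventually[OF charge.integral_Im_cauchy_transform_tendsto[OF t2 True]])
      show "\<forall>\<^sub>F e in at_right 0. (LINT y|lborel. indicator {x..1} y * Im (cauchy_transform t2 (Complex y e))) = (LINT y|lborel. indicator {x..1} y * Im (cauchy_transform t1 (Complex y e)))"
        using eventually_at_right_less[of 0] by eventually_elim (simp add: eq)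
    qed
    from tendsto_unique[OF trivial_limit_at_right_real this charge.integral_Im_cauchy_transform_tendsto[OF t1 True]]
    show ?thesis by simp
  qed simp
  then show "(LINT y|lborel. indicator {x<..} y * t1 y) = (LINT y|lborel. indicator {x<..} y * t2 y)"
    by (simp only: ind[OF t1] ind[OF t2] ae[OF t1] ae[OF t2])
qed

context slope
begin

text \<open>
  Both transforms map the upper half plane to itself, as the charges are nonpositive, so
  their quotient avoids the negative half line and has a square root. Its boundary values are
  nonnegative: along the interval both transforms have direction \<open>i - f\<close>. After the transformation
  \<open>w \<mapsto> (w - 1) / (w + 1)\<close> one has a bounded function with real boundary values vanishing at infinity.
  The nonpositivity of \<open>t\<close> is essential: at a jump of \<open>f\<close> of the right sign the pressure vanishes like a
  power, and its product with \<open>1 + k / (x - c)\<close> is another integrable solution with the same mass.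
\<close>
theorem pressure_unique:
  assumes t: "mild_charge t s M" and ft: "charge (\<lambda>x. f x * t x)"
    and neg: "AE x in lborel. t x \<le> 0" and mass: "(LINT x|lborel. t x) = - P"
    and eq: "\<And>x. x \<in> {-1..1} \<Longrightarrow> log_potential t x = c + primitive (\<lambda>x. f x * t x) x"
  shows "AE x in lborel. t x = pressure x"
proof -
  interpret t: mild_charge t s M by (rule t)
  interpret p: charge pressure by (rule pressure_charge)
  let ?F = "cauchy_transform t" and ?G = "cauchy_transform pressure"
  have nz: "(LINT x|lborel. t x) \<noteq> 0" "(LINT x|lborel. pressure x) \<noteq> 0"
    using mass pressure_mass P by auto
  have F: "0 < Im (?F z)" and G: "0 < Im (?G z)" if "0 < Im z" for z
    using t.Im_cauchy_transform_pos[OF neg nz(1) that] p.Im_cauchy_transform_pos[OF pressure_nonpos nz(2) that] by auto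
  have G0: "?G z \<noteq> 0" if "0 < Im z" for z using G[OF that] by auto
  have slit: "?F z / ?G z \<notin> \<real>\<^sub>\<le>\<^sub>0" if "0 < Im z" for z
  proof
    assume "?F z / ?G z \<in> \<real>\<^sub>\<le>\<^sub>0"
    then obtain r where "?F z / ?G z = of_real r" "r \<le> 0" by (auto elim!: nonpos_Reals_cases)
    then have "?F z = of_real r * ?G z" using G0[OF that] by (simp add: field_simps)
    then have "Im (?F z) = r * Im (?G z)" by simp
    also have "\<dots> \<le> 0" using G[OF that] \<open>r \<le> 0\<close> by (simp add: mult_nonpos_nonneg)
    finally show False using F[OF that] by simp
  qed
  define w where "w = (\<lambda>z. csqrt (?F z / ?G z))"
  define B where "B = (\<lambda>z. (w z - 1) / (w z + 1))"
  have Rew: "0 \<le> Re (w z)" for z using csqrt_principal[of "?F z / ?G z"] by (auto simp: w_def)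
  have w1: "1 \<le> norm (w z + 1)" for z using Rew[of z] abs_Re_le_cmod[of "w z + 1"] by simp
  then have w1': "w z + 1 \<noteq> 0" for z by (metis norm_zero not_one_le_zero)
  have holB: "B holomorphic_on {z. 0 < Im z}"
  proof -
    have "(\<lambda>z. ?F z / ?G z) holomorphic_on {z. 0 < Im z}"
      using G0 by (intro holomorphic_intros t.holomorphic_cauchy_transform p.holomorphic_cauchy_transform) auto
    then have "w holomorphic_on {z. 0 < Im z}"
      unfolding w_def using slit by (intro holomorphic_on_csqrt') auto
    then show ?thesis unfolding B_def using w1' by (intro holomorphic_intros) auto
  qed
  have B1: "norm (B z) \<le> 1" for z
  proof -
    have "(norm (w z - 1))\<^sup>2 \<le> (norm (w z + 1))\<^sup>2"
      using Rew[of z] by (simp only: cmod_power2) (simp add: power2_eq_square algebra_simps)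
    then have "norm (w z - 1) \<le> norm (w z + 1)" by (rule power2_le_imp_le) simp
    then show ?thesis using w1' by (simp add: B_def norm_divide divide_le_eq_1)
  qed
  \<comment> \<open>From \<open>w\<^sup>2 - 1 = (w - 1) (w + 1)\<close> the decay of the quotient at infinity passes to \<open>B\<close>.\<close>
  have B2: "norm (B z) \<le> norm (?F z / ?G z - 1)" for z
  proof -
    have "(w z)\<^sup>2 = ?F z / ?G z" by (simp add: w_def)
    then have "?F z / ?G z - 1 = (w z - 1) * (w z + 1)" by (simp add: power2_eq_square algebra_simps)
    then have "norm (?F z / ?G z - 1) = norm (w z - 1) * norm (w z + 1)" by (simp only: norm_mult)
    moreover have "norm (w z - 1) / norm (w z + 1) \<le> norm (w z - 1) * norm (w z + 1)"
    proof -
      have "norm (w z - 1) / norm (w z + 1) \<le> norm (w z - 1) / 1" using w1[of z] by (intro divide_left_mono) auto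
      also have "\<dots> \<le> norm (w z - 1) * norm (w z + 1)" using mult_left_mono[OF w1[of z], of "norm (w z - 1)"] by simp
      finally show ?thesis .
    qed
    ultimately show ?thesis by (simp add: B_def norm_divide)
  qed
  obtain R C where C: "0 \<le> C" and RC: "\<And>z. 0 < Im z \<Longrightarrow> R \<le> norm z \<Longrightarrow> norm (?F z / ?G z - 1) \<le> C / norm z"
    by (rule cauchy_transform_ratio_at_infinity[OF t.charge_axioms pressure_charge _ nz(2)])
       (use mass pressure_mass in auto)
  have decay: "norm (B z) \<le> C / norm z" if "0 < Im z" "R \<le> norm z" for z
    using order_trans[OF B2 RC[OF that]] .
  define C' where "C' = 2 + \<bar>R\<bar> + 2 * C"
  have dom: "AE x in lborel. norm (B (Complex x e)) \<le> C' * (1 / (1 + \<bar>x\<bar>))" if e: "0 < e" for e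
  proof (intro AE_I2)
    fix x :: real
    have pos: "0 < 1 + \<bar>x\<bar>" by (rule add_pos_nonneg) auto
    show "norm (B (Complex x e)) \<le> C' * (1 / (1 + \<bar>x\<bar>))"
    proof (cases "max 1 \<bar>R\<bar> \<le> \<bar>x\<bar>")
      case True
      have xz: "\<bar>x\<bar> \<le> norm (Complex x e)" using abs_Re_le_cmod[of "Complex x e"] by simp
      have "norm (B (Complex x e)) \<le> C / norm (Complex x e)" using e True xz by (intro decay) auto
      also have "\<dots> \<le> C / ((1 + \<bar>x\<bar>) / 2)" using C True xz pos by (intro divide_left_mono mult_pos_pos) auto
      also have "\<dots> = (2 * C) * (1 / (1 + \<bar>x\<bar>))" by simp
      also have "\<dots> \<le> C' * (1 / (1 + \<bar>x\<bar>))" using pos by (intro mult_right_mono) (auto simp: C'_def)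
      finally show ?thesis .
    next
      case False
      then have "\<bar>x\<bar> \<le> 1 + \<bar>R\<bar>" by (auto simp: max_def split: if_splits)
      then have "1 + \<bar>x\<bar> \<le> C'" using C by (simp add: C'_def)
      then have "1 \<le> C' / (1 + \<bar>x\<bar>)" using pos by (simp only: pos_le_divide_eq) simp
      from order_trans[OF B1 this] show ?thesis by simp
    qed
  qed
  have g: "integrable lborel (\<lambda>x. C' * (1 / (1 + \<bar>x\<bar>)) / (1 + \<bar>x\<bar>))"
    using integrable_mult_right[OF integrable_inverse_square_1_plus_abs, of C'] by simp
  have lim: "AE x in lborel. ((\<lambda>e. Im (B (Complex x e))) \<longlongrightarrow> 0) (at_right 0)"
    using regular AE_lborel_singleton[of 1] AE_lborel_singleton[of "-1"]
  proof eventually_elim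
    case (elim x)
    have rotate: "((\<lambda>e. Im (B (Complex x e))) \<longlongrightarrow> 0) (at_right 0)"
      if a: "a \<noteq> 0" and p: "((\<lambda>e. norm (a * ?F (Complex x e)) - Re (a * ?F (Complex x e))) \<longlongrightarrow> 0) (at_right 0)"
        and q: "((\<lambda>e. a * ?G (Complex x e)) \<longlongrightarrow> of_real q0) (at_right 0)" and q0: "0 < q0" for a q0
    proof -
      have "(a * ?F (Complex x e)) / (a * ?G (Complex x e)) = ?F (Complex x e) / ?G (Complex x e)" for e
        using a by simp
      with Im_cayley_csqrt_tendsto[OF p q q0] show ?thesis by (simp only: B_def w_def)
    qed
    show ?case
    proof (cases "x \<in> {-1<..<1}")
      case True
      then obtain K where K: "0 \<le> K" "\<And>y. y \<in> {-1<..<1} \<Longrightarrow> \<bar>f y - f x\<bar> \<le> K * \<bar>x - y\<bar>"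
        using elim by blast
      have Gl: "((\<lambda>e. ?G (Complex x e)) \<longlongrightarrow> of_real (pressure x) * (of_real (f x) - \<i>)) (at_right 0)"
        by (rule Lim_transform_eventually[OF pressure_boundary(2)[OF True K]])
           (use eventually_at_right_less[of 0] in \<open>auto elim!: eventually_mono simp: solution_transform_eq_cauchy_transform\<close>)
      \<comment> \<open>The factor \<open>a\<close> rotates the common boundary direction onto the positive real axis.\<close>
      define a where "a = - (of_real (f x) + \<i>)"
      have a: "a \<noteq> 0" by (simp add: a_def complex_eq_iff)
      define d where "d = (\<lambda>e. Re (?F (Complex x e)) + f x * Im (?F (Complex x e)))"
      have d: "(d \<longlongrightarrow> 0) (at_right 0)"
        unfolding d_def using K
        by (intro t.boundary_direction[OF ft _ eq True]) (auto simp: abs_minus_commute)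
      have "((\<lambda>e. norm (a * ?F (Complex x e)) - Re (a * ?F (Complex x e))) \<longlongrightarrow> 0) (at_right 0)"
      proof (rule Lim_null_comparison)
        have "((\<lambda>e. (2 * \<bar>f x\<bar> + 1) * \<bar>d e\<bar>) \<longlongrightarrow> (2 * \<bar>f x\<bar> + 1) * \<bar>0\<bar>) (at_right 0)"
          by (intro tendsto_intros d)
        then show "((\<lambda>e. (2 * \<bar>f x\<bar> + 1) * \<bar>d e\<bar>) \<longlongrightarrow> 0) (at_right 0)" by simp
        have "norm (norm (a * ?F (Complex x e)) - Re (a * ?F (Complex x e))) \<le> (2 * \<bar>f x\<bar> + 1) * \<bar>d e\<bar>" if e: "0 < e" for e
        proof -
          let ?p = "a * ?F (Complex x e)"
          have Im: "Im ?p = - d e" by (simp add: a_def d_def algebra_simps)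
          have Re: "Re ?p = (1 + (f x)\<^sup>2) * Im (?F (Complex x e)) - f x * d e"
            by (simp add: a_def d_def algebra_simps power2_eq_square)
          have "0 \<le> (1 + (f x)\<^sup>2) * Im (?F (Complex x e))" using F[of "Complex x e"] e by simp
          moreover have "f x * d e \<le> \<bar>f x\<bar> * \<bar>d e\<bar>" by (metis abs_ge_self abs_mult)
          ultimately have "- (\<bar>f x\<bar> * \<bar>d e\<bar>) \<le> Re ?p" unfolding Re by linarith
          moreover have "0 \<le> \<bar>f x\<bar> * \<bar>d e\<bar>" by simp
          ultimately have "\<bar>Re ?p\<bar> - Re ?p \<le> 2 * (\<bar>f x\<bar> * \<bar>d e\<bar>)" by linarith
          moreover have "norm ?p \<le> \<bar>Re ?p\<bar> + \<bar>d e\<bar>" using cmod_le[of ?p] Im by simp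
          moreover have "Re ?p \<le> norm ?p" by (rule complex_Re_le_cmod)
          ultimately have "norm (norm ?p - Re ?p) \<le> 2 * (\<bar>f x\<bar> * \<bar>d e\<bar>) + \<bar>d e\<bar>"
            unfolding real_norm_def by linarith
          then show ?thesis by (simp add: algebra_simps)
        qed
        then show "\<forall>\<^sub>F e in at_right 0. norm (norm (a * ?F (Complex x e)) - Re (a * ?F (Complex x e))) \<le> (2 * \<bar>f x\<bar> + 1) * \<bar>d e\<bar>"
          using eventually_at_right_less[of 0] by (auto elim!: eventually_mono)
      qed
      moreover have "((\<lambda>e. a * ?G (Complex x e)) \<longlongrightarrow> of_real (- pressure x * (1 + (f x)\<^sup>2))) (at_right 0)"
      proof -
        have "((\<lambda>e. a * ?G (Complex x e)) \<longlongrightarrow> a * (of_real (pressure x) * (of_real (f x) - \<i>))) (at_right 0)"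
          by (intro tendsto_intros Gl)
        moreover have "a * (of_real (pressure x) * (of_real (f x) - \<i>)) = of_real (- pressure x * (1 + (f x)\<^sup>2))"
          by (simp add: a_def complex_eq_iff power2_eq_square algebra_simps)
        ultimately show ?thesis by (simp only:)
      qed
      moreover have "0 < - pressure x * (1 + (f x)\<^sup>2)"
        using pressure_boundary(1)[OF True K] by (intro mult_pos_pos add_pos_nonneg) auto
      ultimately show ?thesis by (rule rotate[OF a])
    next
      case False
      then have x: "1 < \<bar>x\<bar>" using elim by auto
      let ?r = "\<lambda>t. (LINT y|lborel. t y / (x - y)) / pi"
      have pos: "0 < - sgn x * ?r t" "0 < - sgn x * ?r pressure"
        using t.sign_outside[OF neg nz(1) x] p.sign_outside[OF pressure_nonpos nz(2) x] by auto
      have "((\<lambda>e. of_real (- sgn x) * ?F (Complex x e)) \<longlongrightarrow> of_real (- sgn x) * of_real (?r t)) (at_right 0)"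
        by (intro tendsto_intros t.cauchy_transform_outside_tendsto x)
      then have l: "((\<lambda>e. of_real (- sgn x) * ?F (Complex x e)) \<longlongrightarrow> of_real (- sgn x * ?r t)) (at_right 0)"
        by (simp only: of_real_mult)
      have "((\<lambda>e. norm (of_real (- sgn x) * ?F (Complex x e)) - Re (of_real (- sgn x) * ?F (Complex x e)))
          \<longlongrightarrow> norm (complex_of_real (- sgn x * ?r t)) - Re (complex_of_real (- sgn x * ?r t))) (at_right 0)"
        by (intro tendsto_diff tendsto_norm tendsto_Re l)
      also have "norm (complex_of_real (- sgn x * ?r t)) - Re (complex_of_real (- sgn x * ?r t)) = 0"
        using pos(1) by (simp only: norm_of_real Re_complex_of_real)
      finally have p: "((\<lambda>e. norm (of_real (- sgn x) * ?F (Complex x e)) - Re (of_real (- sgn x) * ?F (Complex x e))) \<longlongrightarrow> 0) (at_right 0)" .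
      have "((\<lambda>e. of_real (- sgn x) * ?G (Complex x e)) \<longlongrightarrow> of_real (- sgn x) * of_real (?r pressure)) (at_right 0)"
        by (intro tendsto_intros p.cauchy_transform_outside_tendsto x)
      then have q: "((\<lambda>e. of_real (- sgn x) * ?G (Complex x e)) \<longlongrightarrow> of_real (- sgn x * ?r pressure)) (at_right 0)"
        by (simp only: of_real_mult)
      have "complex_of_real (- sgn x) \<noteq> 0"
      proof -
        have "x \<noteq> 0" using x by auto
        then have "sgn x \<noteq> 0" by (simp only: sgn_0_0 not_False_eq_True)
        then show ?thesis by (simp only: of_real_eq_0_iff neg_equal_0_iff_equal not_False_eq_True)
      qed
      then show ?thesis by (rule rotate[OF _ p q pos(2)])
    qed
  qed
  have "?F z = ?G z" if z: "0 < Im z" for z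
  proof -
    have "B z = (LINT x|lborel. of_real 0 / (of_real x - z)) / of_real pi"
      by (rule half_plane_Cauchy_formula[OF holB decay C dom g lim _ z]) auto
    then have "w z = 1" using w1'[of z] by (simp add: B_def)
    moreover have "(w z)\<^sup>2 = ?F z / ?G z" by (simp add: w_def)
    ultimately show ?thesis using G0[OF z] by (simp add: field_simps)
  qed
  then show ?thesis by (rule charge_eq_of_cauchy_transform_eq[OF t.charge_axioms pressure_charge])
qed

end

section \<open>Step functions, and the contact problem\<close>

lemma abel_summation:
  fixes a l :: "nat \<Rightarrow> real"
  shows "(\<Sum>i=1..Suc m. a i * (l (i - 1) - l i)) = a 1 * l 0 - a (Suc m) * l (Suc m) - (\<Sum>i=1..m. (a i - a (i + 1)) * l i)"
  by (induction m) (simp_all add: algebra_simps)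

lemma partition_mono:
  fixes \<xi> :: "nat \<Rightarrow> real"
  assumes "\<forall>i\<in>{1..n}. \<xi> (i - 1) < \<xi> i" "i \<le> j" "j \<le> n"
  shows "\<xi> i \<le> \<xi> j"
  using assms(2,3)
proof (induction j rule: dec_induct)
  case (step k)
  have "Suc k \<in> {1..n}" using step assms(3) by auto
  with assms(1) have "\<xi> (Suc k - 1) < \<xi> (Suc k)" by (rule bspec)
  moreover have "\<xi> i \<le> \<xi> k" using step by simp
  ultimately show ?case by simp
qed simp

lemma partition_cell:
  fixes \<xi> :: "nat \<Rightarrow> real"
  assumes "\<xi> 0 < x" "x < \<xi> n" "x \<notin> \<xi> ` {0..n}"
  obtains k where "k \<in> {1..n}" "\<xi> (k - 1) < x" "x < \<xi> k"
proof -
  define k where "k = (LEAST k. x < \<xi> k)"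
  have k: "x < \<xi> k" unfolding k_def by (rule LeastI[of _ n]) (rule assms)
  have kn: "k \<le> n" unfolding k_def by (rule Least_le) (rule assms)
  have k0: "0 < k" using k assms(1) by (cases k) auto
  then have "\<not> x < \<xi> (k - 1)" unfolding k_def by (intro not_less_Least) auto
  moreover have "x \<noteq> \<xi> (k - 1)" using assms(3) kn by auto
  ultimately show ?thesis using that[of k] k kn k0 by auto
qed

context slope
begin

text \<open>
  For a step function the exponent is a finite sum of logarithms, and the modulus of the boundary
  values can be read off.
\<close>
theorem pressure_step_function:
  fixes \<xi> c \<alpha> :: "nat \<Rightarrow> real"
  assumes \<xi>: "\<xi> 0 = -1" "\<xi> n = 1" and mono: "\<forall>i\<in>{1..n}. \<xi> (i - 1) < \<xi> i"
    and f: "\<And>x. x \<in> {-1<..<1} \<Longrightarrow> f x = (\<Sum>i=1..n. c i * indicator {\<xi> (i - 1)<..<\<xi> i} x)"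
    and \<alpha>: "\<And>i. \<alpha> i = arctan (c i) / pi"
  shows "AE x in lborel. x \<in> {-1<..<1} \<longrightarrow> pressure x =
      - (P * (\<Prod>i=1..n-1. \<bar>x - \<xi> i\<bar> powr (\<alpha> i - \<alpha> (i + 1))))
      / (pi * sqrt (1 + (f x)\<^sup>2) * (1 + x) powr (1/2 + \<alpha> 1) * (1 - x) powr (1/2 - \<alpha> n))"
proof -
  define \<theta> where "\<theta> = (\<lambda>i. 1 / 2 + \<alpha> i)"
  let ?S = "\<xi> ` {0..n}"
  have n: "n \<noteq> 0" using \<xi> by (cases n) auto
  then obtain m where m: "n = Suc m" by (cases n) auto
  have cell: "\<exists>k\<in>{1..n}. \<xi> (k - 1) < x \<and> x < \<xi> k" if "x \<in> {-1<..<1}" "x \<notin> ?S" for x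
  proof -
    have "\<xi> 0 < x" "x < \<xi> n" using that(1) \<xi> by auto
    from partition_cell[OF this that(2)] show ?thesis by blast
  qed
  have only: "indicator {\<xi> (i - 1)<..<\<xi> i} x = (if i = k then 1 else (0::real))"
    if "k \<in> {1..n}" "\<xi> (k - 1) < x" "x < \<xi> k" "i \<in> {1..n}" for i k x
  proof -
    consider "i = k" | "i < k" | "k < i" by linarith
    then show ?thesis
    proof cases
      case 2
      then have "\<xi> i \<le> \<xi> (k - 1)" using that by (intro partition_mono[OF mono]) auto
      then show ?thesis using 2 that by (auto simp: indicator_def)
    next
      case 3
      then have "\<xi> k \<le> \<xi> (i - 1)" using that by (intro partition_mono[OF mono]) auto
      then show ?thesis using 3 that by (auto simp: indicator_def)
    qed (use that in \<open>auto simp: indicator_def\<close>)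
  qed
  have range: "-1 \<le> \<xi> i" "\<xi> i \<le> 1" if "i \<le> n" for i
    using partition_mono[OF mono, of 0 i] partition_mono[OF mono, of i n] that \<xi> by auto
  have AE_S: "AE x in lborel. x \<notin> ?S" by (intro AE_not_in finite_imp_null_set_lborel) auto
  have angle_eq: "angle x = (\<Sum>i=1..n. \<theta> i * indicator {\<xi> (i - 1)<..<\<xi> i} x)" if "x \<notin> ?S" for x
  proof (cases "x \<in> {-1<..<1}")
    case True
    from cell[OF this that] obtain k where k: "k \<in> {1..n}" "\<xi> (k - 1) < x" "x < \<xi> k" by blast
    have pick: "(\<Sum>i=1..n. h i * indicator {\<xi> (i - 1)<..<\<xi> i} x) = h k" for h :: "nat \<Rightarrow> real"
    proof -
      have "(\<Sum>i=1..n. h i * indicator {\<xi> (i - 1)<..<\<xi> i} x) = (\<Sum>i=1..n. if i = k then h i else 0)"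
        proof (intro sum.cong refl)
        fix i assume "i \<in> {1..n}"
        then show "h i * indicator {\<xi> (i - 1)<..<\<xi> i} x = (if i = k then h i else 0)"
          by (simp only: only[OF k]) simp
      qed
      then show ?thesis using k by simp
    qed
    show ?thesis unfolding angle_inside[OF True] f[OF True] pick by (simp add: \<theta>_def \<alpha>)
  next
    case False
    have "x \<notin> {\<xi> (i - 1)<..<\<xi> i}" if "i \<in> {1..n}" for i
    proof -
      have "i \<le> n" "i - 1 \<le> n" using that by auto
      then show ?thesis using range(2)[of i] range(1)[of "i - 1"] False by auto
    qed
    then show ?thesis using False by (simp add: angle_outside)
  qed
  let ?l = "\<lambda>x e i. ln ((x - \<xi> i)\<^sup>2 + e\<^sup>2) / 2"
  have Re_eq: "Re (log_ratio (Complex x e)) = (\<Sum>i=1..n. \<theta> i * (?l x e (i - 1) - ?l x e i))" if e: "0 < e" for x e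
  proof -
    let ?\<kappa> = "\<lambda>y. (x - y) / ((x - y)\<^sup>2 + e\<^sup>2)"
    have int: "integrable lborel (\<lambda>y. indicator {a<..<b} y * ?\<kappa> y)" for a b :: real
    proof (rule Bochner_Integration.integrable_bound)
      show "integrable lborel (\<lambda>y::real. (1 / e) * indicator {a..b} y)"
        by (intro integrable_mult_right integrable_indicator_Icc)
      show "AE y in lborel. norm (indicator {a<..<b} y * ?\<kappa> y) \<le> norm ((1 / e) * indicator {a..b} y)"
        using conjugate_kernel_bound(2)[OF e] e by (intro AE_I2) (auto simp: indicator_def)
    qed measurable
    have "Re (log_ratio (Complex x e)) = (LINT y|lborel. (\<Sum>i=1..n. \<theta> i * (indicator {\<xi> (i - 1)<..<\<xi> i} y * ?\<kappa> y)))"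
      unfolding Re_log_ratio[OF e]
    proof (rule integral_cong_AE)
      show "AE y in lborel. angle y * ?\<kappa> y = (\<Sum>i=1..n. \<theta> i * (indicator {\<xi> (i - 1)<..<\<xi> i} y * ?\<kappa> y))"
        using AE_S by eventually_elim (simp only: angle_eq sum_distrib_right mult.assoc not_False_eq_True)
    qed measurable
    also have "\<dots> = (\<Sum>i=1..n. \<theta> i * (LINT y|lborel. indicator {\<xi> (i - 1)<..<\<xi> i} y * ?\<kappa> y))"
      by (subst Bochner_Integration.integral_sum) (intro integrable_mult_right int, simp only: integral_mult_right_zero)
    also have "\<dots> = (\<Sum>i=1..n. \<theta> i * (?l x e (i - 1) - ?l x e i))"
    proof (intro sum.cong refl arg_cong2[of _ _ _ _ times])
      fix i assume i: "i \<in> {1..n}"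
      have "\<xi> (i - 1) \<le> \<xi> i" using mono i by (auto intro: less_imp_le)
      then have "\<bar>(LINT y|lborel. indicator {\<xi> (i - 1)<..<\<xi> i} y * (1 * ?\<kappa> y)) - 1 * (?l x e (i - 1) - ?l x e i)\<bar> \<le> 0 * (\<xi> i - \<xi> (i - 1))"
        by (intro conjugate_integral_piece[where B = 1 and \<theta> = "\<lambda>_. 1"]) (use e in auto)
      then show "(LINT y|lborel. indicator {\<xi> (i - 1)<..<\<xi> i} y * ?\<kappa> y) = ?l x e (i - 1) - ?l x e i" by simp
    qed
    finally show ?thesis .
  qed
  show ?thesis
    using AE_S regular
  proof (eventually_elim, intro impI)
    fix x assume xS: "x \<notin> ?S" and reg: "x \<in> {-1<..<1} \<longrightarrow> (\<exists>K\<ge>0. \<forall>y\<in>{-1<..<1}. \<bar>f y - f x\<bar> \<le> K * \<bar>x - y\<bar>)"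
      and x: "x \<in> {-1<..<1}"
    define l where "l = (\<lambda>i. ln \<bar>x - \<xi> i\<bar>)"
    have nz: "x - \<xi> i \<noteq> 0" if "i \<le> n" for i using xS that by auto
    have llim: "((\<lambda>e. ?l x e i) \<longlongrightarrow> l i) (at_right 0)" if "i \<le> n" for i
    proof -
      have "((\<lambda>e. ?l x e i) \<longlongrightarrow> ln ((x - \<xi> i)\<^sup>2 + 0\<^sup>2) / 2) (at_right 0)"
        using nz[OF that] by (intro tendsto_intros) auto
      moreover have "ln ((x - \<xi> i)\<^sup>2) = 2 * ln \<bar>x - \<xi> i\<bar>"
        using nz[OF that] by (metis ln_realpow of_nat_numeral power2_abs zero_less_abs_iff)
      ultimately show ?thesis by (simp add: l_def)
    qed
    define \<Lambda> where "\<Lambda> = (\<Sum>i=1..n. \<theta> i * (l (i - 1) - l i))"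
    have "((\<lambda>e. \<Sum>i=1..n. \<theta> i * (?l x e (i - 1) - ?l x e i)) \<longlongrightarrow> \<Lambda>) (at_right 0)"
      unfolding \<Lambda>_def by (intro tendsto_sum tendsto_mult_left tendsto_diff llim) auto
    then have Re: "((\<lambda>e. Re (log_ratio (Complex x e))) \<longlongrightarrow> \<Lambda>) (at_right 0)"
      by (rule Lim_transform_eventually) (use eventually_at_right_less[of 0] in \<open>eventually_elim, simp only: Re_eq\<close>)
    have "((\<lambda>e. norm (solution_transform (Complex x e))) \<longlongrightarrow> P / pi * exp (- \<Lambda>) / norm (complex_of_real x - 1)) (at_right 0)"
      unfolding norm_solution_transform using x
      by (intro tendsto_intros Re Complex_tendsto_at_right_0) (auto simp: complex_eq_iff)
    moreover obtain K where "0 \<le> K" "\<And>y. y \<in> {-1<..<1} \<Longrightarrow> \<bar>f y - f x\<bar> \<le> K * \<bar>x - y\<bar>" using reg x by blast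
    note pb = pressure_boundary[OF x this]
    have "((\<lambda>e. norm (solution_transform (Complex x e))) \<longlongrightarrow> norm (of_real (pressure x) * (of_real (f x) - \<i>))) (at_right 0)"
      by (intro tendsto_norm pb(2))
    ultimately have "norm (of_real (pressure x) * (of_real (f x) - \<i>)) = P / pi * exp (- \<Lambda>) / norm (complex_of_real x - 1)"
      using tendsto_unique[OF trivial_limit_at_right_real] by blast
    moreover have "norm (of_real (f x) - \<i>) = sqrt (1 + (f x)\<^sup>2)" by (simp add: cmod_def add.commute)
    moreover have "norm (complex_of_real x - 1) = 1 - x"
    proof -
      have "norm (complex_of_real (x - 1)) = 1 - x" using x by (simp only: norm_of_real) simp
      then show ?thesis by simp
    qed
    ultimately have main: "- pressure x * sqrt (1 + (f x)\<^sup>2) = P / pi * exp (- \<Lambda>) / (1 - x)"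
      using pb(1) by (simp add: norm_mult)
    have "\<Lambda> = \<theta> 1 * l 0 - \<theta> n * l n - (\<Sum>i=1..n-1. (\<theta> i - \<theta> (i + 1)) * l i)"
      unfolding \<Lambda>_def m using abel_summation[of \<theta> l m] by simp
    moreover have "(\<Sum>i=1..n-1. (\<theta> i - \<theta> (i + 1)) * l i) = (\<Sum>i=1..n-1. (\<alpha> i - \<alpha> (i + 1)) * l i)"
      by (simp add: \<theta>_def)
    ultimately have "- \<Lambda> = (\<Sum>i=1..n-1. (\<alpha> i - \<alpha> (i + 1)) * l i) + \<theta> n * l n - \<theta> 1 * l 0" by simp
    then have "exp (- \<Lambda>) = (\<Prod>i=1..n-1. exp ((\<alpha> i - \<alpha> (i + 1)) * l i)) * exp (\<theta> n * l n) / exp (\<theta> 1 * l 0)"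
      by (simp only: exp_add exp_diff exp_sum finite_atLeastAtMost)
    also have "(\<Prod>i=1..n-1. exp ((\<alpha> i - \<alpha> (i + 1)) * l i)) = (\<Prod>i=1..n-1. \<bar>x - \<xi> i\<bar> powr (\<alpha> i - \<alpha> (i + 1)))"
    proof (intro prod.cong refl)
      fix i assume "i \<in> {1..n-1}"
      then have "x - \<xi> i \<noteq> 0" by (intro nz) auto
      then show "exp ((\<alpha> i - \<alpha> (i + 1)) * l i) = \<bar>x - \<xi> i\<bar> powr (\<alpha> i - \<alpha> (i + 1))"
        by (simp add: powr_def l_def)
    qed
    also have "exp (\<theta> n * l n) = (1 - x) powr \<theta> n" using x \<xi> by (simp add: powr_def l_def)
    also have "exp (\<theta> 1 * l 0) = (1 + x) powr \<theta> 1" using x \<xi> by (simp add: powr_def l_def add.commute)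
    finally have "exp (- \<Lambda>) / (1 - x) = (\<Prod>i=1..n-1. \<bar>x - \<xi> i\<bar> powr (\<alpha> i - \<alpha> (i + 1))) / (1 + x) powr (1/2 + \<alpha> 1) * ((1 - x) powr (1 / 2 + \<alpha> n) / (1 - x))"
      by (simp add: \<theta>_def)
    also have "(1 - x) powr (1 / 2 + \<alpha> n) / (1 - x) = 1 / (1 - x) powr (1 / 2 - \<alpha> n)"
    proof -
      have "(1 - x) powr (1 / 2 + \<alpha> n) * (1 - x) powr (1 / 2 - \<alpha> n) = (1 - x) powr 1"
        by (simp only: powr_add[symmetric]) simp
      then show ?thesis using x by (simp add: field_simps)
    qed
    finally have ex: "exp (- \<Lambda>) / (1 - x) = (\<Prod>i=1..n-1. \<bar>x - \<xi> i\<bar> powr (\<alpha> i - \<alpha> (i + 1))) / ((1 + x) powr (1/2 + \<alpha> 1) * (1 - x) powr (1 / 2 - \<alpha> n))"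
      by simp
    have "0 < sqrt (1 + (f x)\<^sup>2)" by (simp add: add_pos_nonneg)
    then have "pressure x = - (P / pi * (exp (- \<Lambda>) / (1 - x))) / sqrt (1 + (f x)\<^sup>2)"
    proof -
      have "pressure x = - (- pressure x * sqrt (1 + (f x)\<^sup>2)) / sqrt (1 + (f x)\<^sup>2)"
        using \<open>0 < sqrt (1 + (f x)\<^sup>2)\<close> by simp
      then show ?thesis unfolding main by simp
    qed
    then show "pressure x = - (P * (\<Prod>i=1..n-1. \<bar>x - \<xi> i\<bar> powr (\<alpha> i - \<alpha> (i + 1))))
      / (pi * sqrt (1 + (f x)\<^sup>2) * (1 + x) powr (1/2 + \<alpha> 1) * (1 - x) powr (1/2 - \<alpha> n))"
      unfolding ex by (simp add: mult_ac)
  qed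
qed

lemma bounded_mult_charge:
  assumes "charge t"
  shows "charge (\<lambda>x. f x * t x)"
proof -
  interpret charge t by (rule assms)
  have "integrable lborel (\<lambda>x. of_real (t x) * f x)"
    by (rule integrable_mult_bounded[of _ Mf]) (simp_all add: f_bound)
  then show ?thesis by unfold_locales (auto simp: support mult.commute)
qed

text \<open>
  The solution concept only knows classes modulo null sets; a Borel representative that vanishes outside
  the interval is a charge.
\<close>
lemma Lp_charge:
  assumes p: "1 < p" and t': "t' \<in> Lp_functions p {-1<..<1}"
  obtains t s M where "mild_charge t s M" "AE x in lborel. x \<in> {-1<..<1} \<longrightarrow> t' x = t x"
proof -
  have m: "t' \<in> borel_measurable (lebesgue_on {-1<..<1})"
    and i: "integrable (lebesgue_on {-1<..<1}) (\<lambda>x. \<bar>t' x\<bar> powr p)"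
    using t' by (auto simp: Lp_functions_def)
  obtain t where t: "t \<in> borel_measurable borel" "\<And>x. x \<notin> {-1<..<1} \<Longrightarrow> t x = 0"
    "AE x in lborel. x \<in> {-1<..<1} \<longrightarrow> t' x = t x"
    by (rule borel_representative[OF m]) blast
  note [measurable] = t(1)
  have "integrable lborel (\<lambda>x. \<bar>t x\<bar> powr p)"
  proof (rule AE_cong_measurable_lebesgue_on(2)[THEN iffD1, OF _ _ _ _ i])
    show "AE x in lborel. x \<in> {-1<..<1} \<longrightarrow> \<bar>t' x\<bar> powr p = \<bar>t x\<bar> powr p"
      using t(3) by eventually_elim auto
    show "(\<lambda>x. \<bar>t' x\<bar> powr p) \<in> borel_measurable (lebesgue_on {-1<..<1})" using m by measurable
  qed (use t(2) in auto)
  then obtain s M where "mild_charge t s M" using mild_charge_of_Lp[OF t(1,2) p] by blast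
  then show ?thesis using t(3) by (rule that)
qed

theorem contact_solution_unique:
  assumes sol: "contact_solution P f' t' u'" and f': "\<And>x. x \<in> {-1<..<1} \<Longrightarrow> f' x = f x"
  shows "AE x in lborel. x \<in> {-1<..<1} \<longrightarrow> t' x = pressure x"
    and "AE x in lborel. x \<in> {-1<..<1} \<longrightarrow> u' x = 0"
proof -
  obtain p q where p: "1 < p" "t' \<in> Lp_functions p {-1<..<1}" and q: "1 < q" "u' \<in> Lp_functions q {-1<..<1}"
    using sol by (auto simp: contact_solution_def W1p_functions_def)
  obtain t s M where t: "mild_charge t s M" and tt: "AE x in lborel. x \<in> {-1<..<1} \<longrightarrow> t' x = t x"
    by (rule Lp_charge[OF p]) blast
  obtain u s' M' where u: "mild_charge u s' M'" and uu: "AE x in lborel. x \<in> {-1<..<1} \<longrightarrow> u' x = u x"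
    by (rule Lp_charge[OF q]) blast
  interpret t: mild_charge t s M by (rule t)
  have uc: "charge u" using u by (rule mild_charge.axioms(1))
  have mt: "t' \<in> borel_measurable (lebesgue_on {-1<..<1})" and mu: "u' \<in> borel_measurable (lebesgue_on {-1<..<1})"
    using p q by (auto simp: Lp_functions_def)
  note ft = bounded_mult_charge[OF t.charge_axioms]
  interpret ft: charge "\<lambda>x. f x * t x" by (rule ft)
  from sol have "\<exists>c. AE x in lborel. x \<in> {-1<..<1} \<longrightarrow> u x = c + primitive (\<lambda>x. f x * t x) x - log_potential t x"
    unfolding contact_solution_def
    using t.contact_equation_iff[OF mt tt mu uu uc ft f_borel f'] by blast
  then obtain c where c: "AE x in lborel. x \<in> {-1<..<1} \<longrightarrow> u x = c + primitive (\<lambda>x. f x * t x) x - log_potential t x"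
    by blast
  have signs: "AE x in lborel. x \<in> {-1<..<1} \<longrightarrow> u' x \<le> 0 \<and> t' x \<le> 0 \<and> u' x * t' x = 0"
    using sol unfolding contact_solution_def AE_lebesgue_on_interval by blast
  have neg: "AE x in lborel. t x \<le> 0"
    using signs tt
  proof eventually_elim
    case (elim x) then show ?case using t.support[of x] by (cases "x \<in> {-1<..<1}") auto
  qed
  have "(LINT x|lebesgue_on {-1<..<1}. t' x) = (LINT x|lborel. t x)"
    by (rule AE_cong_measurable_lebesgue_on(1)[OF tt t.borel t.support mt])
  then have mass: "(LINT x|lborel. t x) = - P" using sol by (simp add: contact_solution_def)
  define v where "v = (\<lambda>x. c + primitive (\<lambda>x. f x * t x) x - log_potential t x)"
  have v0: "v x = 0" if "x \<in> {-1<..<1}" for x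
  proof (rule t.displacement_eq_0[OF ft _ neg _ _ _ _ that])
    show "v x = c + primitive (\<lambda>x. f x * t x) x - log_potential t x" for x by (simp add: v_def)
    show "AE x in lborel. x \<in> {-1<..<1} \<longrightarrow> v x \<le> 0"
      using signs uu c by eventually_elim (auto simp: v_def)
    show "AE x in lborel. x \<in> {-1<..<1} \<longrightarrow> v x * t x = 0"
      using signs uu tt c by eventually_elim (auto simp: v_def)
  qed (use mass P in auto)
  have cv: "continuous_on UNIV v"
    unfolding v_def by (intro continuous_intros ft.continuous_primitive t.continuous_log_potential)
  have "v x = 0" if "x \<in> {-1..1}" for x
  proof (rule continuous_constant_on_closure[where S = "{-1<..<1}" and f = v])
    show "continuous_on (closure {-1<..<1}) v" by (rule continuous_on_subset[OF cv]) simp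
  qed (use that v0 in auto)
  then have "log_potential t x = c + primitive (\<lambda>x. f x * t x) x" if "x \<in> {-1..1}" for x
    using that by (force simp: v_def)
  from pressure_unique[OF t ft neg mass this] have "AE x in lborel. t x = pressure x" .
  with tt show "AE x in lborel. x \<in> {-1<..<1} \<longrightarrow> t' x = pressure x" by eventually_elim auto
  show "AE x in lborel. x \<in> {-1<..<1} \<longrightarrow> u' x = 0"
    using uu c by eventually_elim (use v0 in \<open>auto simp: v_def\<close>)
qed

theorem contact_solution_pressure:
  assumes f': "\<And>x. x \<in> {-1<..<1} \<Longrightarrow> f' x = f x"
  shows "contact_solution P f' pressure (\<lambda>_. 0)"
proof -
  obtain p where p: "1 < p" "integrable lborel (\<lambda>x. \<bar>pressure x\<bar> powr p)" by (rule pressure_Lp)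
  have mp: "pressure \<in> borel_measurable (lebesgue_on {-1<..<1})"
    by (rule borel_measurable_lebesgue_on[OF pressure_measurable])
  have "integrable (lebesgue_on {-1<..<1}) (\<lambda>x. \<bar>pressure x\<bar> powr p)"
  proof (rule AE_cong_measurable_lebesgue_on(2)[THEN iffD2, OF _ _ _ _ p(2)])
    show "(\<lambda>x. \<bar>pressure x\<bar> powr p) \<in> borel_measurable (lebesgue_on {-1<..<1})" using mp by measurable
  qed (auto simp: pressure_outside)
  then have 1: "pressure \<in> Lp_functions p {-1<..<1}" using mp by (simp add: Lp_functions_def)
  have L0: "(\<lambda>_. 0) \<in> Lp_functions 2 {-1<..<1}" by (simp add: Lp_functions_def)
  then have 2: "(\<lambda>_. 0) \<in> W1p_functions 2 {-1<..<1}"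
    by (auto simp: W1p_functions_def distr_eq_def distr_deriv_def regular_distr_def intro!: bexI[OF _ L0])
  obtain s M where "mild_charge pressure s M" by (rule pressure_mild_charge)
  then interpret t: mild_charge pressure s M .
  note ft = bounded_mult_charge[OF t.charge_axioms]
  have c0: "charge (\<lambda>_. 0)" by unfold_locales auto
  have "AE x in lborel. x \<in> {-1<..<1} \<longrightarrow> (0::real) = log_potential pressure (-1) + primitive (\<lambda>x. f x * pressure x) x - log_potential pressure x"
  proof (rule AE_I2, rule impI)
    fix x :: real assume "x \<in> {-1<..<1}"
    then have "x \<in> {-1..1}" by auto
    from pressure_equation[OF ft this]
    show "0 = log_potential pressure (-1) + primitive (\<lambda>x. f x * pressure x) x - log_potential pressure x"
      by linarith
  qed
  then have 3: "distr_eq {-1<..<1}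
       (\<lambda>\<phi>. - (1 / pi) * distr_conv pv_inverse (regular_distr UNIV (zero_extension {-1<..<1} pressure)) \<phi>
             + regular_distr {-1<..<1} (\<lambda>x. f' x * pressure x) \<phi>)
       (distr_deriv (regular_distr {-1<..<1} (\<lambda>_. 0)))"
    by (intro t.contact_equation_iff[OF mp _ _ _ c0 ft f_borel f', THEN iffD2]) auto
  have 4: "(LINT x|lebesgue_on {-1<..<1}. pressure x) = - P"
    using AE_cong_measurable_lebesgue_on(1)[OF _ pressure_measurable pressure_outside mp] pressure_mass by simp
  have 5: "AE x in lebesgue_on {-1<..<1}. (0::real) \<le> 0 \<and> pressure x \<le> 0 \<and> 0 * pressure x = 0"
    unfolding AE_lebesgue_on_interval using pressure_nonpos by eventually_elim auto
  have "(1::real) < 2" by simp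
  with p(1) 1 2 3 4 5 show ?thesis unfolding contact_solution_def by blast
qed

end

text \<open>
  The sum of the Lipschitz constants serves all pieces at once, and with it the estimate holds on every
  interval free of break points. For points separated by a break point, boundedness gives a Lipschitz
  estimate at any fixed point that is not itself a break point.
\<close>
lemma slope_of_piecewise_lipschitz:
  assumes P: "0 < P" and pl: "piecewise_lipschitz f"
  obtains Mf where "slope (\<lambda>x. indicator {-1<..<1} x * f x) Mf P"
proof -
  obtain m :: nat and y where y: "y 0 = -1" "y m = 1" and mono: "\<forall>j\<in>{1..m}. y (j - 1) < y j"
    and ex: "\<forall>j\<in>{1..m}. \<exists>C. C-lipschitz_on {y (j - 1)<..<y j} f"
    using pl unfolding piecewise_lipschitz_def by blast
  obtain C where C: "\<And>j. j \<in> {1..m} \<Longrightarrow> (C j)-lipschitz_on {y (j - 1)<..<y j} f"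
    using bchoice[OF ex] by blast
  let ?S = "y ` {0..m}"
  let ?I = "\<lambda>j. {y (j - 1)<..<y j}"
  define h where "h = (\<lambda>x. indicator {-1<..<1} x * f x)"
  define K where "K = (\<Sum>j\<in>{1..m}. C j)"
  have C0: "0 \<le> C j" if "j \<in> {1..m}" for j using lipschitz_on_nonneg[OF C[OF that]] .
  have K: "0 \<le> K" "\<And>j. j \<in> {1..m} \<Longrightarrow> C j \<le> K"
    unfolding K_def using C0 by (auto intro: sum_nonneg member_le_sum)
  have ends: "-1 \<in> ?S" "1 \<in> ?S" using y by force+
  have sub: "?I j \<subseteq> {-1<..<1}" if "j \<in> {1..m}" for j
  proof -
    have j: "0 \<le> j - 1" "j - 1 \<le> m" "j \<le> m" using that by auto
    have "-1 \<le> y (j - 1)" "y j \<le> 1"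
      using partition_mono[OF mono j(1,2)] partition_mono[OF mono j(3) order_refl] by (simp_all only: y)
    then show ?thesis by auto
  qed
  have cell: "\<exists>j\<in>{1..m}. x \<in> ?I j" if "x \<in> {-1<..<1}" "x \<notin> ?S" for x
  proof -
    have "y 0 < x" "x < y m" using that(1) y by auto
    from partition_cell[OF this that(2)] obtain j where "j \<in> {1..m}" "y (j - 1) < x" "x < y j" .
    then show ?thesis by (intro bexI[of _ j]) auto
  qed
  have hI: "h x = f x" if "j \<in> {1..m}" "x \<in> ?I j" for x j using sub[OF that(1)] that(2) by (auto simp: h_def)
  have lip: "\<bar>h x - h w\<bar> \<le> K * \<bar>x - w\<bar>" if ab: "\<And>s. s \<in> ?S \<Longrightarrow> s \<notin> {a<..<b}" and x: "x \<in> {a<..<b}" and w: "w \<in> {a<..<b}" for a b x w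
  proof -
    have inside: "\<bar>h x - h w\<bar> \<le> K * \<bar>x - w\<bar>" if xi: "x \<in> {-1<..<1}" and x: "x \<in> {a<..<b}" and w: "w \<in> {a<..<b}" for x w
    proof -
      have "x \<notin> ?S" using ab x by blast
      from cell[OF xi this] obtain j where j: "j \<in> {1..m}" "x \<in> ?I j" by blast
      have "y (j - 1) \<in> ?S" "y j \<in> ?S" using j by auto
      with ab have "y (j - 1) \<notin> {a<..<b}" "y j \<notin> {a<..<b}" by blast+
      then have wj: "w \<in> ?I j" using j(2) x w by auto
      have "\<bar>f x - f w\<bar> \<le> C j * \<bar>x - w\<bar>"
        using lipschitz_onD[OF C[OF j(1)] j(2) wj] by (simp add: dist_real_def)
      also have "\<dots> \<le> K * \<bar>x - w\<bar>" using K(2)[OF j(1)] by (intro mult_right_mono) auto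
      finally show ?thesis using hI j wj by simp
    qed
    show ?thesis
    proof (cases "x \<in> {-1<..<1} \<or> w \<in> {-1<..<1}")
      case True
      then show ?thesis using inside[of x w] inside[of w x] x w by (auto simp: abs_minus_commute)
    next
      case False
      then show ?thesis using K(1) by (simp add: h_def)
    qed
  qed
  have finS: "finite ?S" by simp
  have avoid: "\<exists>d>0. \<forall>s\<in>?S. s \<noteq> x \<longrightarrow> d \<le> \<bar>x - s\<bar>" for x
    using finite_set_avoid[OF finS, of x] by (simp add: dist_real_def)
  have "bounded (range h)"
  proof (rule bounded_subset)
    have piece: "bounded (f ` ?I j)" if "j \<in> {1..m}" for j
      by (intro bounded_uniformly_continuous_image lipschitz_on_uniformly_continuous[OF C[OF that]]) simp
    have "bounded (\<Union>j\<in>{1..m}. f ` ?I j)" by (intro bounded_UN ballI piece) auto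
    moreover have "bounded (f ` ?S)" by (intro finite_imp_bounded) simp
    ultimately show "bounded (insert 0 (f ` ?S \<union> (\<Union>j\<in>{1..m}. f ` ?I j)))"
      by (simp only: bounded_insert bounded_Un)
    show "range h \<subseteq> insert 0 (f ` ?S \<union> (\<Union>j\<in>{1..m}. f ` ?I j))"
    proof (intro image_subsetI)
      fix x
      consider "x \<notin> {-1<..<1}" | "x \<in> ?S" "x \<in> {-1<..<1}" | "\<exists>j\<in>{1..m}. x \<in> ?I j" "x \<in> {-1<..<1}"
        using cell[of x] by blast
      then show "h x \<in> insert 0 (f ` ?S \<union> (\<Union>j\<in>{1..m}. f ` ?I j))"
      proof cases
        case 2
        then have "h x = f x" by (simp add: h_def)
        then show ?thesis using 2(1) by blast
      next
        case 3
        then have "h x = f x" by (simp add: h_def)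
        then show ?thesis using 3(1) by blast
      qed (simp add: h_def)
    qed
  qed
  then obtain Mf where Mf: "\<And>x. \<bar>h x\<bar> \<le> Mf" by (auto simp: bounded_iff)
  have "slope h Mf P"
  proof
    show "h \<in> borel_measurable borel"
    proof (rule measurable_discrete_difference[where X = ?S])
      have "continuous_on (?I j) f" if "j \<in> {1..m}" for j
        by (rule lipschitz_on_continuous_on[OF C[OF that]])
      then show "(\<lambda>x. \<Sum>j\<in>{1..m}. indicator (?I j) x *\<^sub>R f x) \<in> borel_measurable borel"
        by (intro borel_measurable_sum borel_measurable_continuous_on_indicator) auto
      fix x assume xS: "x \<notin> ?S"
      show "(\<Sum>j\<in>{1..m}. indicator (?I j) x *\<^sub>R f x) = h x"
      proof (cases "x \<in> {-1<..<1}")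
        case True
        from cell[OF True xS] obtain k where k: "k \<in> {1..m}" "x \<in> ?I k" by blast
        have "indicator (?I j) x *\<^sub>R f x = (if j = k then f x else 0)" if j: "j \<in> {1..m}" for j
        proof -
          have "x \<notin> ?I j" if "j < k"
          proof -
            have "j \<le> k - 1" "k - 1 \<le> m" using that k by auto
            from partition_mono[OF mono this] show ?thesis using k by auto
          qed
          moreover have "x \<notin> ?I j" if "k < j"
          proof -
            have "k \<le> j - 1" "j - 1 \<le> m" using that j by auto
            from partition_mono[OF mono this] show ?thesis using k by auto
          qed
          ultimately show ?thesis using k by (cases j k rule: linorder_cases) auto
        qed
        then have "(\<Sum>j\<in>{1..m}. indicator (?I j) x *\<^sub>R f x) = (\<Sum>j\<in>{1..m}. if j = k then f x else 0)"
          by (intro sum.cong) auto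
        then show ?thesis using k True by (simp add: h_def)
      next
        case False
        then have "x \<notin> ?I j" if "j \<in> {1..m}" for j using sub[OF that] by blast
        then show ?thesis using False by (simp add: h_def)
      qed
    qed auto
    show "\<bar>h x\<bar> \<le> Mf" for x by (rule Mf)
    show "0 < P" by (rule P)
    show "\<exists>r>0. \<exists>K\<ge>0. (\<forall>x\<in>{c-r<..<c}. \<forall>y\<in>{c-r<..<c}. \<bar>h x - h y\<bar> \<le> K * \<bar>x - y\<bar>)
        \<and> (\<forall>x\<in>{c<..<c+r}. \<forall>y\<in>{c<..<c+r}. \<bar>h x - h y\<bar> \<le> K * \<bar>x - y\<bar>)" for c
    proof -
      obtain d where d: "0 < d" "\<And>s. s \<in> ?S \<Longrightarrow> s \<noteq> c \<Longrightarrow> d \<le> \<bar>c - s\<bar>" using avoid[of c] by blast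
      have "s \<notin> {c-d<..<c}" "s \<notin> {c<..<c+d}" if "s \<in> ?S" for s using d(2)[OF that] by (auto simp: abs_if split: if_splits)
      note clear = this
      show ?thesis
      proof (rule exI[of _ d], rule conjI[OF d(1)], rule exI[of _ K], rule conjI[OF K(1)], intro conjI ballI)
        show "\<bar>h x - h y\<bar> \<le> K * \<bar>x - y\<bar>" if "x \<in> {c-d<..<c}" "y \<in> {c-d<..<c}" for x y
          by (rule lip[OF clear(1) that])
        show "\<bar>h x - h y\<bar> \<le> K * \<bar>x - y\<bar>" if "x \<in> {c<..<c+d}" "y \<in> {c<..<c+d}" for x y
          by (rule lip[OF clear(2) that])
      qed
    qed
    show "AE x in lborel. x \<in> {-1<..<1} \<longrightarrow> (\<exists>K\<ge>0. \<forall>y\<in>{-1<..<1}. \<bar>h y - h x\<bar> \<le> K * \<bar>x - y\<bar>)"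
    proof -
      have "AE x in lborel. x \<notin> ?S" by (intro AE_not_in finite_imp_null_set_lborel) auto
      then show ?thesis
      proof eventually_elim
        case (elim x)
        obtain d where d: "0 < d" "\<And>s. s \<in> ?S \<Longrightarrow> s \<noteq> x \<Longrightarrow> d \<le> \<bar>x - s\<bar>" using avoid[of x] by blast
        have clear: "s \<notin> {x-d<..<x+d}" if "s \<in> ?S" for s
        proof -
          have "s \<noteq> x" using elim that by blast
          then show ?thesis using d(2)[OF that] by (auto simp: abs_if split: if_splits)
        qed
        have Mf0: "0 \<le> Mf" using Mf[of 0] by simp
        have "\<bar>h w - h x\<bar> \<le> (K + 2 * Mf / d) * \<bar>x - w\<bar>" for w
        proof (cases "\<bar>x - w\<bar> < d")
          case True
          have "\<bar>h w - h x\<bar> \<le> K * \<bar>w - x\<bar>" by (rule lip[OF clear]) (use True d(1) in auto)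
          also have "\<dots> \<le> (K + 2 * Mf / d) * \<bar>x - w\<bar>"
            using Mf0 d(1) by (simp add: abs_minus_commute mult_right_mono)
          finally show ?thesis .
        next
          case False
          have "\<bar>h w - h x\<bar> \<le> 2 * Mf" using Mf[of w] Mf[of x] by linarith
          also have "\<dots> = 2 * Mf / d * d" using d(1) by simp
          also have "\<dots> \<le> 2 * Mf / d * \<bar>x - w\<bar>" using False Mf0 d(1) by (intro mult_left_mono) auto
          also have "\<dots> \<le> (K + 2 * Mf / d) * \<bar>x - w\<bar>" using K(1) by (intro mult_right_mono) auto
          finally show ?thesis .
        qed
        moreover have "0 \<le> K + 2 * Mf / d" using K(1) Mf0 d(1) by simp
        ultimately show ?case by blast
      qed
    qed
  qed
  then show ?thesis unfolding h_def by (rule that)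
qed

theorem proposition1:
  fixes P :: real and f :: "real \<Rightarrow> real"
  assumes "P > 0" and "piecewise_lipschitz f"
  shows "\<exists>t u. contact_solution P f t u
    \<and> (\<forall>t' u'. contact_solution P f t' u' \<longrightarrow>
          (AE x in lebesgue_on {-1<..<1}. t' x = t x) \<and>
          (AE x in lebesgue_on {-1<..<1}. u' x = u x))
    \<and> (AE x in lebesgue_on {-1<..<1}. u x = 0)
    \<and> (\<forall>(n::nat) (\<xi>::nat \<Rightarrow> real) (c::nat \<Rightarrow> real) (\<alpha>::nat \<Rightarrow> real).
          \<xi> 0 = -1 \<and> \<xi> n = 1 \<and> (\<forall>i\<in>{1..n}. \<xi> (i - 1) < \<xi> i)
          \<and> (\<forall>x\<in>{-1<..<1}. f x = (\<Sum>i=1..n. c i * indicator {\<xi> (i - 1)<..<\<xi> i} x))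
          \<and> (\<forall>i. \<alpha> i = arctan (c i) / pi)
        \<longrightarrow> (AE x in lebesgue_on {-1<..<1}. t x =
              - (P * (\<Prod>i=1..n-1. \<bar>x - \<xi> i\<bar> powr (\<alpha> i - \<alpha> (i + 1))))
              / (pi * sqrt (1 + (f x)\<^sup>2) * (1 + x) powr (1/2 + \<alpha> 1)
                    * (1 - x) powr (1/2 - \<alpha> n))))"
proof -
  obtain Mf where "slope (\<lambda>x. indicator {-1<..<1} x * f x) Mf P"
    by (rule slope_of_piecewise_lipschitz[OF assms])
  then interpret slope "\<lambda>x. indicator {-1<..<1} x * f x" Mf P .
  have f: "f x = indicator {-1<..<1} x * f x" if "x \<in> {-1<..<1}" for x using that by simp
  have unique: "\<forall>t' u'. contact_solution P f t' u' \<longrightarrow>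
      (AE x in lebesgue_on {-1<..<1}. t' x = pressure x) \<and> (AE x in lebesgue_on {-1<..<1}. u' x = 0)"
  proof (intro allI impI conjI)
    fix t' u' assume sol: "contact_solution P f t' u'"
    show "AE x in lebesgue_on {-1<..<1}. t' x = pressure x"
      unfolding AE_lebesgue_on_interval by (rule contact_solution_unique(1)[OF sol f])
    show "AE x in lebesgue_on {-1<..<1}. u' x = 0"
      unfolding AE_lebesgue_on_interval by (rule contact_solution_unique(2)[OF sol f])
  qed
  have explicit: "\<forall>(n::nat) (\<xi>::nat \<Rightarrow> real) (c::nat \<Rightarrow> real) (\<alpha>::nat \<Rightarrow> real).
        \<xi> 0 = -1 \<and> \<xi> n = 1 \<and> (\<forall>i\<in>{1..n}. \<xi> (i - 1) < \<xi> i)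
        \<and> (\<forall>x\<in>{-1<..<1}. f x = (\<Sum>i=1..n. c i * indicator {\<xi> (i - 1)<..<\<xi> i} x))
        \<and> (\<forall>i. \<alpha> i = arctan (c i) / pi)
      \<longrightarrow> (AE x in lebesgue_on {-1<..<1}. pressure x =
            - (P * (\<Prod>i=1..n-1. \<bar>x - \<xi> i\<bar> powr (\<alpha> i - \<alpha> (i + 1))))
            / (pi * sqrt (1 + (f x)\<^sup>2) * (1 + x) powr (1/2 + \<alpha> 1) * (1 - x) powr (1/2 - \<alpha> n)))"
    unfolding AE_lebesgue_on_interval
  proof (intro allI impI)
    fix n :: nat and \<xi> c \<alpha> :: "nat \<Rightarrow> real"
    assume a: "\<xi> 0 = -1 \<and> \<xi> n = 1 \<and> (\<forall>i\<in>{1..n}. \<xi> (i - 1) < \<xi> i)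
          \<and> (\<forall>x\<in>{-1<..<1}. f x = (\<Sum>i=1..n. c i * indicator {\<xi> (i - 1)<..<\<xi> i} x))
          \<and> (\<forall>i. \<alpha> i = arctan (c i) / pi)"
    have "AE x in lborel. x \<in> {-1<..<1} \<longrightarrow> pressure x =
      - (P * (\<Prod>i=1..n-1. \<bar>x - \<xi> i\<bar> powr (\<alpha> i - \<alpha> (i + 1))))
      / (pi * sqrt (1 + (indicator {-1<..<1} x * f x)\<^sup>2) * (1 + x) powr (1/2 + \<alpha> 1) * (1 - x) powr (1/2 - \<alpha> n))"
      by (rule pressure_step_function[where c = c]) (use a in auto)
    then show "AE x in lborel. x \<in> {-1<..<1} \<longrightarrow> pressure x =
      - (P * (\<Prod>i=1..n-1. \<bar>x - \<xi> i\<bar> powr (\<alpha> i - \<alpha> (i + 1))))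
      / (pi * sqrt (1 + (f x)\<^sup>2) * (1 + x) powr (1/2 + \<alpha> 1) * (1 - x) powr (1/2 - \<alpha> n))"
      by eventually_elim auto
  qed
  show ?thesis
    by (intro exI[of _ pressure] exI[of _ "\<lambda>_. 0"] conjI contact_solution_pressure[OF f] unique explicit)
      auto
qed

end
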